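(* Consider the adaptive attack design objective $$\mathcal{J}(\rho,\tau):=\mathcal{S}(\rho,\tau)-\lambda\,\mathcal{D}(\rho,\tau)+\frac12\mathbb{E}\int_0^T\rho_t^{\top}P_t\rho_t\,dt,$$ with $\lambda\ge0$, $P\in C([0,T];\mathbb{S}^{d\times d}_{++})$, and, for each $\tau\in C([0,T];\mathbb{R}^m)$, let $\rho^*(\tau)$ be the optimal state attack for fixed $\tau$ given in the context. The optimal observation attack $\tau^*$, i.e. the minimizer of $\tau\mapsto\mathcal{J}(\rho^*(\tau),\tau)$ over $\tau\in C([0,T];\mathbb{R}^m)$, is $$\tau^*_t=-(Q^F_t)^{\top}(F^\tau_t\mathbf f^\phi_t+\mathbf f^\tau_t+\Phi_0)-(\sigma_W\sigma_W^{\top})G_t^{\top}\mathbf f^\phi_t,$$ where $\mathbf f^\phi$ is the function associated with $\tau=\tau^*$ (see context), and $F^\tau\in C([0,T];\mathbb{S}^{3d\times3d})$, $\mathbf f^\tau\in C([0,T];\mathbb{R}^{3d})$ solve \begin{align*} &\dot F^\tau_t+F^\tau_tQ^F_t(\sigma_W\sigma_W^{\top})^{-1}(Q^F_t)^{\top}F^\tau_t+(O_t+G_t\sigma_W\sigma_W^{\top}G_t^{\top})\\ &\quad-F^\tau_t[(D^\phi_t)^{\top}-F^\phi_tO_t-Q^F_tG_t^{\top}]-[(D^\phi_t)^{\top}-F^\phi_tO_t-Q^F_tG_t^{\top}]^{\top}F^\tau_t=0,\\ &\dot{\mathbf f}^\tau_t-F^\tau_t[F^\phi_td^\phi_t+\ell^\phi_t-Q^F_t(\sigma_W\sigma_W^{\top})^{-1}(Q^F_t)^{\top}(\mathbf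 f^\tau_t+\Phi_0)]\\ &\quad+[G_t(Q^F_t)^{\top}-D^\phi_t+O_t^{\top}(F^\phi_t)^{\top}](\mathbf f^\tau_t+\Phi_0)-d^\phi_t=0, \end{align*} with initial conditions $F^\tau_0=0$, $\mathbf f^\tau_0=0$, and with coefficients $$\Phi_0:=\mathrm{Concat}(\hat X^c_0,\hat X^a_0,\Delta X_0)\in\mathbb{R}^{3d},\quad G_t:=\mathrm{Concat}(0_{d\times m},\mathcal{T}_t,-\mathcal{T}_t)\in\mathbb{R}^{3d\times m},\quad Q^F_t:=F^\phi_tG_t\sigma_W\sigma_W^{\top}+e_{\Delta x}H_t^{\top}\in\mathbb{R}^{3d\times m}.$$ Moreover, the ODE system for $(F^\tau,\mathbf f^\tau)$ admits a unique solution on $[0,T]$ for small enough $T$.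
   Context: Basic data. Fix $T>0$ and dimensions $d,m,c,p,q$ with $d\le p$, $m\le q$. $V,W$ are independent standard Brownian motions in $\mathbb{R}^p,\mathbb{R}^q$; $\sigma_V\in\mathbb{R}^{d\times p}$ has rank $d$ and $\sigma_W\in\mathbb{R}^{m\times q}$ has rank $m$. The coefficients $A_t\in\mathbb{R}^{d\times d}$, $B_t\in\mathbb{R}^{d\times c}$, $H_t\in\mathbb{R}^{m\times d}$, $a_t\in\mathbb{R}^d$, $h_t\in\mathbb{R}^m$ are deterministic and continuous on $[0,T]$. $\mathbb{S}^{n\times n}$, $\mathbb{S}^{n\times n}_+$, $\mathbb{S}^{n\times n}_{++}$ denote symmetric, positive semidefinite, positive definite matrices. $Q\in C([0,T];\mathbb{S}^{d\times d}_+)$, $S\in C([0,T];\mathbb{S}^{c\times c}_{++})$, $r\in C([0,T];\mathbb{R}^d)$, $x_0\in\mathbb{R}^d$, $R_0\in\mathbb{S}^{d\times d}_+$. For a process $Z$, $\mathscr{F}^Z_t:=\sigma(Z_s,\ s\le t)$. $\mathrm{Concat}$ is vertical concatenation. $\mathscr{F}_t$ is the filtration generated by $V$, $W$ and the initial state. Agent's feedback. Let $K_t:=B_tS_t^{-1}B_t^{\top}$, and let $F\in C([0,T];\mathbb{S}^{d\times d})$, $\mathbf{f}\in C([0,T];\mathbb{R}^d)$ solve $\dot F_t+A_t^{\top}F_t+F_tA_t+Q_t-F_tK_tF_t=0$, $\dot{\mathbf f}_t+A_t^{\top}\mathbf f_t+2F_ta_t-2Q_tr_t-F_tK_t\mathbf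 f_t=0$, $F_T=0$, $\mathbf f_T=0$. Put $u^*(t,x):=-S_t^{-1}B_t^{\top}F_tx-\tfrac12S_t^{-1}B_t^{\top}\mathbf f_t$. Let $R$ solve $\dot R_t=A_tR_t+R_tA_t^{\top}+\sigma_V\sigma_V^{\top}-R_tH_t^{\top}(\sigma_W\sigma_W^{\top})^{-1}H_tR_t$ with initial value $R_0$. Put $\mathcal{T}_t:=R_tH_t^{\top}(\sigma_W\sigma_W^{\top})^{-1}$ and $\Theta_t:=\mathcal{T}_tH_t$. Attacked system. $X^c_0\sim N(x_0,R_0)$ is independent of $(V,W)$, $Y^c_0=0$, and $$dX^c_t=(A_tX^c_t+B_tu^a_t+a_t+\rho_t)dt+\sigma_V dV_t,\qquad dY^c_t=(H_tX^c_t+h_t+\tau_t)dt+\sigma_W dW_t,$$ where $u^a_t:=u^*(t,\hat X^a_t)$ and the agent's filter $\hat X^a$ solves $$d\hat X^a_t=(A_t\hat X^a_t+B_tu^a_t+a_t)dt+\mathcal{T}_t(dY^c_t-(H_t\hat X^a_t+h_t)dt),\quad \hat X^a_0=x_0.$$ One has $\mathscr{F}^{Y^c}_t\subset\mathscr{F}_t$. The attack-aware filter $\hat X^c_t:=\mathbb{E}(X^c_t\mid\mathscr{F}^{Y^c}_t)$ satisfies (Kalman–Bucy) $$d\hat X^c_t=(A_t\hat X^c_t+B_tu^a_t+a_t+\rho_t)dt+\mathcal{T}_t(dY^c_t-(H_t\hat X^c_t+h_t+\tau_t)dt),\quad \hat X^c_0=x_0,$$ with $\mathrm{cov}(X^c_t\mid\mathscr{F}^{Y^c}_t)=R_t$.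 Let $\Delta X_t:=\hat X^c_t-\hat X^a_t$, which satisfies $d\Delta X_t=([A_t-\Theta_t]\Delta X_t+\rho_t-\mathcal{T}_t\tau_t)dt$, $\Delta X_0=0$. Thus $\Phi_0=\mathrm{Concat}(x_0,x_0,0)$. State attacks satisfy: $\rho_t$ is $\mathscr{F}^{Y^c}_t$-measurable for all $t$, $\mathbb{E}\int_0^T\|\rho_t\|^2dt<\infty$; observation attacks satisfy $\tau\in C([0,T];\mathbb{R}^m)$. Criteria. $$\mathcal{D}(\rho,\tau):=\mathbb{E}\int_0^T[(X^c_t-r_t)^{\top}Q_t(X^c_t-r_t)+(u^a_t)^{\top}S_tu^a_t]dt,$$ $$\mathcal{S}(\rho,\tau)=\frac12\mathbb{E}\int_0^T(H_t\Delta X_t+\tau_t)^{\top}(\sigma_W\sigma_W^{\top})^{-1}(H_t\Delta X_t+\tau_t)dt.$$ Optimal state attack for fixed $\tau$. $\rho^*(\tau)$ is the feedback $\rho^*_t=-P_t^{-1}(e_{x^c}+e_{\Delta x})^{\top}(F^\phi_t\phi_t+\mathbf f^\phi_t)$ with $\phi_t=\mathrm{Concat}(\hat X^c_t,\hat X^a_t,\Delta X_t)$, where $F^\phi\in C([0,T];\mathbb{S}^{3d\times3d})$ and $\mathbf f^\phi\in C([0,T];\mathbb{R}^{3d})$ (the latter depending on $\tau$) solve $$\dot F^\phi_t-F^\phi_tO_tF^\phi_t+F^\phi_tD^\phi_t+(D^\phi_t)^{\top}F^\phi_t+2Q^\phi_t=0,\quad F^\phi_T=0,$$ $$\dot{\mathbf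 f}^\phi_t-F^\phi_tO_t\mathbf f^\phi_t+F^\phi_t(d^\phi_t+d^\tau_t)+(D^\phi_t)^{\top}\mathbf f^\phi_t+\ell^\phi_t+\ell^\tau_t=0,\quad \mathbf f^\phi_T=0,$$ with $$D^\phi_t:=\begin{bmatrix}A_t&-K_tF_t&0\\ \Theta_t&A_t-K_tF_t-\Theta_t&0\\0&0&A_t-\Theta_t\end{bmatrix},\quad d^\phi_t:=\mathrm{Concat}(a_t-\tfrac12K_t\mathbf f_t,\ a_t-\tfrac12K_t\mathbf f_t,\ 0),$$ $e_{x^c}^{\top}:=[I_d\ 0\ 0]$, $e_{x^a}^{\top}:=[0\ I_d\ 0]$, $e_{\Delta x}^{\top}:=[0\ 0\ I_d]\in\mathbb{R}^{d\times3d}$, $O_t:=(e_{x^c}+e_{\Delta x})P_t^{-1}(e_{x^c}+e_{\Delta x})^{\top}$, $\ell^\phi_t:=2\lambda e_{x^c}Q_tr_t-\lambda e_{x^a}F_tK_t\mathbf f_t$, $$Q^\phi_t:=\tfrac12e_{\Delta x}H_t^{\top}(\sigma_W\sigma_W^{\top})^{-1}H_te_{\Delta x}^{\top}-\lambda e_{x^a}F_tK_tF_te_{x^a}^{\top}-\lambda e_{x^c}Q_te_{x^c}^{\top},$$ $d^\tau_t:=\mathrm{Concat}(0,\mathcal{T}_t\tau_t,-\mathcal{T}_t\tau_t)$, $\ell^\tau_t:=e_{\Delta x}H_t^{\top}(\sigma_W\sigma_W^{\top})^{-1}\tau_t$. The optimality formula is understood for $T$ such that the ODE systems for $(F^\phi,\mathbf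 f^\phi)$ and $(F^\tau,\mathbf f^\tau)$ have solutions on $[0,T]$. *)

theory Defs
  imports "HOL-Probability.Probability"
begin

section \<open>Matrices and block vectors\<close>

definition sym_mat :: "real^'n^'n \<Rightarrow> bool" where
  "sym_mat X \<longleftrightarrow> transpose X = X"

definition psd_mat :: "real^'n^'n \<Rightarrow> bool" where
  "psd_mat X \<longleftrightarrow> sym_mat X \<and> (\<forall>v. 0 \<le> v \<bullet> (X *v v))"

definition pd_mat :: "real^'n^'n \<Rightarrow> bool" where
  "pd_mat X \<longleftrightarrow> sym_mat X \<and> (\<forall>v. v \<noteq> 0 \<longrightarrow> 0 < v \<bullet> (X *v v))"

text \<open>
  Dimension \<open>3d\<close> is rendered by the index type \<open>'d + 'd + 'd\<close>.  Vertical concatenation is polymorphic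
  in the entries; since a matrix is a vector of rows, it also stacks matrices.
\<close>

definition Concat :: "'a^'d \<Rightarrow> 'a^'d \<Rightarrow> 'a^'d \<Rightarrow> 'a^('d + 'd + 'd)" where
  "Concat x y z = (\<chi> i. case i of Inl j \<Rightarrow> x $ j | Inr (Inl j) \<Rightarrow> y $ j | Inr (Inr j) \<Rightarrow> z $ j)"

definition HConcat :: "'a^'d^'n \<Rightarrow> 'a^'d^'n \<Rightarrow> 'a^'d^'n \<Rightarrow> 'a^('d + 'd + 'd)^'n" where
  "HConcat X Y Z = (\<chi> i. Concat (X $ i) (Y $ i) (Z $ i))"

definition e_xc :: "real^'d^('d + 'd + 'd)" where "e_xc = Concat (mat 1) 0 0"
definition e_xa :: "real^'d^('d + 'd + 'd)" where "e_xa = Concat 0 (mat 1) 0"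
definition e_dx :: "real^'d^('d + 'd + 'd)" where "e_dx = Concat 0 0 (mat 1)"


section \<open>Data of the model\<close>

text \<open>
  \<open>dyn_A, dyn_B, dyn_a, sig_V\<close>: \<open>A, B, a, \<sigma>\<^sub>V\<close>;  \<open>obs_H, obs_h, sig_W\<close>: \<open>H, h, \<sigma>\<^sub>W\<close>;
  \<open>cost_Q, cost_S, target\<close>: \<open>Q, S, r\<close>;  \<open>lam, pen_P\<close>: \<open>\<lambda>, P\<close>.
\<close>

record ('d, 'm, 'c, 'p, 'q) model =
  dyn_A :: "real \<Rightarrow> real^'d^'d"
  dyn_B :: "real \<Rightarrow> real^'c^'d"
  dyn_a :: "real \<Rightarrow> real^'d"
  sig_V :: "real^'p^'d"
  obs_H :: "real \<Rightarrow> real^'d^'m"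
  obs_h :: "real \<Rightarrow> real^'m"
  sig_W :: "real^'q^'m"
  cost_Q :: "real \<Rightarrow> real^'d^'d"
  cost_S :: "real \<Rightarrow> real^'c^'c"
  target :: "real \<Rightarrow> real^'d"
  init_x :: "real^'d"
  init_R :: "real^'d^'d"
  lam :: real
  pen_P :: "real \<Rightarrow> real^'d^'d"

definition valid_model :: "('d::finite, 'm::finite, 'c::finite, 'p::finite, 'q::finite) model \<Rightarrow> real \<Rightarrow> bool" where
  "valid_model \<M> T \<longleftrightarrow>
     CARD('d) \<le> CARD('p) \<and> CARD('m) \<le> CARD('q) \<and>
     rank (sig_V \<M>) = CARD('d) \<and> rank (sig_W \<M>) = CARD('m) \<and>
     continuous_on {0..T} (dyn_A \<M>) \<and> continuous_on {0..T} (dyn_B \<M>) \<and>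
     continuous_on {0..T} (dyn_a \<M>) \<and> continuous_on {0..T} (obs_H \<M>) \<and>
     continuous_on {0..T} (obs_h \<M>) \<and>
     continuous_on {0..T} (cost_Q \<M>) \<and> (\<forall>t\<in>{0..T}. psd_mat (cost_Q \<M> t)) \<and>
     continuous_on {0..T} (cost_S \<M>) \<and> (\<forall>t\<in>{0..T}. pd_mat (cost_S \<M> t)) \<and>
     continuous_on {0..T} (target \<M>) \<and> psd_mat (init_R \<M>) \<and>
     0 \<le> lam \<M> \<and>
     continuous_on {0..T} (pen_P \<M>) \<and> (\<forall>t\<in>{0..T}. pd_mat (pen_P \<M> t))"


section \<open>The deterministic ordinary differential equations\<close>

text \<open>\<open>ode_zero T y E\<close> says that \<open>y' + E = 0\<close> on \<open>[0, T]\<close> (one-sided derivatives at the end points).\<close>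

definition ode_zero :: "real \<Rightarrow> (real \<Rightarrow> 'a::real_normed_vector) \<Rightarrow> (real \<Rightarrow> 'a) \<Rightarrow> bool" where
  "ode_zero T y E \<longleftrightarrow> (\<forall>t\<in>{0..T}. (y has_vector_derivative (- E t)) (at t within {0..T}))"

definition K_mat :: "('d::finite, 'm::finite, 'c::finite, 'p::finite, 'q::finite) model \<Rightarrow> real \<Rightarrow> real^'d^'d" where
  "K_mat \<M> t = dyn_B \<M> t ** matrix_inv (cost_S \<M> t) ** transpose (dyn_B \<M> t)"

definition Sig_W :: "('d::finite, 'm::finite, 'c::finite, 'p::finite, 'q::finite) model \<Rightarrow> real^'m^'m" where
  "Sig_W \<M> = sig_W \<M> ** transpose (sig_W \<M>)"

definition is_F :: "('d::finite, 'm::finite, 'c::finite, 'p::finite, 'q::finite) model \<Rightarrow> real \<Rightarrow> (real \<Rightarrow> real^'d^'d) \<Rightarrow> bool" where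
  "is_F \<M> T F \<longleftrightarrow> (\<forall>t\<in>{0..T}. sym_mat (F t)) \<and> F T = 0 \<and>
     ode_zero T F (\<lambda>t. transpose (dyn_A \<M> t) ** F t + F t ** dyn_A \<M> t + cost_Q \<M> t
                        - F t ** K_mat \<M> t ** F t)"

definition is_f :: "('d::finite, 'm::finite, 'c::finite, 'p::finite, 'q::finite) model \<Rightarrow> real \<Rightarrow> (real \<Rightarrow> real^'d^'d)
    \<Rightarrow> (real \<Rightarrow> real^'d) \<Rightarrow> bool" where
  "is_f \<M> T F f \<longleftrightarrow> f T = 0 \<and>
     ode_zero T f (\<lambda>t. transpose (dyn_A \<M> t) *v f t + 2 *\<^sub>R (F t *v dyn_a \<M> t)
                        - 2 *\<^sub>R (cost_Q \<M> t *v target \<M> t) - F t *v (K_mat \<M> t *v f t))"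

definition u_star :: "('d::finite, 'm::finite, 'c::finite, 'p::finite, 'q::finite) model \<Rightarrow> (real \<Rightarrow> real^'d^'d) \<Rightarrow> (real \<Rightarrow> real^'d)
    \<Rightarrow> real \<Rightarrow> real^'d \<Rightarrow> real^'c" where
  "u_star \<M> F f t x =
     - ((matrix_inv (cost_S \<M> t) ** transpose (dyn_B \<M> t) ** F t) *v x)
     - (1/2) *\<^sub>R ((matrix_inv (cost_S \<M> t) ** transpose (dyn_B \<M> t)) *v f t)"

definition is_R :: "('d::finite, 'm::finite, 'c::finite, 'p::finite, 'q::finite) model \<Rightarrow> real \<Rightarrow> (real \<Rightarrow> real^'d^'d) \<Rightarrow> bool" where
  "is_R \<M> T R \<longleftrightarrow> R 0 = init_R \<M> \<and>
     ode_zero T R (\<lambda>t. - (dyn_A \<M> t ** R t + R t ** transpose (dyn_A \<M> t)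
                         + sig_V \<M> ** transpose (sig_V \<M>)
                         - R t ** transpose (obs_H \<M> t) ** matrix_inv (Sig_W \<M>) ** obs_H \<M> t ** R t))"

definition gain :: "('d::finite, 'm::finite, 'c::finite, 'p::finite, 'q::finite) model \<Rightarrow> (real \<Rightarrow> real^'d^'d) \<Rightarrow> real \<Rightarrow> real^'m^'d" where
  "gain \<M> R t = R t ** transpose (obs_H \<M> t) ** matrix_inv (Sig_W \<M>)"

definition Theta :: "('d::finite, 'm::finite, 'c::finite, 'p::finite, 'q::finite) model \<Rightarrow> (real \<Rightarrow> real^'d^'d) \<Rightarrow> real \<Rightarrow> real^'d^'d" where
  "Theta \<M> R t = gain \<M> R t ** obs_H \<M> t"

definition D_phi :: "('d::finite, 'm::finite, 'c::finite, 'p::finite, 'q::finite) model \<Rightarrow> (real \<Rightarrow> real^'d^'d) \<Rightarrow> (real \<Rightarrow> real^'d^'d)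
    \<Rightarrow> real \<Rightarrow> real^('d + 'd + 'd)^('d + 'd + 'd)" where
  "D_phi \<M> F R t = Concat
     (HConcat (dyn_A \<M> t) (- (K_mat \<M> t ** F t)) 0)
     (HConcat (Theta \<M> R t) (dyn_A \<M> t - K_mat \<M> t ** F t - Theta \<M> R t) 0)
     (HConcat 0 0 (dyn_A \<M> t - Theta \<M> R t))"

definition d_phi :: "('d::finite, 'm::finite, 'c::finite, 'p::finite, 'q::finite) model \<Rightarrow> (real \<Rightarrow> real^'d)
    \<Rightarrow> real \<Rightarrow> real^('d + 'd + 'd)" where
  "d_phi \<M> f t = Concat
     (dyn_a \<M> t - (1/2) *\<^sub>R (K_mat \<M> t *v f t))
     (dyn_a \<M> t - (1/2) *\<^sub>R (K_mat \<M> t *v f t))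
     0"

definition O_mat :: "('d::finite, 'm::finite, 'c::finite, 'p::finite, 'q::finite) model
    \<Rightarrow> real \<Rightarrow> real^('d + 'd + 'd)^('d + 'd + 'd)" where
  "O_mat \<M> t = (e_xc + e_dx) ** matrix_inv (pen_P \<M> t) ** transpose (e_xc + e_dx)"

definition l_phi :: "('d::finite, 'm::finite, 'c::finite, 'p::finite, 'q::finite) model \<Rightarrow> (real \<Rightarrow> real^'d^'d) \<Rightarrow> (real \<Rightarrow> real^'d)
    \<Rightarrow> real \<Rightarrow> real^('d + 'd + 'd)" where
  "l_phi \<M> F f t =
     (2 * lam \<M>) *\<^sub>R (e_xc *v (cost_Q \<M> t *v target \<M> t))
     - lam \<M> *\<^sub>R (e_xa *v ((F t ** K_mat \<M> t) *v f t))"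

definition Q_phi :: "('d::finite, 'm::finite, 'c::finite, 'p::finite, 'q::finite) model \<Rightarrow> (real \<Rightarrow> real^'d^'d)
    \<Rightarrow> real \<Rightarrow> real^('d + 'd + 'd)^('d + 'd + 'd)" where
  "Q_phi \<M> F t =
     (1/2) *\<^sub>R (e_dx ** transpose (obs_H \<M> t) ** matrix_inv (Sig_W \<M>) ** obs_H \<M> t ** transpose e_dx)
     - lam \<M> *\<^sub>R (e_xa ** F t ** K_mat \<M> t ** F t ** transpose e_xa)
     - lam \<M> *\<^sub>R (e_xc ** cost_Q \<M> t ** transpose e_xc)"

definition d_tau :: "('d::finite, 'm::finite, 'c::finite, 'p::finite, 'q::finite) model \<Rightarrow> (real \<Rightarrow> real^'d^'d) \<Rightarrow> (real \<Rightarrow> real^'m)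
    \<Rightarrow> real \<Rightarrow> real^('d + 'd + 'd)" where
  "d_tau \<M> R \<tau> t = Concat 0 (gain \<M> R t *v \<tau> t) (- (gain \<M> R t *v \<tau> t))"

definition l_tau :: "('d::finite, 'm::finite, 'c::finite, 'p::finite, 'q::finite) model \<Rightarrow> (real \<Rightarrow> real^'m)
    \<Rightarrow> real \<Rightarrow> real^('d + 'd + 'd)" where
  "l_tau \<M> \<tau> t = (e_dx ** transpose (obs_H \<M> t) ** matrix_inv (Sig_W \<M>)) *v \<tau> t"

definition is_Fphi :: "('d::finite, 'm::finite, 'c::finite, 'p::finite, 'q::finite) model \<Rightarrow> real \<Rightarrow> (real \<Rightarrow> real^'d^'d) \<Rightarrow> (real \<Rightarrow> real^'d^'d)
    \<Rightarrow> (real \<Rightarrow> real^('d + 'd + 'd)^('d + 'd + 'd)) \<Rightarrow> bool" where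
  "is_Fphi \<M> T F R F\<phi> \<longleftrightarrow> (\<forall>t\<in>{0..T}. sym_mat (F\<phi> t)) \<and> F\<phi> T = 0 \<and>
     ode_zero T F\<phi> (\<lambda>t. - (F\<phi> t ** O_mat \<M> t ** F\<phi> t) + F\<phi> t ** D_phi \<M> F R t
                         + transpose (D_phi \<M> F R t) ** F\<phi> t + 2 *\<^sub>R Q_phi \<M> F t)"

definition is_fphi :: "('d::finite, 'm::finite, 'c::finite, 'p::finite, 'q::finite) model \<Rightarrow> real \<Rightarrow> (real \<Rightarrow> real^'d^'d) \<Rightarrow> (real \<Rightarrow> real^'d)
    \<Rightarrow> (real \<Rightarrow> real^'d^'d) \<Rightarrow> (real \<Rightarrow> real^('d + 'd + 'd)^('d + 'd + 'd)) \<Rightarrow> (real \<Rightarrow> real^'m)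
    \<Rightarrow> (real \<Rightarrow> real^('d + 'd + 'd)) \<Rightarrow> bool" where
  "is_fphi \<M> T F f R F\<phi> \<tau> f\<phi> \<longleftrightarrow> f\<phi> T = 0 \<and>
     ode_zero T f\<phi> (\<lambda>t. - ((F\<phi> t ** O_mat \<M> t) *v f\<phi> t)
                         + F\<phi> t *v (d_phi \<M> f t + d_tau \<M> R \<tau> t)
                         + transpose (D_phi \<M> F R t) *v f\<phi> t
                         + l_phi \<M> F f t + l_tau \<M> \<tau> t)"

definition Phi0 :: "('d::finite, 'm::finite, 'c::finite, 'p::finite, 'q::finite) model \<Rightarrow> real^('d + 'd + 'd)" where
  "Phi0 \<M> = Concat (init_x \<M>) (init_x \<M>) 0"

definition G_mat :: "('d::finite, 'm::finite, 'c::finite, 'p::finite, 'q::finite) model \<Rightarrow> (real \<Rightarrow> real^'d^'d)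
    \<Rightarrow> real \<Rightarrow> real^'m^('d + 'd + 'd)" where
  "G_mat \<M> R t = Concat 0 (gain \<M> R t) (- gain \<M> R t)"

definition Q_F :: "('d::finite, 'm::finite, 'c::finite, 'p::finite, 'q::finite) model \<Rightarrow> (real \<Rightarrow> real^'d^'d)
    \<Rightarrow> (real \<Rightarrow> real^('d + 'd + 'd)^('d + 'd + 'd)) \<Rightarrow> real \<Rightarrow> real^'m^('d + 'd + 'd)" where
  "Q_F \<M> R F\<phi> t = F\<phi> t ** G_mat \<M> R t ** Sig_W \<M> + e_dx ** transpose (obs_H \<M> t)"

definition is_Ftau :: "('d::finite, 'm::finite, 'c::finite, 'p::finite, 'q::finite) model \<Rightarrow> real \<Rightarrow> (real \<Rightarrow> real^'d^'d) \<Rightarrow> (real \<Rightarrow> real^'d^'d)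
    \<Rightarrow> (real \<Rightarrow> real^('d + 'd + 'd)^('d + 'd + 'd)) \<Rightarrow> (real \<Rightarrow> real^('d + 'd + 'd)^('d + 'd + 'd)) \<Rightarrow> bool" where
  "is_Ftau \<M> T F R F\<phi> F\<tau> \<longleftrightarrow> (\<forall>t\<in>{0..T}. sym_mat (F\<tau> t)) \<and> F\<tau> 0 = 0 \<and>
     ode_zero T F\<tau> (\<lambda>t.
       let Q = Q_F \<M> R F\<phi> t; G = G_mat \<M> R t;
           N = transpose (D_phi \<M> F R t) - F\<phi> t ** O_mat \<M> t - Q ** transpose G
       in F\<tau> t ** Q ** matrix_inv (Sig_W \<M>) ** transpose Q ** F\<tau> t
          + (O_mat \<M> t + G ** Sig_W \<M> ** transpose G)
          - F\<tau> t ** N - transpose N ** F\<tau> t)"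

definition is_ftau :: "('d::finite, 'm::finite, 'c::finite, 'p::finite, 'q::finite) model \<Rightarrow> real \<Rightarrow> (real \<Rightarrow> real^'d^'d) \<Rightarrow> (real \<Rightarrow> real^'d)
    \<Rightarrow> (real \<Rightarrow> real^'d^'d) \<Rightarrow> (real \<Rightarrow> real^('d + 'd + 'd)^('d + 'd + 'd))
    \<Rightarrow> (real \<Rightarrow> real^('d + 'd + 'd)^('d + 'd + 'd)) \<Rightarrow> (real \<Rightarrow> real^('d + 'd + 'd)) \<Rightarrow> bool" where
  "is_ftau \<M> T F f R F\<phi> F\<tau> f\<tau> \<longleftrightarrow> f\<tau> 0 = 0 \<and>
     ode_zero T f\<tau> (\<lambda>t.
       let Q = Q_F \<M> R F\<phi> t; G = G_mat \<M> R t
       in - (F\<tau> t *v (F\<phi> t *v d_phi \<M> f t + l_phi \<M> F f t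
               - (Q ** matrix_inv (Sig_W \<M>) ** transpose Q) *v (f\<tau> t + Phi0 \<M>)))
          + (G ** transpose Q - D_phi \<M> F R t + transpose (O_mat \<M> t) ** transpose (F\<phi> t))
              *v (f\<tau> t + Phi0 \<M>)
          - d_phi \<M> f t)"

definition tau_formula :: "('d::finite, 'm::finite, 'c::finite, 'p::finite, 'q::finite) model \<Rightarrow> (real \<Rightarrow> real^'d^'d)
    \<Rightarrow> (real \<Rightarrow> real^('d + 'd + 'd)^('d + 'd + 'd)) \<Rightarrow> (real \<Rightarrow> real^('d + 'd + 'd)^('d + 'd + 'd))
    \<Rightarrow> (real \<Rightarrow> real^('d + 'd + 'd)) \<Rightarrow> (real \<Rightarrow> real^('d + 'd + 'd)) \<Rightarrow> real \<Rightarrow> real^'m" where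
  "tau_formula \<M> R F\<phi> F\<tau> f\<tau> f\<phi> t =
     - (transpose (Q_F \<M> R F\<phi> t) *v (F\<tau> t *v f\<phi> t + f\<tau> t + Phi0 \<M>))
     - (Sig_W \<M> ** transpose (G_mat \<M> R t)) *v f\<phi> t"


section \<open>Processes and noise\<close>

definition process_sigma :: "'w measure \<Rightarrow> real set \<Rightarrow> (real \<Rightarrow> 'w \<Rightarrow> 'b::topological_space) \<Rightarrow> 'w measure" where
  "process_sigma M I Z = sigma (space M) (\<Union>s\<in>I. {Z s -` B \<inter> space M | B. B \<in> sets borel})"

definition nat_filt :: "'w measure \<Rightarrow> (real \<Rightarrow> 'w \<Rightarrow> 'b::topological_space) \<Rightarrow> real \<Rightarrow> 'w measure" where
  "nat_filt M Z t = process_sigma M {0..t} Z"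

definition measurable_process :: "'w measure \<Rightarrow> real \<Rightarrow> (real \<Rightarrow> 'w \<Rightarrow> 'b::topological_space) \<Rightarrow> bool" where
  "measurable_process M T Z \<longleftrightarrow>
     (\<lambda>(t, \<omega>). Z t \<omega>) \<in> borel_measurable (restrict_space borel {0..T} \<Otimes>\<^sub>M M)"

text \<open>
  A random vector is \<open>N(\<mu>, C)\<close> iff each linear functional of it is univariate normal with the
  induced mean and variance; variance \<open>0\<close> (allowed, as \<open>C\<close> need only be semidefinite) is a Dirac law.
\<close>

definition gaussian :: "'w measure \<Rightarrow> ('w \<Rightarrow> real^'n) \<Rightarrow> real^'n \<Rightarrow> real^'n^'n \<Rightarrow> bool" where
  "gaussian M X \<mu> C \<longleftrightarrow> X \<in> borel_measurable M \<and>
     (\<forall>v. distr M borel (\<lambda>\<omega>. v \<bullet> X \<omega>) =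
        (if v \<bullet> (C *v v) = 0 then return borel (v \<bullet> \<mu>)
         else density lborel (normal_density (v \<bullet> \<mu>) (sqrt (v \<bullet> (C *v v))))))"

definition brownian_motion :: "'w measure \<Rightarrow> (real \<Rightarrow> 'w \<Rightarrow> real^'n) \<Rightarrow> bool" where
  "brownian_motion M V \<longleftrightarrow>
     (\<forall>t\<ge>0. V t \<in> borel_measurable M) \<and>
     (AE \<omega> in M. V 0 \<omega> = 0) \<and>
     (AE \<omega> in M. continuous_on {0..} (\<lambda>t. V t \<omega>)) \<and>
     (\<forall>s t. 0 \<le> s \<and> s < t \<longrightarrow>
        gaussian M (\<lambda>\<omega>. V t \<omega> - V s \<omega>) 0 (mat (t - s)) \<and>
        prob_space.indep_set M (sets (nat_filt M V s))
          (sets (vimage_algebra (space M) (\<lambda>\<omega>. V t \<omega> - V s \<omega>) borel)))"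

definition noise_setup :: "('d::finite, 'm::finite, 'c::finite, 'p::finite, 'q::finite) model \<Rightarrow> 'w measure \<Rightarrow> ('w \<Rightarrow> real^'d)
    \<Rightarrow> (real \<Rightarrow> 'w \<Rightarrow> real^'p) \<Rightarrow> (real \<Rightarrow> 'w \<Rightarrow> real^'q) \<Rightarrow> bool" where
  "noise_setup \<M> M X0 V W \<longleftrightarrow>
     prob_space M \<and> brownian_motion M V \<and> brownian_motion M W \<and>
     prob_space.indep_set M (sets (process_sigma M {0..} V)) (sets (process_sigma M {0..} W)) \<and>
     gaussian M X0 (init_x \<M>) (init_R \<M>) \<and>
     prob_space.indep_set M (sets (vimage_algebra (space M) X0 borel))
       (sets (process_sigma M {0..} (\<lambda>t \<omega>. (V t \<omega>, W t \<omega>))))"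

text \<open>
  \<open>I\<close> is (a continuous version of) the Ito integral \<open>\<integral>\<^sub>0\<^sup>t g\<^sub>s dY\<^sub>s\<close> of a deterministic continuous
  integrand against a continuous semimartingale: for such integrands it is the limit in probability of
  the left-endpoint Riemann sums.  All the drift integrals below are pathwise Lebesgue integrals, and
  integrals of constants against \<open>V\<close>, \<open>W\<close> are written out.
\<close>

definition ito_integral :: "'w measure \<Rightarrow> real \<Rightarrow> (real \<Rightarrow> real^'m^'d) \<Rightarrow> (real \<Rightarrow> 'w \<Rightarrow> real^'m)
    \<Rightarrow> (real \<Rightarrow> 'w \<Rightarrow> real^'d) \<Rightarrow> bool" where
  "ito_integral M T g Y I \<longleftrightarrow>
     (AE \<omega> in M. continuous_on {0..T} (\<lambda>t. I t \<omega>)) \<and>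
     (\<forall>t\<in>{0..T}. I t \<in> borel_measurable M \<and>
       (\<forall>\<epsilon>>0. (\<lambda>n. measure M {\<omega> \<in> space M. \<epsilon> <
           norm ((\<Sum>k<n. g (real k * t / real n) *v
                    (Y (real (Suc k) * t / real n) \<omega> - Y (real k * t / real n) \<omega>)) - I t \<omega>)})
         \<longlonglongrightarrow> 0))"

definition is_cond_exp :: "'w measure \<Rightarrow> 'w measure \<Rightarrow> ('w \<Rightarrow> real^'n) \<Rightarrow> ('w \<Rightarrow> real^'n) \<Rightarrow> bool" where
  "is_cond_exp M \<F> X Z \<longleftrightarrow> Z \<in> borel_measurable \<F> \<and>
     (\<forall>i. AE \<omega> in M. Z \<omega> $ i = real_cond_exp M \<F> (\<lambda>\<omega>. X \<omega> $ i) \<omega>)"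


section \<open>The attacked system and the criteria\<close>

definition state_attack :: "'w measure \<Rightarrow> real \<Rightarrow> (real \<Rightarrow> 'w \<Rightarrow> real^'m) \<Rightarrow> (real \<Rightarrow> 'w \<Rightarrow> real^'d) \<Rightarrow> bool" where
  "state_attack M T Yc \<rho> \<longleftrightarrow>
     measurable_process M T \<rho> \<and>
     (\<forall>t\<in>{0..T}. \<rho> t \<in> borel_measurable (nat_filt M Yc t)) \<and>
     (\<integral>\<^sup>+\<omega>. (\<integral>\<^sup>+t\<in>{0..T}. ennreal ((norm (\<rho> t \<omega>))\<^sup>2) \<partial>lborel) \<partial>M) < \<infinity>"

definition obs_attack :: "real \<Rightarrow> (real \<Rightarrow> real^'m) \<Rightarrow> bool" where
  "obs_attack T \<tau> \<longleftrightarrow> continuous_on {0..T} \<tau>"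

definition attacked_system :: "('d::finite, 'm::finite, 'c::finite, 'p::finite, 'q::finite) model \<Rightarrow> real \<Rightarrow> 'w measure
    \<Rightarrow> ('w \<Rightarrow> real^'d) \<Rightarrow> (real \<Rightarrow> 'w \<Rightarrow> real^'p) \<Rightarrow> (real \<Rightarrow> 'w \<Rightarrow> real^'q)
    \<Rightarrow> (real \<Rightarrow> real^'d^'d) \<Rightarrow> (real \<Rightarrow> real^'d)
    \<Rightarrow> (real \<Rightarrow> 'w \<Rightarrow> real^'d) \<Rightarrow> (real \<Rightarrow> real^'m)
    \<Rightarrow> (real \<Rightarrow> 'w \<Rightarrow> real^'d) \<Rightarrow> (real \<Rightarrow> 'w \<Rightarrow> real^'m) \<Rightarrow> (real \<Rightarrow> 'w \<Rightarrow> real^'d) \<Rightarrow> bool" where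
  "attacked_system \<M> T M X0 V W F f \<rho> \<tau> Xc Yc Xa \<longleftrightarrow>
     measurable_process M T Xc \<and> measurable_process M T Yc \<and>
     (\<forall>t\<in>{0..T}. Xc t \<in> borel_measurable (nat_filt M (\<lambda>t \<omega>. (X0 \<omega>, V t \<omega>, W t \<omega>)) t)) \<and>
     (\<forall>t\<in>{0..T}. sets (nat_filt M Yc t) \<subseteq> sets (nat_filt M (\<lambda>t \<omega>. (X0 \<omega>, V t \<omega>, W t \<omega>)) t)) \<and>
     (AE \<omega> in M. continuous_on {0..T} (\<lambda>t. Xc t \<omega>) \<and> continuous_on {0..T} (\<lambda>t. Yc t \<omega>)) \<and>
     (AE \<omega> in M. \<forall>t\<in>{0..T}. Xc t \<omega> = X0 \<omega>
        + (LINT s:{0..t}|lborel. dyn_A \<M> s *v Xc s \<omega> + dyn_B \<M> s *v u_star \<M> F f s (Xa s \<omega>)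
                                 + dyn_a \<M> s + \<rho> s \<omega>)
        + sig_V \<M> *v V t \<omega>) \<and>
     (AE \<omega> in M. \<forall>t\<in>{0..T}. Yc t \<omega> =
        (LINT s:{0..t}|lborel. obs_H \<M> s *v Xc s \<omega> + obs_h \<M> s + \<tau> s)
        + sig_W \<M> *v W t \<omega>)"

definition agent_filter :: "('d::finite, 'm::finite, 'c::finite, 'p::finite, 'q::finite) model \<Rightarrow> real \<Rightarrow> 'w measure
    \<Rightarrow> (real \<Rightarrow> real^'d^'d) \<Rightarrow> (real \<Rightarrow> real^'d) \<Rightarrow> (real \<Rightarrow> real^'d^'d)
    \<Rightarrow> (real \<Rightarrow> 'w \<Rightarrow> real^'m) \<Rightarrow> (real \<Rightarrow> 'w \<Rightarrow> real^'d) \<Rightarrow> bool" where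
  "agent_filter \<M> T M F f R Yc Xa \<longleftrightarrow>
     measurable_process M T Xa \<and>
     (\<forall>t\<in>{0..T}. Xa t \<in> borel_measurable (nat_filt M Yc t)) \<and>
     (AE \<omega> in M. continuous_on {0..T} (\<lambda>t. Xa t \<omega>)) \<and>
     (\<exists>I. ito_integral M T (gain \<M> R) Yc I \<and>
       (AE \<omega> in M. \<forall>t\<in>{0..T}. Xa t \<omega> = init_x \<M>
          + (LINT s:{0..t}|lborel. dyn_A \<M> s *v Xa s \<omega> + dyn_B \<M> s *v u_star \<M> F f s (Xa s \<omega>)
                                   + dyn_a \<M> s - gain \<M> R s *v (obs_H \<M> s *v Xa s \<omega> + obs_h \<M> s))
          + I t \<omega>))"

text \<open>
  The attack-aware filter is the conditional mean; that it obeys the Kalman--Bucy equation is a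
  standing fact of the model and is recorded here together with it.
\<close>

definition aware_filter :: "('d::finite, 'm::finite, 'c::finite, 'p::finite, 'q::finite) model \<Rightarrow> real \<Rightarrow> 'w measure
    \<Rightarrow> (real \<Rightarrow> real^'d^'d) \<Rightarrow> (real \<Rightarrow> real^'d) \<Rightarrow> (real \<Rightarrow> real^'d^'d)
    \<Rightarrow> (real \<Rightarrow> 'w \<Rightarrow> real^'d) \<Rightarrow> (real \<Rightarrow> real^'m)
    \<Rightarrow> (real \<Rightarrow> 'w \<Rightarrow> real^'d) \<Rightarrow> (real \<Rightarrow> 'w \<Rightarrow> real^'m) \<Rightarrow> (real \<Rightarrow> 'w \<Rightarrow> real^'d)
    \<Rightarrow> (real \<Rightarrow> 'w \<Rightarrow> real^'d) \<Rightarrow> bool" where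
  "aware_filter \<M> T M F f R \<rho> \<tau> Xc Yc Xa Xhat \<longleftrightarrow>
     (\<forall>t\<in>{0..T}. is_cond_exp M (nat_filt M Yc t) (Xc t) (Xhat t)) \<and>
     measurable_process M T Xhat \<and>
     (AE \<omega> in M. continuous_on {0..T} (\<lambda>t. Xhat t \<omega>)) \<and>
     (\<exists>I. ito_integral M T (gain \<M> R) Yc I \<and>
       (AE \<omega> in M. \<forall>t\<in>{0..T}. Xhat t \<omega> = init_x \<M>
          + (LINT s:{0..t}|lborel. dyn_A \<M> s *v Xhat s \<omega> + dyn_B \<M> s *v u_star \<M> F f s (Xa s \<omega>)
                                   + dyn_a \<M> s + \<rho> s \<omega>
                                   - gain \<M> R s *v (obs_H \<M> s *v Xhat s \<omega> + obs_h \<M> s + \<tau> s))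
          + I t \<omega>))"

definition rho_star :: "('d::finite, 'm::finite, 'c::finite, 'p::finite, 'q::finite) model
    \<Rightarrow> (real \<Rightarrow> real^('d + 'd + 'd)^('d + 'd + 'd)) \<Rightarrow> (real \<Rightarrow> real^('d + 'd + 'd))
    \<Rightarrow> (real \<Rightarrow> 'w \<Rightarrow> real^'d) \<Rightarrow> (real \<Rightarrow> 'w \<Rightarrow> real^'d) \<Rightarrow> real \<Rightarrow> 'w \<Rightarrow> real^'d" where
  "rho_star \<M> F\<phi> f\<phi> Xa Xhat t \<omega> =
     - ((matrix_inv (pen_P \<M> t) ** transpose (e_xc + e_dx)) *v
         (F\<phi> t *v Concat (Xhat t \<omega>) (Xa t \<omega>) (Xhat t \<omega> - Xa t \<omega>) + f\<phi> t))"

text \<open>The system under the observation attack \<open>\<tau>\<close> and the state attack \<open>\<rho>\<close>, with both filters.\<close>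

definition full_system :: "('d::finite, 'm::finite, 'c::finite, 'p::finite, 'q::finite) model \<Rightarrow> real \<Rightarrow> 'w measure
    \<Rightarrow> ('w \<Rightarrow> real^'d) \<Rightarrow> (real \<Rightarrow> 'w \<Rightarrow> real^'p) \<Rightarrow> (real \<Rightarrow> 'w \<Rightarrow> real^'q)
    \<Rightarrow> (real \<Rightarrow> real^'d^'d) \<Rightarrow> (real \<Rightarrow> real^'d) \<Rightarrow> (real \<Rightarrow> real^'d^'d)
    \<Rightarrow> (real \<Rightarrow> 'w \<Rightarrow> real^'d) \<Rightarrow> (real \<Rightarrow> real^'m)
    \<Rightarrow> (real \<Rightarrow> 'w \<Rightarrow> real^'d) \<Rightarrow> (real \<Rightarrow> 'w \<Rightarrow> real^'m) \<Rightarrow> (real \<Rightarrow> 'w \<Rightarrow> real^'d)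
    \<Rightarrow> (real \<Rightarrow> 'w \<Rightarrow> real^'d) \<Rightarrow> bool" where
  "full_system \<M> T M X0 V W F f R \<rho> \<tau> Xc Yc Xa Xhat \<longleftrightarrow>
     state_attack M T Yc \<rho> \<and> obs_attack T \<tau> \<and>
     attacked_system \<M> T M X0 V W F f \<rho> \<tau> Xc Yc Xa \<and>
     agent_filter \<M> T M F f R Yc Xa \<and>
     aware_filter \<M> T M F f R \<rho> \<tau> Xc Yc Xa Xhat"

definition D_crit :: "('d::finite, 'm::finite, 'c::finite, 'p::finite, 'q::finite) model \<Rightarrow> real \<Rightarrow> 'w measure
    \<Rightarrow> (real \<Rightarrow> real^'d^'d) \<Rightarrow> (real \<Rightarrow> real^'d)
    \<Rightarrow> (real \<Rightarrow> 'w \<Rightarrow> real^'d) \<Rightarrow> (real \<Rightarrow> 'w \<Rightarrow> real^'d) \<Rightarrow> real" where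
  "D_crit \<M> T M F f Xc Xa = (\<integral>\<omega>. (LINT t:{0..T}|lborel.
       (Xc t \<omega> - target \<M> t) \<bullet> (cost_Q \<M> t *v (Xc t \<omega> - target \<M> t))
       + u_star \<M> F f t (Xa t \<omega>) \<bullet> (cost_S \<M> t *v u_star \<M> F f t (Xa t \<omega>))) \<partial>M)"

definition S_crit :: "('d::finite, 'm::finite, 'c::finite, 'p::finite, 'q::finite) model \<Rightarrow> real \<Rightarrow> 'w measure
    \<Rightarrow> (real \<Rightarrow> real^'m) \<Rightarrow> (real \<Rightarrow> 'w \<Rightarrow> real^'d) \<Rightarrow> (real \<Rightarrow> 'w \<Rightarrow> real^'d) \<Rightarrow> real" where
  "S_crit \<M> T M \<tau> Xa Xhat = (1/2) * (\<integral>\<omega>. (LINT t:{0..T}|lborel.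
       (obs_H \<M> t *v (Xhat t \<omega> - Xa t \<omega>) + \<tau> t) \<bullet>
         (matrix_inv (Sig_W \<M>) *v (obs_H \<M> t *v (Xhat t \<omega> - Xa t \<omega>) + \<tau> t))) \<partial>M)"

definition J_crit :: "('d::finite, 'm::finite, 'c::finite, 'p::finite, 'q::finite) model \<Rightarrow> real \<Rightarrow> 'w measure
    \<Rightarrow> (real \<Rightarrow> real^'d^'d) \<Rightarrow> (real \<Rightarrow> real^'d)
    \<Rightarrow> (real \<Rightarrow> 'w \<Rightarrow> real^'d) \<Rightarrow> (real \<Rightarrow> real^'m)
    \<Rightarrow> (real \<Rightarrow> 'w \<Rightarrow> real^'d) \<Rightarrow> (real \<Rightarrow> 'w \<Rightarrow> real^'d) \<Rightarrow> (real \<Rightarrow> 'w \<Rightarrow> real^'d) \<Rightarrow> real" where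
  "J_crit \<M> T M F f \<rho> \<tau> Xc Xa Xhat =
     S_crit \<M> T M \<tau> Xa Xhat - lam \<M> * D_crit \<M> T M F f Xc Xa
     + (1/2) * (\<integral>\<omega>. (LINT t:{0..T}|lborel. \<rho> t \<omega> \<bullet> (pen_P \<M> t *v \<rho> t \<omega>)) \<partial>M)"

end

theory Submission
  imports Defs
begin

text \<open>
  Write \<open>e = X\<^sup>c - \<Phi>\<^sub>1\<close>, where \<open>\<Phi> = Concat(X\<^sup>c-filter, X\<^sup>a-filter, \<Delta>X)\<close>.  Under the feedback \<open>\<rho>\<^sup>*(\<tau>)\<close> the pair
  \<open>(e, \<Phi>)\<close> solves a linear equation whose noise does not depend on \<open>\<tau>\<close>: the martingale part of each Ito
  integral against \<open>Y\<^sup>c\<close> is the limit in probability of Riemann sums of \<open>\<sigma>\<^sub>W W\<close>.  Hence \<open>\<Phi>\<close> is its mean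
  \<open>\<phi>\<close> plus a centred process that is almost surely the same for all \<open>\<tau>\<close>, and \<open>\<J>(\<rho>\<^sup>*(\<tau>), \<tau>)\<close> is
  the cost of the deterministic path \<open>\<phi>\<close> plus a constant.

  For the deterministic cost, add the derivative of \<open>\<onehalf> \<phi>\<bullet>F\<^sup>\<phi>\<phi> + f\<^sup>\<phi>\<bullet>\<phi>\<close> and subtract that of
  \<open>\<onehalf> f\<^sup>\<phi>\<bullet>F\<^sup>\<tau>f\<^sup>\<phi> + (f\<^sup>\<tau> + \<Phi>\<^sub>0)\<bullet>f\<^sup>\<phi>\<close>.  The two Riccati equations turn the integrand into
  \<open>\<onehalf> |\<tau> - \<tau>\<^sup>*|\<^sup>2\<close> in the norm of \<open>(\<sigma>\<^sub>W \<sigma>\<^sub>W\<^sup>T)\<^sup>-\<^sup>1\<close>, plus terms independent of \<open>\<tau>\<close>, where \<open>\<tau>\<^sup>*\<close> is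
  the asserted feedback in \<open>f\<^sup>\<phi>\<close>.  Closing the loop leaves a linear terminal value problem for \<open>f\<^sup>\<phi>\<close>, which
  has exactly one solution.  Solvability for small \<open>T\<close> is Picard's theorem, applied to the Riccati equations
  truncated outside a ball.
\<close>

section \<open>Ordinary differential equations\<close>

text \<open>The weights of \<open>D_crit\<close> enter with a negative sign, so no convexity is at
  hand: both completions of squares are exact identities, and positivity comes only from
  \<open>matrix_inv (Sig_W \<M>)\<close>. After the first completion \<open>f\<phi>\<close> is the
  state of a second linear-quadratic problem steered by \<tau>. It is known at \<open>T\<close>,
  while its value at 0 is charged through \<open>f\<phi> 0 \<bullet> Phi0\<close>. Hence the Riccati
  equation of \<open>F\<tau>\<close> runs forward from 0, and \<open>Phi0\<close> always accompanies
  \<open>f\<tau>\<close>. The candidate refers to an \<open>f\<phi>\<close> that itself depends on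
  \<tau>, so its existence is a fixed point question. The systems for different \<tau> are linked
  only by limits in probability at fixed times; their noise is compared time by time and then along
  paths by continuity. Second moments must be uniform in time before expectation and time integral
  can be exchanged; a pathwise Gronwall bound and Fatou's lemma supply them. Data prescribed at
  \<open>T\<close> make coefficients depend on the horizon, so each existence time has to be uniform
  over all solutions of the preceding equations.\<close>

lemma gronwall_sq:
  fixes y :: "real \<Rightarrow> 'a::real_inner"
  assumes der: "\<And>t. t \<in> {0..T} \<Longrightarrow> (y has_vector_derivative y' t) (at t within {0..T})"
    and y0: "y 0 = 0"
    and bnd: "\<And>t. t \<in> {0..T} \<Longrightarrow> norm (y' t) \<le> L * norm (y t) + h t"
    and h: "continuous_on {0..T} h" "\<And>t. t \<in> {0..T} \<Longrightarrow> 0 \<le> h t"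
    and "0 \<le> L" and t: "t \<in> {0..T}"
  shows "(norm (y t))\<^sup>2 \<le> exp ((2 * L + 1) * t) * integral {0..t} (\<lambda>s. (h s)\<^sup>2)"
proof (cases "t = 0")
  case True
  then show ?thesis using y0 by simp
next
  case False
  with t have t0: "0 < t" and tT: "t \<le> T" by auto
  \<comment> \<open>The squared norm is used because it is differentiable where \<open>y\<close>
    vanishes. In the rate \<open>?c\<close>, the part 2L absorbs the linear growth and the 1 pays
    for the mixed term, by 2|y|h \<le> |y|^2 + h^2.\<close>
  let ?c = "2 * L + 1"
  let ?\<psi> = "\<lambda>s. exp (- ?c * s) * (y s \<bullet> y s) - integral {0..s} (\<lambda>s. (h s)\<^sup>2)"
  let ?\<psi>' = "\<lambda>s. exp (- ?c * s) * (y s \<bullet> y' s + y' s \<bullet> y s) + (- ?c * exp (- ?c * s)) * (y s \<bullet> y s) - (h s)\<^sup>2"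
  have sub: "{0..t} \<subseteq> {0..T}" using tT by auto
  have ch: "continuous_on {0..t} (\<lambda>s. (h s)\<^sup>2)"
    using h(1) sub by (intro continuous_intros) (rule continuous_on_subset)
  have d: "(?\<psi> has_derivative (\<lambda>x. x * ?\<psi>' s)) (at s within {0..t})" if s: "0 \<le> s" "s \<le> t" for s
  proof -
    have 1: "(y has_vector_derivative y' s) (at s within {0..t})"
      using der[of s] s tT has_vector_derivative_within_subset[OF _ sub] by auto
    have 2: "((\<lambda>s. integral {0..s} (\<lambda>s. (h s)\<^sup>2)) has_real_derivative (h s)\<^sup>2) (at s within {0..t})"
      using integral_has_real_derivative[OF ch] s by auto
    have 3: "((\<lambda>s. y s \<bullet> y s) has_real_derivative (y s \<bullet> y' s + y' s \<bullet> y s)) (at s within {0..t})"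
      using bounded_bilinear.has_vector_derivative[OF bounded_bilinear_inner 1 1]
      by (simp add: has_real_derivative_iff_has_vector_derivative)
    have "(?\<psi> has_real_derivative ?\<psi>' s) (at s within {0..t})"
      by (rule DERIV_diff[OF _ 2] derivative_eq_intros 3 refl | simp)+
    then show ?thesis
      by (simp only: has_field_derivative_def mult_commute_abs)
  qed
  obtain s where s: "s \<in> {0<..<t}" and eq: "?\<psi> t - ?\<psi> 0 = (t - 0) * ?\<psi>' s"
    using mvt_simple[OF t0, of ?\<psi> "\<lambda>s x. x * ?\<psi>' s"] d by blast
  have sT: "s \<in> {0..T}" using s tT by auto
  have "?\<psi>' s \<le> 0"
  proof -
    have "y s \<bullet> y' s \<le> norm (y s) * norm (y' s)" by (rule norm_cauchy_schwarz)
    also have "\<dots> \<le> norm (y s) * (L * norm (y s) + h s)"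
      by (intro mult_left_mono bnd sT) auto
    finally have "2 * (y s \<bullet> y' s) \<le> 2 * L * (norm (y s))\<^sup>2 + 2 * norm (y s) * h s"
      by (simp add: algebra_simps power2_eq_square)
    moreover have "2 * norm (y s) * h s \<le> (norm (y s))\<^sup>2 + (h s)\<^sup>2"
      by (rule sum_squares_bound)
    ultimately have a: "2 * (y s \<bullet> y' s) - ?c * (y s \<bullet> y s) \<le> (h s)\<^sup>2"
      by (simp add: algebra_simps power2_norm_eq_inner)
    have "?\<psi>' s = exp (- ?c * s) * (2 * (y s \<bullet> y' s) - ?c * (y s \<bullet> y s)) - (h s)\<^sup>2"
      by (simp add: algebra_simps inner_commute)
    also have "\<dots> \<le> exp (- ?c * s) * (h s)\<^sup>2 - (h s)\<^sup>2"
      using a by simp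
    also have "\<dots> \<le> 0"
      using s \<open>0 \<le> L\<close> by (simp add: mult_left_le_one_le mult_le_0_iff)
    finally show ?thesis .
  qed
  then have "(t - 0) * ?\<psi>' s \<le> 0" using t0 by (intro mult_nonneg_nonpos) auto
  then have "?\<psi> t \<le> ?\<psi> 0" unfolding eq[symmetric] by linarith
  then have "exp (- ?c * t) * (y t \<bullet> y t) \<le> integral {0..t} (\<lambda>s. (h s)\<^sup>2)" using y0 by simp
  then have "exp (?c * t) * (exp (- ?c * t) * (y t \<bullet> y t)) \<le> exp (?c * t) * integral {0..t} (\<lambda>s. (h s)\<^sup>2)"
    by simp
  moreover have "exp (?c * t) * (exp (- ?c * t) * (y t \<bullet> y t)) = y t \<bullet> y t"
    by (simp only: mult.assoc[symmetric] exp_add[symmetric]) (simp add: algebra_simps)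
  ultimately show ?thesis by (simp only: power2_norm_eq_inner)
qed

text \<open>Time reversal reduces problems with data at \<open>T\<close> to problems with data at
  0.\<close>

lemma has_vector_derivative_reverse:
  fixes y :: "real \<Rightarrow> 'a::real_normed_vector"
  assumes "(y has_vector_derivative y') (at (T - t) within {0..T})"
  shows "((\<lambda>s. y (T - s)) has_vector_derivative - y') (at t within {0..T})"
proof -
  have im: "(\<lambda>s. T - s) ` {0..T} = {0..T}"
    by (auto simp: image_iff intro!: bexI[of _ "T - x" for x])
  have "((\<lambda>s. T - s) has_vector_derivative (0 - 1)) (at t within {0..T})"
    by (rule has_vector_derivative_diff has_vector_derivative_const has_vector_derivative_id)+
  from vector_diff_chain_within[OF this, of y y'] assms
  show ?thesis by (simp add: im o_def)
qed

lemma linear_growth_zero: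
  fixes w :: "real \<Rightarrow> 'a::real_inner"
  assumes der: "\<And>t. t \<in> {0..T} \<Longrightarrow> (w has_vector_derivative w' t) (at t within {0..T})"
    and bnd: "\<And>t. t \<in> {0..T} \<Longrightarrow> norm (w' t) \<le> L * norm (w t)"
    and L: "0 \<le> L" and t: "t \<in> {0..T}" and w0: "w 0 = 0 \<or> w T = 0"
  shows "w t = 0"
  using w0
proof
  assume "w 0 = 0"
  have "(norm (w t))\<^sup>2 \<le> exp ((2 * L + 1) * t) * integral {0..t} (\<lambda>s. (0::real)\<^sup>2)"
    by (rule gronwall_sq[OF der \<open>w 0 = 0\<close> _ _ _ L t]) (use bnd in auto)
  then show ?thesis by simp
next
  assume "w T = 0"
  have der': "((\<lambda>s. w (T - s)) has_vector_derivative - w' (T - s)) (at s within {0..T})" if "s \<in> {0..T}" for s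
    by (rule has_vector_derivative_reverse) (use der that in auto)
  have "(norm (w (T - (T - t))))\<^sup>2 \<le> exp ((2 * L + 1) * (T - t)) * integral {0..T - t} (\<lambda>s. (0::real)\<^sup>2)"
    by (rule gronwall_sq[OF der' _ _ _ _ L]) (use bnd t \<open>w T = 0\<close> in auto)
  then show ?thesis by simp
qed

text \<open>Banach's fixed point theorem for the rescaled unknown exp(-K t) y(t) in the space of
  bounded continuous functions. The exponential weight makes the integral operator a contraction on
  all of [0, T], so no local solutions have to be glued together.\<close>

lemma picard_global:
  fixes g :: "real \<Rightarrow> 'a::euclidean_space \<Rightarrow> 'a"
  assumes cont: "continuous_on ({0..T} \<times> UNIV) (\<lambda>(t, x). g t x)"
    and lip: "\<And>t x y. t \<in> {0..T} \<Longrightarrow> norm (g t x - g t y) \<le> L * norm (x - y)"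
    and T: "0 \<le> T"
  obtains y where "y 0 = y0"
    and "\<And>t. t \<in> {0..T} \<Longrightarrow> (y has_vector_derivative g t (y t)) (at t within {0..T})"
proof -
  \<comment> \<open>Integrating (|L| + 1) exp(K s) produces the factor (|L| + 1) / K, which this
    choice makes equal to 1/2. Using |L| + 1 in place of \<open>L\<close> keeps \<open>K\<close>
    positive whatever the value of \<open>L\<close>.\<close>
  define K where "K = 2 * (\<bar>L\<bar> + 1)"
  have K: "0 < K" by (simp add: K_def)
  \<comment> \<open>Bounded continuous functions live on the whole line; clamping the argument
    extends a function on [0, T] by constants.\<close>
  define cl where "cl t = max 0 (min T t)" for t :: real
  have cl: "cl t \<in> {0..T}" "continuous_on A cl" for t A
    using T by (auto simp: cl_def intro!: continuous_intros)
  have cl_id: "cl t = t" if "t \<in> {0..T}" for t using that by (auto simp: cl_def)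
  define I where "I z t = exp (- K * t) *\<^sub>R (y0 + integral {0..t} (\<lambda>s. g s (exp (K * s) *\<^sub>R z s)))"
    for z :: "real \<Rightarrow> 'a" and t
  have cg: "continuous_on {0..T} (\<lambda>s. g s (exp (K * s) *\<^sub>R z s))" if "continuous_on {0..T} z" for z
  proof -
    have "continuous_on {0..T} (\<lambda>s. (s, exp (K * s) *\<^sub>R z s))" by (intro continuous_intros that)
    from continuous_on_compose2[OF cont this] show ?thesis by auto
  qed
  have cI: "continuous_on {0..T} (I z)" if "continuous_on {0..T} z" for z
    unfolding I_def
    by (intro continuous_intros indefinite_integral_continuous_1 integrable_continuous_real cg that)
  have bI: "(\<lambda>t. I z (cl t)) \<in> bcontfun" if "continuous_on {0..T} z" for z
  proof -
    have "compact (I z ` {0..T})" by (intro compact_continuous_image cI that) auto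
    then have "bounded (I z ` {0..T})" by (rule compact_imp_bounded)
    then obtain b where "\<forall>x\<in>I z ` {0..T}. norm x \<le> b" unfolding bounded_iff ..
    moreover have "continuous_on UNIV (\<lambda>t. I z (cl t))"
      by (rule continuous_on_compose2[OF cI[OF that] cl(2)]) (use cl in auto)
    ultimately show ?thesis using cl by (intro bcontfun_normI[of _ b]) auto
  qed
  define F where "F z = Bcontfun (\<lambda>t. I (apply_bcontfun z) (cl t))" for z :: "real \<Rightarrow>\<^sub>C 'a"
  have F: "apply_bcontfun (F z) t = I (apply_bcontfun z) (cl t)" for z t
    unfolding F_def by (subst Bcontfun_inverse[OF bI]) auto
  have contr: "dist (F z) (F w) \<le> (1/2) * dist z w" for z w
  proof (rule dist_bound)
    fix t0
    define t where "t = cl t0"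
    have t: "t \<in> {0..T}" using cl by (simp add: t_def)
    let ?d = "dist z w"
    let ?G = "\<lambda>z s. g s (exp (K * s) *\<^sub>R apply_bcontfun z s)"
    have sub: "{0..t} \<subseteq> {0..T}" using t by auto
    have int: "?G z integrable_on {0..t}" for z
      by (intro integrable_continuous_real continuous_on_subset[OF cg sub]) auto
    have ei: "((\<lambda>s. (\<bar>L\<bar> + 1) * ?d * exp (K * s)) has_integral
        ((\<bar>L\<bar> + 1) * ?d * exp (K * t) / K - (\<bar>L\<bar> + 1) * ?d * exp (K * 0) / K)) {0..t}"
      using t K
      by (intro fundamental_theorem_of_calculus)
        (auto intro!: derivative_eq_intros simp: has_real_derivative_iff_has_vector_derivative[symmetric])
    have "norm (integral {0..t} (?G z) - integral {0..t} (?G w))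
        = norm (integral {0..t} (\<lambda>s. ?G z s - ?G w s))"
      by (simp add: integral_diff int)
    also have "\<dots> \<le> integral {0..t} (\<lambda>s. (\<bar>L\<bar> + 1) * ?d * exp (K * s))"
    proof (rule integral_norm_bound_integral)
      show "(\<lambda>s. ?G z s - ?G w s) integrable_on {0..t}" by (intro integrable_diff int)
      show "(\<lambda>s. (\<bar>L\<bar> + 1) * ?d * exp (K * s)) integrable_on {0..t}" using ei by blast
      fix s assume s: "s \<in> {0..t}"
      have "norm (?G z s - ?G w s) \<le> L * norm (exp (K * s) *\<^sub>R apply_bcontfun z s - exp (K * s) *\<^sub>R apply_bcontfun w s)"
        using s sub by (intro lip) auto
      also have "\<dots> \<le> (\<bar>L\<bar> + 1) * norm (exp (K * s) *\<^sub>R apply_bcontfun z s - exp (K * s) *\<^sub>R apply_bcontfun w s)"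
        by (intro mult_right_mono) auto
      also have "\<dots> = (\<bar>L\<bar> + 1) * exp (K * s) * dist (apply_bcontfun z s) (apply_bcontfun w s)"
        by (simp add: dist_norm scaleR_diff_right[symmetric])
      also have "\<dots> \<le> (\<bar>L\<bar> + 1) * exp (K * s) * ?d"
        by (intro mult_left_mono dist_bounded) auto
      finally show "norm (?G z s - ?G w s) \<le> (\<bar>L\<bar> + 1) * ?d * exp (K * s)" by (simp add: mult_ac)
    qed
    also have "\<dots> = (\<bar>L\<bar> + 1) * ?d * exp (K * t) / K - (\<bar>L\<bar> + 1) * ?d * exp (K * 0) / K"
      using ei by blast
    also have "\<dots> \<le> (\<bar>L\<bar> + 1) * ?d * exp (K * t) / K" using K by simp
    also have "\<dots> = exp (K * t) * ((1/2) * ?d)" by (simp add: K_def field_simps)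
    finally have "exp (- K * t) * norm (integral {0..t} (?G z) - integral {0..t} (?G w))
        \<le> exp (- K * t) * (exp (K * t) * ((1/2) * ?d))" by simp
    also have "\<dots> = (1/2) * ?d" by (simp add: mult.assoc[symmetric] exp_add[symmetric])
    finally show "dist (apply_bcontfun (F z) t0) (apply_bcontfun (F w) t0) \<le> (1/2) * ?d"
      by (simp add: F I_def dist_norm scaleR_diff_right[symmetric] t_def)
  qed
  obtain z where z: "F z = z"
    using banach_fix_type[of "1/2" F] contr by auto
  define y where "y t = exp (K * t) *\<^sub>R apply_bcontfun z t" for t
  have y: "y t = y0 + integral {0..t} (\<lambda>s. g s (y s))" if "t \<in> {0..T}" for t
  proof -
    have "apply_bcontfun z t = I (apply_bcontfun z) t" using F[of z t] z cl_id[OF that] by simp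
    then have "y t = (exp (K * t) * exp (- K * t)) *\<^sub>R (y0 + integral {0..t} (\<lambda>s. g s (y s)))"
      unfolding y_def I_def by simp
    then show ?thesis by (simp add: exp_add[symmetric])
  qed
  have cgy: "continuous_on {0..T} (\<lambda>s. g s (y s))" unfolding y_def by (rule cg) auto
  show ?thesis
  proof (rule that)
    show "y 0 = y0" using y[of 0] T by simp
    fix t assume t: "t \<in> {0..T}"
    have "((\<lambda>t. y0 + integral {0..t} (\<lambda>s. g s (y s))) has_vector_derivative 0 + g t (y t)) (at t within {0..T})"
      by (intro has_vector_derivative_add has_vector_derivative_const integral_has_vector_derivative cgy t)
    then show "(y has_vector_derivative g t (y t)) (at t within {0..T})"
      using has_vector_derivative_transform[OF t y] by simp
  qed
qed

lemma picard_terminal: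
  fixes g :: "real \<Rightarrow> 'a::euclidean_space \<Rightarrow> 'a"
  assumes cont: "continuous_on ({0..T} \<times> UNIV) (\<lambda>(t, x). g t x)"
    and lip: "\<And>t x y. t \<in> {0..T} \<Longrightarrow> norm (g t x - g t y) \<le> L * norm (x - y)"
    and T: "0 \<le> T"
  obtains y where "y T = y0"
    and "\<And>t. t \<in> {0..T} \<Longrightarrow> (y has_vector_derivative g t (y t)) (at t within {0..T})"
proof -
  have c: "continuous_on ({0..T} \<times> UNIV) (\<lambda>(t, x). - g (T - t) x)"
  proof -
    have "continuous_on ({0..T} \<times> UNIV) (\<lambda>p :: real \<times> 'a. (T - fst p, snd p))" by (intro continuous_intros)
    from continuous_on_compose2[OF cont this] have "continuous_on ({0..T} \<times> UNIV) (\<lambda>p. g (T - fst p) (snd p))"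
      by (auto simp: image_subset_iff)
    then show ?thesis unfolding case_prod_unfold by (rule continuous_on_minus)
  qed
  have l: "norm (- g (T - t) x - - g (T - t) y) \<le> L * norm (x - y)" if "t \<in> {0..T}" for t x y
    using lip[of "T - t" y x] that by (simp add: norm_minus_commute[of x y])
  obtain x where x: "x 0 = y0" "\<And>t. t \<in> {0..T} \<Longrightarrow> (x has_vector_derivative - g (T - t) (x t)) (at t within {0..T})"
    by (rule picard_global[OF c _ T, of L y0], erule l, rule that)
  show ?thesis
  proof (rule that[of "\<lambda>t. x (T - t)"])
    fix t assume "t \<in> {0..T}"
    then show "((\<lambda>t. x (T - t)) has_vector_derivative g t (x (T - t))) (at t within {0..T})"
      using has_vector_derivative_reverse[OF x(2)[of "T - t"]] by simp
  qed (use x in simp)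
qed
section \<open>Matrix functions\<close>

lemma matrix_add_mult_distrib:
  "(A + B) ** C = A ** C + B ** C" for A B :: "'a::semiring_1^'n^'m"
  by (simp add: matrix_matrix_mult_def vec_eq_iff sum.distrib distrib_right)

lemma matrix_inv:
  assumes "invertible A"
  shows matrix_inv_right: "A ** matrix_inv A = mat 1"
    and matrix_inv_left: "matrix_inv A ** A = mat 1"
  using someI_ex[OF assms[unfolded invertible_def]] by (simp_all add: matrix_inv_def)

lemma bounded_bilinear_matrix_matrix_mult:
  "bounded_bilinear ((**) :: real^'n^'m \<Rightarrow> real^'p^'n \<Rightarrow> real^'p^'m)"
  unfolding bilinear_conv_bounded_bilinear[symmetric] bilinear_def
  by (auto intro!: linearI simp: matrix_add_ldistrib matrix_add_mult_distrib
      scalar_matrix_assoc[symmetric] matrix_scalar_ac)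

lemma bounded_bilinear_matrix_vector_mult:
  "bounded_bilinear ((*v) :: real^'n^'m \<Rightarrow> real^'n \<Rightarrow> real^'m)"
  unfolding bilinear_conv_bounded_bilinear[symmetric] bilinear_def
  by (auto intro!: linearI simp: matrix_vector_right_distrib matrix_vector_mult_add_rdistrib
      scaleR_matrix_vector_assoc[symmetric] matrix_vector_mult_scaleR)

lemma bounded_linear_transpose: "bounded_linear (transpose :: real^'n^'m \<Rightarrow> real^'m^'n)"
  unfolding linear_conv_bounded_linear[symmetric]
  by (auto intro!: linearI simp: transpose_def vec_eq_iff)

lemmas continuous_on_matrix_mult [continuous_intros] =
  bounded_bilinear.continuous_on[OF bounded_bilinear_matrix_matrix_mult]
lemmas continuous_on_matrix_vector_mult [continuous_intros] =
  bounded_bilinear.continuous_on[OF bounded_bilinear_matrix_vector_mult]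
lemmas continuous_on_transpose [continuous_intros] =
  bounded_linear.continuous_on[OF bounded_linear_transpose]

lemma continuous_on_Concat [continuous_intros]:
  fixes f g h :: "'x::topological_space \<Rightarrow> 'a::topological_space^'d"
  assumes "continuous_on S f" "continuous_on S g" "continuous_on S h"
  shows "continuous_on S (\<lambda>x. Concat (f x) (g x) (h x))"
  unfolding Concat_def
proof (rule continuous_on_vec_lambda)
  fix i :: "'d + 'd + 'd"
  show "continuous_on S (\<lambda>x. case i of Inl j \<Rightarrow> f x $ j | Inr (Inl j) \<Rightarrow> g x $ j | Inr (Inr j) \<Rightarrow> h x $ j)"
  proof (cases i)
    case (Inl a)
    then show ?thesis using assms by (simp add: continuous_on_component)
  next
    case (Inr b)
    then show ?thesis using assms by (cases b) (simp_all add: continuous_on_component)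
  qed
qed

lemma continuous_on_HConcat [continuous_intros]:
  fixes f g h :: "'x::topological_space \<Rightarrow> 'a::topological_space^'d^'n"
  assumes "continuous_on S f" "continuous_on S g" "continuous_on S h"
  shows "continuous_on S (\<lambda>x. HConcat (f x) (g x) (h x))"
  unfolding HConcat_def
  using assms by (intro continuous_on_vec_lambda continuous_on_Concat continuous_on_component)

text \<open>Cramer's rule, column by column. The quotient of determinants makes the continuity of
  inversion evident.\<close>

lemma matrix_inv_eq:
  fixes A :: "real^'n^'n"
  assumes "invertible A"
  shows "matrix_inv A = (\<chi> i j. det (\<chi> k l. if l = i then axis j 1 $ k else A $ k $ l) / det A)"
proof -
  have d: "det A \<noteq> 0" using assms invertible_det_nz by blast
  have "matrix_inv A $ i $ j = det (\<chi> k l. if l = i then axis j 1 $ k else A $ k $ l) / det A" for i j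
  proof -
    have "A *v (matrix_inv A *v axis j 1) = axis j 1"
      by (simp add: matrix_vector_mul_assoc matrix_inv_right[OF assms])
    then have "matrix_inv A *v axis j 1 = (\<chi> k. det (\<chi> i l. if l = k then axis j 1 $ i else A $ i $ l) / det A)"
      using cramer[OF d] by blast
    moreover have "matrix_inv A $ i $ j = (matrix_inv A *v axis j 1) $ i"
      by (simp add: matrix_vector_mult_basis column_def)
    ultimately show ?thesis by simp
  qed
  then show ?thesis by (simp add: vec_eq_iff)
qed

lemma continuous_on_det [continuous_intros]:
  fixes f :: "'x::topological_space \<Rightarrow> real^'n^'n"
  assumes "continuous_on S f"
  shows "continuous_on S (\<lambda>x. det (f x))"
  unfolding det_def using assms by (intro continuous_intros)

lemma continuous_on_matrix_inv:
  fixes f :: "'x::topological_space \<Rightarrow> real^'n^'n"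
  assumes "continuous_on S f" "\<And>x. x \<in> S \<Longrightarrow> invertible (f x)"
  shows "continuous_on S (\<lambda>x. matrix_inv (f x))"
proof -
  have c: "continuous_on S (\<lambda>x. if l = i then axis j 1 $ k else f x $ k $ l)" for i j k l :: 'n
    using assms(1) by (cases "l = i") (auto intro!: continuous_intros)
  have "continuous_on S (\<lambda>x. \<chi> i j. det (\<chi> k l. if l = i then axis j 1 $ k else f x $ k $ l) / det (f x))"
    using assms invertible_det_nz
    by (intro continuous_on_vec_lambda continuous_on_divide continuous_on_det c) auto
  then show ?thesis
    by (rule continuous_on_eq) (simp add: matrix_inv_eq[OF assms(2)])
qed

lemma pd_mat_invertible:
  fixes A :: "real^'n^'n"
  assumes "pd_mat A"
  shows "invertible A"
proof -
  have "v = 0" if "A *v v = 0" for v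
    using assms that unfolding pd_mat_def by (metis inner_zero_right less_irrefl)
  then show ?thesis
    using matrix_left_invertible_ker[of A] invertible_left_inverse by blast
qed

lemma sym_mat_inner: "sym_mat A \<Longrightarrow> (A *v x) \<bullet> y = x \<bullet> (A *v y)"
  by (metis dot_lmul_matrix inner_commute sym_mat_def transpose_matrix_vector)

lemma inner_transpose_right: "x \<bullet> (transpose A *v y) = (A *v x) \<bullet> y" for A :: "real^'n^'m"
  by (metis dot_lmul_matrix inner_commute transpose_matrix_vector)

lemma pd_mat_matrix_inv:
  fixes A :: "real^'n^'n"
  assumes "pd_mat A"
  shows "pd_mat (matrix_inv A)"
  unfolding pd_mat_def
proof (intro conjI allI impI)
  note i = pd_mat_invertible[OF assms]
  have s: "transpose A = A" using assms by (simp add: pd_mat_def sym_mat_def)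
  have "transpose (matrix_inv A) ** A = mat 1"
    using arg_cong[OF matrix_inv_right[OF i], of transpose] by (simp add: matrix_transpose_mul s transpose_mat)
  then have "transpose (matrix_inv A) = matrix_inv A"
    by (metis i matrix_inv_right matrix_mul_assoc matrix_mul_lid matrix_mul_rid)
  then show "sym_mat (matrix_inv A)" by (simp add: sym_mat_def)
  fix v :: "real^'n" assume v: "v \<noteq> 0"
  have e: "A *v (matrix_inv A *v v) = v"
    by (simp add: matrix_vector_mul_assoc matrix_inv_right[OF i])
  then have "matrix_inv A *v v \<noteq> 0" using v by auto
  then have "0 < (matrix_inv A *v v) \<bullet> (A *v (matrix_inv A *v v))"
    using assms unfolding pd_mat_def by blast
  then show "0 < v \<bullet> (matrix_inv A *v v)" by (simp add: e inner_commute)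
qed

text \<open>Full row rank makes the transpose of \<open>sig_W\<close> injective, and the quadratic
  form of \<open>Sig_W\<close> is the squared norm of the image under that transpose.\<close>

lemma pd_mat_Sig_W:
  fixes \<M> :: "('d::finite, 'm::finite, 'c::finite, 'p::finite, 'q::finite) model"
  assumes "rank (sig_W \<M>) = CARD('m)"
  shows "pd_mat (Sig_W \<M>)"
  unfolding pd_mat_def
proof (intro conjI allI impI)
  let ?s = "sig_W \<M>"
  show "sym_mat (Sig_W \<M>)"
    by (simp add: sym_mat_def Sig_W_def matrix_transpose_mul transpose_transpose)
  fix v :: "real^'m" assume v: "v \<noteq> 0"
  have "inj ((*v) (transpose ?s))"
    using assms full_rank_injective[of "transpose ?s"] by (simp add: rank_transpose)
  then have "transpose ?s *v v \<noteq> 0"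
    using v by (metis injD matrix_vector_mult_0_right)
  then have "0 < (transpose ?s *v v) \<bullet> (transpose ?s *v v)" by simp
  also have "\<dots> = v \<bullet> (Sig_W \<M> *v v)"
    by (simp only: Sig_W_def matrix_vector_mul_assoc[symmetric] inner_transpose_right[symmetric]
        transpose_transpose)
  finally show "0 < v \<bullet> (Sig_W \<M> *v v)" .
qed

lemma compact_continuous_bound:
  fixes f :: "'a::topological_space \<Rightarrow> 'b::real_normed_vector"
  assumes "compact S" "continuous_on S f"
  obtains C where "0 \<le> C" "\<And>x. x \<in> S \<Longrightarrow> norm (f x) \<le> C"
proof -
  have "bounded (f ` S)" by (intro compact_imp_bounded compact_continuous_image assms)
  then obtain C where "\<And>x. x \<in> S \<Longrightarrow> norm (f x) \<le> C" unfolding bounded_iff by auto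
  then show ?thesis using that[of "max C 0"] by (simp add: le_max_iff_disj)
qed

lemma matrix_mult_minus_left: "(- A) ** B = - (A ** B)" for A :: "real^'n^'m"
  by (rule bounded_bilinear.minus_left[OF bounded_bilinear_matrix_matrix_mult])

lemma matrix_mult_minus_right: "A ** (- B) = - (A ** B)" for A :: "real^'n^'m"
  by (rule bounded_bilinear.minus_right[OF bounded_bilinear_matrix_matrix_mult])

lemma matrix_diff_mult_distrib: "(A - B) ** C = A ** C - B ** C" for A :: "real^'n^'m"
  by (rule bounded_bilinear.diff_left[OF bounded_bilinear_matrix_matrix_mult])

lemma matrix_diff_ldistrib: "A ** (B - C) = A ** B - A ** C" for A :: "real^'n^'m"
  by (rule bounded_bilinear.diff_right[OF bounded_bilinear_matrix_matrix_mult])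

lemma transpose_add: "transpose (A + B) = transpose A + transpose B" for A :: "real^'n^'m"
  by (simp add: transpose_def vec_eq_iff)

lemma transpose_diff: "transpose (A - B) = transpose A - transpose B" for A :: "real^'n^'m"
  by (simp add: transpose_def vec_eq_iff)

lemma transpose_minus: "transpose (- A) = - transpose A" for A :: "real^'n^'m"
  by (simp add: transpose_def vec_eq_iff)

lemma picard_at:
  fixes g :: "real \<Rightarrow> 'a::euclidean_space \<Rightarrow> 'a"
  assumes cont: "continuous_on ({0..T} \<times> UNIV) (\<lambda>(t, x). g t x)"
    and lip: "\<And>t x y. t \<in> {0..T} \<Longrightarrow> norm (g t x - g t y) \<le> L * norm (x - y)"
    and T: "0 \<le> T" and \<theta>: "\<theta> = 0 \<or> \<theta> = T"
  obtains y where "y \<theta> = y0"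
    and "\<And>t. t \<in> {0..T} \<Longrightarrow> (y has_vector_derivative g t (y t)) (at t within {0..T})"
  using \<theta>
proof
  assume "\<theta> = 0"
  then show ?thesis
    using that by (rule_tac picard_global[OF cont _ T, of L y0], erule_tac lip) auto
next
  assume "\<theta> = T"
  then show ?thesis
    using that by (rule_tac picard_terminal[OF cont _ T, of L y0], erule_tac lip) auto
qed

lemma linear_ode_exists:
  fixes A :: "real \<Rightarrow> real^'n^'n" and b :: "real \<Rightarrow> real^'n"
  assumes "continuous_on {0..T} A" "continuous_on {0..T} b" "0 \<le> T" "\<theta> = 0 \<or> \<theta> = T"
  obtains y where "y \<theta> = y0"
    and "\<And>t. t \<in> {0..T} \<Longrightarrow> (y has_vector_derivative (A t *v y t + b t)) (at t within {0..T})"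
proof -
  obtain K where K: "0 < K" "\<And>(B :: real^'n^'n) (x :: real^'n). norm (B *v x) \<le> norm B * norm x * K"
    using bounded_bilinear.pos_bounded[OF bounded_bilinear_matrix_vector_mult] by blast
  obtain C where C: "\<And>t. t \<in> {0..T} \<Longrightarrow> norm (A t) \<le> C"
    using compact_continuous_bound[OF _ assms(1)] by (metis compact_Icc)
  have "continuous_on ({0..T} \<times> UNIV) (\<lambda>p. A (fst p) *v snd p + b (fst p))"
    by (intro continuous_intros continuous_on_compose2[OF assms(1)] continuous_on_compose2[OF assms(2)]) auto
  then have 1: "continuous_on ({0..T} \<times> UNIV) (\<lambda>(t, x). A t *v x + b t)"
    by (simp add: case_prod_unfold)
  have 2: "norm ((A t *v x + b t) - (A t *v y + b t)) \<le> (C * K) * norm (x - y)" if "t \<in> {0..T}" for t x y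
  proof -
    have "norm ((A t *v x + b t) - (A t *v y + b t)) = norm (A t *v (x - y))"
      by (simp add: matrix_vector_mult_diff_distrib)
    also have "\<dots> \<le> norm (A t) * norm (x - y) * K" by (rule K)
    also have "\<dots> \<le> C * norm (x - y) * K"
      using K C[OF that] by (intro mult_right_mono) auto
    finally show ?thesis by (simp add: mult_ac)
  qed
  show ?thesis
    by (rule picard_at[OF 1 _ assms(3,4), of "C * K" y0], erule 2) (rule that)
qed

lemma linear_ode_zero:
  fixes A :: "real \<Rightarrow> real^'n^'n"
  assumes A: "continuous_on {0..T} A"
    and w: "\<And>t. t \<in> {0..T} \<Longrightarrow> (w has_vector_derivative (A t *v w t)) (at t within {0..T})"
    and w0: "w 0 = 0 \<or> w T = 0" and t: "t \<in> {0..T}"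
  shows "w t = 0"
proof -
  obtain K where K: "0 < K" "\<And>(B :: real^'n^'n) (x :: real^'n). norm (B *v x) \<le> norm B * norm x * K"
    using bounded_bilinear.pos_bounded[OF bounded_bilinear_matrix_vector_mult] by blast
  obtain C where C: "0 \<le> C" "\<And>t. t \<in> {0..T} \<Longrightarrow> norm (A t) \<le> C"
    using compact_continuous_bound[OF _ A] by (metis compact_Icc)
  show ?thesis
  proof (rule linear_growth_zero[OF w _ _ t w0, of "C * K"])
    fix s assume s: "s \<in> {0..T}"
    have "norm (A s *v w s) \<le> norm (A s) * norm (w s) * K" by (rule K)
    also have "\<dots> \<le> C * norm (w s) * K"
      using K C(2)[OF s] by (intro mult_right_mono) auto
    finally show "norm (A s *v w s) \<le> C * K * norm (w s)" by (simp add: mult_ac)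
  qed (use K C in auto)
qed

section \<open>Matrix Riccati equations\<close>

definition ric :: "real^'n^'n \<Rightarrow> real^'n^'n \<Rightarrow> real^'n^'n \<Rightarrow> real^'n^'n \<Rightarrow> real^'n^'n" where
  "ric a k q y = transpose a ** y + y ** a + q - y ** k ** y"

text \<open>Serves to prove solutions symmetric: the transpose of a solution solves the same
  equation, and uniqueness identifies the two.\<close>

lemma transpose_ric:
  assumes "sym_mat k" "sym_mat q"
  shows "transpose (ric a k q y) = ric a k q (transpose y)"
  using assms
  by (simp add: ric_def sym_mat_def transpose_add transpose_diff matrix_transpose_mul matrix_mul_assoc)

text \<open>The constant depends only on the bounds \<open>C\<close> and \<open>R\<close>, not on
  the individual coefficients; \<open>q\<close> cancels in the difference and needs no
  bound.\<close>

lemma ric_lipschitz: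
  obtains L where "0 \<le> L" "\<And>(a :: real^'n^'n) k q u v. norm a \<le> C \<Longrightarrow> norm k \<le> C \<Longrightarrow>
    norm u \<le> R \<Longrightarrow> norm v \<le> R \<Longrightarrow> norm (ric a k q u - ric a k q v) \<le> L * norm (u - v)"
proof (cases "0 \<le> C \<and> 0 \<le> R")
  \<comment> \<open>A negative bound is met by no matrix, so the claim is vacuous and
    \<open>L\<close> = 0 will do.\<close>
  case False
  have "norm a \<le> C \<Longrightarrow> 0 \<le> C" "norm u \<le> R \<Longrightarrow> 0 \<le> R" for a u :: "real^'n^'n"
    using norm_ge_zero order.trans by blast+
  then show ?thesis using that[of 0] False by auto
next
  case CR: True
  obtain K where K: "0 < K" "\<And>(A :: real^'n^'n) (B :: real^'n^'n). norm (A ** B) \<le> norm A * norm B * K"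
    using bounded_bilinear.pos_bounded[OF bounded_bilinear_matrix_matrix_mult] by blast
  obtain K' where K': "0 < K'" "\<And>A :: real^'n^'n. norm (transpose A) \<le> norm A * K'"
    using bounded_linear.pos_bounded[OF bounded_linear_transpose] by blast
  have Kb: "norm (A ** B) \<le> \<alpha> * \<beta> * K" if "norm A \<le> \<alpha>" "norm B \<le> \<beta>" "0 \<le> \<alpha>" for A B :: "real^'n^'n" and \<alpha> \<beta>
  proof -
    have "norm A * norm B * K \<le> \<alpha> * \<beta> * K"
      using that K by (intro mult_right_mono mult_mono) auto
    with K(2) show ?thesis by (rule order.trans)
  qed
  define L where "L = C * K' * K + C * K + (C * R * K * K + R * C * K * K)"
  show ?thesis
  proof (rule that[of L])
    show "0 \<le> L" using CR K K' by (auto simp: L_def)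
    fix a k q u v :: "real^'n^'n"
    assume h: "norm a \<le> C" "norm k \<le> C" "norm u \<le> R" "norm v \<le> R"
    \<comment> \<open>The quadratic part is handled by u k u - v k v = (u - v) k u + v k (u -
      v).\<close>
    let ?w = "u - v"
    have "ric a k q u - ric a k q v = transpose a ** ?w + ?w ** a - (?w ** k ** u + v ** k ** ?w)"
      by (simp add: ric_def matrix_diff_mult_distrib matrix_diff_ldistrib algebra_simps)
    also have "norm \<dots> \<le> norm (transpose a ** ?w) + norm (?w ** a) + (norm (?w ** k ** u) + norm (v ** k ** ?w))"
      by (intro order.trans[OF norm_triangle_ineq4] add_mono norm_triangle_ineq)
    also have "\<dots> \<le> (C * K') * norm ?w * K + norm ?w * C * K + ((norm ?w * C * K) * R * K + (R * C * K) * norm ?w * K)"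
    proof -
      have "norm (transpose a) \<le> C * K'"
        using K'(1) by (intro order.trans[OF K'(2)] mult_right_mono h) auto
      then show ?thesis using h CR K K' by (intro add_mono Kb) auto
    qed
    also have "\<dots> = L * norm ?w" by (simp add: L_def algebra_simps)
    finally show "norm (ric a k q u - ric a k q v) \<le> L * norm ?w" .
  qed
qed

text \<open>The right-hand side is only locally Lipschitz, but two given solutions are continuous on
  a compact interval and hence stay in a common ball.\<close>

lemma riccati_unique:
  fixes a k q :: "real \<Rightarrow> real^'n^'n"
  assumes a: "continuous_on {0..T} a" "continuous_on {0..T} k"
    and x: "\<And>t. t \<in> {0..T} \<Longrightarrow> (x has_vector_derivative - ric (a t) (k t) (q t) (x t)) (at t within {0..T})"
    and y: "\<And>t. t \<in> {0..T} \<Longrightarrow> (y has_vector_derivative - ric (a t) (k t) (q t) (y t)) (at t within {0..T})"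
    and eq: "x \<theta> = y \<theta>" "\<theta> = 0 \<or> \<theta> = T" and t: "t \<in> {0..T}"
  shows "x t = y t"
proof -
  have c: "continuous_on {0..T} x" "continuous_on {0..T} y"
    using continuous_on_vector_derivative[OF x] continuous_on_vector_derivative[OF y] by auto
  obtain C where C: "\<And>t. t \<in> {0..T} \<Longrightarrow> norm (a t) \<le> C" "\<And>t. t \<in> {0..T} \<Longrightarrow> norm (k t) \<le> C"
  proof -
    obtain C1 C2 where "\<And>t. t \<in> {0..T} \<Longrightarrow> norm (a t) \<le> C1" "\<And>t. t \<in> {0..T} \<Longrightarrow> norm (k t) \<le> C2"
      using compact_continuous_bound[OF _ a(1)] compact_continuous_bound[OF _ a(2)] by (metis compact_Icc)
    then show ?thesis using that[of "max C1 C2"] by (simp add: le_max_iff_disj)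
  qed
  obtain R where R: "\<And>t. t \<in> {0..T} \<Longrightarrow> norm (x t) \<le> R" "\<And>t. t \<in> {0..T} \<Longrightarrow> norm (y t) \<le> R"
  proof -
    obtain C1 C2 where "\<And>t. t \<in> {0..T} \<Longrightarrow> norm (x t) \<le> C1" "\<And>t. t \<in> {0..T} \<Longrightarrow> norm (y t) \<le> C2"
      using compact_continuous_bound[OF _ c(1)] compact_continuous_bound[OF _ c(2)] by (metis compact_Icc)
    then show ?thesis using that[of "max C1 C2"] by (simp add: le_max_iff_disj)
  qed
  obtain L where L: "0 \<le> L" "\<And>(a :: real^'n^'n) k q u v. norm a \<le> C \<Longrightarrow> norm k \<le> C \<Longrightarrow>
    norm u \<le> R \<Longrightarrow> norm v \<le> R \<Longrightarrow> norm (ric a k q u - ric a k q v) \<le> L * norm (u - v)"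
    using ric_lipschitz by blast
  have "(\<lambda>t. x t - y t) t = 0"
  proof (rule linear_growth_zero[OF _ _ L(1) t])
    fix s assume s: "s \<in> {0..T}"
    show "((\<lambda>t. x t - y t) has_vector_derivative - ric (a s) (k s) (q s) (x s) - - ric (a s) (k s) (q s) (y s)) (at s within {0..T})"
      by (intro has_vector_derivative_diff x y s)
    show "norm (- ric (a s) (k s) (q s) (x s) - - ric (a s) (k s) (q s) (y s)) \<le> L * norm (x s - y s)"
      using L(2)[OF C(1)[OF s] C(2)[OF s] R(1)[OF s] R(2)[OF s], of "q s"]
      by (simp add: norm_minus_commute)
  qed (use eq in auto)
  then show ?thesis by simp
qed

text \<open>The unknown is projected onto the ball of radius r + 1 before it enters the right-hand
  side, which makes the equation globally Lipschitz with speed at most \<open>B\<close>. Within time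
  1 / (B + 1) a solution starting in radius r cannot leave that ball, so the projection never acts.
  The existence time depends on \<open>r\<close> and \<open>C\<close> alone and is fixed before the
  horizon and the coefficients.\<close>

lemma riccati_local_existence:
  fixes C r :: real
  obtains \<epsilon> where "0 < \<epsilon>"
    "\<And>T \<theta> (a :: real \<Rightarrow> real^'n^'n) k q y0.
      0 \<le> T \<Longrightarrow> T \<le> \<epsilon> \<Longrightarrow> \<theta> = 0 \<or> \<theta> = T \<Longrightarrow> norm y0 \<le> r \<Longrightarrow> sym_mat y0 \<Longrightarrow>
      continuous_on {0..T} a \<Longrightarrow> continuous_on {0..T} k \<Longrightarrow> continuous_on {0..T} q \<Longrightarrow>
      (\<And>t. t \<in> {0..T} \<Longrightarrow> norm (a t) \<le> C \<and> norm (k t) \<le> C \<and> norm (q t) \<le> C) \<Longrightarrow>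
      (\<And>t. t \<in> {0..T} \<Longrightarrow> sym_mat (k t) \<and> sym_mat (q t)) \<Longrightarrow>
      \<exists>y. y \<theta> = y0 \<and> (\<forall>t\<in>{0..T}. sym_mat (y t) \<and> norm (y t) \<le> r + 1 \<and>
        (y has_vector_derivative - ric (a t) (k t) (q t) (y t)) (at t within {0..T}))"
proof -
  obtain L where L: "0 \<le> L" "\<And>(a :: real^'n^'n) k q u v. norm a \<le> C \<Longrightarrow> norm k \<le> C \<Longrightarrow>
    norm u \<le> r + 1 \<Longrightarrow> norm v \<le> r + 1 \<Longrightarrow> norm (ric a k q u - ric a k q v) \<le> L * norm (u - v)"
    using ric_lipschitz by blast
  \<comment> \<open>A bound for \<open>ric\<close> on the ball: its value at 0 is \<open>q\<close>,
    bounded by \<open>C\<close>, and the rest is the Lipschitz constant times the radius. The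
    absolute values keep \<open>B\<close> nonnegative before any sign of \<open>C\<close> or
    \<open>r\<close> is known.\<close>
  define B where "B = \<bar>C\<bar> + L * \<bar>r + 1\<bar>"
  have B: "0 \<le> B" using L by (simp add: B_def)
  show ?thesis
  proof (rule that[of "1 / (B + 1)"])
    show "0 < 1 / (B + 1)" using B by simp
    fix T \<theta> :: real and a k q :: "real \<Rightarrow> real^'n^'n" and y0 :: "real^'n^'n"
    assume T: "0 \<le> T" "T \<le> 1 / (B + 1)" and \<theta>: "\<theta> = 0 \<or> \<theta> = T" and y0: "norm y0 \<le> r" "sym_mat y0"
      and ca: "continuous_on {0..T} a" and ck: "continuous_on {0..T} k" and cq: "continuous_on {0..T} q"
      and bd: "\<And>t. t \<in> {0..T} \<Longrightarrow> norm (a t) \<le> C \<and> norm (k t) \<le> C \<and> norm (q t) \<le> C"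
      and sy: "\<And>t. t \<in> {0..T} \<Longrightarrow> sym_mat (k t) \<and> sym_mat (q t)"
    have r: "0 \<le> r" using y0 norm_ge_zero order.trans by blast
    let ?S = "cball (0 :: real^'n^'n) (r + 1)"
    \<comment> \<open>The metric projection onto a convex set is 1-Lipschitz, so the truncated field
      keeps the constant \<open>L\<close>.\<close>
    define P where "P = closest_point ?S"
    have S: "convex ?S" "closed ?S" "?S \<noteq> {}" using r by auto
    have P: "norm (P x) \<le> r + 1" for x
      using closest_point_in_set[OF S(2,3), of x] by (simp add: P_def)
    have Pl: "norm (P x - P y) \<le> norm (x - y)" for x y
      using closest_point_lipschitz[OF S] by (simp add: P_def dist_norm)
    have Pid: "P x = x" if "norm x \<le> r + 1" for x
      using that by (simp add: P_def closest_point_self)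
    have cP: "continuous_on UNIV P"
      using continuous_on_closest_point[OF S] by (simp add: P_def)
    have "continuous_on ({0..T} \<times> UNIV) (\<lambda>p. - ric (a (fst p)) (k (fst p)) (q (fst p)) (P (snd p)))"
      unfolding ric_def
      by (intro continuous_intros continuous_on_compose2[OF ca] continuous_on_compose2[OF ck]
          continuous_on_compose2[OF cq] continuous_on_compose2[OF cP]) auto
    then have 1: "continuous_on ({0..T} \<times> UNIV) (\<lambda>(t, x). - ric (a t) (k t) (q t) (P x))"
      by (simp add: case_prod_unfold)
    have 2: "norm (- ric (a t) (k t) (q t) (P x) - - ric (a t) (k t) (q t) (P y)) \<le> L * norm (x - y)"
      if "t \<in> {0..T}" for t x y
    proof -
      have "norm (- ric (a t) (k t) (q t) (P x) - - ric (a t) (k t) (q t) (P y))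
          = norm (ric (a t) (k t) (q t) (P x) - ric (a t) (k t) (q t) (P y))"
        by (simp add: norm_minus_commute)
      also have "\<dots> \<le> L * norm (P x - P y)" using bd that P by (intro L(2)) auto
      also have "\<dots> \<le> L * norm (x - y)" by (intro mult_left_mono Pl L)
      finally show ?thesis .
    qed
    obtain y where y: "y \<theta> = y0"
      "\<And>t. t \<in> {0..T} \<Longrightarrow> (y has_vector_derivative - ric (a t) (k t) (q t) (P (y t))) (at t within {0..T})"
      by (rule picard_at[OF 1 _ T(1) \<theta>, of L y0], erule 2) (rule that)
    have rb: "norm (ric (a t) (k t) (q t) (P x)) \<le> B" if "t \<in> {0..T}" for t x
    proof -
      have "norm (ric (a t) (k t) (q t) (P x) - ric (a t) (k t) (q t) 0) \<le> L * norm (P x - 0)"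
        using bd that P r by (intro L(2)) auto
      also have "\<dots> \<le> L * \<bar>r + 1\<bar>" using P[of x] by (intro mult_left_mono L) auto
      finally have "norm (ric (a t) (k t) (q t) (P x) - q t) \<le> L * \<bar>r + 1\<bar>"
        by (simp add: ric_def)
      then show ?thesis using bd[OF that] norm_triangle_sub[of "ric (a t) (k t) (q t) (P x)" "q t"]
        unfolding B_def by linarith
    qed
    have yb: "norm (y t) \<le> r + 1" if t: "t \<in> {0..T}" for t
    proof -
      have "norm (y t - y \<theta>) \<le> B * norm (t - \<theta>)"
      proof (rule differentiable_bound)
        show "convex {0..T}" by simp
        show "(y has_derivative (\<lambda>h. h *\<^sub>R - ric (a s) (k s) (q s) (P (y s)))) (at s within {0..T})"
          if "s \<in> {0..T}" for s
          using y(2)[OF that] by (simp add: has_vector_derivative_def)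
        show "onorm (\<lambda>h. h *\<^sub>R - ric (a s) (k s) (q s) (P (y s))) \<le> B" if "s \<in> {0..T}" for s
          using rb[OF that, of "y s"] onorm_scaleR_left[OF bounded_linear_ident, of "- ric (a s) (k s) (q s) (P (y s))"]
          by (simp add: onorm_id)
      qed (use t \<theta> T in auto)
      also have "\<dots> \<le> B * (1 / (B + 1))"
        using t \<theta> T B by (intro mult_left_mono) auto
      also have "\<dots> \<le> 1" using B by simp
      finally show ?thesis using y0 norm_triangle_sub[of "y t" "y \<theta>"] unfolding y(1) by linarith
    qed
    have sol: "(y has_vector_derivative - ric (a t) (k t) (q t) (y t)) (at t within {0..T})" if "t \<in> {0..T}" for t
      using y(2)[OF that] Pid[OF yb[OF that]] by simp
    have solt: "((\<lambda>t. transpose (y t)) has_vector_derivative - ric (a t) (k t) (q t) (transpose (y t))) (at t within {0..T})"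
      if "t \<in> {0..T}" for t
      using bounded_linear.has_vector_derivative[OF bounded_linear_transpose sol[OF that]] sy[OF that]
      by (simp add: transpose_minus transpose_ric)
    \<comment> \<open>Symmetry is not built into the fixed point argument; it comes from uniqueness,
      since the coefficients and the prescribed value are symmetric.\<close>
    have "transpose (y t) = y t" if "t \<in> {0..T}" for t
      by (rule riccati_unique[OF ca ck solt sol _ \<theta> that]) (use y y0 in \<open>auto simp: sym_mat_def\<close>)
    then show "\<exists>y. y \<theta> = y0 \<and> (\<forall>t\<in>{0..T}. sym_mat (y t) \<and> norm (y t) \<le> r + 1 \<and>
        (y has_vector_derivative - ric (a t) (k t) (q t) (y t)) (at t within {0..T}))"
      using y(1) yb sol by (auto simp: sym_mat_def)
  qed
qed

section \<open>The coefficients of the model\<close>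

lemma transpose_scaleR: "transpose (c *\<^sub>R A) = c *\<^sub>R transpose A" for A :: "real^'n^'m"
  by (simp add: transpose_def vec_eq_iff)

lemma sym_mat_congruence:
  fixes B :: "real^'n^'m"
  assumes "sym_mat X"
  shows "sym_mat (B ** X ** transpose B)" "sym_mat (transpose C ** X ** C)"
  using assms by (simp_all add: sym_mat_def matrix_transpose_mul matrix_mul_assoc)

lemma valid_model_subset: "valid_model \<M> T \<Longrightarrow> T' \<le> T \<Longrightarrow> valid_model \<M> T'"
  unfolding valid_model_def by (auto intro: continuous_on_subset)

lemma valid_model_sym:
  assumes "valid_model \<M> T" "t \<in> {0..T}"
  shows "sym_mat (K_mat \<M> t)" "sym_mat (O_mat \<M> t)" "sym_mat (cost_Q \<M> t)"
    "sym_mat (matrix_inv (Sig_W \<M>))" "sym_mat (Sig_W \<M>)" "sym_mat (init_R \<M>)"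
proof -
  have "pd_mat (matrix_inv (cost_S \<M> t))" "pd_mat (matrix_inv (pen_P \<M> t))"
    "pd_mat (Sig_W \<M>)" "pd_mat (matrix_inv (Sig_W \<M>))"
    using assms by (auto simp: valid_model_def intro!: pd_mat_matrix_inv pd_mat_Sig_W)
  then show "sym_mat (K_mat \<M> t)" "sym_mat (O_mat \<M> t)" "sym_mat (cost_Q \<M> t)"
    "sym_mat (matrix_inv (Sig_W \<M>))" "sym_mat (Sig_W \<M>)" "sym_mat (init_R \<M>)"
    using assms unfolding K_mat_def O_mat_def valid_model_def pd_mat_def psd_mat_def
    by (auto intro!: sym_mat_congruence)
qed

lemma sym_mat_Q_phi:
  assumes "valid_model \<M> T" "t \<in> {0..T}" "sym_mat (F t)"
  shows "sym_mat (Q_phi \<M> F t)"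
  using valid_model_sym[OF assms(1,2)] assms(3)
  by (simp add: Q_phi_def sym_mat_def transpose_diff transpose_scaleR matrix_transpose_mul matrix_mul_assoc)

definition N_ric :: "('d::finite, 'm::finite, 'c::finite, 'p::finite, 'q::finite) model \<Rightarrow> (real \<Rightarrow> real^'d^'d)
    \<Rightarrow> (real \<Rightarrow> real^'d^'d) \<Rightarrow> (real \<Rightarrow> real^('d + 'd + 'd)^('d + 'd + 'd)) \<Rightarrow> real
    \<Rightarrow> real^('d + 'd + 'd)^('d + 'd + 'd)" where
  "N_ric \<M> F R F\<phi> t = transpose (D_phi \<M> F R t) - F\<phi> t ** O_mat \<M> t
     - Q_F \<M> R F\<phi> t ** transpose (G_mat \<M> R t)"

definition k_ric :: "('d::finite, 'm::finite, 'c::finite, 'p::finite, 'q::finite) model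
    \<Rightarrow> (real \<Rightarrow> real^'d^'d) \<Rightarrow> (real \<Rightarrow> real^('d + 'd + 'd)^('d + 'd + 'd)) \<Rightarrow> real
    \<Rightarrow> real^('d + 'd + 'd)^('d + 'd + 'd)" where
  "k_ric \<M> R F\<phi> t = Q_F \<M> R F\<phi> t ** matrix_inv (Sig_W \<M>) ** transpose (Q_F \<M> R F\<phi> t)"

definition q_ric :: "('d::finite, 'm::finite, 'c::finite, 'p::finite, 'q::finite) model
    \<Rightarrow> (real \<Rightarrow> real^'d^'d) \<Rightarrow> real \<Rightarrow> real^('d + 'd + 'd)^('d + 'd + 'd)" where
  "q_ric \<M> R t = O_mat \<M> t + G_mat \<M> R t ** Sig_W \<M> ** transpose (G_mat \<M> R t)"

text \<open>All four Riccati equations are cast as y' = - \<open>ric\<close>. For \<open>F\<close>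
  and \<open>F\<phi>\<close> the coefficients fit directly; the equation of \<open>R\<close> needs
  all three negated, that of \<open>F\<tau>\<close> the linear and the quadratic one.\<close>

lemma is_F_iff_ric:
  "is_F \<M> T F \<longleftrightarrow> (\<forall>t\<in>{0..T}. sym_mat (F t)) \<and> F T = 0 \<and> (\<forall>t\<in>{0..T}.
    (F has_vector_derivative - ric (dyn_A \<M> t) (K_mat \<M> t) (cost_Q \<M> t) (F t)) (at t within {0..T}))"
  by (simp add: is_F_def ode_zero_def ric_def)

lemma is_R_iff_ric:
  "is_R \<M> T R \<longleftrightarrow> R 0 = init_R \<M> \<and> (\<forall>t\<in>{0..T}.
    (R has_vector_derivative - ric (- transpose (dyn_A \<M> t))
      (- (transpose (obs_H \<M> t) ** matrix_inv (Sig_W \<M>) ** obs_H \<M> t))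
      (- (sig_V \<M> ** transpose (sig_V \<M>))) (R t)) (at t within {0..T}))"
  by (simp add: is_R_def ode_zero_def ric_def transpose_minus matrix_mult_minus_left matrix_mult_minus_right
      matrix_mul_assoc algebra_simps)

lemma is_Fphi_iff_ric:
  "is_Fphi \<M> T F R F\<phi> \<longleftrightarrow> (\<forall>t\<in>{0..T}. sym_mat (F\<phi> t)) \<and> F\<phi> T = 0 \<and> (\<forall>t\<in>{0..T}.
    (F\<phi> has_vector_derivative - ric (D_phi \<M> F R t) (O_mat \<M> t) (2 *\<^sub>R Q_phi \<M> F t) (F\<phi> t)) (at t within {0..T}))"
  by (simp add: is_Fphi_def ode_zero_def ric_def algebra_simps)

lemma is_Ftau_iff_ric:
  "is_Ftau \<M> T F R F\<phi> F\<tau> \<longleftrightarrow> (\<forall>t\<in>{0..T}. sym_mat (F\<tau> t)) \<and> F\<tau> 0 = 0 \<and> (\<forall>t\<in>{0..T}.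
    (F\<tau> has_vector_derivative - ric (- N_ric \<M> F R F\<phi> t) (- k_ric \<M> R F\<phi> t) (q_ric \<M> R t) (F\<tau> t))
      (at t within {0..T}))"
  by (simp add: is_Ftau_def ode_zero_def ric_def N_ric_def k_ric_def q_ric_def Let_def transpose_minus
      transpose_diff matrix_diff_mult_distrib matrix_diff_ldistrib matrix_mult_minus_left matrix_mult_minus_right matrix_mul_assoc
      transpose_add matrix_add_ldistrib matrix_add_mult_distrib algebra_simps)

lemma is_f_iff_linear:
  "is_f \<M> T F f \<longleftrightarrow> f T = 0 \<and> (\<forall>t\<in>{0..T}.
    (f has_vector_derivative ((F t ** K_mat \<M> t - transpose (dyn_A \<M> t)) *v f t
      + (2 *\<^sub>R (cost_Q \<M> t *v target \<M> t) - 2 *\<^sub>R (F t *v dyn_a \<M> t)))) (at t within {0..T}))"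
  by (simp add: is_f_def ode_zero_def matrix_vector_mult_diff_rdistrib matrix_vector_mul_assoc algebra_simps)

lemma is_fphi_iff_linear:
  "is_fphi \<M> T F f R F\<phi> \<tau> f\<phi> \<longleftrightarrow> f\<phi> T = 0 \<and> (\<forall>t\<in>{0..T}.
    (f\<phi> has_vector_derivative ((F\<phi> t ** O_mat \<M> t - transpose (D_phi \<M> F R t)) *v f\<phi> t
      - (F\<phi> t *v (d_phi \<M> f t + d_tau \<M> R \<tau> t) + l_phi \<M> F f t + l_tau \<M> \<tau> t))) (at t within {0..T}))"
  by (simp add: is_fphi_def ode_zero_def matrix_vector_mult_diff_rdistrib matrix_vector_mul_assoc algebra_simps)

lemma is_ftau_iff_linear:
  fixes \<M> F R F\<phi> F\<tau>
  defines "L \<equiv> \<lambda>t. - (F\<tau> t ** k_ric \<M> R F\<phi> t) - (G_mat \<M> R t ** transpose (Q_F \<M> R F\<phi> t)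
      - D_phi \<M> F R t + transpose (O_mat \<M> t) ** transpose (F\<phi> t))"
  shows "is_ftau \<M> T F f R F\<phi> F\<tau> f\<tau> \<longleftrightarrow> f\<tau> 0 = 0 \<and> (\<forall>t\<in>{0..T}.
    (f\<tau> has_vector_derivative (L t *v f\<tau> t
      + (F\<tau> t *v (F\<phi> t *v d_phi \<M> f t + l_phi \<M> F f t) + d_phi \<M> f t + L t *v Phi0 \<M>)))
      (at t within {0..T}))"
  by (simp add: is_ftau_def ode_zero_def L_def k_ric_def Let_def matrix_vector_mult_diff_rdistrib
      matrix_vector_mult_diff_distrib matrix_vector_mult_add_rdistrib matrix_vector_right_distrib
      matrix_vector_mul_assoc matrix_mult_minus_left algebra_simps)

context
  fixes \<M> :: "('d::finite, 'm::finite, 'c::finite, 'p::finite, 'q::finite) model" and T :: real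
    and S :: "'x::topological_space set" and s :: "'x \<Rightarrow> real"
  assumes valid: "valid_model \<M> T" and s: "continuous_on S s" "s ` S \<subseteq> {0..T}"
begin

text \<open>Time enters through a map \<open>s\<close> on an arbitrary space \<open>S\<close>. With
  \<open>S\<close> an interval this yields continuity in time; with \<open>S\<close> a product of
  the interval and balls of matrices it yields, by compactness, coefficient bounds that do not
  depend on which solutions are inserted.\<close>

lemma continuous_on_data:
  shows "continuous_on S (\<lambda>x. dyn_A \<M> (s x))" "continuous_on S (\<lambda>x. dyn_B \<M> (s x))"
    "continuous_on S (\<lambda>x. dyn_a \<M> (s x))" "continuous_on S (\<lambda>x. obs_H \<M> (s x))"
    "continuous_on S (\<lambda>x. obs_h \<M> (s x))" "continuous_on S (\<lambda>x. cost_Q \<M> (s x))"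
    "continuous_on S (\<lambda>x. cost_S \<M> (s x))" "continuous_on S (\<lambda>x. target \<M> (s x))"
    "continuous_on S (\<lambda>x. pen_P \<M> (s x))"
  using valid unfolding valid_model_def
  by (auto intro!: continuous_on_compose2[OF _ s])

lemma continuous_on_inv_data:
  shows "continuous_on S (\<lambda>x. matrix_inv (cost_S \<M> (s x)))"
    and "continuous_on S (\<lambda>x. matrix_inv (pen_P \<M> (s x)))"
  using valid s
  by (auto simp: valid_model_def image_subset_iff intro!: continuous_on_matrix_inv continuous_on_data pd_mat_invertible)

lemma continuous_on_K_mat: "continuous_on S (\<lambda>x. K_mat \<M> (s x))"
  unfolding K_mat_def by (intro continuous_intros continuous_on_data continuous_on_inv_data)

lemma continuous_on_O_mat: "continuous_on S (\<lambda>x. O_mat \<M> (s x))"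
  unfolding O_mat_def by (intro continuous_intros continuous_on_data continuous_on_inv_data)

context
  fixes X Y :: "'x \<Rightarrow> real^'d^'d" and Z :: "'x \<Rightarrow> real^('d + 'd + 'd)^('d + 'd + 'd)"
  assumes XYZ: "continuous_on S X" "continuous_on S Y" "continuous_on S Z"
begin

lemma continuous_on_gain: "continuous_on S (\<lambda>x. gain \<M> (\<lambda>_. Y x) (s x))"
  unfolding gain_def by (intro continuous_intros continuous_on_data XYZ)

lemma continuous_on_Theta: "continuous_on S (\<lambda>x. Theta \<M> (\<lambda>_. Y x) (s x))"
  unfolding Theta_def by (intro continuous_intros continuous_on_data continuous_on_gain)

lemma continuous_on_D_phi: "continuous_on S (\<lambda>x. D_phi \<M> (\<lambda>_. X x) (\<lambda>_. Y x) (s x))"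
  unfolding D_phi_def
  by (intro continuous_intros continuous_on_data continuous_on_K_mat continuous_on_Theta XYZ)

lemma continuous_on_Q_phi: "continuous_on S (\<lambda>x. Q_phi \<M> (\<lambda>_. X x) (s x))"
  unfolding Q_phi_def by (intro continuous_intros continuous_on_data continuous_on_K_mat XYZ)

lemma continuous_on_G_mat: "continuous_on S (\<lambda>x. G_mat \<M> (\<lambda>_. Y x) (s x))"
  unfolding G_mat_def by (intro continuous_intros continuous_on_gain)

lemma continuous_on_Q_F: "continuous_on S (\<lambda>x. Q_F \<M> (\<lambda>_. Y x) (\<lambda>_. Z x) (s x))"
  unfolding Q_F_def by (intro continuous_intros continuous_on_data continuous_on_G_mat XYZ)

lemma continuous_on_N_ric: "continuous_on S (\<lambda>x. N_ric \<M> (\<lambda>_. X x) (\<lambda>_. Y x) (\<lambda>_. Z x) (s x))"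
  unfolding N_ric_def
  by (intro continuous_intros continuous_on_D_phi continuous_on_O_mat continuous_on_Q_F continuous_on_G_mat XYZ)

lemma continuous_on_k_ric: "continuous_on S (\<lambda>x. k_ric \<M> (\<lambda>_. Y x) (\<lambda>_. Z x) (s x))"
  unfolding k_ric_def by (intro continuous_intros continuous_on_Q_F)

lemma continuous_on_q_ric: "continuous_on S (\<lambda>x. q_ric \<M> (\<lambda>_. Y x) (s x))"
  unfolding q_ric_def by (intro continuous_intros continuous_on_O_mat continuous_on_G_mat)

end

lemma continuous_on_d_phi:
  assumes "continuous_on S g"
  shows "continuous_on S (\<lambda>x. d_phi \<M> (\<lambda>_. g x) (s x))"
  unfolding d_phi_def by (intro continuous_intros continuous_on_data continuous_on_K_mat assms)

lemma continuous_on_l_phi: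
  assumes "continuous_on S X" "continuous_on S g"
  shows "continuous_on S (\<lambda>x. l_phi \<M> (\<lambda>_. X x) (\<lambda>_. g x) (s x))"
  unfolding l_phi_def by (intro continuous_intros continuous_on_data continuous_on_K_mat assms)

end

text \<open>Each coefficient at time \<open>t\<close> depends on the solutions only through their
  values at \<open>t\<close>; this passes between the pointwise form used for bounds and the form
  with functions of time.\<close>

lemma const_arg:
  "gain \<M> (\<lambda>_. R t) t = gain \<M> R t" "Theta \<M> (\<lambda>_. R t) t = Theta \<M> R t"
  "D_phi \<M> (\<lambda>_. F t) (\<lambda>_. R t) t = D_phi \<M> F R t" "Q_phi \<M> (\<lambda>_. F t) t = Q_phi \<M> F t"
  "G_mat \<M> (\<lambda>_. R t) t = G_mat \<M> R t" "Q_F \<M> (\<lambda>_. R t) (\<lambda>_. F\<phi> t) t = Q_F \<M> R F\<phi> t"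
  "N_ric \<M> (\<lambda>_. F t) (\<lambda>_. R t) (\<lambda>_. F\<phi> t) t = N_ric \<M> F R F\<phi> t"
  "k_ric \<M> (\<lambda>_. R t) (\<lambda>_. F\<phi> t) t = k_ric \<M> R F\<phi> t" "q_ric \<M> (\<lambda>_. R t) t = q_ric \<M> R t"
  "d_phi \<M> (\<lambda>_. f t) t = d_phi \<M> f t" "l_phi \<M> (\<lambda>_. F t) (\<lambda>_. f t) t = l_phi \<M> F f t"
  by (simp_all add: gain_def Theta_def D_phi_def Q_phi_def G_mat_def Q_F_def N_ric_def k_ric_def q_ric_def
      d_phi_def l_phi_def)

lemma ode_zero_continuous_on: "ode_zero T y E \<Longrightarrow> continuous_on {0..T} y"
  unfolding ode_zero_def by (rule continuous_on_vector_derivative) blast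

lemma solution_continuous_on:
  shows is_F_continuous: "is_F \<M> T F \<Longrightarrow> continuous_on {0..T} F"
    and is_R_continuous: "is_R \<M> T R \<Longrightarrow> continuous_on {0..T} R"
    and is_f_continuous: "is_f \<M> T F f \<Longrightarrow> continuous_on {0..T} f"
    and is_Fphi_continuous: "is_Fphi \<M> T F R F\<phi> \<Longrightarrow> continuous_on {0..T} F\<phi>"
    and is_fphi_continuous: "is_fphi \<M> T F f R F\<phi> \<tau> f\<phi> \<Longrightarrow> continuous_on {0..T} f\<phi>"
    and is_Ftau_continuous: "is_Ftau \<M> T F R F\<phi> F\<tau> \<Longrightarrow> continuous_on {0..T} F\<tau>"
    and is_ftau_continuous: "is_ftau \<M> T F f R F\<phi> F\<tau> f\<tau> \<Longrightarrow> continuous_on {0..T} f\<tau>"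
  unfolding is_F_def is_R_def is_f_def is_Fphi_def is_fphi_def is_Ftau_def is_ftau_def
  by (auto intro: ode_zero_continuous_on)

context
  fixes \<M> :: "('d::finite, 'm::finite, 'c::finite, 'p::finite, 'q::finite) model" and T :: real
  assumes valid: "valid_model \<M> T"
begin

lemmas continuous_on_data_id = continuous_on_data[OF valid continuous_on_id[of "{0..T}"], simplified]
  and continuous_on_inv_data_id = continuous_on_inv_data[OF valid continuous_on_id[of "{0..T}"], simplified]
  and continuous_on_K_mat_id = continuous_on_K_mat[OF valid continuous_on_id[of "{0..T}"], simplified]
  and continuous_on_O_mat_id = continuous_on_O_mat[OF valid continuous_on_id[of "{0..T}"], simplified]

context
  fixes F R :: "real \<Rightarrow> real^'d^'d" and f :: "real \<Rightarrow> real^'d" and F\<phi> :: "real \<Rightarrow> real^('d + 'd + 'd)^('d + 'd + 'd)"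
  assumes c: "continuous_on {0..T} F" "continuous_on {0..T} R" "continuous_on {0..T} f" "continuous_on {0..T} F\<phi>"
begin

lemma continuous_on_coefficients:
  shows "continuous_on {0..T} (gain \<M> R)" "continuous_on {0..T} (Theta \<M> R)"
    "continuous_on {0..T} (D_phi \<M> F R)" "continuous_on {0..T} (Q_phi \<M> F)"
    "continuous_on {0..T} (G_mat \<M> R)" "continuous_on {0..T} (Q_F \<M> R F\<phi>)"
    "continuous_on {0..T} (N_ric \<M> F R F\<phi>)" "continuous_on {0..T} (k_ric \<M> R F\<phi>)"
    "continuous_on {0..T} (q_ric \<M> R)" "continuous_on {0..T} (d_phi \<M> f)"
    "continuous_on {0..T} (l_phi \<M> F f)"
  using continuous_on_gain[OF valid continuous_on_id _ c(1,2,4)]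
    continuous_on_Theta[OF valid continuous_on_id _ c(1,2,4)] continuous_on_D_phi[OF valid continuous_on_id _ c(1,2,4)]
    continuous_on_Q_phi[OF valid continuous_on_id _ c(1,2,4)] continuous_on_G_mat[OF valid continuous_on_id _ c(1,2,4)]
    continuous_on_Q_F[OF valid continuous_on_id _ c(1,2,4)] continuous_on_N_ric[OF valid continuous_on_id _ c(1,2,4)]
    continuous_on_k_ric[OF valid continuous_on_id _ c(1,2,4)] continuous_on_q_ric[OF valid continuous_on_id _ c(1,2,4)]
    continuous_on_d_phi[OF valid continuous_on_id _ c(3)] continuous_on_l_phi[OF valid continuous_on_id _ c(1,3)]
  by (simp_all add: const_arg)

end

end

lemma bound3:
  fixes f1 f2 f3 :: "'x::topological_space \<Rightarrow> 'b::real_normed_vector"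
  assumes "compact S" "continuous_on S f1" "continuous_on S f2" "continuous_on S f3"
  obtains C where "0 \<le> C" "\<And>x. x \<in> S \<Longrightarrow> norm (f1 x) \<le> C \<and> norm (f2 x) \<le> C \<and> norm (f3 x) \<le> C"
proof -
  obtain C1 C2 C3 where "0 \<le> C1" "\<And>x. x \<in> S \<Longrightarrow> norm (f1 x) \<le> C1" "\<And>x. x \<in> S \<Longrightarrow> norm (f2 x) \<le> C2"
    "\<And>x. x \<in> S \<Longrightarrow> norm (f3 x) \<le> C3"
    using compact_continuous_bound[OF assms(1,2)] compact_continuous_bound[OF assms(1,3)]
      compact_continuous_bound[OF assms(1,4)] by metis
  then show ?thesis using that[of "max C1 (max C2 C3)"] by (simp add: le_max_iff_disj)
qed

section \<open>Solvability on short intervals\<close>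

context
  fixes \<M> :: "('d::finite, 'm::finite, 'c::finite, 'p::finite, 'q::finite) model" and T :: real
  assumes valid: "valid_model \<M> T"
begin

text \<open>The bound is claimed for every solution on every short horizon \<open>T'\<close>. The
  coefficients of the next Riccati equation are built from \<open>F\<close>, which changes with
  \<open>T'\<close>, and the existence time of that equation has to be chosen before
  \<open>T'\<close>. The value 1 is r + 1 with r = 0, as the terminal value is zero.\<close>

lemma is_F_local:
  obtains \<epsilon> where "0 < \<epsilon>" "\<And>T'. 0 \<le> T' \<Longrightarrow> T' \<le> \<epsilon> \<Longrightarrow> T' \<le> T \<Longrightarrow>
    (\<exists>F. is_F \<M> T' F) \<and> (\<forall>F. is_F \<M> T' F \<longrightarrow> (\<forall>t\<in>{0..T'}. norm (F t) \<le> 1))"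
proof -
  obtain C where C: "\<And>t. t \<in> {0..T} \<Longrightarrow> norm (dyn_A \<M> t) \<le> C \<and> norm (K_mat \<M> t) \<le> C \<and> norm (cost_Q \<M> t) \<le> C"
    using bound3[OF _ continuous_on_data_id(1)[OF valid] continuous_on_K_mat_id[OF valid] continuous_on_data_id(6)[OF valid]]
    by (metis compact_Icc)
  obtain \<epsilon> where e: "0 < \<epsilon>" and ex: "\<And>T \<theta> (a :: real \<Rightarrow> real^'d^'d) k q y0.
      0 \<le> T \<Longrightarrow> T \<le> \<epsilon> \<Longrightarrow> \<theta> = 0 \<or> \<theta> = T \<Longrightarrow> norm y0 \<le> 0 \<Longrightarrow> sym_mat y0 \<Longrightarrow>
      continuous_on {0..T} a \<Longrightarrow> continuous_on {0..T} k \<Longrightarrow> continuous_on {0..T} q \<Longrightarrow>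
      (\<And>t. t \<in> {0..T} \<Longrightarrow> norm (a t) \<le> C \<and> norm (k t) \<le> C \<and> norm (q t) \<le> C) \<Longrightarrow>
      (\<And>t. t \<in> {0..T} \<Longrightarrow> sym_mat (k t) \<and> sym_mat (q t)) \<Longrightarrow>
      \<exists>y. y \<theta> = y0 \<and> (\<forall>t\<in>{0..T}. sym_mat (y t) \<and> norm (y t) \<le> 0 + 1 \<and>
        (y has_vector_derivative - ric (a t) (k t) (q t) (y t)) (at t within {0..T}))"
    using riccati_local_existence[of 0 C] by blast
  show ?thesis
  proof (rule that[OF e])
    fix T' assume T': "0 \<le> T'" "T' \<le> \<epsilon>" "T' \<le> T"
    note v = valid_model_subset[OF valid T'(3)]
    have "\<exists>F. F T' = 0 \<and> (\<forall>t\<in>{0..T'}. sym_mat (F t) \<and> norm (F t) \<le> 0 + 1 \<and>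
        (F has_vector_derivative - ric (dyn_A \<M> t) (K_mat \<M> t) (cost_Q \<M> t) (F t)) (at t within {0..T'}))"
      using C T' valid_model_sym[OF v]
      by (intro ex continuous_on_data_id[OF v] continuous_on_K_mat_id[OF v])
        (auto simp: sym_mat_def transpose_def vec_eq_iff)
    then obtain F0 where F0: "F0 T' = 0" "\<And>t. t \<in> {0..T'} \<Longrightarrow> norm (F0 t) \<le> 1" "is_F \<M> T' F0"
      by (auto simp: is_F_iff_ric)
    have "norm (F t) \<le> 1" if "is_F \<M> T' F" "t \<in> {0..T'}" for F t
    proof -
      have "F t = F0 t"
        by (rule riccati_unique[OF continuous_on_data_id(1)[OF v] continuous_on_K_mat_id[OF v], where \<theta> = T'])
          (use that F0(3) in \<open>auto simp: is_F_iff_ric\<close>)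
      then show ?thesis using F0(2)[OF that(2)] by simp
    qed
    then show "(\<exists>F. is_F \<M> T' F) \<and> (\<forall>F. is_F \<M> T' F \<longrightarrow> (\<forall>t\<in>{0..T'}. norm (F t) \<le> 1))"
      using F0 by blast
  qed
qed

lemma is_R_local:
  obtains \<epsilon> where "0 < \<epsilon>" "\<And>T'. 0 \<le> T' \<Longrightarrow> T' \<le> \<epsilon> \<Longrightarrow> T' \<le> T \<Longrightarrow>
    (\<exists>R. is_R \<M> T' R) \<and> (\<forall>R. is_R \<M> T' R \<longrightarrow> (\<forall>t\<in>{0..T'}. norm (R t) \<le> norm (init_R \<M>) + 1))"
proof -
  define a where "a t = - transpose (dyn_A \<M> t)" for t
  define k where "k t = - (transpose (obs_H \<M> t) ** matrix_inv (Sig_W \<M>) ** obs_H \<M> t)" for t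
  define q :: "real \<Rightarrow> real^'d^'d" where "q t = - (sig_V \<M> ** transpose (sig_V \<M>))" for t
  have cont: "continuous_on {0..T'} a" "continuous_on {0..T'} k" "continuous_on {0..T'} q" if "T' \<le> T" for T'
    using continuous_on_data_id[OF valid_model_subset[OF valid that]] unfolding a_def k_def q_def
    by (auto intro!: continuous_intros)
  obtain C where C: "\<And>t. t \<in> {0..T} \<Longrightarrow> norm (a t) \<le> C \<and> norm (k t) \<le> C \<and> norm (q t) \<le> C"
    using bound3[OF _ cont] by (metis compact_Icc order_refl)
  obtain \<epsilon> where e: "0 < \<epsilon>" and ex: "\<And>T \<theta> (a :: real \<Rightarrow> real^'d^'d) k q y0.
      0 \<le> T \<Longrightarrow> T \<le> \<epsilon> \<Longrightarrow> \<theta> = 0 \<or> \<theta> = T \<Longrightarrow> norm y0 \<le> norm (init_R \<M>) \<Longrightarrow> sym_mat y0 \<Longrightarrow>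
      continuous_on {0..T} a \<Longrightarrow> continuous_on {0..T} k \<Longrightarrow> continuous_on {0..T} q \<Longrightarrow>
      (\<And>t. t \<in> {0..T} \<Longrightarrow> norm (a t) \<le> C \<and> norm (k t) \<le> C \<and> norm (q t) \<le> C) \<Longrightarrow>
      (\<And>t. t \<in> {0..T} \<Longrightarrow> sym_mat (k t) \<and> sym_mat (q t)) \<Longrightarrow>
      \<exists>y. y \<theta> = y0 \<and> (\<forall>t\<in>{0..T}. sym_mat (y t) \<and> norm (y t) \<le> norm (init_R \<M>) + 1 \<and>
        (y has_vector_derivative - ric (a t) (k t) (q t) (y t)) (at t within {0..T}))"
    using riccati_local_existence[of "norm (init_R \<M>)" C] by blast
  show ?thesis
  proof (rule that[OF e])
    fix T' assume T': "0 \<le> T'" "T' \<le> \<epsilon>" "T' \<le> T"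
    note v = valid_model_subset[OF valid T'(3)]
    have "sym_mat (k t) \<and> sym_mat (q t)" if "t \<in> {0..T'}" for t
      using valid_model_sym[OF v that]
      by (simp add: k_def q_def sym_mat_def transpose_minus matrix_transpose_mul matrix_mul_assoc)
    then have "\<exists>R. R 0 = init_R \<M> \<and> (\<forall>t\<in>{0..T'}. sym_mat (R t) \<and> norm (R t) \<le> norm (init_R \<M>) + 1 \<and>
        (R has_vector_derivative - ric (a t) (k t) (q t) (R t)) (at t within {0..T'}))"
      using C T' valid_model_sym(6)[OF v, of 0]
      by (intro ex cont) auto
    then obtain R0 where R0: "\<And>t. t \<in> {0..T'} \<Longrightarrow> norm (R0 t) \<le> norm (init_R \<M>) + 1" "is_R \<M> T' R0"
      unfolding is_R_iff_ric a_def k_def q_def by blast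
    have "norm (R t) \<le> norm (init_R \<M>) + 1" if "is_R \<M> T' R" "t \<in> {0..T'}" for R t
    proof -
      have "R t = R0 t"
        by (rule riccati_unique[OF cont(1,2)[OF T'(3)], where \<theta> = 0])
          (use that R0(2) in \<open>auto simp: is_R_iff_ric a_def k_def q_def\<close>)
      then show ?thesis using R0(1)[OF that(2)] by simp
    qed
    then show "(\<exists>R. is_R \<M> T' R) \<and> (\<forall>R. is_R \<M> T' R \<longrightarrow> (\<forall>t\<in>{0..T'}. norm (R t) \<le> norm (init_R \<M>) + 1))"
      using R0 by blast
  qed
qed

lemma is_Fphi_local:
  obtains \<epsilon> where "0 < \<epsilon>" "\<And>T' F R. 0 \<le> T' \<Longrightarrow> T' \<le> \<epsilon> \<Longrightarrow> T' \<le> T \<Longrightarrow> is_F \<M> T' F \<Longrightarrow> is_R \<M> T' R \<Longrightarrow>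
    (\<And>t. t \<in> {0..T'} \<Longrightarrow> norm (F t) \<le> 1 \<and> norm (R t) \<le> r) \<Longrightarrow>
    (\<exists>F\<phi>. is_Fphi \<M> T' F R F\<phi>) \<and> (\<forall>F\<phi>. is_Fphi \<M> T' F R F\<phi> \<longrightarrow> (\<forall>t\<in>{0..T'}. norm (F\<phi> t) \<le> 1))"
proof -
  \<comment> \<open>\<open>F\<close> and \<open>R\<close> vary with the horizon but stay in fixed
    balls, so \<open>C\<close> is taken as a bound over time and over all matrices in these
    balls.\<close>
  let ?S = "{0..T} \<times> cball (0 :: real^'d^'d) 1 \<times> cball (0 :: real^'d^'d) r"
  have S: "compact ?S" by (intro compact_Times) auto
  have f: "continuous_on ?S fst" "fst ` ?S \<subseteq> {0..T}" by (auto intro!: continuous_intros)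
  have XY: "continuous_on ?S (\<lambda>p. fst (snd p))" "continuous_on ?S (\<lambda>p. snd (snd p))"
    by (intro continuous_intros)+
  note c = XY continuous_on_const[of ?S "0 :: real^('d+'d+'d)^('d+'d+'d)"]
  have 2: "continuous_on ?S (\<lambda>p. 2 *\<^sub>R Q_phi \<M> (\<lambda>_. fst (snd p)) (fst p))"
    by (intro continuous_intros continuous_on_Q_phi[OF valid f c])
  obtain C where C: "\<And>p. p \<in> ?S \<Longrightarrow> norm (D_phi \<M> (\<lambda>_. fst (snd p)) (\<lambda>_. snd (snd p)) (fst p)) \<le> C
      \<and> norm (O_mat \<M> (fst p)) \<le> C \<and> norm (2 *\<^sub>R Q_phi \<M> (\<lambda>_. fst (snd p)) (fst p)) \<le> C"
    using bound3[OF S continuous_on_D_phi[OF valid f c] continuous_on_O_mat[OF valid f] 2] by metis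
  obtain \<epsilon> where e: "0 < \<epsilon>" and ex: "\<And>T \<theta> (a :: real \<Rightarrow> real^('d+'d+'d)^('d+'d+'d)) k q y0.
      0 \<le> T \<Longrightarrow> T \<le> \<epsilon> \<Longrightarrow> \<theta> = 0 \<or> \<theta> = T \<Longrightarrow> norm y0 \<le> 0 \<Longrightarrow> sym_mat y0 \<Longrightarrow>
      continuous_on {0..T} a \<Longrightarrow> continuous_on {0..T} k \<Longrightarrow> continuous_on {0..T} q \<Longrightarrow>
      (\<And>t. t \<in> {0..T} \<Longrightarrow> norm (a t) \<le> C \<and> norm (k t) \<le> C \<and> norm (q t) \<le> C) \<Longrightarrow>
      (\<And>t. t \<in> {0..T} \<Longrightarrow> sym_mat (k t) \<and> sym_mat (q t)) \<Longrightarrow>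
      \<exists>y. y \<theta> = y0 \<and> (\<forall>t\<in>{0..T}. sym_mat (y t) \<and> norm (y t) \<le> 0 + 1 \<and>
        (y has_vector_derivative - ric (a t) (k t) (q t) (y t)) (at t within {0..T}))"
    using riccati_local_existence[of 0 C] by blast
  show ?thesis
  proof (rule that[OF e])
    fix T' F R
    assume T': "0 \<le> T'" "T' \<le> \<epsilon>" "T' \<le> T" and F: "is_F \<M> T' F" and R: "is_R \<M> T' R"
      and b: "\<And>t. t \<in> {0..T'} \<Longrightarrow> norm (F t) \<le> 1 \<and> norm (R t) \<le> r"
    note v = valid_model_subset[OF valid T'(3)]
    have cF: "continuous_on {0..T'} F" "continuous_on {0..T'} R"
      using F R by (auto intro: solution_continuous_on)
    note cc = continuous_on_coefficients[OF v cF continuous_on_const[of _ 0] continuous_on_const[of _ 0]]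
    have bd: "norm (D_phi \<M> F R t) \<le> C \<and> norm (O_mat \<M> t) \<le> C \<and> norm (2 *\<^sub>R Q_phi \<M> F t) \<le> C"
      if "t \<in> {0..T'}" for t
      using C[of "(t, F t, R t)"] that b[OF that] T' by (simp add: const_arg)
    have sy: "sym_mat (O_mat \<M> t) \<and> sym_mat (2 *\<^sub>R Q_phi \<M> F t)" if "t \<in> {0..T'}" for t
      using valid_model_sym[OF v that] sym_mat_Q_phi[OF v that, of F] F that
      by (auto simp: is_F_def sym_mat_def transpose_scaleR)
    have "\<exists>y. y T' = 0 \<and> (\<forall>t\<in>{0..T'}. sym_mat (y t) \<and> norm (y t) \<le> 0 + 1 \<and>
        (y has_vector_derivative - ric (D_phi \<M> F R t) (O_mat \<M> t) (2 *\<^sub>R Q_phi \<M> F t) (y t)) (at t within {0..T'}))"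
      by (intro ex bd sy cc continuous_on_O_mat_id[OF v] continuous_on_scaleR continuous_on_const T')
        (auto simp: sym_mat_def transpose_def vec_eq_iff)
    then obtain y where y: "\<And>t. t \<in> {0..T'} \<Longrightarrow> norm (y t) \<le> 1" "is_Fphi \<M> T' F R y"
      unfolding is_Fphi_iff_ric add_0_left by blast
    have "norm (F\<phi> t) \<le> 1" if "is_Fphi \<M> T' F R F\<phi>" "t \<in> {0..T'}" for F\<phi> t
    proof -
      have "F\<phi> t = y t"
        by (rule riccati_unique[OF cc(3) continuous_on_O_mat_id[OF v], where \<theta> = T'])
          (use that y(2) in \<open>auto simp: is_Fphi_iff_ric\<close>)
      then show ?thesis using y(1)[OF that(2)] by simp
    qed
    then show "(\<exists>F\<phi>. is_Fphi \<M> T' F R F\<phi>) \<and> (\<forall>F\<phi>. is_Fphi \<M> T' F R F\<phi> \<longrightarrow> (\<forall>t\<in>{0..T'}. norm (F\<phi> t) \<le> 1))"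
      using y by blast
  qed
qed

text \<open>No bound on \<open>F\<tau>\<close> is recorded: the remaining equation, for
  \<open>f\<tau>\<close>, is linear and solvable on the whole interval.\<close>

lemma is_Ftau_local:
  obtains \<epsilon> where "0 < \<epsilon>" "\<And>T' F R F\<phi>. 0 \<le> T' \<Longrightarrow> T' \<le> \<epsilon> \<Longrightarrow> T' \<le> T \<Longrightarrow> is_F \<M> T' F \<Longrightarrow> is_R \<M> T' R \<Longrightarrow>
    is_Fphi \<M> T' F R F\<phi> \<Longrightarrow>
    (\<And>t. t \<in> {0..T'} \<Longrightarrow> norm (F t) \<le> 1 \<and> norm (R t) \<le> r \<and> norm (F\<phi> t) \<le> 1) \<Longrightarrow>
    (\<exists>F\<tau>. is_Ftau \<M> T' F R F\<phi> F\<tau>)"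
proof -
  let ?S = "{0..T} \<times> cball (0 :: real^'d^'d) 1 \<times> cball (0 :: real^'d^'d) r \<times> cball (0 :: real^('d+'d+'d)^('d+'d+'d)) 1"
  have S: "compact ?S" by (intro compact_Times) auto
  have f: "continuous_on ?S fst" "fst ` ?S \<subseteq> {0..T}" by (auto intro!: continuous_intros)
  have c: "continuous_on ?S (\<lambda>p. fst (snd p))" "continuous_on ?S (\<lambda>p. fst (snd (snd p)))"
    "continuous_on ?S (\<lambda>p. snd (snd (snd p)))"
    by (intro continuous_intros)+
  obtain C where C: "\<And>p. p \<in> ?S \<Longrightarrow>
      norm (- N_ric \<M> (\<lambda>_. fst (snd p)) (\<lambda>_. fst (snd (snd p))) (\<lambda>_. snd (snd (snd p))) (fst p)) \<le> C
      \<and> norm (- k_ric \<M> (\<lambda>_. fst (snd (snd p))) (\<lambda>_. snd (snd (snd p))) (fst p)) \<le> C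
      \<and> norm (q_ric \<M> (\<lambda>_. fst (snd (snd p))) (fst p)) \<le> C"
    using bound3[OF S continuous_on_minus[OF continuous_on_N_ric[OF valid f c]]
        continuous_on_minus[OF continuous_on_k_ric[OF valid f c]] continuous_on_q_ric[OF valid f c]] by metis
  obtain \<epsilon> where e: "0 < \<epsilon>" and ex: "\<And>T \<theta> (a :: real \<Rightarrow> real^('d+'d+'d)^('d+'d+'d)) k q y0.
      0 \<le> T \<Longrightarrow> T \<le> \<epsilon> \<Longrightarrow> \<theta> = 0 \<or> \<theta> = T \<Longrightarrow> norm y0 \<le> 0 \<Longrightarrow> sym_mat y0 \<Longrightarrow>
      continuous_on {0..T} a \<Longrightarrow> continuous_on {0..T} k \<Longrightarrow> continuous_on {0..T} q \<Longrightarrow>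
      (\<And>t. t \<in> {0..T} \<Longrightarrow> norm (a t) \<le> C \<and> norm (k t) \<le> C \<and> norm (q t) \<le> C) \<Longrightarrow>
      (\<And>t. t \<in> {0..T} \<Longrightarrow> sym_mat (k t) \<and> sym_mat (q t)) \<Longrightarrow>
      \<exists>y. y \<theta> = y0 \<and> (\<forall>t\<in>{0..T}. sym_mat (y t) \<and> norm (y t) \<le> 0 + 1 \<and>
        (y has_vector_derivative - ric (a t) (k t) (q t) (y t)) (at t within {0..T}))"
    using riccati_local_existence[of 0 C] by blast
  show ?thesis
  proof (rule that[OF e])
    fix T' F R F\<phi>
    assume T': "0 \<le> T'" "T' \<le> \<epsilon>" "T' \<le> T" and F: "is_F \<M> T' F" and R: "is_R \<M> T' R" and F\<phi>: "is_Fphi \<M> T' F R F\<phi>"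
      and b: "\<And>t. t \<in> {0..T'} \<Longrightarrow> norm (F t) \<le> 1 \<and> norm (R t) \<le> r \<and> norm (F\<phi> t) \<le> 1"
    note v = valid_model_subset[OF valid T'(3)]
    have cF: "continuous_on {0..T'} F" "continuous_on {0..T'} R" "continuous_on {0..T'} F\<phi>"
      using F R F\<phi> by (auto intro: solution_continuous_on)
    note cc = continuous_on_coefficients[OF v cF(1,2) continuous_on_const[of _ 0] cF(3)]
    have bd: "norm (- N_ric \<M> F R F\<phi> t) \<le> C \<and> norm (- k_ric \<M> R F\<phi> t) \<le> C \<and> norm (q_ric \<M> R t) \<le> C"
      if "t \<in> {0..T'}" for t
      using C[of "(t, F t, R t, F\<phi> t)"] that b[OF that] T' by (simp add: const_arg)
    have sy: "sym_mat (- k_ric \<M> R F\<phi> t) \<and> sym_mat (q_ric \<M> R t)" if "t \<in> {0..T'}" for t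
      using valid_model_sym[OF v that]
      by (simp add: k_ric_def q_ric_def sym_mat_def transpose_minus transpose_add matrix_transpose_mul matrix_mul_assoc)
    have "\<exists>y. y 0 = 0 \<and> (\<forall>t\<in>{0..T'}. sym_mat (y t) \<and> norm (y t) \<le> 0 + 1 \<and>
        (y has_vector_derivative - ric (- N_ric \<M> F R F\<phi> t) (- k_ric \<M> R F\<phi> t) (q_ric \<M> R t) (y t)) (at t within {0..T'}))"
      by (intro ex bd sy cc continuous_on_minus T')
        (auto simp: sym_mat_def transpose_def vec_eq_iff)
    then show "\<exists>F\<tau>. is_Ftau \<M> T' F R F\<phi> F\<tau>"
      by (auto simp: is_Ftau_iff_ric)
  qed
qed

lemma is_ftau_coefficients_continuous:
  assumes "is_F \<M> T F" "is_R \<M> T R" "is_f \<M> T F f" "is_Fphi \<M> T F R F\<phi>" "is_Ftau \<M> T F R F\<phi> F\<tau>"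
  shows "continuous_on {0..T} (\<lambda>t. - (F\<tau> t ** k_ric \<M> R F\<phi> t) - (G_mat \<M> R t ** transpose (Q_F \<M> R F\<phi> t)
      - D_phi \<M> F R t + transpose (O_mat \<M> t) ** transpose (F\<phi> t)))"
    and "continuous_on {0..T} (\<lambda>t. F\<tau> t *v (F\<phi> t *v d_phi \<M> f t + l_phi \<M> F f t) + d_phi \<M> f t)"
proof -
  have c: "continuous_on {0..T} F" "continuous_on {0..T} R" "continuous_on {0..T} f" "continuous_on {0..T} F\<phi>"
     "continuous_on {0..T} F\<tau>"
    using assms by (auto intro: solution_continuous_on)
  note cc = continuous_on_coefficients[OF valid c(1-4)] continuous_on_O_mat_id[OF valid] c
  show "continuous_on {0..T} (\<lambda>t. - (F\<tau> t ** k_ric \<M> R F\<phi> t) - (G_mat \<M> R t ** transpose (Q_F \<M> R F\<phi> t)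
      - D_phi \<M> F R t + transpose (O_mat \<M> t) ** transpose (F\<phi> t)))"
    "continuous_on {0..T} (\<lambda>t. F\<tau> t *v (F\<phi> t *v d_phi \<M> f t + l_phi \<M> F f t) + d_phi \<M> f t)"
    by (intro continuous_intros cc)+
qed

lemma is_ftau_exists:
  assumes "0 \<le> T" and h: "is_F \<M> T F" "is_R \<M> T R" "is_f \<M> T F f" "is_Fphi \<M> T F R F\<phi>" "is_Ftau \<M> T F R F\<phi> F\<tau>"
  shows "\<exists>f\<tau>. is_ftau \<M> T F f R F\<phi> F\<tau> f\<tau>"
proof -
  note c = is_ftau_coefficients_continuous[OF h]
  note c2 = continuous_on_add[OF c(2) continuous_on_matrix_vector_mult[OF c(1) continuous_on_const[of _ "Phi0 \<M>"]]]
  show ?thesis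
    unfolding is_ftau_iff_linear
    by (rule linear_ode_exists[OF c(1) c2 assms(1), of 0 0]) auto
qed

text \<open>Stated for two versions of \<open>F\<tau>\<close> that agree on the interval, so that
  uniqueness of the pair follows in two stages.\<close>

lemma is_ftau_unique:
  assumes h: "is_F \<M> T F" "is_R \<M> T R" "is_f \<M> T F f" "is_Fphi \<M> T F R F\<phi>" "is_Ftau \<M> T F R F\<phi> F\<tau>"
    and g: "is_ftau \<M> T F f R F\<phi> F\<tau> g" "is_ftau \<M> T F f R F\<phi> F\<tau>' g'"
    and eq: "\<And>t. t \<in> {0..T} \<Longrightarrow> F\<tau>' t = F\<tau> t" and t: "t \<in> {0..T}"
  shows "g' t = g t"
proof -
  have "is_ftau \<M> T F f R F\<phi> F\<tau> g'"
    using g(2) eq by (simp add: is_ftau_def ode_zero_def Let_def)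
  then have "(\<lambda>t. g' t - g t) t = 0"
    by (intro linear_ode_zero[OF is_ftau_coefficients_continuous(1)[OF h] _ _ t])
      (use g(1) in \<open>auto simp: is_ftau_iff_linear matrix_vector_mult_diff_distrib
        intro!: has_vector_derivative_diff[THEN has_vector_derivative_eq_rhs]\<close>)
  then show ?thesis by simp
qed

lemma is_Ftau_unique:
  assumes h: "is_F \<M> T F" "is_R \<M> T R" "is_Fphi \<M> T F R F\<phi>"
    and g: "is_Ftau \<M> T F R F\<phi> g" "is_Ftau \<M> T F R F\<phi> g'" and t: "t \<in> {0..T}"
  shows "g' t = g t"
proof -
  have c: "continuous_on {0..T} F" "continuous_on {0..T} R" "continuous_on {0..T} F\<phi>"
    using h by (auto intro: solution_continuous_on)
  note cc = continuous_on_coefficients[OF valid c(1,2) continuous_on_const[of _ 0] c(3)]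
  show ?thesis
    by (rule riccati_unique[OF continuous_on_minus[OF cc(7)] continuous_on_minus[OF cc(8)], where \<theta> = 0])
      (use g t in \<open>auto simp: is_Ftau_iff_ric\<close>)
qed

lemma is_f_exists:
  assumes "0 \<le> T" "is_F \<M> T F"
  shows "\<exists>f. is_f \<M> T F f"
proof -
  have F: "continuous_on {0..T} F"
    using assms by (auto intro: solution_continuous_on)
  have c: "continuous_on {0..T} (\<lambda>t. F t ** K_mat \<M> t - transpose (dyn_A \<M> t))"
    "continuous_on {0..T} (\<lambda>t. 2 *\<^sub>R (cost_Q \<M> t *v target \<M> t) - 2 *\<^sub>R (F t *v dyn_a \<M> t))"
    by (intro continuous_intros F continuous_on_data_id[OF valid] continuous_on_K_mat_id[OF valid])+
  show ?thesis
    unfolding is_f_iff_linear by (rule linear_ode_exists[OF c assms(1), of T 0]) auto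
qed

end

text \<open>The existence times are obtained along the chain \<open>F\<close> and \<open>R\<close>,
  then \<open>F\<phi>\<close>, then \<open>F\<tau>\<close>, each uniform over the solutions of the
  earlier equations. Therefore one \<epsilon> serves every horizon and every choice of these
  solutions.\<close>

lemma small_time_solvability:
  fixes \<M> :: "('d::finite, 'm::finite, 'c::finite, 'p::finite, 'q::finite) model"
  assumes T: "0 < T" and valid: "valid_model \<M> T"
  shows "\<exists>\<epsilon>>0. \<epsilon> \<le> T \<and> (\<forall>T'. 0 < T' \<and> T' \<le> \<epsilon> \<longrightarrow>
        (\<exists>F f R F\<phi>. is_F \<M> T' F \<and> is_f \<M> T' F f \<and> is_R \<M> T' R \<and> is_Fphi \<M> T' F R F\<phi>) \<and>
        (\<forall>F f R F\<phi>.
           is_F \<M> T' F \<and> is_f \<M> T' F f \<and> is_R \<M> T' R \<and> is_Fphi \<M> T' F R F\<phi> \<longrightarrow>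
           (\<exists>F\<tau> f\<tau>. is_Ftau \<M> T' F R F\<phi> F\<tau> \<and> is_ftau \<M> T' F f R F\<phi> F\<tau> f\<tau> \<and>
              (\<forall>F\<tau>' f\<tau>'. is_Ftau \<M> T' F R F\<phi> F\<tau>' \<and> is_ftau \<M> T' F f R F\<phi> F\<tau>' f\<tau>' \<longrightarrow>
                 (\<forall>t\<in>{0..T'}. F\<tau>' t = F\<tau> t \<and> f\<tau>' t = f\<tau> t)))))"
proof -
  let ?r = "norm (init_R \<M>) + 1"
  obtain \<epsilon>1 where e1: "0 < \<epsilon>1" "\<And>T'. 0 \<le> T' \<Longrightarrow> T' \<le> \<epsilon>1 \<Longrightarrow> T' \<le> T \<Longrightarrow>
    (\<exists>F. is_F \<M> T' F) \<and> (\<forall>F. is_F \<M> T' F \<longrightarrow> (\<forall>t\<in>{0..T'}. norm (F t) \<le> 1))"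
    using is_F_local[OF valid] by metis
  obtain \<epsilon>2 where e2: "0 < \<epsilon>2" "\<And>T'. 0 \<le> T' \<Longrightarrow> T' \<le> \<epsilon>2 \<Longrightarrow> T' \<le> T \<Longrightarrow>
    (\<exists>R. is_R \<M> T' R) \<and> (\<forall>R. is_R \<M> T' R \<longrightarrow> (\<forall>t\<in>{0..T'}. norm (R t) \<le> ?r))"
    using is_R_local[OF valid] by metis
  obtain \<epsilon>3 where e3: "0 < \<epsilon>3" "\<And>T' F R. 0 \<le> T' \<Longrightarrow> T' \<le> \<epsilon>3 \<Longrightarrow> T' \<le> T \<Longrightarrow> is_F \<M> T' F \<Longrightarrow> is_R \<M> T' R \<Longrightarrow>
    (\<And>t. t \<in> {0..T'} \<Longrightarrow> norm (F t) \<le> 1 \<and> norm (R t) \<le> ?r) \<Longrightarrow>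
    (\<exists>F\<phi>. is_Fphi \<M> T' F R F\<phi>) \<and> (\<forall>F\<phi>. is_Fphi \<M> T' F R F\<phi> \<longrightarrow> (\<forall>t\<in>{0..T'}. norm (F\<phi> t) \<le> 1))"
    using is_Fphi_local[OF valid, of ?r] by blast
  obtain \<epsilon>4 where e4: "0 < \<epsilon>4" "\<And>T' F R F\<phi>. 0 \<le> T' \<Longrightarrow> T' \<le> \<epsilon>4 \<Longrightarrow> T' \<le> T \<Longrightarrow> is_F \<M> T' F \<Longrightarrow> is_R \<M> T' R \<Longrightarrow>
    is_Fphi \<M> T' F R F\<phi> \<Longrightarrow>
    (\<And>t. t \<in> {0..T'} \<Longrightarrow> norm (F t) \<le> 1 \<and> norm (R t) \<le> ?r \<and> norm (F\<phi> t) \<le> 1) \<Longrightarrow>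
    (\<exists>F\<tau>. is_Ftau \<M> T' F R F\<phi> F\<tau>)"
    using is_Ftau_local[OF valid, of ?r] by blast
  define \<epsilon> where "\<epsilon> = Min {T, \<epsilon>1, \<epsilon>2, \<epsilon>3, \<epsilon>4}"
  have e: "0 < \<epsilon>" "\<epsilon> \<le> T" using T e1(1) e2(1) e3(1) e4(1) by (simp_all add: \<epsilon>_def)
  show ?thesis
  proof (intro exI[of _ \<epsilon>] conjI e allI impI)
    fix T' assume T': "0 < T' \<and> T' \<le> \<epsilon>"
    then have le: "0 \<le> T'" "T' \<le> T" "T' \<le> \<epsilon>1" "T' \<le> \<epsilon>2" "T' \<le> \<epsilon>3" "T' \<le> \<epsilon>4" by (simp_all add: \<epsilon>_def)
    note v = valid_model_subset[OF valid le(2)]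
    obtain F R where F: "is_F \<M> T' F" and R: "is_R \<M> T' R"
      using e1(2) e2(2) le by blast
    moreover obtain f where "is_f \<M> T' F f" using is_f_exists[OF v le(1) F] by blast
    moreover obtain F\<phi> where "is_Fphi \<M> T' F R F\<phi>"
      using e3(2)[OF le(1,5,2) F R] e1(2)[OF le(1,3,2)] e2(2)[OF le(1,4,2)] F R by blast
    ultimately show "\<exists>F f R F\<phi>. is_F \<M> T' F \<and> is_f \<M> T' F f \<and> is_R \<M> T' R \<and> is_Fphi \<M> T' F R F\<phi>"
      by blast
  next
    fix T' F f R F\<phi>
    assume T': "0 < T' \<and> T' \<le> \<epsilon>"
      and h: "is_F \<M> T' F \<and> is_f \<M> T' F f \<and> is_R \<M> T' R \<and> is_Fphi \<M> T' F R F\<phi>"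
    from T' have le: "0 \<le> T'" "T' \<le> T" "T' \<le> \<epsilon>1" "T' \<le> \<epsilon>2" "T' \<le> \<epsilon>3" "T' \<le> \<epsilon>4" by (simp_all add: \<epsilon>_def)
    note v = valid_model_subset[OF valid le(2)]
    from h have F: "is_F \<M> T' F" and R: "is_R \<M> T' R" and f: "is_f \<M> T' F f" and F\<phi>: "is_Fphi \<M> T' F R F\<phi>"
      by auto
    have b: "norm (F t) \<le> 1 \<and> norm (R t) \<le> ?r" if "t \<in> {0..T'}" for t
      using e1(2)[OF le(1,3,2)] e2(2)[OF le(1,4,2)] F R that by blast
    have b': "norm (F t) \<le> 1 \<and> norm (R t) \<le> ?r \<and> norm (F\<phi> t) \<le> 1" if "t \<in> {0..T'}" for t
      using e3(2)[OF le(1,5,2) F R b] F\<phi> b that by blast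
    obtain F\<tau> where F\<tau>: "is_Ftau \<M> T' F R F\<phi> F\<tau>"
      using e4(2)[OF le(1,6,2) F R F\<phi> b'] by blast
    obtain f\<tau> where f\<tau>: "is_ftau \<M> T' F f R F\<phi> F\<tau> f\<tau>"
      using is_ftau_exists[OF v le(1) F R f F\<phi> F\<tau>] by blast
    show "\<exists>F\<tau> f\<tau>. is_Ftau \<M> T' F R F\<phi> F\<tau> \<and> is_ftau \<M> T' F f R F\<phi> F\<tau> f\<tau> \<and>
              (\<forall>F\<tau>' f\<tau>'. is_Ftau \<M> T' F R F\<phi> F\<tau>' \<and> is_ftau \<M> T' F f R F\<phi> F\<tau>' f\<tau>' \<longrightarrow>
                 (\<forall>t\<in>{0..T'}. F\<tau>' t = F\<tau> t \<and> f\<tau>' t = f\<tau> t))"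
    proof (intro exI[of _ F\<tau>] exI[of _ f\<tau>] conjI F\<tau> f\<tau> allI impI ballI)
      fix F' f' t assume p: "is_Ftau \<M> T' F R F\<phi> F' \<and> is_ftau \<M> T' F f R F\<phi> F' f'" and t: "t \<in> {0..T'}"
      have eq: "F' s = F\<tau> s" if "s \<in> {0..T'}" for s
        using is_Ftau_unique[OF v F R F\<phi> F\<tau> _ that] p by blast
      then show "F' t = F\<tau> t" using t by blast
      show "f' t = f\<tau> t"
        using is_ftau_unique[OF v F R f F\<phi> F\<tau> f\<tau> _ eq t] p by blast
    qed
  qed
qed

section \<open>The two completions of squares\<close>

lemma completion_state:
  fixes O' Y D Q :: "real^'n^'n" and \<phi> f d l :: "real^'n"
  assumes sym: "sym_mat O'" "sym_mat Y"
  defines "\<phi>' \<equiv> (D - O' ** Y) *v \<phi> + d - O' *v f"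
    and "Y' \<equiv> - ric D O' (2 *\<^sub>R Q) Y"
    and "f' \<equiv> (Y ** O' - transpose D) *v f - (Y *v d + l)"
  shows "\<phi> \<bullet> (Q *v \<phi>) + l \<bullet> \<phi> + (1/2) * ((Y *v \<phi> + f) \<bullet> (O' *v (Y *v \<phi> + f)))
      + ((1/2) * (\<phi>' \<bullet> (Y *v \<phi>) + \<phi> \<bullet> (Y' *v \<phi> + Y *v \<phi>')) + (f' \<bullet> \<phi> + f \<bullet> \<phi>'))
    = f \<bullet> d - (1/2) * (f \<bullet> (O' *v f))"
proof -
  \<comment> \<open>The feedback is already inserted, so the penalty is a quadratic form of Y \<phi>
    + f with matrix \<open>O'\<close>. The Riccati equation cancels everything quadratic in \<phi>
    and the equation of \<open>f\<close> everything linear in \<phi>; what survives is a cost in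
    \<open>f\<close> alone.\<close>
  define y g where "y = Y *v \<phi>" and "g = D *v \<phi>"
  have \<phi>': "\<phi>' = g - O' *v y + d - O' *v f"
    by (simp del: transpose_matrix_vector add: \<phi>'_def y_def g_def matrix_vector_mult_diff_rdistrib matrix_vector_mul_assoc)
  have 1: "\<phi> \<bullet> (Y' *v \<phi>) = - 2 * (g \<bullet> y) - 2 * (\<phi> \<bullet> (Q *v \<phi>)) + y \<bullet> (O' *v y)"
  proof -
    have "Y' *v \<phi> = - (transpose D *v y) - Y *v g - 2 *\<^sub>R (Q *v \<phi>) + Y *v (O' *v y)"
      by (simp del: transpose_matrix_vector add: Y'_def ric_def y_def g_def matrix_vector_mult_diff_rdistrib matrix_vector_mult_add_rdistrib
          matrix_vector_mul_assoc scaleR_matrix_vector_assoc matrix_mul_assoc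
          bounded_bilinear.minus_left[OF bounded_bilinear_matrix_vector_mult])
    then show ?thesis
      by (simp del: transpose_matrix_vector add: inner_simps inner_transpose_right sym_mat_inner[OF sym(2), symmetric] g_def[symmetric]
          y_def[symmetric] inner_commute)
  qed
  have 2: "\<phi> \<bullet> (Y *v \<phi>') = y \<bullet> \<phi>'"
    by (simp del: transpose_matrix_vector add: sym_mat_inner[OF sym(2), symmetric] y_def)
  have 3: "f' \<bullet> \<phi> = (O' *v f) \<bullet> y - f \<bullet> g - d \<bullet> y - l \<bullet> \<phi>"
    by (simp del: transpose_matrix_vector add: f'_def inner_simps matrix_vector_mult_diff_rdistrib matrix_vector_mul_assoc[symmetric]
        sym_mat_inner[OF sym(2)] y_def g_def) (simp del: transpose_matrix_vector add: inner_commute inner_transpose_right)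
  have 4: "(O' *v f) \<bullet> y = f \<bullet> (O' *v y)" "y \<bullet> (O' *v f) = f \<bullet> (O' *v y)"
    using sym_mat_inner[OF sym(1), of f y] by (simp_all add: inner_commute)
  show ?thesis
    unfolding y_def[symmetric] inner_add_right 1 2 3 4(1)
    by (simp del: transpose_matrix_vector add: \<phi>' inner_simps 4 matrix_vector_right_distrib inner_commute[of _ y] inner_commute[of d]
        inner_commute[of g]) (simp add: add_divide_distrib diff_divide_distrib)
qed

text \<open>Here \<open>f\<close> is the state and \<tau> the control, acting through Q
  \<Sigma>^{-1} \<tau>; the leftover of \<open>completion_state\<close> together with the price of
  \<tau> is the running cost. The derivative of the quadratic function in \<open>f\<close> is
  subtracted rather than added because the value of \<open>f\<close> is fixed at the final time. In
  the application \<open>a\<close> is F\<phi> d\<phi> + l\<phi>, \<open>g\<close> is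
  \<open>f\<tau>\<close> + \<open>Phi0\<close>, and the last bracket is free of \<tau> and
  \<open>f\<close>.\<close>

lemma completion_obs:
  fixes O' Ft N0 :: "real^'n^'n" and Q G :: "real^'m^'n" and \<Sigma> :: "real^'m^'m" and f a d g :: "real^'n"
    and \<tau> :: "real^'m"
  assumes sym: "sym_mat Ft" "sym_mat \<Sigma>" and inv: "invertible \<Sigma>"
  defines "\<Sigma>i \<equiv> matrix_inv \<Sigma>"
  assumes symi: "sym_mat \<Sigma>i"
  defines "f' \<equiv> - (N0 *v f) - a - Q *v (\<Sigma>i *v \<tau>)"
    and "Ft' \<equiv> - ric (- (N0 - Q ** transpose G)) (- (Q ** \<Sigma>i ** transpose Q)) (O' + G ** \<Sigma> ** transpose G) Ft"
    and "g' \<equiv> - (Ft *v (Q *v (\<Sigma>i *v (transpose Q *v g)))) - G *v (transpose Q *v g) + transpose N0 *v g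
      + Ft *v a + d"
    and "th \<equiv> - (transpose Q *v (Ft *v f + g)) - \<Sigma> *v (transpose G *v f)"
  shows "f \<bullet> (d + G *v \<tau>) - (1/2) * (f \<bullet> (O' *v f)) + (1/2) * (\<tau> \<bullet> (\<Sigma>i *v \<tau>))
      - ((1/2) * (f' \<bullet> (Ft *v f) + f \<bullet> (Ft' *v f + Ft *v f')) + (g' \<bullet> f + g \<bullet> f'))
    = (1/2) * ((\<tau> - th) \<bullet> (\<Sigma>i *v (\<tau> - th)))
      + (g \<bullet> a - (1/2) * ((transpose Q *v g) \<bullet> (\<Sigma>i *v (transpose Q *v g))))"
proof -
  define y z s h u n where "y = Ft *v f" and "z = transpose Q *v y" and "s = transpose Q *v g"
    and "h = transpose G *v f" and "u = \<Sigma>i *v \<tau>" and "n = N0 *v f"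
  have tq: "(Q *v v) \<bullet> x = v \<bullet> (transpose Q *v x)" "(G *v v) \<bullet> x = v \<bullet> (transpose G *v x)"
    "(transpose N0 *v w) \<bullet> x = w \<bullet> (N0 *v x)" for v x w
    using inner_transpose_right[of v Q x] inner_transpose_right[of v G x] inner_transpose_right[of x N0 w]
    by (simp_all add: inner_commute inner_transpose_right)
  have s\<Sigma>: "\<Sigma>i *v (\<Sigma> *v x) = x" for x
    by (simp del: transpose_matrix_vector add: \<Sigma>i_def matrix_vector_mul_assoc matrix_inv_left[OF inv])
  have fy: "f \<bullet> (Ft *v x) = y \<bullet> x" for x
    by (simp del: transpose_matrix_vector add: y_def sym_mat_inner[OF sym(1)])
  have f': "f' \<bullet> x = - (n \<bullet> x) - a \<bullet> x - u \<bullet> (transpose Q *v x)" for x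
    by (simp del: transpose_matrix_vector add: f'_def inner_simps tq n_def u_def)
  have 1: "f \<bullet> (Ft' *v f) = 2 * (n \<bullet> y) - 2 * (h \<bullet> z) - f \<bullet> (O' *v f) - h \<bullet> (\<Sigma> *v h) - z \<bullet> (\<Sigma>i *v z)"
  proof -
    have "Ft' *v f = transpose N0 *v y - G *v z + Ft *v (n - Q *v h) - O' *v f - G *v (\<Sigma> *v h)
        - Ft *v (Q *v (\<Sigma>i *v z))"
      by (simp del: transpose_matrix_vector add: Ft'_def ric_def y_def n_def h_def z_def matrix_vector_mult_diff_rdistrib matrix_vector_mult_add_rdistrib
          matrix_vector_mult_diff_distrib matrix_vector_mul_assoc matrix_mul_assoc transpose_minus transpose_diff
          matrix_mult_minus_left matrix_mult_minus_right matrix_diff_mult_distrib matrix_diff_ldistrib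
          matrix_transpose_mul bounded_bilinear.minus_left[OF bounded_bilinear_matrix_vector_mult])
    then have "f \<bullet> (Ft' *v f) = y \<bullet> n - z \<bullet> h + y \<bullet> (n - Q *v h) - f \<bullet> (O' *v f) - (\<Sigma> *v h) \<bullet> h
        - (\<Sigma>i *v z) \<bullet> z"
      by (simp del: transpose_matrix_vector add: inner_diff_right inner_add_right fy inner_commute[of f "transpose N0 *v y"] tq(3) n_def[symmetric]
          inner_commute[of f "G *v x" for x] tq(2) h_def[symmetric] inner_commute[of y "Q *v x" for x] tq(1) z_def[symmetric])
    moreover have "y \<bullet> (n - Q *v h) = n \<bullet> y - h \<bullet> z"
      unfolding inner_diff_right inner_commute[of y "Q *v h"] tq(1) z_def[symmetric] inner_commute[of y n] ..
    ultimately show ?thesis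
      unfolding inner_commute[of z h] inner_commute[of y n] inner_commute[of "\<Sigma> *v h" h] inner_commute[of "\<Sigma>i *v z" z]
      by simp
  qed
  have 2: "g' \<bullet> f = - ((\<Sigma>i *v s) \<bullet> z) - s \<bullet> h + g \<bullet> n + a \<bullet> y + d \<bullet> f"
    by (simp del: transpose_matrix_vector add: g'_def inner_simps sym_mat_inner[OF sym(1)] tq y_def[symmetric] z_def[symmetric] s_def[symmetric]
        h_def[symmetric] n_def[symmetric])
  have 3: "f \<bullet> (G *v \<tau>) = \<tau> \<bullet> h"
    by (simp del: transpose_matrix_vector add: inner_commute[of f] tq h_def)
  have th: "\<tau> - th = \<tau> + z + s + \<Sigma> *v h"
    by (simp del: transpose_matrix_vector add: th_def z_def s_def h_def y_def matrix_vector_right_distrib)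
  have 4: "x \<bullet> (\<Sigma>i *v w) = w \<bullet> (\<Sigma>i *v x)" for x w
    using sym_mat_inner[OF symi, of w x] by (simp del: transpose_matrix_vector add: inner_commute)
  \<comment> \<open>The term \<Sigma> h in \<open>th\<close> exists for this reason: it turns the
    cross term \<tau> \<bullet> h of the cost into one of the mixed terms of the square.\<close>
  have 5: "(\<Sigma> *v h) \<bullet> (\<Sigma>i *v x) = h \<bullet> x" for x
    using sym_mat_inner[OF symi, of "\<Sigma> *v h" x] by (simp del: transpose_matrix_vector add: s\<Sigma>)
  have 6: "(\<tau> - th) \<bullet> (\<Sigma>i *v (\<tau> - th)) = \<tau> \<bullet> u + z \<bullet> (\<Sigma>i *v z) + s \<bullet> (\<Sigma>i *v s) + h \<bullet> (\<Sigma> *v h)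
     + 2 * (u \<bullet> z) + 2 * (u \<bullet> s) + 2 * (\<tau> \<bullet> h) + 2 * (s \<bullet> (\<Sigma>i *v z)) + 2 * (z \<bullet> h) + 2 * (s \<bullet> h)"
  proof -
    have e: "\<tau> \<bullet> (\<Sigma>i *v \<tau>) = \<tau> \<bullet> u" "\<tau> \<bullet> (\<Sigma>i *v z) = u \<bullet> z" "z \<bullet> (\<Sigma>i *v \<tau>) = u \<bullet> z"
      "\<tau> \<bullet> (\<Sigma>i *v s) = u \<bullet> s" "s \<bullet> (\<Sigma>i *v \<tau>) = u \<bullet> s"
      using 4[of \<tau> z] 4[of \<tau> s] unfolding u_def by (simp_all only: inner_commute)
    have e': "x \<bullet> h = h \<bullet> x" for x by (rule inner_commute)
    show ?thesis
      unfolding th matrix_vector_right_distrib inner_add_left inner_add_right s\<Sigma> 5 e 4[of z s]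
        e'[of \<tau>] e'[of z] e'[of s] e'[of "\<Sigma> *v h"]
      by simp
  qed
  have c: "d \<bullet> f = f \<bullet> d" "g \<bullet> n = n \<bullet> g" "g \<bullet> a = a \<bullet> g" "z \<bullet> h = h \<bullet> z" "(\<Sigma>i *v s) \<bullet> z = s \<bullet> (\<Sigma>i *v z)"
    using sym_mat_inner[OF symi, of s z] by (simp_all only: inner_commute)
  show ?thesis
    unfolding inner_add_right fy y_def[symmetric] s_def[symmetric] u_def[symmetric] inner_commute[of y f'] inner_commute[of g f']
      f' 1 2 3 6 z_def[symmetric] c
    by (simp add: add_divide_distrib diff_divide_distrib)
qed

section \<open>The cost along the mean path\<close>

lemma transpose_e_Concat:
  "transpose e_xc *v Concat x y z = x" "transpose e_xa *v Concat x y z = y" "transpose e_dx *v Concat x y z = z"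
  for x y z :: "real^'d"
proof -
  have *: "(\<Sum>i\<in>UNIV. F (i :: 'd + 'd + 'd)) = (\<Sum>i\<in>UNIV. F (Inl i)) + ((\<Sum>i\<in>UNIV. F (Inr (Inl i))) + (\<Sum>i\<in>UNIV. F (Inr (Inr i))))"
    for F :: "'d + 'd + 'd \<Rightarrow> real"
    by (simp add: UNIV_Plus_UNIV[symmetric] sum.Plus del: UNIV_Plus_UNIV)
  show "transpose e_xc *v Concat x y z = x" "transpose e_xa *v Concat x y z = y" "transpose e_dx *v Concat x y z = z"
    by (simp_all add: vec_eq_iff matrix_vector_mult_def transpose_def e_xc_def e_xa_def e_dx_def Concat_def mat_def *
        if_distrib[of "\<lambda>a. a * b" for b] cong: if_cong)
qed

definition det_rho :: "('d::finite, 'm::finite, 'c::finite, 'p::finite, 'q::finite) model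
    \<Rightarrow> (real \<Rightarrow> real^('d + 'd + 'd)^('d + 'd + 'd)) \<Rightarrow> (real \<Rightarrow> real^('d + 'd + 'd))
    \<Rightarrow> (real \<Rightarrow> real^('d + 'd + 'd)) \<Rightarrow> real \<Rightarrow> real^'d" where
  "det_rho \<M> F\<phi> f\<phi> \<phi> t =
     - ((matrix_inv (pen_P \<M> t) ** transpose (e_xc + e_dx)) *v (F\<phi> t *v \<phi> t + f\<phi> t))"

text \<open>The state is represented by the first block of \<phi>: the filtering error is centred,
  so the attacked state and its filter have the same mean.\<close>

definition det_cost :: "('d::finite, 'm::finite, 'c::finite, 'p::finite, 'q::finite) model
    \<Rightarrow> (real \<Rightarrow> real^'d^'d) \<Rightarrow> (real \<Rightarrow> real^'d)
    \<Rightarrow> (real \<Rightarrow> real^('d + 'd + 'd)^('d + 'd + 'd)) \<Rightarrow> (real \<Rightarrow> real^('d + 'd + 'd))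
    \<Rightarrow> (real \<Rightarrow> real^'m) \<Rightarrow> (real \<Rightarrow> real^('d + 'd + 'd)) \<Rightarrow> real \<Rightarrow> real" where
  "det_cost \<M> F f F\<phi> f\<phi> \<tau> \<phi> t =
     (let xc = transpose e_xc *v \<phi> t; xa = transpose e_xa *v \<phi> t; y = obs_H \<M> t *v (transpose e_dx *v \<phi> t) + \<tau> t
      in (1/2) * (y \<bullet> (matrix_inv (Sig_W \<M>) *v y))
         - lam \<M> * ((xc - target \<M> t) \<bullet> (cost_Q \<M> t *v (xc - target \<M> t))
                    + u_star \<M> F f t xa \<bullet> (cost_S \<M> t *v u_star \<M> F f t xa))
         + (1/2) * (det_rho \<M> F\<phi> f\<phi> \<phi> t \<bullet> (pen_P \<M> t *v det_rho \<M> F\<phi> f\<phi> \<phi> t)))"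

lemma matrix_vector_mult_minus_right: "A *v (- x) = - (A *v x)" for A :: "real^'n^'m"
  by (rule bounded_bilinear.minus_right[OF bounded_bilinear_matrix_vector_mult])

lemma matrix_vector_mult_minus_left: "(- A) *v x = - (A *v x)" for A :: "real^'n^'m"
  by (rule bounded_bilinear.minus_left[OF bounded_bilinear_matrix_vector_mult])

lemma d_tau_eq: "d_tau \<M> R \<tau> t = G_mat \<M> R t *v \<tau> t"
  by (auto simp: d_tau_def G_mat_def Concat_def vec_eq_iff matrix_vector_mult_def sum_negf split: sum.split)

text \<open>With w = F x + f/2 the control is - S^{-1} B^T w, and its cost collapses to w \<bullet>
  K w. The 1/4 is the square of that half.\<close>

lemma u_star_cost:
  assumes "valid_model \<M> T" "t \<in> {0..T}" "sym_mat (F t)"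
  shows "u_star \<M> F f t x \<bullet> (cost_S \<M> t *v u_star \<M> F f t x)
    = x \<bullet> ((F t ** K_mat \<M> t ** F t) *v x) + ((F t ** K_mat \<M> t) *v f t) \<bullet> x + (1/4) * (f t \<bullet> (K_mat \<M> t *v f t))"
proof -
  have S: "pd_mat (cost_S \<M> t)" using assms by (simp add: valid_model_def)
  define w where "w = F t *v x + (1/2) *\<^sub>R f t"
  have u: "u_star \<M> F f t x = - (matrix_inv (cost_S \<M> t) *v (transpose (dyn_B \<M> t) *v w))"
    by (simp del: transpose_matrix_vector add: u_star_def w_def matrix_vector_mul_assoc matrix_mul_assoc
        matrix_vector_right_distrib matrix_vector_mult_scaleR)
  have "u_star \<M> F f t x \<bullet> (cost_S \<M> t *v u_star \<M> F f t x)
      = (matrix_inv (cost_S \<M> t) *v (transpose (dyn_B \<M> t) *v w)) \<bullet> (transpose (dyn_B \<M> t) *v w)"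
    unfolding u matrix_vector_mult_minus_right
    by (simp del: transpose_matrix_vector add: matrix_vector_mul_assoc[of "cost_S \<M> t"] matrix_inv_right[OF pd_mat_invertible[OF S]])
  also have "\<dots> = (dyn_B \<M> t *v (matrix_inv (cost_S \<M> t) *v (transpose (dyn_B \<M> t) *v w))) \<bullet> w"
    by (rule inner_transpose_right)
  also have "\<dots> = w \<bullet> (K_mat \<M> t *v w)"
    by (simp only: K_mat_def matrix_vector_mul_assoc matrix_mul_assoc inner_commute)
  also have "\<dots> = (F t *v x) \<bullet> (K_mat \<M> t *v (F t *v x)) + (F t *v x) \<bullet> (K_mat \<M> t *v f t) + (1/4) * (f t \<bullet> (K_mat \<M> t *v f t))"
    using sym_mat_inner[OF valid_model_sym(1)[OF assms(1,2)], of "f t" "F t *v x"]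
    by (simp add: w_def inner_add_left inner_add_right matrix_vector_right_distrib matrix_vector_mult_scaleR inner_commute)
  also have "(F t *v x) \<bullet> (K_mat \<M> t *v (F t *v x)) = x \<bullet> ((F t ** K_mat \<M> t ** F t) *v x)"
    by (simp add: sym_mat_inner[OF assms(3)] matrix_vector_mul_assoc matrix_mul_assoc)
  also have "(F t *v x) \<bullet> (K_mat \<M> t *v f t) = ((F t ** K_mat \<M> t) *v f t) \<bullet> x"
    by (simp add: sym_mat_inner[OF assms(3)] matrix_vector_mul_assoc inner_commute)
  finally show ?thesis .
qed

lemma det_rho_cost:
  assumes "valid_model \<M> T" "t \<in> {0..T}"
  shows "det_rho \<M> F\<phi> f\<phi> \<phi> t \<bullet> (pen_P \<M> t *v det_rho \<M> F\<phi> f\<phi> \<phi> t)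
    = (F\<phi> t *v \<phi> t + f\<phi> t) \<bullet> (O_mat \<M> t *v (F\<phi> t *v \<phi> t + f\<phi> t))"
proof -
  have P: "pd_mat (pen_P \<M> t)" using assms by (simp add: valid_model_def)
  define E where "E = (e_xc + e_dx :: real^'a^('a + 'a + 'a))"
  define p where "p = F\<phi> t *v \<phi> t + f\<phi> t"
  have r: "det_rho \<M> F\<phi> f\<phi> \<phi> t = - (matrix_inv (pen_P \<M> t) *v (transpose E *v p))"
    unfolding det_rho_def E_def p_def matrix_vector_mul_assoc ..
  have "det_rho \<M> F\<phi> f\<phi> \<phi> t \<bullet> (pen_P \<M> t *v det_rho \<M> F\<phi> f\<phi> \<phi> t)
      = (matrix_inv (pen_P \<M> t) *v (transpose E *v p)) \<bullet> (transpose E *v p)"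
    unfolding r matrix_vector_mult_minus_right
    by (simp del: transpose_matrix_vector add: matrix_vector_mul_assoc[of "pen_P \<M> t"] matrix_inv_right[OF pd_mat_invertible[OF P]])
  also have "\<dots> = (E *v (matrix_inv (pen_P \<M> t) *v (transpose E *v p))) \<bullet> p"
    by (rule inner_transpose_right)
  finally show ?thesis
    unfolding p_def[symmetric] O_mat_def E_def[symmetric] matrix_vector_mul_assoc matrix_mul_assoc
    by (simp only: inner_commute)
qed

text \<open>The origin of \<open>Q_phi\<close>, \<open>l_phi\<close> and \<open>l_tau\<close>: they
  are the coefficients of the running cost after the squares around the target, the control and the
  observation have been multiplied out. The last line depends on neither \<tau> nor \<phi>.\<close>

lemma det_cost_expand:
  assumes v: "valid_model \<M> T" and t: "t \<in> {0..T}" and F: "sym_mat (F t)"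
  shows "det_cost \<M> F f F\<phi> f\<phi> \<tau> \<phi> t = \<phi> t \<bullet> (Q_phi \<M> F t *v \<phi> t) + (l_phi \<M> F f t + l_tau \<M> \<tau> t) \<bullet> \<phi> t
     + (1/2) * ((F\<phi> t *v \<phi> t + f\<phi> t) \<bullet> (O_mat \<M> t *v (F\<phi> t *v \<phi> t + f\<phi> t)))
     + (1/2) * (\<tau> t \<bullet> (matrix_inv (Sig_W \<M>) *v \<tau> t))
     - lam \<M> * (target \<M> t \<bullet> (cost_Q \<M> t *v target \<M> t) + (1/4) * (f t \<bullet> (K_mat \<M> t *v f t)))"
proof -
  let ?\<Sigma> = "matrix_inv (Sig_W \<M>)" and ?r = "target \<M> t" and ?Q = "cost_Q \<M> t"
  define xc xa xd where "xc = transpose e_xc *v \<phi> t" and "xa = transpose e_xa *v \<phi> t" and "xd = transpose e_dx *v \<phi> t"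
  have dl: "(e_xc *v a) \<bullet> \<phi> t = a \<bullet> xc" "(e_xa *v a) \<bullet> \<phi> t = a \<bullet> xa" "(e_dx *v a) \<bullet> \<phi> t = a \<bullet> xd" for a
    unfolding xc_def xa_def xd_def by (rule inner_transpose_right[symmetric])+
  have dr: "\<phi> t \<bullet> (e_xc *v a) = xc \<bullet> a" "\<phi> t \<bullet> (e_xa *v a) = xa \<bullet> a" "\<phi> t \<bullet> (e_dx *v a) = xd \<bullet> a" for a
    using dl[of a] by (simp_all only: inner_commute)
  have q: "\<phi> t \<bullet> (Q_phi \<M> F t *v \<phi> t) = (1/2) * ((obs_H \<M> t *v xd) \<bullet> (?\<Sigma> *v (obs_H \<M> t *v xd)))
      - lam \<M> * (xa \<bullet> ((F t ** K_mat \<M> t ** F t) *v xa)) - lam \<M> * (xc \<bullet> (?Q *v xc))"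
    by (simp del: transpose_matrix_vector add: Q_phi_def matrix_vector_mult_diff_rdistrib scaleR_matrix_vector_assoc[symmetric]
        matrix_vector_mul_assoc[symmetric] inner_diff_right dr xc_def[symmetric] xa_def[symmetric] xd_def[symmetric]
        inner_transpose_right)
  have l: "l_phi \<M> F f t \<bullet> \<phi> t = 2 * lam \<M> * ((?Q *v ?r) \<bullet> xc) - lam \<M> * (((F t ** K_mat \<M> t) *v f t) \<bullet> xa)"
    by (simp add: l_phi_def inner_diff_left dl)
  have l': "l_tau \<M> \<tau> t \<bullet> \<phi> t = (obs_H \<M> t *v xd) \<bullet> (?\<Sigma> *v \<tau> t)"
    by (simp del: transpose_matrix_vector add: l_tau_def matrix_vector_mul_assoc[symmetric] dl
        inner_commute[of "transpose (obs_H \<M> t) *v x" for x] inner_transpose_right)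
  have 1: "(xc - ?r) \<bullet> (?Q *v (xc - ?r)) = xc \<bullet> (?Q *v xc) - 2 * ((?Q *v ?r) \<bullet> xc) + ?r \<bullet> (?Q *v ?r)"
    using sym_mat_inner[OF valid_model_sym(3)[OF v t], of ?r xc]
    by (simp add: inner_diff_left inner_diff_right matrix_vector_mult_diff_distrib inner_commute)
  have 2: "\<tau> t \<bullet> (?\<Sigma> *v (obs_H \<M> t *v xd)) = (obs_H \<M> t *v xd) \<bullet> (?\<Sigma> *v \<tau> t)"
    using sym_mat_inner[OF valid_model_sym(4)[OF v t], of "\<tau> t" "obs_H \<M> t *v xd"] by (simp add: inner_commute)
  show ?thesis
    unfolding det_cost_def Let_def det_rho_cost[OF v t] u_star_cost[where F = F and T = T, OF v t F] xc_def[symmetric]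
      xa_def[symmetric] xd_def[symmetric] inner_add_left[of "l_phi \<M> F f t"] q l l' 1
    unfolding inner_add_left[of "obs_H \<M> t *v xd"] inner_add_right matrix_vector_right_distrib[of ?\<Sigma>] 2
    by (simp add: algebra_simps)
qed

text \<open>The closed-loop equation of the stacked filters under the feedback, with the observation
  noise and the filtering error replaced by their mean, zero. The third block is carried as an
  unknown of its own although it is the difference of the other two.\<close>

definition is_mean :: "('d::finite, 'm::finite, 'c::finite, 'p::finite, 'q::finite) model \<Rightarrow> real
    \<Rightarrow> (real \<Rightarrow> real^'d^'d) \<Rightarrow> (real \<Rightarrow> real^'d) \<Rightarrow> (real \<Rightarrow> real^'d^'d)
    \<Rightarrow> (real \<Rightarrow> real^('d + 'd + 'd)^('d + 'd + 'd)) \<Rightarrow> (real \<Rightarrow> real^('d + 'd + 'd))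
    \<Rightarrow> (real \<Rightarrow> real^'m) \<Rightarrow> (real \<Rightarrow> real^('d + 'd + 'd)) \<Rightarrow> bool" where
  "is_mean \<M> T F f R F\<phi> f\<phi> \<tau> \<phi> \<longleftrightarrow> \<phi> 0 = Phi0 \<M> \<and> (\<forall>t\<in>{0..T}.
     (\<phi> has_vector_derivative ((D_phi \<M> F R t - O_mat \<M> t ** F\<phi> t) *v \<phi> t
       + (d_phi \<M> f t + d_tau \<M> R \<tau> t - O_mat \<M> t *v f\<phi> t))) (at t within {0..T}))"

text \<open>\<open>C\<close> is obtained before \<tau>, \<open>f\<phi>\<close> and \<phi> are fixed;
  only this order of quantifiers allows the costs of different attacks to be compared.\<close>

lemma det_cost_integral:
  fixes \<M> :: "('d::finite, 'm::finite, 'c::finite, 'p::finite, 'q::finite) model"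
  assumes T: "0 < T" and v: "valid_model \<M> T"
    and F: "is_F \<M> T F" and f: "is_f \<M> T F f" and R: "is_R \<M> T R" and F\<phi>: "is_Fphi \<M> T F R F\<phi>"
    and F\<tau>: "is_Ftau \<M> T F R F\<phi> F\<tau>" and f\<tau>: "is_ftau \<M> T F f R F\<phi> F\<tau> f\<tau>"
  obtains C where "\<And>\<tau> f\<phi> \<phi>. obs_attack T \<tau> \<Longrightarrow> is_fphi \<M> T F f R F\<phi> \<tau> f\<phi> \<Longrightarrow> is_mean \<M> T F f R F\<phi> f\<phi> \<tau> \<phi> \<Longrightarrow>
    (det_cost \<M> F f F\<phi> f\<phi> \<tau> \<phi> has_integral
      C + (1/2) * integral {0..T} (\<lambda>t. (\<tau> t - tau_formula \<M> R F\<phi> F\<tau> f\<tau> f\<phi> t) \<bullet>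
        (matrix_inv (Sig_W \<M>) *v (\<tau> t - tau_formula \<M> R F\<phi> F\<tau> f\<tau> f\<phi> t)))) {0..T}"
proof -
  let ?\<Sigma>i = "matrix_inv (Sig_W \<M>)"
  have inv: "invertible (Sig_W \<M>)"
    using v by (auto simp: valid_model_def intro!: pd_mat_invertible pd_mat_Sig_W)
  define a where "a t = F\<phi> t *v d_phi \<M> f t + l_phi \<M> F f t" for t
  \<comment> \<open>The shift by the constant \<open>Phi0\<close> leaves the derivative of
    \<open>f\<tau>\<close> unchanged and makes \<open>g\<close> equal to \<open>Phi0\<close> at time
    0, which is what the boundary terms require.\<close>
  define g where "g t = f\<tau> t + Phi0 \<M>" for t
  \<comment> \<open>Collects everything the two completions leave behind that involves neither
    \<tau> nor \<open>f\<phi>\<close> nor \<phi>; its integral is part of \<open>C\<close>.\<close>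
  define \<kappa> where "\<kappa> t = (g t \<bullet> a t - (1/2) * ((transpose (Q_F \<M> R F\<phi> t) *v g t) \<bullet> (?\<Sigma>i *v (transpose (Q_F \<M> R F\<phi> t) *v g t))))
     - lam \<M> * (target \<M> t \<bullet> (cost_Q \<M> t *v target \<M> t) + (1/4) * (f t \<bullet> (K_mat \<M> t *v f t)))" for t
  note cont = is_F_continuous[OF F] is_f_continuous[OF f] is_R_continuous[OF R] is_Fphi_continuous[OF F\<phi>]
    is_Ftau_continuous[OF F\<tau>] is_ftau_continuous[OF f\<tau>]
  note coef = continuous_on_coefficients[OF v cont(1,3,2,4)] continuous_on_data_id[OF v] continuous_on_K_mat_id[OF v]
  have c\<kappa>: "\<kappa> integrable_on {0..T}"
    unfolding \<kappa>_def g_def a_def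
    by (intro integrable_continuous_real continuous_intros continuous_on_inner cont coef)
  show ?thesis
  proof (rule that[of "(1/2) * (Phi0 \<M> \<bullet> (F\<phi> 0 *v Phi0 \<M>)) + integral {0..T} \<kappa>"])
    fix \<tau> f\<phi> \<phi>
    assume \<tau>: "obs_attack T \<tau>" and f\<phi>: "is_fphi \<M> T F f R F\<phi> \<tau> f\<phi>" and \<phi>: "is_mean \<M> T F f R F\<phi> f\<phi> \<tau> \<phi>"
    let ?th = "tau_formula \<M> R F\<phi> F\<tau> f\<tau> f\<phi>"
    define err where "err t = (\<tau> t - ?th t) \<bullet> (?\<Sigma>i *v (\<tau> t - ?th t))" for t
    have cerr: "err integrable_on {0..T}"
      unfolding err_def tau_formula_def using \<tau>[unfolded obs_attack_def]
      by (intro integrable_continuous_real continuous_intros continuous_on_inner cont coef is_fphi_continuous[OF f\<phi>])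
    define \<phi>' where "\<phi>' t = (D_phi \<M> F R t - O_mat \<M> t ** F\<phi> t) *v \<phi> t
      + (d_phi \<M> f t + d_tau \<M> R \<tau> t) - O_mat \<M> t *v f\<phi> t" for t
    define Y' where "Y' t = - ric (D_phi \<M> F R t) (O_mat \<M> t) (2 *\<^sub>R Q_phi \<M> F t) (F\<phi> t)" for t
    define f' where "f' t = (F\<phi> t ** O_mat \<M> t - transpose (D_phi \<M> F R t)) *v f\<phi> t
      - (F\<phi> t *v (d_phi \<M> f t + d_tau \<M> R \<tau> t) + (l_phi \<M> F f t + l_tau \<M> \<tau> t))" for t
    define Ft' where "Ft' t = - ric (- N_ric \<M> F R F\<phi> t) (- k_ric \<M> R F\<phi> t) (q_ric \<M> R t) (F\<tau> t)" for t
    define g' where "g' t = - (F\<tau> t *v (Q_F \<M> R F\<phi> t *v (?\<Sigma>i *v (transpose (Q_F \<M> R F\<phi> t) *v g t))))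
      - G_mat \<M> R t *v (transpose (Q_F \<M> R F\<phi> t) *v g t)
      + transpose (transpose (D_phi \<M> F R t) - F\<phi> t ** O_mat \<M> t) *v g t + F\<tau> t *v a t + d_phi \<M> f t" for t
    have d\<phi>: "(\<phi> has_vector_derivative \<phi>' t) (at t within {0..T})" if "t \<in> {0..T}" for t
      using \<phi> that by (simp add: is_mean_def \<phi>'_def add_diff_eq)
    have dY: "(F\<phi> has_vector_derivative Y' t) (at t within {0..T})" if "t \<in> {0..T}" for t
      using F\<phi> that by (simp add: is_Fphi_iff_ric Y'_def)
    have df: "(f\<phi> has_vector_derivative f' t) (at t within {0..T})" if "t \<in> {0..T}" for t
      using f\<phi> that by (simp add: is_fphi_iff_linear f'_def add.assoc)
    have dFt: "(F\<tau> has_vector_derivative Ft' t) (at t within {0..T})" if "t \<in> {0..T}" for t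
      using F\<tau> that by (simp add: is_Ftau_iff_ric Ft'_def)
    have dg: "(g has_vector_derivative g' t) (at t within {0..T})" if t: "t \<in> {0..T}" for t
    proof -
      let ?L = "- (F\<tau> t ** k_ric \<M> R F\<phi> t) - (G_mat \<M> R t ** transpose (Q_F \<M> R F\<phi> t)
        - D_phi \<M> F R t + transpose (O_mat \<M> t) ** transpose (F\<phi> t))"
      have "(f\<tau> has_vector_derivative (?L *v f\<tau> t + (F\<tau> t *v a t + d_phi \<M> f t + ?L *v Phi0 \<M>))) (at t within {0..T})"
        using f\<tau> t by (simp add: is_ftau_iff_linear a_def)
      moreover have "?L *v f\<tau> t + (F\<tau> t *v a t + d_phi \<M> f t + ?L *v Phi0 \<M>) = g' t"
      proof -
        have "?L *v f\<tau> t + (F\<tau> t *v a t + d_phi \<M> f t + ?L *v Phi0 \<M>) = ?L *v g t + F\<tau> t *v a t + d_phi \<M> f t"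
          by (simp add: g_def matrix_vector_right_distrib)
        also have "?L *v g t = - (F\<tau> t *v (Q_F \<M> R F\<phi> t *v (?\<Sigma>i *v (transpose (Q_F \<M> R F\<phi> t) *v g t))))
          - G_mat \<M> R t *v (transpose (Q_F \<M> R F\<phi> t) *v g t)
          + transpose (transpose (D_phi \<M> F R t) - F\<phi> t ** O_mat \<M> t) *v g t"
          by (simp del: transpose_matrix_vector add: matrix_vector_mult_diff_rdistrib matrix_vector_mult_add_rdistrib
            matrix_vector_mult_minus_left k_ric_def matrix_vector_mul_assoc matrix_mul_assoc transpose_diff matrix_transpose_mul)
        finally show ?thesis by (simp add: g'_def)
      qed
      ultimately have "(f\<tau> has_vector_derivative g' t) (at t within {0..T})" by simp
      then have "(g has_vector_derivative g' t + 0) (at t within {0..T})"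
        unfolding g_def by (intro has_vector_derivative_add has_vector_derivative_const)
      then show ?thesis by simp
    qed
    let ?v = "\<lambda>t. (1/2) * (\<phi> t \<bullet> (F\<phi> t *v \<phi> t)) + f\<phi> t \<bullet> \<phi> t"
    let ?w = "\<lambda>t. (1/2) * (f\<phi> t \<bullet> (F\<tau> t *v f\<phi> t)) + g t \<bullet> f\<phi> t"
    let ?v' = "\<lambda>t. (1/2) * (\<phi>' t \<bullet> (F\<phi> t *v \<phi> t) + \<phi> t \<bullet> (Y' t *v \<phi> t + F\<phi> t *v \<phi>' t)) + (f' t \<bullet> \<phi> t + f\<phi> t \<bullet> \<phi>' t)"
    let ?w' = "\<lambda>t. (1/2) * (f' t \<bullet> (F\<tau> t *v f\<phi> t) + f\<phi> t \<bullet> (Ft' t *v f\<phi> t + F\<tau> t *v f' t)) + (g' t \<bullet> f\<phi> t + g t \<bullet> f' t)"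
    note hvd = has_vector_derivative_add[OF bounded_linear.has_vector_derivative[OF bounded_linear_mult_right[of "1/2 :: real"]
        bounded_bilinear.has_vector_derivative[OF bounded_bilinear_inner]] bounded_bilinear.has_vector_derivative[OF bounded_bilinear_inner]]
    have dv: "(?v has_vector_derivative ?v' t) (at t within {0..T})" if t: "t \<in> {0..T}" for t
      using hvd[OF d\<phi>[OF t] bounded_bilinear.has_vector_derivative[OF bounded_bilinear_matrix_vector_mult dY[OF t] d\<phi>[OF t]]
          df[OF t] d\<phi>[OF t]]
      by (simp add: add_ac)
    have dw: "(?w has_vector_derivative ?w' t) (at t within {0..T})" if t: "t \<in> {0..T}" for t
      using hvd[OF df[OF t] bounded_bilinear.has_vector_derivative[OF bounded_bilinear_matrix_vector_mult dFt[OF t] df[OF t]]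
          dg[OF t] df[OF t]]
      by (simp add: add_ac)
    have iv: "(?v' has_integral ?v T - ?v 0) {0..T}" "(?w' has_integral ?w T - ?w 0) {0..T}"
      by (rule fundamental_theorem_of_calculus[OF less_imp_le[OF T] dv]
          fundamental_theorem_of_calculus[OF less_imp_le[OF T] dw]; assumption)+
    have key: "det_cost \<M> F f F\<phi> f\<phi> \<tau> \<phi> t = ?w' t - ?v' t + ((1/2) * err t + \<kappa> t)" if t: "t \<in> {0..T}" for t
    proof -
      have sF: "sym_mat (F t)" "sym_mat (F\<phi> t)" "sym_mat (F\<tau> t)"
        using F F\<phi> F\<tau> t by (auto simp: is_F_def is_Fphi_def is_Ftau_def)
      note sy = valid_model_sym[OF v t]
      \<comment> \<open>\<tau> drives \<open>f\<phi>\<close> through two channels,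
        \<open>d_tau\<close> and \<open>l_tau\<close>. Their sum is \<open>Q_F\<close> applied to
        \<Sigma>^{-1} \<tau>, which is the meaning of \<open>Q_F\<close>.\<close>
      have f'2: "f' t = - ((transpose (D_phi \<M> F R t) - F\<phi> t ** O_mat \<M> t) *v f\<phi> t) - a t - Q_F \<M> R F\<phi> t *v (?\<Sigma>i *v \<tau> t)"
      proof -
        have "Q_F \<M> R F\<phi> t *v (?\<Sigma>i *v \<tau> t) = F\<phi> t *v (d_tau \<M> R \<tau> t) + l_tau \<M> \<tau> t"
          by (simp del: transpose_matrix_vector add: Q_F_def d_tau_eq l_tau_def matrix_vector_mult_add_rdistrib matrix_vector_mul_assoc
              matrix_add_mult_distrib matrix_mul_assoc[symmetric] matrix_inv_right[OF inv])
        then show ?thesis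
          by (simp del: transpose_matrix_vector add: f'_def a_def matrix_vector_mult_diff_rdistrib matrix_vector_right_distrib algebra_simps)
      qed
      have Ft'2: "Ft' t = - ric (- ((transpose (D_phi \<M> F R t) - F\<phi> t ** O_mat \<M> t) - Q_F \<M> R F\<phi> t ** transpose (G_mat \<M> R t)))
          (- (Q_F \<M> R F\<phi> t ** ?\<Sigma>i ** transpose (Q_F \<M> R F\<phi> t)))
          (O_mat \<M> t + G_mat \<M> R t ** Sig_W \<M> ** transpose (G_mat \<M> R t)) (F\<tau> t)"
        by (simp add: Ft'_def N_ric_def k_ric_def q_ric_def)
      have th: "?th t = - (transpose (Q_F \<M> R F\<phi> t) *v (F\<tau> t *v f\<phi> t + g t)) - Sig_W \<M> *v (transpose (G_mat \<M> R t) *v f\<phi> t)"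
        by (simp add: tau_formula_def g_def add.assoc matrix_vector_mul_assoc del: transpose_matrix_vector)
      have 1: "\<phi> t \<bullet> (Q_phi \<M> F t *v \<phi> t) + (l_phi \<M> F f t + l_tau \<M> \<tau> t) \<bullet> \<phi> t
          + (1/2) * ((F\<phi> t *v \<phi> t + f\<phi> t) \<bullet> (O_mat \<M> t *v (F\<phi> t *v \<phi> t + f\<phi> t))) + ?v' t
        = f\<phi> t \<bullet> (d_phi \<M> f t + d_tau \<M> R \<tau> t) - (1/2) * (f\<phi> t \<bullet> (O_mat \<M> t *v f\<phi> t))"
        unfolding \<phi>'_def Y'_def f'_def by (rule completion_state[OF sy(2) sF(2)])
      have 2: "f\<phi> t \<bullet> (d_phi \<M> f t + G_mat \<M> R t *v \<tau> t) - (1/2) * (f\<phi> t \<bullet> (O_mat \<M> t *v f\<phi> t)) + (1/2) * (\<tau> t \<bullet> (?\<Sigma>i *v \<tau> t)) - ?w' t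
        = (1/2) * err t + (g t \<bullet> a t - (1/2) * ((transpose (Q_F \<M> R F\<phi> t) *v g t) \<bullet> (?\<Sigma>i *v (transpose (Q_F \<M> R F\<phi> t) *v g t))))"
        unfolding err_def th f'2 Ft'2 g'_def
        by (rule completion_obs[OF sF(3) sy(5) inv sy(4)])
      show ?thesis
        unfolding det_cost_expand[where F = F and T = T, OF v t sF(1)] \<kappa>_def using 1 2 unfolding d_tau_eq by linarith
    qed
    have "((\<lambda>t. ?w' t - ?v' t + ((1/2) * err t + \<kappa> t)) has_integral
       (?w T - ?w 0) - (?v T - ?v 0) + ((1/2) * integral {0..T} err + integral {0..T} \<kappa>)) {0..T}"
      by (intro has_integral_add has_integral_diff iv has_integral_mult_right integrable_integral cerr c\<kappa>)
    \<comment> \<open>At \<open>T\<close> both functions vanish since \<open>f\<phi>\<close> and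
      \<open>F\<phi>\<close> do. At 0 the contributions f\<phi> \<bullet> \<open>Phi0\<close> of
      \<open>?v\<close> and \<open>?w\<close> cancel because \<open>F\<tau>\<close> is zero and
      \<open>g\<close> equals \<open>Phi0\<close> there, so no unknown value of
      \<open>f\<phi>\<close> remains.\<close>
    moreover have "(?w T - ?w 0) - (?v T - ?v 0) = (1/2) * (Phi0 \<M> \<bullet> (F\<phi> 0 *v Phi0 \<M>))"
      using \<phi> f\<phi> f\<tau> F\<tau> F\<phi> by (simp add: is_mean_def is_fphi_def is_ftau_def is_Ftau_def is_Fphi_def g_def inner_commute)
    ultimately have "((\<lambda>t. ?w' t - ?v' t + ((1/2) * err t + \<kappa> t)) has_integral
      (1/2) * (Phi0 \<M> \<bullet> (F\<phi> 0 *v Phi0 \<M>)) + ((1/2) * integral {0..T} err + integral {0..T} \<kappa>)) {0..T}"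
      by (simp only:)
    then have "((\<lambda>t. ?w' t - ?v' t + ((1/2) * err t + \<kappa> t)) has_integral
      (1/2) * (Phi0 \<M> \<bullet> (F\<phi> 0 *v Phi0 \<M>)) + integral {0..T} \<kappa> + (1/2) * integral {0..T} err) {0..T}"
      by (simp only: add.assoc add.commute[of "(1/2) * integral {0..T} err"])
    then show "(det_cost \<M> F f F\<phi> f\<phi> \<tau> \<phi> has_integral
      (1/2) * (Phi0 \<M> \<bullet> (F\<phi> 0 *v Phi0 \<M>)) + integral {0..T} \<kappa>
      + (1/2) * integral {0..T} (\<lambda>t. (\<tau> t - ?th t) \<bullet> (?\<Sigma>i *v (\<tau> t - ?th t)))) {0..T}"
      unfolding err_def[abs_def, symmetric] by (rule has_integral_eq[rotated]) (simp only: key)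
  qed
qed

lemma tau_formula_eq:
  "tau_formula \<M> R F\<phi> F\<tau> f\<tau> f\<phi> t = - (transpose (Q_F \<M> R F\<phi> t) *v (F\<tau> t *v f\<phi> t + (f\<tau> t + Phi0 \<M>)))
     - Sig_W \<M> *v (transpose (G_mat \<M> R t) *v f\<phi> t)"
  by (simp add: tau_formula_def add.assoc matrix_vector_mul_assoc del: transpose_matrix_vector)

lemma fphi_rhs:
  fixes \<M> :: "('d::finite, 'm::finite, 'c::finite, 'p::finite, 'q::finite) model"
  assumes inv: "invertible (Sig_W \<M>)"
  shows "(F\<phi> t ** O_mat \<M> t - transpose (D_phi \<M> F R t)) *v x
      - (F\<phi> t *v (d_phi \<M> f t + d_tau \<M> R \<tau> t) + l_phi \<M> F f t + l_tau \<M> \<tau> t)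
    = - ((transpose (D_phi \<M> F R t) - F\<phi> t ** O_mat \<M> t) *v x) - (F\<phi> t *v d_phi \<M> f t + l_phi \<M> F f t)
      - Q_F \<M> R F\<phi> t *v (matrix_inv (Sig_W \<M>) *v \<tau> t)"
proof -
  have "Q_F \<M> R F\<phi> t *v (matrix_inv (Sig_W \<M>) *v \<tau> t) = F\<phi> t *v (d_tau \<M> R \<tau> t) + l_tau \<M> \<tau> t"
    by (simp del: transpose_matrix_vector add: Q_F_def d_tau_eq l_tau_def matrix_vector_mult_add_rdistrib matrix_vector_mul_assoc
        matrix_add_mult_distrib matrix_mul_assoc[symmetric] matrix_inv_right[OF inv])
  then show ?thesis
    by (simp del: transpose_matrix_vector add: matrix_vector_mult_diff_rdistrib matrix_vector_right_distrib algebra_simps)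
qed

section \<open>The observation attack in closed loop\<close>

context
  fixes \<M> :: "('d::finite, 'm::finite, 'c::finite, 'p::finite, 'q::finite) model" and T :: real
    and F R :: "real \<Rightarrow> real^'d^'d" and f :: "real \<Rightarrow> real^'d"
    and F\<phi> F\<tau> :: "real \<Rightarrow> real^('d + 'd + 'd)^('d + 'd + 'd)" and f\<tau> :: "real \<Rightarrow> real^('d + 'd + 'd)"
  assumes T: "0 < T" and v: "valid_model \<M> T"
    and F: "is_F \<M> T F" and f: "is_f \<M> T F f" and R: "is_R \<M> T R" and F\<phi>: "is_Fphi \<M> T F R F\<phi>"
    and F\<tau>: "is_Ftau \<M> T F R F\<phi> F\<tau>" and f\<tau>: "is_ftau \<M> T F f R F\<phi> F\<tau> f\<tau>"
begin

lemmas cont = is_F_continuous[OF F] is_f_continuous[OF f] is_R_continuous[OF R] is_Fphi_continuous[OF F\<phi>]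
    is_Ftau_continuous[OF F\<tau>] is_ftau_continuous[OF f\<tau>]

lemmas coef = continuous_on_coefficients[OF v cont(1,3,2,4)] continuous_on_data_id[OF v] continuous_on_K_mat_id[OF v]
    continuous_on_O_mat_id[OF v] continuous_on_inv_data_id[OF v]

lemma invertible_Sig_W: "invertible (Sig_W \<M>)"
  using v by (auto simp: valid_model_def intro!: pd_mat_invertible pd_mat_Sig_W)

lemma continuous_on_tau_formula:
  assumes "continuous_on {0..T} f\<phi>"
  shows "continuous_on {0..T} (tau_formula \<M> R F\<phi> F\<tau> f\<tau> f\<phi>)"
  unfolding tau_formula_def by (intro continuous_intros cont coef assms)

text \<open>Inserting the formula for \<tau> makes the equation of \<open>f\<phi>\<close> linear
  with \<tau> eliminated: the part with \<Sigma> G^T becomes Q G^T and completes the drift to -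
  \<open>N_ric\<close>, while the rest is multiplied by \<open>k_ric\<close>.\<close>

lemma feedback_rhs:
  assumes "\<tau> t = tau_formula \<M> R F\<phi> F\<tau> f\<tau> f\<phi> t"
  shows "(F\<phi> t ** O_mat \<M> t - transpose (D_phi \<M> F R t)) *v f\<phi> t
      - (F\<phi> t *v (d_phi \<M> f t + d_tau \<M> R \<tau> t) + l_phi \<M> F f t + l_tau \<M> \<tau> t)
    = (k_ric \<M> R F\<phi> t ** F\<tau> t - N_ric \<M> F R F\<phi> t) *v f\<phi> t
      + (k_ric \<M> R F\<phi> t *v (f\<tau> t + Phi0 \<M>) - (F\<phi> t *v d_phi \<M> f t + l_phi \<M> F f t))"
  unfolding fphi_rhs[OF invertible_Sig_W] assms tau_formula_eq
  by (simp del: transpose_matrix_vector add: k_ric_def N_ric_def matrix_vector_mult_diff_rdistrib matrix_vector_right_distrib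
      matrix_vector_mult_add_rdistrib matrix_vector_mult_diff_distrib matrix_vector_mult_minus_right matrix_vector_mul_assoc
      matrix_mul_assoc[symmetric] matrix_diff_mult_distrib)
    (simp del: transpose_matrix_vector add: matrix_mul_assoc[of "matrix_inv (Sig_W \<M>)"] matrix_inv_left[OF invertible_Sig_W])

lemma is_fphi_unique:
  assumes "is_fphi \<M> T F f R F\<phi> \<tau> g" "is_fphi \<M> T F f R F\<phi> \<tau> g'" "t \<in> {0..T}"
  shows "g t = g' t"
proof -
  have c: "continuous_on {0..T} (\<lambda>t. F\<phi> t ** O_mat \<M> t - transpose (D_phi \<M> F R t))"
    by (intro continuous_intros cont coef)
  have "(\<lambda>t. g t - g' t) t = 0"
    by (rule linear_ode_zero[OF c _ _ assms(3)])
      (use assms(1,2) in \<open>auto simp: is_fphi_iff_linear matrix_vector_mult_diff_distrib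
        intro!: has_vector_derivative_diff[THEN has_vector_derivative_eq_rhs]\<close>)
  then show ?thesis by simp
qed

text \<open>The formula for \<tau> uses \<open>f\<phi>\<close>, which is defined from \<tau>. To
  break the circle, the closed-loop equation is solved first and \<tau> is read off its solution
  \<open>y\<close>; uniqueness then shows that every \<open>f\<phi>\<close> belonging to this \<tau>
  coincides with \<open>y\<close>.\<close>

lemma feedback_attack_exists:
  obtains \<tau>s where "obs_attack T \<tau>s"
    "\<And>f\<phi> t. is_fphi \<M> T F f R F\<phi> \<tau>s f\<phi> \<Longrightarrow> t \<in> {0..T} \<Longrightarrow> \<tau>s t = tau_formula \<M> R F\<phi> F\<tau> f\<tau> f\<phi> t"
proof -
  have c: "continuous_on {0..T} (\<lambda>t. k_ric \<M> R F\<phi> t ** F\<tau> t - N_ric \<M> F R F\<phi> t)"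
    "continuous_on {0..T} (\<lambda>t. k_ric \<M> R F\<phi> t *v (f\<tau> t + Phi0 \<M>) - (F\<phi> t *v d_phi \<M> f t + l_phi \<M> F f t))"
    by (intro continuous_intros cont coef)+
  obtain y where y: "y T = 0" "\<And>t. t \<in> {0..T} \<Longrightarrow> (y has_vector_derivative
      ((k_ric \<M> R F\<phi> t ** F\<tau> t - N_ric \<M> F R F\<phi> t) *v y t
      + (k_ric \<M> R F\<phi> t *v (f\<tau> t + Phi0 \<M>) - (F\<phi> t *v d_phi \<M> f t + l_phi \<M> F f t)))) (at t within {0..T})"
    by (rule linear_ode_exists[OF c less_imp_le[OF T], of T 0]) auto
  let ?\<tau> = "tau_formula \<M> R F\<phi> F\<tau> f\<tau> y"
  have "is_fphi \<M> T F f R F\<phi> ?\<tau> y"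
    unfolding is_fphi_iff_linear feedback_rhs[where \<tau> = ?\<tau> and f\<phi> = y, OF refl] using y by blast
  moreover have "obs_attack T ?\<tau>"
    unfolding obs_attack_def using y(2) by (intro continuous_on_tau_formula continuous_on_vector_derivative)
  moreover have "?\<tau> t = tau_formula \<M> R F\<phi> F\<tau> f\<tau> f\<phi> t"
    if "is_fphi \<M> T F f R F\<phi> ?\<tau> f\<phi>" "t \<in> {0..T}" for f\<phi> t
    using is_fphi_unique[OF \<open>is_fphi \<M> T F f R F\<phi> ?\<tau> y\<close> that] by (simp add: tau_formula_def)
  ultimately show ?thesis using that by blast
qed

text \<open>Both attacks close the loop, so \<open>g\<close> and \<open>g'\<close> solve one and the
  same linear equation with value zero at \<open>T\<close>.\<close>

lemma feedback_attack_unique: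
  assumes "is_fphi \<M> T F f R F\<phi> \<tau> g" "\<And>t. t \<in> {0..T} \<Longrightarrow> \<tau> t = tau_formula \<M> R F\<phi> F\<tau> f\<tau> g t"
    and "is_fphi \<M> T F f R F\<phi> \<tau>' g'" "\<And>t. t \<in> {0..T} \<Longrightarrow> \<tau>' t = tau_formula \<M> R F\<phi> F\<tau> f\<tau> g' t"
    and t: "t \<in> {0..T}"
  shows "\<tau> t = \<tau>' t"
proof -
  have c: "continuous_on {0..T} (\<lambda>t. k_ric \<M> R F\<phi> t ** F\<tau> t - N_ric \<M> F R F\<phi> t)"
    by (intro continuous_intros cont coef)
  have sol: "(h has_vector_derivative
      ((k_ric \<M> R F\<phi> t ** F\<tau> t - N_ric \<M> F R F\<phi> t) *v h t
      + (k_ric \<M> R F\<phi> t *v (f\<tau> t + Phi0 \<M>) - (F\<phi> t *v d_phi \<M> f t + l_phi \<M> F f t)))) (at t within {0..T})"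
    if "is_fphi \<M> T F f R F\<phi> \<sigma> h" "\<sigma> t = tau_formula \<M> R F\<phi> F\<tau> f\<tau> h t" "t \<in> {0..T}" for \<sigma> h t
    using that(1,3) unfolding is_fphi_iff_linear feedback_rhs[where \<tau> = \<sigma> and t = t and f\<phi> = h, OF that(2), symmetric]
    by blast
  note g = sol[OF assms(1) assms(2)] sol[OF assms(3) assms(4)]
  have "(\<lambda>t. g t - g' t) t = 0"
  proof (rule linear_ode_zero[OF c _ _ t])
    show "((\<lambda>t. g t - g' t) has_vector_derivative (k_ric \<M> R F\<phi> s ** F\<tau> s - N_ric \<M> F R F\<phi> s) *v (g s - g' s)) (at s within {0..T})"
      if "s \<in> {0..T}" for s
      by (rule has_vector_derivative_diff[OF g[OF that that], THEN has_vector_derivative_eq_rhs])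
        (simp add: matrix_vector_mult_diff_distrib)
  qed (use assms(1,3) in \<open>auto simp: is_fphi_def\<close>)
  then have "g t = g' t" by simp
  then show ?thesis using assms(2)[OF t] assms(4)[OF t] by (simp add: tau_formula_def)
qed

lemma is_mean_exists:
  assumes "obs_attack T \<tau>" "is_fphi \<M> T F f R F\<phi> \<tau> f\<phi>"
  obtains \<phi> where "is_mean \<M> T F f R F\<phi> f\<phi> \<tau> \<phi>"
proof -
  have c: "continuous_on {0..T} (\<lambda>t. D_phi \<M> F R t - O_mat \<M> t ** F\<phi> t)"
    by (intro continuous_intros cont coef)
  have c2: "continuous_on {0..T} (\<lambda>t. d_phi \<M> f t + d_tau \<M> R \<tau> t - O_mat \<M> t *v f\<phi> t)"
    unfolding d_tau_eq
    by (intro continuous_intros cont coef is_fphi_continuous[OF assms(2)] assms(1)[unfolded obs_attack_def])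
  obtain y where "y 0 = Phi0 \<M>" "\<And>t. t \<in> {0..T} \<Longrightarrow> (y has_vector_derivative
      ((D_phi \<M> F R t - O_mat \<M> t ** F\<phi> t) *v y t + (d_phi \<M> f t + d_tau \<M> R \<tau> t - O_mat \<M> t *v f\<phi> t)))
      (at t within {0..T})"
    by (rule linear_ode_exists[OF c c2 less_imp_le[OF T], of 0 "Phi0 \<M>"]) auto
  then show ?thesis
    by (intro that[of y]) (simp add: is_mean_def)
qed

text \<open>The deviation is continuous, so a vanishing integral of the positive definite form
  forces it to vanish at every time of the interval and not merely at almost every time.\<close>

lemma deviation_nonneg:
  assumes "obs_attack T \<tau>" "is_fphi \<M> T F f R F\<phi> \<tau> f\<phi>"
  defines "dev \<equiv> \<lambda>t. \<tau> t - tau_formula \<M> R F\<phi> F\<tau> f\<tau> f\<phi> t"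
  shows "0 \<le> integral {0..T} (\<lambda>t. dev t \<bullet> (matrix_inv (Sig_W \<M>) *v dev t))"
    and "integral {0..T} (\<lambda>t. dev t \<bullet> (matrix_inv (Sig_W \<M>) *v dev t)) = 0 \<Longrightarrow> t \<in> {0..T} \<Longrightarrow>
      \<tau> t = tau_formula \<M> R F\<phi> F\<tau> f\<tau> f\<phi> t"
    and "(\<And>t. t \<in> {0..T} \<Longrightarrow> \<tau> t = tau_formula \<M> R F\<phi> F\<tau> f\<tau> f\<phi> t) \<Longrightarrow>
      integral {0..T} (\<lambda>t. dev t \<bullet> (matrix_inv (Sig_W \<M>) *v dev t)) = 0"
proof -
  have pd: "pd_mat (matrix_inv (Sig_W \<M>))"
    using v by (auto simp: valid_model_def intro!: pd_mat_matrix_inv pd_mat_Sig_W)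
  have nn: "0 \<le> x \<bullet> (matrix_inv (Sig_W \<M>) *v x)" and z: "x \<bullet> (matrix_inv (Sig_W \<M>) *v x) = 0 \<Longrightarrow> x = 0" for x
    using pd unfolding pd_mat_def by (metis inner_zero_left less_imp_le order_refl, metis less_irrefl)
  have c: "continuous_on {0..T} dev"
    unfolding dev_def
    by (intro continuous_intros continuous_on_tau_formula is_fphi_continuous[OF assms(2)] assms(1)[unfolded obs_attack_def])
  show "0 \<le> integral {0..T} (\<lambda>t. dev t \<bullet> (matrix_inv (Sig_W \<M>) *v dev t))"
    by (intro integral_nonneg integrable_continuous_real continuous_on_inner continuous_intros c nn)
  show "integral {0..T} (\<lambda>t. dev t \<bullet> (matrix_inv (Sig_W \<M>) *v dev t)) = 0"
    if "\<And>t. t \<in> {0..T} \<Longrightarrow> \<tau> t = tau_formula \<M> R F\<phi> F\<tau> f\<tau> f\<phi> t"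
  proof -
    have "integral {0..T} (\<lambda>t. dev t \<bullet> (matrix_inv (Sig_W \<M>) *v dev t)) = integral {0..T} (\<lambda>t. 0)"
      using that by (intro integral_cong) (simp add: dev_def)
    then show ?thesis by simp
  qed
  assume i: "integral {0..T} (\<lambda>t. dev t \<bullet> (matrix_inv (Sig_W \<M>) *v dev t)) = 0" and t: "t \<in> {0..T}"
  have "continuous_on {0..T} (\<lambda>t. dev t \<bullet> (matrix_inv (Sig_W \<M>) *v dev t))"
    by (intro continuous_on_inner continuous_intros c)
  then have "dev t \<bullet> (matrix_inv (Sig_W \<M>) *v dev t) = 0"
    using integral_eq_0_iff[of 0 T "\<lambda>t. dev t \<bullet> (matrix_inv (Sig_W \<M>) *v dev t)"] i t T nn by blast
  then show "\<tau> t = tau_formula \<M> R F\<phi> F\<tau> f\<tau> f\<phi> t"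
    using z[of "dev t"] by (simp add: dev_def)
qed

end

section \<open>Second moments of the noise\<close>

lemma mat_mult_vec: "mat c *v x = c *\<^sub>R x" for x :: "real^'n"
  by (simp add: mat_def matrix_vector_mult_def vec_eq_iff if_distrib[of "\<lambda>a. a * b" for b] cong: if_cong)

lemma gaussian_inner_moments:
  fixes X :: "'w \<Rightarrow> real^'n"
  assumes M: "prob_space M" and X: "gaussian M X \<mu> C" and psd: "0 \<le> v \<bullet> (C *v v)"
  shows "integrable M (\<lambda>\<omega>. v \<bullet> X \<omega>)" "(\<integral>\<omega>. v \<bullet> X \<omega> \<partial>M) = v \<bullet> \<mu>"
    "integrable M (\<lambda>\<omega>. (v \<bullet> X \<omega> - v \<bullet> \<mu>)\<^sup>2)" "(\<integral>\<omega>. (v \<bullet> X \<omega> - v \<bullet> \<mu>)\<^sup>2 \<partial>M) = v \<bullet> (C *v v)"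
proof -
  interpret prob_space M by fact
  have Xm [measurable]: "X \<in> borel_measurable M" using X by (simp add: gaussian_def)
  have m [measurable]: "(\<lambda>\<omega>. v \<bullet> X \<omega>) \<in> borel_measurable M" by simp
  let ?m = "v \<bullet> \<mu>" and ?s = "v \<bullet> (C *v v)"
  have *: "integrable M (\<lambda>\<omega>. h (v \<bullet> X \<omega>)) = integrable (distr M borel (\<lambda>\<omega>. v \<bullet> X \<omega>)) h"
    "(\<integral>\<omega>. h (v \<bullet> X \<omega>) \<partial>M) = integral\<^sup>L (distr M borel (\<lambda>\<omega>. v \<bullet> X \<omega>)) h"
    if "h \<in> borel_measurable borel" for h :: "real \<Rightarrow> real"
    using that by (simp_all add: integrable_distr_eq integral_distr)
  have "integrable M (\<lambda>\<omega>. v \<bullet> X \<omega>) \<and> (\<integral>\<omega>. v \<bullet> X \<omega> \<partial>M) = v \<bullet> \<mu> \<and>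
    integrable M (\<lambda>\<omega>. (v \<bullet> X \<omega> - ?m)\<^sup>2) \<and> (\<integral>\<omega>. (v \<bullet> X \<omega> - ?m)\<^sup>2 \<partial>M) = ?s"
  proof (cases "?s = 0")
    \<comment> \<open>A direction of zero variance has a Dirac law, and its moments are read off
      without a density.\<close>
    case True
    then have d: "distr M borel (\<lambda>\<omega>. v \<bullet> X \<omega>) = return borel ?m" using X by (simp add: gaussian_def)
    have i: "integrable (return borel ?m) h" if "h \<in> borel_measurable borel" for h :: "real \<Rightarrow> real"
      using that by (subst integrable_iff_bounded) (simp add: nn_integral_return)
    show ?thesis
      using *[of "\<lambda>x. x"] *[of "\<lambda>x. (x - ?m)\<^sup>2"] True
      by (simp add: d i integral_return)
  next
    case False
    with psd have s: "0 < sqrt ?s" by simp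
    have d: "distr M borel (\<lambda>\<omega>. v \<bullet> X \<omega>) = density lborel (normal_density ?m (sqrt ?s))"
      using X False by (simp add: gaussian_def)
    have "integrable lborel (\<lambda>x. normal_density ?m (sqrt ?s) x * x)"
      "(\<integral>x. normal_density ?m (sqrt ?s) x * x \<partial>lborel) = ?m"
      using integrable_normal_moment_nz_1[OF s] integral_normal_moment_nz_1[OF s] by auto
    moreover have "integrable lborel (\<lambda>x. normal_density ?m (sqrt ?s) x * (x - ?m)^2)"
      "(\<integral>x. normal_density ?m (sqrt ?s) x * (x - ?m)^2 \<partial>lborel) = ?s"
      using integrable_normal_moment[OF s, of ?m 2] integral_normal_moment_even[OF s, of ?m 1] psd
      by (simp_all add: fact_numeral)
    ultimately show ?thesis
      using *[of "\<lambda>x. x"] *[of "\<lambda>x. (x - ?m)\<^sup>2"]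
      by (simp add: d integrable_density integral_density normal_density_nonneg)
  qed
  then show "integrable M (\<lambda>\<omega>. v \<bullet> X \<omega>)" "(\<integral>\<omega>. v \<bullet> X \<omega> \<partial>M) = v \<bullet> \<mu>"
    "integrable M (\<lambda>\<omega>. (v \<bullet> X \<omega> - v \<bullet> \<mu>)\<^sup>2)" "(\<integral>\<omega>. (v \<bullet> X \<omega> - v \<bullet> \<mu>)\<^sup>2 \<partial>M) = v \<bullet> (C *v v)"
    by auto
qed

lemma integrable_euclidean:
  fixes X :: "'w \<Rightarrow> 'a::euclidean_space"
  assumes "\<And>b. b \<in> Basis \<Longrightarrow> integrable M (\<lambda>\<omega>. b \<bullet> X \<omega>)"
  shows "integrable M X"
proof -
  have "integrable M (\<lambda>\<omega>. \<Sum>b\<in>Basis. (b \<bullet> X \<omega>) *\<^sub>R b)"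
    by (intro Bochner_Integration.integrable_sum Bochner_Integration.integrable_scaleR_left assms)
  then show ?thesis by (simp add: inner_commute[of _ "X _"] euclidean_representation)
qed

text \<open>Assembled from the coordinate directions; the sum over \<open>Basis\<close> is the trace
  of \<open>C\<close>.\<close>

lemma gaussian_moments:
  fixes X :: "'w \<Rightarrow> real^'n"
  assumes M: "prob_space M" and X: "gaussian M X \<mu> C" and psd: "\<And>v. 0 \<le> v \<bullet> (C *v v)"
  shows "integrable M X" "(\<integral>\<omega>. X \<omega> \<partial>M) = \<mu>" "integrable M (\<lambda>\<omega>. (norm (X \<omega> - \<mu>))\<^sup>2)"
    "(\<integral>\<omega>. (norm (X \<omega> - \<mu>))\<^sup>2 \<partial>M) = (\<Sum>b\<in>Basis. b \<bullet> (C *v b))"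
proof -
  note g = gaussian_inner_moments[OF M X psd]
  show i: "integrable M X" by (rule integrable_euclidean) (rule g)
  show "(\<integral>\<omega>. X \<omega> \<partial>M) = \<mu>"
  proof (rule euclidean_eqI)
    fix b :: "real^'n"
    have "(\<integral>\<omega>. X \<omega> \<partial>M) \<bullet> b = (\<integral>\<omega>. X \<omega> \<bullet> b \<partial>M)" using i by simp
    then show "(\<integral>\<omega>. X \<omega> \<partial>M) \<bullet> b = \<mu> \<bullet> b" using g(2)[of b] by (simp add: inner_commute)
  qed
  have eq: "(norm (X \<omega> - \<mu>))\<^sup>2 = (\<Sum>b\<in>Basis. (b \<bullet> X \<omega> - b \<bullet> \<mu>)\<^sup>2)" for \<omega>
    unfolding power2_norm_eq_inner
    by (subst euclidean_inner) (simp add: power2_eq_square inner_diff_left inner_diff_right inner_commute)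
  show "integrable M (\<lambda>\<omega>. (norm (X \<omega> - \<mu>))\<^sup>2)"
    "(\<integral>\<omega>. (norm (X \<omega> - \<mu>))\<^sup>2 \<partial>M) = (\<Sum>b\<in>Basis. b \<bullet> (C *v b))"
    unfolding eq using g(3,4) by (auto intro!: Bochner_Integration.integrable_sum simp: Bochner_Integration.integral_sum)
qed

context
  fixes M :: "'w measure" and W :: "real \<Rightarrow> 'w \<Rightarrow> real^'n"
  assumes M: "prob_space M" and W: "brownian_motion M W"
begin

interpretation prob_space M by (rule M)

lemma brownian_measurable: "0 \<le> t \<Longrightarrow> W t \<in> borel_measurable M"
  using W by (simp add: brownian_motion_def)

lemma brownian_increment:
  assumes "0 \<le> s" "s < t"
  shows "integrable M (\<lambda>\<omega>. W t \<omega> - W s \<omega>)" "(\<integral>\<omega>. W t \<omega> - W s \<omega> \<partial>M) = 0"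
    "integrable M (\<lambda>\<omega>. (norm (W t \<omega> - W s \<omega>))\<^sup>2)"
    "(\<integral>\<omega>. (norm (W t \<omega> - W s \<omega>))\<^sup>2 \<partial>M) = (t - s) * CARD('n)"
proof -
  have g: "gaussian M (\<lambda>\<omega>. W t \<omega> - W s \<omega>) 0 (mat (t - s))"
    using W assms by (simp add: brownian_motion_def)
  have p: "0 \<le> v \<bullet> (mat (t - s) *v v)" for v :: "real^'n"
    using assms by (simp add: mat_mult_vec)
  have "(\<Sum>b\<in>(Basis :: (real^'n) set). b \<bullet> (mat (t - s) *v b)) = (\<Sum>b\<in>(Basis :: (real^'n) set). (t - s))"
    by (intro sum.cong refl) (simp add: mat_mult_vec inner_same_Basis)
  also have "\<dots> = (t - s) * CARD('n)" by simp
  finally show "integrable M (\<lambda>\<omega>. W t \<omega> - W s \<omega>)" "(\<integral>\<omega>. W t \<omega> - W s \<omega> \<partial>M) = 0"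
    "integrable M (\<lambda>\<omega>. (norm (W t \<omega> - W s \<omega>))\<^sup>2)"
    "(\<integral>\<omega>. (norm (W t \<omega> - W s \<omega>))\<^sup>2 \<partial>M) = (t - s) * CARD('n)"
    using gaussian_moments[OF M g p] by simp_all
qed

text \<open>The martingale difference property in scalar form. The sigma-algebras generated by
  \<open>Y\<close> and by v \<bullet> (W t - W s) lie inside the two that are independent by
  definition, and the increment is centred.\<close>

lemma brownian_increment_indep:
  fixes Y :: "'w \<Rightarrow> real"
  assumes st: "0 \<le> s" "s < t" and Y: "Y \<in> borel_measurable (nat_filt M W s)" "integrable M Y"
  shows "integrable M (\<lambda>\<omega>. Y \<omega> * (v \<bullet> (W t \<omega> - W s \<omega>)))" "(\<integral>\<omega>. Y \<omega> * (v \<bullet> (W t \<omega> - W s \<omega>)) \<partial>M) = 0"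
proof -
  let ?D = "\<lambda>\<omega>. W t \<omega> - W s \<omega>"
  have i: "indep_set (sets (nat_filt M W s)) (sets (vimage_algebra (space M) ?D borel))"
    using W st by (simp add: brownian_motion_def)
  have Dm: "(\<lambda>\<omega>. v \<bullet> ?D \<omega>) \<in> borel_measurable (vimage_algebra (space M) ?D borel)"
    using measurable_compose[OF measurable_vimage_algebra1[of ?D "space M" borel], of "\<lambda>x. v \<bullet> x" borel]
    by (simp add: o_def)
  have sp: "space (nat_filt M W s) = space M"
    by (auto simp: nat_filt_def process_sigma_def space_measure_of_conv)
  have sub1: "sigma_sets (space M) {Y -` A \<inter> space M |A. A \<in> sets borel} \<subseteq> sets (nat_filt M W s)"
    using measurable_sets[OF Y(1)] sets.sigma_sets_subset[of "{Y -` A \<inter> space M |A. A \<in> sets borel}" "nat_filt M W s"]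
    by (auto simp: sp)
  have sub2: "sigma_sets (space M) {(\<lambda>\<omega>. v \<bullet> ?D \<omega>) -` A \<inter> space M |A. A \<in> sets borel} \<subseteq> sets (vimage_algebra (space M) ?D borel)"
    using measurable_sets[OF Dm] sets.sigma_sets_subset[of "{(\<lambda>\<omega>. v \<bullet> ?D \<omega>) -` A \<inter> space M |A. A \<in> sets borel}"
        "vimage_algebra (space M) ?D borel"]
    by (auto simp: space_vimage_algebra)
  have Di: "integrable M (\<lambda>\<omega>. v \<bullet> ?D \<omega>)" "(\<integral>\<omega>. v \<bullet> ?D \<omega> \<partial>M) = 0"
    using brownian_increment(1,2)[OF st] by simp_all
  have "indep_var borel Y borel (\<lambda>\<omega>. v \<bullet> ?D \<omega>)"
    unfolding indep_var_eq
  proof (intro conjI)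
    show "Y \<in> borel_measurable M" using Y by auto
    show "(\<lambda>\<omega>. v \<bullet> ?D \<omega>) \<in> borel_measurable M" using Di by auto
    show "indep_set (sigma_sets (space M) {Y -` A \<inter> space M |A. A \<in> sets borel})
      (sigma_sets (space M) {(\<lambda>\<omega>. v \<bullet> ?D \<omega>) -` A \<inter> space M |A. A \<in> sets borel})"
      using i sub1 sub2 unfolding indep_sets2_eq by (meson subset_iff order_trans)
  qed
  from indep_var_integrable[OF this Y(2) Di(1)] indep_var_lebesgue_integral[OF this Y(2) Di(1)]
  show "integrable M (\<lambda>\<omega>. Y \<omega> * (v \<bullet> ?D \<omega>))" "(\<integral>\<omega>. Y \<omega> * (v \<bullet> ?D \<omega>) \<partial>M) = 0"
    by (simp_all only: Di(2) mult_zero_right)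
qed

lemma brownian_nat_filt_measurable:
  assumes "0 \<le> r" "r \<le> s"
  shows "W r \<in> borel_measurable (nat_filt M W s)"
proof (rule measurableI)
  let ?G = "\<Union>u\<in>{0..s}. {W u -` B \<inter> space M |B. B \<in> sets borel}"
  have G: "?G \<subseteq> Pow (space M)" by blast
  fix A :: "(real^'n) set" assume "A \<in> sets borel"
  then have "W r -` A \<inter> space M \<in> ?G"
    using assms by (intro UN_I[of r]) auto
  then show "W r -` A \<inter> space (nat_filt M W s) \<in> sets (nat_filt M W s)"
    unfolding nat_filt_def process_sigma_def space_measure_of[OF G] sets_measure_of[OF G]
    by (rule sigma_sets.Basic)
qed simp

text \<open>A discrete Ito isometry in the form of an inequality: off-diagonal products have mean
  zero, and each of the n diagonal terms contributes at most b^2 (t / n) times the dimension. The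
  bound is independent of the partition.\<close>

lemma brownian_riemann_sum:
  fixes B :: "nat \<Rightarrow> real^'n^'k"
  assumes t: "0 \<le> t" and b: "0 \<le> b" "\<And>k x. k < n \<Longrightarrow> norm (B k *v x) \<le> b * norm x"
  defines "S \<equiv> \<lambda>\<omega>. \<Sum>k<n. B k *v (W (real (Suc k) * t / real n) \<omega> - W (real k * t / real n) \<omega>)"
  shows "integrable M S" "(\<integral>\<omega>. S \<omega> \<partial>M) = 0" "integrable M (\<lambda>\<omega>. (norm (S \<omega>))\<^sup>2)"
    "(\<integral>\<omega>. (norm (S \<omega>))\<^sup>2 \<partial>M) \<le> b\<^sup>2 * CARD('n) * t"
proof -
  have "integrable M S \<and> (\<integral>\<omega>. S \<omega> \<partial>M) = 0 \<and> integrable M (\<lambda>\<omega>. (norm (S \<omega>))\<^sup>2) \<and>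
    (\<integral>\<omega>. (norm (S \<omega>))\<^sup>2 \<partial>M) \<le> b\<^sup>2 * CARD('n) * t"
  proof (cases "t = 0 \<or> n = 0")
    \<comment> \<open>Increments over a partition with t = 0 vanish identically and n = 0 gives the
      empty sum; strict inequality of neighbouring times is available only otherwise.\<close>
    case True
    then have "S = (\<lambda>_. 0)" by (auto simp: S_def)
    then show ?thesis using t by simp
  next
    case False
    with t have t: "0 < t" "0 < n" by auto
    define p where "p k = real k * t / real n" for k
    define D where "D k \<omega> = W (p (Suc k)) \<omega> - W (p k) \<omega>" for k \<omega>
    have p: "0 \<le> p k" "p k < p (Suc k)" "p (Suc k) - p k = t / real n" for k
      using t by (simp_all add: p_def field_simps)
    have pm: "p j \<le> p k" if "j \<le> k" for j k using that t by (simp add: p_def divide_right_mono)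
    note D = brownian_increment[OF p(1,2), folded D_def]
    have S: "S = (\<lambda>\<omega>. \<Sum>k<n. B k *v D k \<omega>)" by (simp add: S_def D_def p_def)
    have iBD: "integrable M (\<lambda>\<omega>. B k *v D k \<omega>)" "(\<integral>\<omega>. B k *v D k \<omega> \<partial>M) = 0" for k
      using integrable_bounded_linear[OF matrix_vector_mul_bounded_linear D(1)]
        integral_bounded_linear[OF matrix_vector_mul_bounded_linear D(1)] D(2)
      by auto
    have diag: "integrable M (\<lambda>\<omega>. (B k *v D k \<omega>) \<bullet> (B k *v D k \<omega>))"
      "(\<integral>\<omega>. (B k *v D k \<omega>) \<bullet> (B k *v D k \<omega>) \<partial>M) \<le> b\<^sup>2 * (t / real n * CARD('n))" if k: "k < n" for k
    proof -
      have le: "(B k *v D k \<omega>) \<bullet> (B k *v D k \<omega>) \<le> b\<^sup>2 * (norm (D k \<omega>))\<^sup>2" for \<omega>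
        using power_mono[OF b(2)[OF k, of "D k \<omega>"], of 2] by (simp add: power_mult_distrib power2_norm_eq_inner)
      have i: "integrable M (\<lambda>\<omega>. b\<^sup>2 * (norm (D k \<omega>))\<^sup>2)" using D(3) by simp
      show 1: "integrable M (\<lambda>\<omega>. (B k *v D k \<omega>) \<bullet> (B k *v D k \<omega>))"
        using iBD(1)[of k] le by (intro Bochner_Integration.integrable_bound[OF i]) auto
      have "(\<integral>\<omega>. (B k *v D k \<omega>) \<bullet> (B k *v D k \<omega>) \<partial>M) \<le> (\<integral>\<omega>. b\<^sup>2 * (norm (D k \<omega>))\<^sup>2 \<partial>M)"
        by (intro integral_mono 1 i le)
      also have "\<dots> = b\<^sup>2 * (t / real n * CARD('n))" using D(4)[of k] p(3) by simp
      finally show "(\<integral>\<omega>. (B k *v D k \<omega>) \<bullet> (B k *v D k \<omega>) \<partial>M) \<le> b\<^sup>2 * (t / real n * CARD('n))" .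
    qed
    have off: "integrable M (\<lambda>\<omega>. (B j *v D j \<omega>) \<bullet> (B k *v D k \<omega>)) \<and>
      (\<integral>\<omega>. (B j *v D j \<omega>) \<bullet> (B k *v D k \<omega>) \<partial>M) = 0" if jk: "j < k" for j k
    proof -
      \<comment> \<open>The later increment is expanded in a basis; its coefficients depend only on
        the earlier increment and so on the past of the partition point \<open>p k\<close>.\<close>
      let ?Y = "\<lambda>i \<omega>. (transpose (B k) *v (B j *v D j \<omega>)) \<bullet> i"
      have eq: "(B j *v D j \<omega>) \<bullet> (B k *v D k \<omega>) = (\<Sum>i\<in>Basis. ?Y i \<omega> * (i \<bullet> D k \<omega>))" for \<omega>
      proof -
        have "(B j *v D j \<omega>) \<bullet> (B k *v D k \<omega>) = (transpose (B k) *v (B j *v D j \<omega>)) \<bullet> D k \<omega>"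
          using inner_transpose_right[of "D k \<omega>" "B k" "B j *v D j \<omega>"] by (simp only: inner_commute)
        also have "\<dots> = (\<Sum>i\<in>Basis. ?Y i \<omega> * (D k \<omega> \<bullet> i))" by (rule euclidean_inner)
        finally show ?thesis by (simp only: inner_commute[of "D k \<omega>"])
      qed
      have "D j \<in> borel_measurable (nat_filt M W (p k))"
        unfolding D_def using p pm[of "Suc j" k] pm[of j k] jk
        by (intro borel_measurable_diff brownian_nat_filt_measurable) auto
      then have "(\<lambda>\<omega>. B j *v D j \<omega>) \<in> borel_measurable (nat_filt M W (p k))"
        by (rule measurable_compose) (intro borel_measurable_continuous_onI continuous_intros)
      then have Ym: "?Y i \<in> borel_measurable (nat_filt M W (p k))" for i
        by (rule measurable_compose) (intro borel_measurable_continuous_onI continuous_intros)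
      have Yi: "integrable M (?Y i)" for i
        using integrable_bounded_linear[OF matrix_vector_mul_bounded_linear iBD(1)[of j], of "transpose (B k)"] by auto
      note ind = brownian_increment_indep[OF p(1,2) Ym Yi, folded D_def]
      show ?thesis unfolding eq using ind by (simp add: Bochner_Integration.integral_sum)
    qed
    have all: "integrable M (\<lambda>\<omega>. (B j *v D j \<omega>) \<bullet> (B k *v D k \<omega>))"
      "(\<integral>\<omega>. (B j *v D j \<omega>) \<bullet> (B k *v D k \<omega>) \<partial>M) \<le> (if j = k then b\<^sup>2 * (t / real n * CARD('n)) else 0)"
      if "j < n" "k < n" for j k
    proof -
      consider "j < k" | "j = k" | "k < j" by linarith
      then show "integrable M (\<lambda>\<omega>. (B j *v D j \<omega>) \<bullet> (B k *v D k \<omega>))"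
        "(\<integral>\<omega>. (B j *v D j \<omega>) \<bullet> (B k *v D k \<omega>) \<partial>M) \<le> (if j = k then b\<^sup>2 * (t / real n * CARD('n)) else 0)"
        using diag that off[of j k] off[of k j] by (cases; simp add: inner_commute)+
    qed
    have n2: "(norm (S \<omega>))\<^sup>2 = (\<Sum>j<n. \<Sum>k<n. (B j *v D j \<omega>) \<bullet> (B k *v D k \<omega>))" for \<omega>
      unfolding S power2_norm_eq_inner by (simp add: inner_sum_left inner_sum_right) (rule sum.swap)
    have "(\<integral>\<omega>. (norm (S \<omega>))\<^sup>2 \<partial>M) = (\<Sum>j<n. (\<integral>\<omega>. (\<Sum>k<n. (B j *v D j \<omega>) \<bullet> (B k *v D k \<omega>)) \<partial>M))"
      unfolding n2 by (intro Bochner_Integration.integral_sum Bochner_Integration.integrable_sum all) auto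
    also have "\<dots> = (\<Sum>j<n. \<Sum>k<n. (\<integral>\<omega>. (B j *v D j \<omega>) \<bullet> (B k *v D k \<omega>) \<partial>M))"
      by (intro sum.cong refl Bochner_Integration.integral_sum all) auto
    also have "\<dots> \<le> (\<Sum>j<n. \<Sum>k<n. if j = k then b\<^sup>2 * (t / real n * CARD('n)) else 0)"
      by (intro sum_mono all) auto
    also have "\<dots> = b\<^sup>2 * CARD('n) * t" using t by simp
    finally have "(\<integral>\<omega>. (norm (S \<omega>))\<^sup>2 \<partial>M) \<le> b\<^sup>2 * CARD('n) * t" .
    moreover have "integrable M (\<lambda>\<omega>. (norm (S \<omega>))\<^sup>2)"
      unfolding n2 by (intro Bochner_Integration.integrable_sum all) auto
    moreover have "integrable M S" "(\<integral>\<omega>. S \<omega> \<partial>M) = 0"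
      unfolding S using iBD by (auto simp: Bochner_Integration.integral_sum)
    ultimately show ?thesis by blast
  qed
  then show "integrable M S" "(\<integral>\<omega>. S \<omega> \<partial>M) = 0" "integrable M (\<lambda>\<omega>. (norm (S \<omega>))\<^sup>2)"
    "(\<integral>\<omega>. (norm (S \<omega>))\<^sup>2 \<partial>M) \<le> b\<^sup>2 * CARD('n) * t"
    by auto
qed

end

text \<open>By uniform continuity \<open>g\<close> may be frozen at the left end of each cell. The
  sum is taken against increments of the integral of \<open>y\<close>, since the drift part of an
  observation increment has this form. A general bilinear product covers both matrix times vector
  and real multiplication.\<close>

lemma riemann_sum_tendsto:
  fixes g :: "real \<Rightarrow> 'a::real_normed_vector" and y :: "real \<Rightarrow> 'b::euclidean_space" and prod :: "'a \<Rightarrow> 'b \<Rightarrow> 'c::euclidean_space"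
  assumes bb: "bounded_bilinear prod" and t: "0 \<le> t"
    and g: "continuous_on {0..t} g" and y: "continuous_on {0..t} y"
  shows "(\<lambda>n. \<Sum>k<n. prod (g (real k * t / real n))
      (integral {0..real (Suc k) * t / real n} y - integral {0..real k * t / real n} y))
    \<longlonglongrightarrow> integral {0..t} (\<lambda>s. prod (g s) (y s))"
proof (cases "t = 0")
  case True
  then show ?thesis by (simp add: bounded_bilinear.zero_right[OF bb])
next
  case False
  with t have t: "0 < t" by simp
  interpret bounded_bilinear prod by (rule bb)
  obtain K where K: "0 < K" "\<And>a b. norm (prod a b) \<le> norm a * norm b * K" using pos_bounded by blast
  obtain Y where Y: "0 \<le> Y" "\<And>s. s \<in> {0..t} \<Longrightarrow> norm (y s) \<le> Y"
    using compact_continuous_bound[OF _ y] by (metis compact_Icc)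
  have cp: "continuous_on {0..t} (\<lambda>s. prod (g s) (y s))" using g y by (rule continuous_on)
  have uc: "uniformly_continuous_on {0..t} g" using g by (rule compact_uniformly_continuous) simp
  show ?thesis
  proof (rule LIMSEQ_I)
    fix e :: real assume e: "0 < e"
    \<comment> \<open>Chosen so that the errors of all cells add up to at most e / 2; Y + 1 avoids a
      division by zero when \<open>y\<close> vanishes.\<close>
    define e' where "e' = e / (2 * (K * (Y + 1) * t))"
    have e': "0 < e'" using e K Y t by (simp add: e'_def)
    obtain d where d: "0 < d" "\<And>s s'. s \<in> {0..t} \<Longrightarrow> s' \<in> {0..t} \<Longrightarrow> dist s' s < d \<Longrightarrow> dist (g s') (g s) < e'"
      using uc e' unfolding uniformly_continuous_on_def by metis
    obtain n0 :: nat where n0: "t / d < real n0" using reals_Archimedean2 by blast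
    show "\<exists>no. \<forall>n\<ge>no. norm ((\<Sum>k<n. prod (g (real k * t / real n))
      (integral {0..real (Suc k) * t / real n} y - integral {0..real k * t / real n} y))
      - integral {0..t} (\<lambda>s. prod (g s) (y s))) < e"
    proof (intro exI[of _ "Suc n0"] allI impI)
      fix n assume n: "Suc n0 \<le> n"
      then have np: "0 < n" by simp
      define p where "p k = real k * t / real n" for k
      have pp: "0 \<le> p k" "p k \<le> p (Suc k)" "p (Suc k) - p k = t / real n" for k
        using t np by (simp_all add: p_def field_simps)
      have pt: "p k \<le> t" if "k \<le> n" for k
        using that t np by (simp add: p_def field_simps)
      have small: "t / real n < d"
      proof -
        have "t / d < real n" using n0 n by linarith
        then show ?thesis using d(1) np by (simp add: field_simps)
      qed
      have split: "integral {0..p (Suc k)} h - integral {0..p k} h = integral {p k..p (Suc k)} h"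
        if h: "continuous_on {0..t} h" and k: "k < n" for h :: "real \<Rightarrow> 'z::euclidean_space" and k
      proof -
        have "continuous_on {0..p (Suc k)} h"
          using h pt[of "Suc k"] k by (intro continuous_on_subset[OF h]) auto
        then have "integral {0..p k} h + integral {p k..p (Suc k)} h = integral {0..p (Suc k)} h"
          by (intro Henstock_Kurzweil_Integration.integral_combine pp integrable_continuous_real)
        then show ?thesis by (simp add: algebra_simps)
      qed
      have tot: "integral {0..t} (\<lambda>s. prod (g s) (y s)) = (\<Sum>k<n. integral {p k..p (Suc k)} (\<lambda>s. prod (g s) (y s)))"
      proof -
        have "(\<Sum>k<n. integral {p k..p (Suc k)} (\<lambda>s. prod (g s) (y s)))
          = (\<Sum>k<n. integral {0..p (Suc k)} (\<lambda>s. prod (g s) (y s)) - integral {0..p k} (\<lambda>s. prod (g s) (y s)))"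
          by (intro sum.cong refl split[OF cp, symmetric]) auto
        also have "\<dots> = integral {0..p n} (\<lambda>s. prod (g s) (y s)) - integral {0..p 0} (\<lambda>s. prod (g s) (y s))"
          by (rule sum_lessThan_telescope)
        finally show ?thesis using np by (simp add: p_def)
      qed
      have "norm ((\<Sum>k<n. prod (g (p k)) (integral {0..p (Suc k)} y - integral {0..p k} y)) - integral {0..t} (\<lambda>s. prod (g s) (y s)))
        = norm (\<Sum>k<n. prod (g (p k)) (integral {p k..p (Suc k)} y) - integral {p k..p (Suc k)} (\<lambda>s. prod (g s) (y s)))"
        unfolding tot sum_subtractf using split[OF y] by simp
      also have "\<dots> \<le> (\<Sum>k<n. e' * Y * K * (t / real n))"
      proof (rule sum_norm_le)
        fix k assume "k \<in> {..<n}"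
        then have k: "k < n" by simp
        have sub: "{p k..p (Suc k)} \<subseteq> {0..t}" using pp(1)[of k] pt[of "Suc k"] k by auto
        have iy: "y integrable_on {p k..p (Suc k)}" and ip: "(\<lambda>s. prod (g s) (y s)) integrable_on {p k..p (Suc k)}"
          using continuous_on_subset[OF y sub] continuous_on_subset[OF cp sub] by (auto intro: integrable_continuous_real)
        have e1: "prod (g (p k)) (integral {p k..p (Suc k)} y) = integral {p k..p (Suc k)} (\<lambda>s. prod (g (p k)) (y s))"
          using integral_linear[OF iy bounded_linear_right[of "g (p k)"]] by (simp add: o_def)
        have i1: "(\<lambda>s. prod (g (p k)) (y s)) integrable_on {p k..p (Suc k)}"
          using integrable_linear[OF iy bounded_linear_right[of "g (p k)"]] by (simp add: o_def)
        have "prod (g (p k)) (integral {p k..p (Suc k)} y) - integral {p k..p (Suc k)} (\<lambda>s. prod (g s) (y s))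
          = integral {p k..p (Suc k)} (\<lambda>s. prod (g (p k) - g s) (y s))"
          unfolding e1 by (subst integral_diff[symmetric, OF i1 ip]) (simp add: diff_left)
        also have "norm \<dots> \<le> (e' * Y * K) * (p (Suc k) - p k)"
        proof (rule integral_bound)
          show "continuous_on {p k..p (Suc k)} (\<lambda>s. prod (g (p k) - g s) (y s))"
            by (intro continuous_on continuous_intros continuous_on_subset[OF g sub] continuous_on_subset[OF y sub])
          fix s assume s: "s \<in> {p k..p (Suc k)}"
          have "dist (g (p k)) (g s) < e'"
            using s sub pp(3)[of k] small pp(2)[of k] by (intro d(2)) (auto simp: dist_real_def)
          then have "norm (g (p k) - g s) * norm (y s) * K \<le> e' * Y * K"
            using s sub Y K e' by (intro mult_right_mono mult_mono) (auto simp: dist_norm)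
          then show "norm (prod (g (p k) - g s) (y s)) \<le> e' * Y * K" using K(2) order.trans by blast
        qed (rule pp)
        finally show "norm (prod (g (p k)) (integral {p k..p (Suc k)} y) - integral {p k..p (Suc k)} (\<lambda>s. prod (g s) (y s)))
          \<le> e' * Y * K * (t / real n)" by (simp add: pp(3))
      qed
      also have "\<dots> = e' * Y * K * t" using np by simp
      also have "\<dots> \<le> e' * (Y + 1) * K * t" using e' K t by (intro mult_right_mono mult_left_mono) auto
      also have "\<dots> = e / 2" using K Y t by (simp add: e'_def)
      also have "\<dots> < e" using e by simp
      finally show "norm ((\<Sum>k<n. prod (g (real k * t / real n))
        (integral {0..real (Suc k) * t / real n} y - integral {0..real k * t / real n} y))
        - integral {0..t} (\<lambda>s. prod (g s) (y s))) < e"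
        by (simp add: p_def)
    qed
  qed
qed

section \<open>Convergence in probability\<close>

text \<open>The mean of the truncated norm metrises convergence in probability. It replaces a family
  of statements indexed by \<epsilon> with a single real sequence and is subadditive in
  \<open>u\<close>.\<close>

definition conv0 :: "'w measure \<Rightarrow> (nat \<Rightarrow> 'w \<Rightarrow> 'a::euclidean_space) \<Rightarrow> bool" where
  "conv0 M u \<longleftrightarrow> (\<lambda>n. \<integral>\<omega>. min 1 (norm (u n \<omega>)) \<partial>M) \<longlonglongrightarrow> 0"

context prob_space
begin

lemma integrable_min_norm:
  fixes u :: "'a \<Rightarrow> 'b::euclidean_space"
  assumes "u \<in> borel_measurable M"
  shows "integrable M (\<lambda>\<omega>. min 1 (norm (u \<omega>)))"
  using assms by (intro integrable_const_bound[where B = 1]) auto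

lemma conv0_prob:
  fixes u :: "nat \<Rightarrow> 'a \<Rightarrow> 'b::euclidean_space"
  assumes m [measurable]: "\<And>n. u n \<in> borel_measurable M"
    and u: "\<And>\<epsilon>. 0 < \<epsilon> \<Longrightarrow> (\<lambda>n. measure M {\<omega> \<in> space M. \<epsilon> < norm (u n \<omega>)}) \<longlonglongrightarrow> 0"
  shows "conv0 M u"
  unfolding conv0_def
proof (rule LIMSEQ_I)
  fix e :: real assume e: "0 < e"
  have "eventually (\<lambda>n. measure M {\<omega> \<in> space M. e / 2 < norm (u n \<omega>)} < e / 2) sequentially"
    using order_tendstoD(2)[OF u[of "e/2"], of "e/2"] e by simp
  then obtain n0 where n0: "\<And>n. n0 \<le> n \<Longrightarrow> measure M {\<omega> \<in> space M. e / 2 < norm (u n \<omega>)} < e / 2"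
    unfolding eventually_sequentially by blast
  show "\<exists>no. \<forall>n\<ge>no. norm ((\<integral>\<omega>. min 1 (norm (u n \<omega>)) \<partial>M) - 0) < e"
  proof (intro exI[of _ n0] allI impI)
    fix n assume n: "n0 \<le> n"
    let ?A = "{\<omega> \<in> space M. e / 2 < norm (u n \<omega>)}"
    have A [measurable]: "?A \<in> sets M" by measurable
    have iA: "integrable M (\<lambda>\<omega>. indicator ?A \<omega> :: real)"
      by (intro integrable_real_indicator A) (simp add: emeasure_eq_measure)
    have "(\<integral>\<omega>. min 1 (norm (u n \<omega>)) \<partial>M) \<le> (\<integral>\<omega>. e / 2 + indicator ?A \<omega> \<partial>M)"
    proof (rule integral_mono[OF integrable_min_norm[OF m]])
      show "integrable M (\<lambda>\<omega>. e / 2 + indicator ?A \<omega>)"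
        by (intro Bochner_Integration.integrable_add integrable_const iA)
      show "min 1 (norm (u n \<omega>)) \<le> e / 2 + indicator ?A \<omega>" if "\<omega> \<in> space M" for \<omega>
        using e that by (cases "\<omega> \<in> ?A") auto
    qed
    also have "\<dots> = e / 2 + measure M ?A"
      by (subst Bochner_Integration.integral_add[OF integrable_const iA]) (simp_all add: prob_space)
    also have "\<dots> < e" using n0[OF n] by simp
    finally have "(\<integral>\<omega>. min 1 (norm (u n \<omega>)) \<partial>M) < e" .
    moreover have "0 \<le> (\<integral>\<omega>. min 1 (norm (u n \<omega>)) \<partial>M)" by (intro integral_nonneg_AE) auto
    ultimately show "norm ((\<integral>\<omega>. min 1 (norm (u n \<omega>)) \<partial>M) - 0) < e" by simp
  qed
qed

lemma conv0_AE:
  fixes u :: "nat \<Rightarrow> 'a \<Rightarrow> 'b::euclidean_space"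
  assumes m [measurable]: "\<And>n. u n \<in> borel_measurable M"
    and u: "AE \<omega> in M. (\<lambda>n. u n \<omega>) \<longlonglongrightarrow> 0"
  shows "conv0 M u"
proof -
  have "(\<lambda>n. \<integral>\<omega>. min 1 (norm (u n \<omega>)) \<partial>M) \<longlonglongrightarrow> (\<integral>\<omega>. 0 \<partial>M)"
  proof (rule integral_dominated_convergence[where w = "\<lambda>_. 1"])
    show "AE \<omega> in M. (\<lambda>n. min 1 (norm (u n \<omega>))) \<longlonglongrightarrow> 0"
      using u
    proof eventually_elim
      case (elim \<omega>)
      from tendsto_min[OF tendsto_const[of 1] tendsto_norm[OF elim]] show ?case by simp
    qed
  qed auto
  then show ?thesis by (simp add: conv0_def)
qed

lemma conv0_add:
  fixes u v :: "nat \<Rightarrow> 'a \<Rightarrow> 'b::euclidean_space"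
  assumes [measurable]: "\<And>n. u n \<in> borel_measurable M" "\<And>n. v n \<in> borel_measurable M"
    and uv: "conv0 M u" "conv0 M v"
  shows "conv0 M (\<lambda>n \<omega>. u n \<omega> + v n \<omega>)"
  unfolding conv0_def
proof (rule tendsto_sandwich[OF _ _ tendsto_const])
  show "(\<lambda>n. (\<integral>\<omega>. min 1 (norm (u n \<omega>)) \<partial>M) + (\<integral>\<omega>. min 1 (norm (v n \<omega>)) \<partial>M)) \<longlonglongrightarrow> 0"
    using tendsto_add[OF uv[unfolded conv0_def]] by simp
  show "\<forall>\<^sub>F n in sequentially. 0 \<le> (\<integral>\<omega>. min 1 (norm (u n \<omega> + v n \<omega>)) \<partial>M)"
    by (intro always_eventually allI integral_nonneg_AE) auto
  show "\<forall>\<^sub>F n in sequentially. (\<integral>\<omega>. min 1 (norm (u n \<omega> + v n \<omega>)) \<partial>M)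
    \<le> (\<integral>\<omega>. min 1 (norm (u n \<omega>)) \<partial>M) + (\<integral>\<omega>. min 1 (norm (v n \<omega>)) \<partial>M)"
  proof (intro always_eventually allI)
    fix n
    have "min 1 (norm (x + y)) \<le> min 1 (norm x) + min 1 (norm y)" for x y :: 'b
      using norm_triangle_ineq[of x y] norm_ge_zero[of x] norm_ge_zero[of y] by linarith
    then have "(\<integral>\<omega>. min 1 (norm (u n \<omega> + v n \<omega>)) \<partial>M) \<le> (\<integral>\<omega>. min 1 (norm (u n \<omega>)) + min 1 (norm (v n \<omega>)) \<partial>M)"
      by (intro integral_mono Bochner_Integration.integrable_add integrable_min_norm) auto
    also have "\<dots> = (\<integral>\<omega>. min 1 (norm (u n \<omega>)) \<partial>M) + (\<integral>\<omega>. min 1 (norm (v n \<omega>)) \<partial>M)"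
      by (intro Bochner_Integration.integral_add integrable_min_norm) auto
    finally show "(\<integral>\<omega>. min 1 (norm (u n \<omega> + v n \<omega>)) \<partial>M)
      \<le> (\<integral>\<omega>. min 1 (norm (u n \<omega>)) \<partial>M) + (\<integral>\<omega>. min 1 (norm (v n \<omega>)) \<partial>M)" .
  qed
qed

lemma conv0_minus: "conv0 M (\<lambda>n \<omega>. - u n \<omega>) = conv0 M u"
  by (simp add: conv0_def)

lemma conv0_subseq:
  fixes u :: "nat \<Rightarrow> 'a \<Rightarrow> 'b::euclidean_space"
  assumes m [measurable]: "\<And>n. u n \<in> borel_measurable M" and u: "conv0 M u"
  obtains r where "strict_mono r" "AE \<omega> in M. (\<lambda>n. u (r n) \<omega>) \<longlonglongrightarrow> 0"
proof -
  have "(\<lambda>n. (\<integral>\<omega>. norm (min 1 (norm (u n \<omega>))) \<partial>M)) \<longlonglongrightarrow> 0"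
    using u by (simp add: conv0_def)
  then obtain r :: "nat \<Rightarrow> nat" where r: "strict_mono r" "AE \<omega> in M. (\<lambda>n. min 1 (norm (u (r n) \<omega>))) \<longlonglongrightarrow> 0"
    using tendsto_L1_AE_subseq[of M "\<lambda>n \<omega>. min 1 (norm (u n \<omega>))"] integrable_min_norm[OF m] by blast
  from r(2) have "AE \<omega> in M. (\<lambda>n. u (r n) \<omega>) \<longlonglongrightarrow> 0"
  proof eventually_elim
    case (elim \<omega>)
    have "\<forall>\<^sub>F n in sequentially. min 1 (norm (u (r n) \<omega>)) < 1"
      using order_tendstoD(2)[OF elim, of 1] by simp
    then have "\<forall>\<^sub>F n in sequentially. min 1 (norm (u (r n) \<omega>)) = norm (u (r n) \<omega>)"
      by eventually_elim (simp add: min_def split: if_splits)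
    then have "(\<lambda>n. norm (u (r n) \<omega>)) \<longlonglongrightarrow> 0"
      using elim by (rule Lim_transform_eventually[rotated])
    then show ?case by (rule tendsto_norm_zero_cancel)
  qed
  with r(1) show ?thesis by (rule that)
qed

lemma conv0_const:
  fixes u :: "'a \<Rightarrow> 'b::euclidean_space"
  assumes m: "u \<in> borel_measurable M" and u: "conv0 M (\<lambda>_. u)"
  shows "AE \<omega> in M. u \<omega> = 0"
proof -
  obtain r :: "nat \<Rightarrow> nat" where "AE \<omega> in M. (\<lambda>n. u \<omega>) \<longlonglongrightarrow> 0"
    using conv0_subseq[OF m u] by metis
  then show ?thesis by eventually_elim (simp add: LIMSEQ_const_iff)
qed

text \<open>Bounded second moments imply uniform integrability, which upgrades convergence in
  probability to convergence in mean.\<close>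

lemma conv0_L2_bounded:
  fixes u :: "nat \<Rightarrow> 'a \<Rightarrow> 'b::euclidean_space"
  assumes m [measurable]: "\<And>n. u n \<in> borel_measurable M" and u: "conv0 M u"
    and C: "\<And>n. integrable M (\<lambda>\<omega>. (norm (u n \<omega>))\<^sup>2)" "\<And>n. (\<integral>\<omega>. (norm (u n \<omega>))\<^sup>2 \<partial>M) \<le> C"
  shows "(\<lambda>n. \<integral>\<omega>. norm (u n \<omega>) \<partial>M) \<longlonglongrightarrow> 0"
proof (rule LIMSEQ_I)
  fix e :: real assume e: "0 < e"
  have "0 \<le> (\<integral>\<omega>. (norm (u 0 \<omega>))\<^sup>2 \<partial>M)" by (intro integral_nonneg_AE) auto
  then have C0: "0 \<le> C" using C(2)[of 0] by linarith
  \<comment> \<open>Large enough for C / K \<le> e / 2. In the splitting below, the truncated norm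
    controls values up to \<open>K\<close> and the square divided by \<open>K\<close> controls
    larger ones.\<close>
  define K where "K = 1 + 2 * C / e"
  have K: "1 \<le> K" using C0 e by (simp add: K_def)
  have le: "a \<le> K * min 1 a + a\<^sup>2 / K" if a: "0 \<le> a" for a :: real
  proof (cases "a \<le> K")
    case True
    then have "a \<le> K * min 1 a" using K a mult_right_mono[of 1 K a] by (auto simp: min_def)
    then show ?thesis using K by (smt (verit) divide_nonneg_nonneg zero_le_power2)
  next
    case False
    then have "a * K \<le> a\<^sup>2" using a K by (simp add: power2_eq_square mult_left_mono)
    then have "a \<le> a\<^sup>2 / K" using K by (simp add: field_simps)
    moreover have "0 \<le> K * min 1 a" using K a by simp
    ultimately show ?thesis by linarith
  qed
  have "eventually (\<lambda>n. (\<integral>\<omega>. min 1 (norm (u n \<omega>)) \<partial>M) < e / (2 * K)) sequentially"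
    using order_tendstoD(2)[OF u[unfolded conv0_def], of "e / (2 * K)"] e K by simp
  then obtain n0 where n0: "\<And>n. n0 \<le> n \<Longrightarrow> (\<integral>\<omega>. min 1 (norm (u n \<omega>)) \<partial>M) < e / (2 * K)"
    unfolding eventually_sequentially by blast
  show "\<exists>no. \<forall>n\<ge>no. norm ((\<integral>\<omega>. norm (u n \<omega>) \<partial>M) - 0) < e"
  proof (intro exI[of _ n0] allI impI)
    fix n assume n: "n0 \<le> n"
    have i: "integrable M (\<lambda>\<omega>. K * min 1 (norm (u n \<omega>)) + (norm (u n \<omega>))\<^sup>2 / K)"
      using C(1) integrable_min_norm[OF m] by simp
    have "(\<integral>\<omega>. norm (u n \<omega>) \<partial>M) \<le> (\<integral>\<omega>. K * min 1 (norm (u n \<omega>)) + (norm (u n \<omega>))\<^sup>2 / K \<partial>M)"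
    proof (rule integral_mono[OF _ i])
      show "integrable M (\<lambda>\<omega>. norm (u n \<omega>))"
        by (rule Bochner_Integration.integrable_bound[OF i]) (use le in \<open>auto intro!: AE_I2 order.trans[OF le abs_ge_self]\<close>)
    qed (use le in auto)
    also have "\<dots> = K * (\<integral>\<omega>. min 1 (norm (u n \<omega>)) \<partial>M) + (\<integral>\<omega>. (norm (u n \<omega>))\<^sup>2 \<partial>M) / K"
      using C(1) integrable_min_norm[OF m] by simp
    also have "\<dots> < K * (e / (2 * K)) + e / 2"
    proof (rule add_less_le_mono)
      show "K * (\<integral>\<omega>. min 1 (norm (u n \<omega>)) \<partial>M) < K * (e / (2 * K))"
        using n0[OF n] K by (intro mult_strict_left_mono) auto
      have "(\<integral>\<omega>. (norm (u n \<omega>))\<^sup>2 \<partial>M) \<le> C" by (rule C)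
      also have "C \<le> e / 2 * K" using e by (simp add: K_def field_simps)
      finally show "(\<integral>\<omega>. (norm (u n \<omega>))\<^sup>2 \<partial>M) / K \<le> e / 2" using K by (simp add: field_simps)
    qed
    also have "\<dots> = e" using K by simp
    finally have "(\<integral>\<omega>. norm (u n \<omega>) \<partial>M) < e" .
    moreover have "0 \<le> (\<integral>\<omega>. norm (u n \<omega>) \<partial>M)" by (intro integral_nonneg_AE) auto
    ultimately show "norm ((\<integral>\<omega>. norm (u n \<omega>) \<partial>M) - 0) < e" by simp
  qed
qed

text \<open>The second moment passes to the limit by Fatou's lemma along an almost surely convergent
  subsequence; the mean passes to the limit because bounded second moments give convergence in
  mean.\<close>

lemma L2_limit:
  fixes S :: "nat \<Rightarrow> 'a \<Rightarrow> 'b::euclidean_space"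
  assumes S: "\<And>n. integrable M (S n)" "\<And>n. (\<integral>\<omega>. S n \<omega> \<partial>M) = 0"
      "\<And>n. integrable M (\<lambda>\<omega>. (norm (S n \<omega>))\<^sup>2)" "\<And>n. (\<integral>\<omega>. (norm (S n \<omega>))\<^sup>2 \<partial>M) \<le> C"
    and N [measurable]: "N \<in> borel_measurable M" and c: "conv0 M (\<lambda>n \<omega>. S n \<omega> - N \<omega>)"
  shows "integrable M N" "(\<integral>\<omega>. N \<omega> \<partial>M) = 0" "integrable M (\<lambda>\<omega>. (norm (N \<omega>))\<^sup>2)" "(\<integral>\<omega>. (norm (N \<omega>))\<^sup>2 \<partial>M) \<le> C"
proof -
  have [measurable]: "S n \<in> borel_measurable M" for n using S(1)[of n] by auto
  have "0 \<le> (\<integral>\<omega>. (norm (S 0 \<omega>))\<^sup>2 \<partial>M)" by (intro integral_nonneg_AE) auto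
  then have C0: "0 \<le> C" using S(4)[of 0] by linarith
  obtain r :: "nat \<Rightarrow> nat" where r: "strict_mono r" "AE \<omega> in M. (\<lambda>n. S (r n) \<omega> - N \<omega>) \<longlonglongrightarrow> 0"
    using conv0_subseq[OF _ c] by auto
  have "(\<integral>\<^sup>+\<omega>. ennreal ((norm (N \<omega>))\<^sup>2) \<partial>M) = (\<integral>\<^sup>+\<omega>. liminf (\<lambda>n. ennreal ((norm (S (r n) \<omega>))\<^sup>2)) \<partial>M)"
  proof (rule nn_integral_cong_AE)
    show "AE \<omega> in M. ennreal ((norm (N \<omega>))\<^sup>2) = liminf (\<lambda>n. ennreal ((norm (S (r n) \<omega>))\<^sup>2))"
      using r(2)
    proof eventually_elim
      case (elim \<omega>)
      from tendsto_add[OF elim tendsto_const[of "N \<omega>"]] have "(\<lambda>n. S (r n) \<omega>) \<longlonglongrightarrow> N \<omega>" by simp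
      then have "(\<lambda>n. ennreal ((norm (S (r n) \<omega>))\<^sup>2)) \<longlonglongrightarrow> ennreal ((norm (N \<omega>))\<^sup>2)"
        by (intro tendsto_ennrealI tendsto_intros)
      then show ?case using lim_imp_Liminf[of sequentially] by (metis trivial_limit_sequentially)
    qed
  qed
  also have "\<dots> \<le> liminf (\<lambda>n. \<integral>\<^sup>+\<omega>. ennreal ((norm (S (r n) \<omega>))\<^sup>2) \<partial>M)"
    by (rule nn_integral_liminf) auto
  also have "\<dots> \<le> liminf (\<lambda>n. ennreal C)"
    using S(3,4) by (intro Liminf_mono always_eventually allI) (simp add: nn_integral_eq_integral ennreal_leI)
  also have "\<dots> = ennreal C" by (simp add: Liminf_const)
  finally have nn: "(\<integral>\<^sup>+\<omega>. ennreal ((norm (N \<omega>))\<^sup>2) \<partial>M) \<le> ennreal C" .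
  show i2: "integrable M (\<lambda>\<omega>. (norm (N \<omega>))\<^sup>2)"
    by (rule integrableI_bounded) (use nn in \<open>auto intro: order.strict_trans1\<close>)
  then show l2: "(\<integral>\<omega>. (norm (N \<omega>))\<^sup>2 \<partial>M) \<le> C"
    using nn C0 by (simp add: nn_integral_eq_integral)
  have ab: "a \<le> 1 + a\<^sup>2" for a :: real using sum_squares_bound[of a 1] by (simp add: power2_eq_square) (smt (verit) mult_nonneg_nonneg zero_le_square)
  show iN: "integrable M N"
    by (rule Bochner_Integration.integrable_bound[of M "\<lambda>\<omega>. 1 + (norm (N \<omega>))\<^sup>2"])
      (use i2 ab in \<open>auto intro!: AE_I2 order.trans[OF ab abs_ge_self]\<close>)
  have d2: "(norm (a - b))\<^sup>2 \<le> 2 * (norm a)\<^sup>2 + 2 * (norm b)\<^sup>2" for a b :: 'b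
  proof -
    have "(norm (a - b))\<^sup>2 \<le> (norm a + norm b)\<^sup>2" by (intro power_mono norm_triangle_ineq4) auto
    also have "\<dots> \<le> 2 * (norm a)\<^sup>2 + 2 * (norm b)\<^sup>2"
      using sum_squares_bound[of "norm a" "norm b"] by (simp add: power2_sum)
    finally show ?thesis .
  qed
  have i: "integrable M (\<lambda>\<omega>. 2 * (norm (S n \<omega>))\<^sup>2 + 2 * (norm (N \<omega>))\<^sup>2)" for n using S(3)[of n] i2 by simp
  have iD: "integrable M (\<lambda>\<omega>. (norm (S n \<omega> - N \<omega>))\<^sup>2)" for n
    by (rule Bochner_Integration.integrable_bound[OF i[of n]]) (use d2 in auto)
  have bD: "(\<integral>\<omega>. (norm (S n \<omega> - N \<omega>))\<^sup>2 \<partial>M) \<le> 4 * C" for n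
  proof -
    have "(\<integral>\<omega>. (norm (S n \<omega> - N \<omega>))\<^sup>2 \<partial>M) \<le> (\<integral>\<omega>. 2 * (norm (S n \<omega>))\<^sup>2 + 2 * (norm (N \<omega>))\<^sup>2 \<partial>M)"
      by (intro integral_mono iD i d2)
    also have "\<dots> = 2 * (\<integral>\<omega>. (norm (S n \<omega>))\<^sup>2 \<partial>M) + 2 * (\<integral>\<omega>. (norm (N \<omega>))\<^sup>2 \<partial>M)"
      using S(3)[of n] i2 by simp
    finally show ?thesis using S(4)[of n] l2 by simp
  qed
  have L: "(\<lambda>n. \<integral>\<omega>. norm (S n \<omega> - N \<omega>) \<partial>M) \<longlonglongrightarrow> 0"
    by (rule conv0_L2_bounded[OF _ c iD bD]) auto
  have "norm (\<integral>\<omega>. N \<omega> \<partial>M) \<le> (\<integral>\<omega>. norm (S n \<omega> - N \<omega>) \<partial>M)" for n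
  proof -
    have "(\<integral>\<omega>. S n \<omega> - N \<omega> \<partial>M) = - (\<integral>\<omega>. N \<omega> \<partial>M)"
      using S(1,2)[of n] iN by (simp add: Bochner_Integration.integral_diff)
    then show ?thesis using integral_norm_bound[of M "\<lambda>\<omega>. S n \<omega> - N \<omega>"] by simp
  qed
  then have "norm (\<integral>\<omega>. N \<omega> \<partial>M) \<le> 0"
    by (intro LIMSEQ_le_const[OF L]) auto
  then show "(\<integral>\<omega>. N \<omega> \<partial>M) = 0" by simp
qed

end

section \<open>Linear integral equations driven by noise\<close>

abbreviation lbT :: "real \<Rightarrow> real measure" where "lbT T \<equiv> restrict_space lborel {0..T}"

lemma space_lbT [simp]: "space (lbT T) = {0..T}"
  by (simp add: space_restrict_space)

lemma finite_measure_lbT: "finite_measure (lbT T)"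
  by (intro finite_measureI) (auto simp: emeasure_restrict_space emeasure_lborel_Icc_eq)

lemma measurable_process_lbT:
  "measurable_process M T Z \<longleftrightarrow> (\<lambda>(t, \<omega>). Z t \<omega>) \<in> borel_measurable (lbT T \<Otimes>\<^sub>M M)"
  unfolding measurable_process_def
  by (intro arg_cong2[where f = "(\<in>)"] refl measurable_cong_sets sets_pair_measure_cong sets_restrict_space_cong) auto

lemma measurable_process_slice:
  assumes "measurable_process M T Z" "t \<in> {0..T}"
  shows "Z t \<in> borel_measurable M"
  using measurable_Pair2[OF assms(1)[unfolded measurable_process_lbT], of t] assms(2) by simp

lemma measurable_process_compose:
  fixes Z :: "real \<Rightarrow> 'w \<Rightarrow> 'a::euclidean_space" and G :: "real \<Rightarrow> 'a \<Rightarrow> 'b::euclidean_space"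
  assumes Z: "measurable_process M T Z" and G: "continuous_on ({0..T} \<times> UNIV) (\<lambda>(t, x). G t x)"
  shows "measurable_process M T (\<lambda>t \<omega>. G t (Z t \<omega>))"
proof -
  have "(\<lambda>p. (fst p, Z (fst p) (snd p))) \<in> lbT T \<Otimes>\<^sub>M M \<rightarrow>\<^sub>M borel \<Otimes>\<^sub>M borel"
  proof (rule measurable_Pair)
    show "fst \<in> lbT T \<Otimes>\<^sub>M M \<rightarrow>\<^sub>M borel"
      by (rule measurable_compose[OF measurable_fst]) (simp add: measurable_restrict_space1)
    show "(\<lambda>p. Z (fst p) (snd p)) \<in> lbT T \<Otimes>\<^sub>M M \<rightarrow>\<^sub>M borel"
      using Z by (simp add: measurable_process_lbT case_prod_unfold)
  qed
  then have "(\<lambda>p. (fst p, Z (fst p) (snd p))) \<in> lbT T \<Otimes>\<^sub>M M \<rightarrow>\<^sub>M restrict_space borel ({0..T} \<times> UNIV)"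
    by (intro measurable_restrict_space2) (auto simp: space_pair_measure borel_prod)
  from measurable_compose[OF this borel_measurable_continuous_on_restrict[OF G]]
  show ?thesis by (simp add: measurable_process_lbT case_prod_unfold)
qed

lemma measurable_process_Pair:
  assumes "measurable_process M T (X :: real \<Rightarrow> 'w \<Rightarrow> 'a::euclidean_space)"
    "measurable_process M T (Y :: real \<Rightarrow> 'w \<Rightarrow> 'b::euclidean_space)"
  shows "measurable_process M T (\<lambda>t \<omega>. (X t \<omega>, Y t \<omega>))"
  using assms unfolding measurable_process_lbT case_prod_unfold by (intro borel_measurable_Pair)

text \<open>The variable end point is moved into the integrand, so that one finite measure on [0, T]
  serves all \<open>t\<close> when Fubini's theorem is applied.\<close>

lemma set_integral_lbT:
  fixes f :: "real \<Rightarrow> 'a::euclidean_space"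
  assumes "t \<in> {0..T}"
  shows "(LINT s:{0..t}|lborel. f s) = (\<integral>s. indicator {0..t} s *\<^sub>R f s \<partial>lbT T)"
proof -
  have "(\<integral>s. indicator {0..t} s *\<^sub>R f s \<partial>lbT T) = (LINT s:{0..T}|lborel. indicator {0..t} s *\<^sub>R f s)"
    by (subst integral_restrict_space) (auto simp: set_lebesgue_integral_def)
  also have "\<dots> = (LINT s:{0..t}|lborel. f s)"
    unfolding set_lebesgue_integral_def using assms
    by (intro Bochner_Integration.integral_cong refl) (auto simp: indicator_def)
  finally show ?thesis by simp
qed

lemma set_integral_continuous:
  fixes h :: "real \<Rightarrow> 'a::euclidean_space"
  assumes "continuous_on {0..T} h" "t \<le> T"
  shows "(LINT s:{0..t}|lborel. h s) = integral {0..t} h" "set_integrable lborel {0..t} h"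
proof -
  show "set_integrable lborel {0..t} h"
    using assms(2) by (intro borel_integrable_atLeastAtMost' continuous_on_subset[OF assms(1)]) auto
  from set_borel_integral_eq_integral(2)[OF this]
  show "(LINT s:{0..t}|lborel. h s) = integral {0..t} h" .
qed

lemma measurable_set_integral:
  fixes f :: "real \<Rightarrow> 'w \<Rightarrow> 'a::euclidean_space"
  assumes "sigma_finite_measure M" and f: "measurable_process M T f" and t: "t \<in> {0..T}"
  shows "(\<lambda>\<omega>. LINT s:{0..t}|lborel. f s \<omega>) \<in> borel_measurable M"
proof -
  interpret finite_measure "lbT T" by (rule finite_measure_lbT)
  have 1: "(\<lambda>p. f (snd p) (fst p)) \<in> borel_measurable (M \<Otimes>\<^sub>M lbT T)"
    using measurable_compose[OF measurable_pair_swap' f[unfolded measurable_process_lbT]]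
    by (simp add: case_prod_unfold)
  have 2: "(\<lambda>p. indicator {0..t} (snd p) :: real) \<in> borel_measurable (M \<Otimes>\<^sub>M lbT T)"
    by (rule measurable_compose[OF measurable_snd]) (simp add: measurable_restrict_space1)
  have "(\<lambda>\<omega>. \<integral>s. indicator {0..t} s *\<^sub>R f s \<omega> \<partial>lbT T) \<in> borel_measurable M"
    by (rule borel_measurable_lebesgue_integral) (use borel_measurable_scaleR[OF 2 1] in \<open>simp add: case_prod_unfold\<close>)
  then show ?thesis by (simp add: set_integral_lbT[OF t])
qed

text \<open>The second moment bound is uniform in time; with it the process is square integrable on
  the product of [0, T] and the probability space.\<close>

definition centered_L2 :: "'w measure \<Rightarrow> real \<Rightarrow> (real \<Rightarrow> 'w \<Rightarrow> 'a::euclidean_space) \<Rightarrow> bool" where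
  "centered_L2 M T x \<longleftrightarrow> measurable_process M T x \<and>
     (\<exists>C. \<forall>t\<in>{0..T}. integrable M (\<lambda>\<omega>. (norm (x t \<omega>))\<^sup>2) \<and> (\<integral>\<omega>. (norm (x t \<omega>))\<^sup>2 \<partial>M) \<le> C) \<and>
     (\<forall>t\<in>{0..T}. integrable M (x t) \<and> (\<integral>\<omega>. x t \<omega> \<partial>M) = 0)"

text \<open>Kept abstract in the state space: it is interpreted on pairs consisting of the filtering
  error and the deviation of the stacked filters.\<close>

locale linear_flow =
  fixes T L :: real and \<A> :: "real \<Rightarrow> 'a::euclidean_space \<Rightarrow> 'a"
  assumes T: "0 < T" and L: "0 \<le> L"
    and lin: "\<And>t. t \<in> {0..T} \<Longrightarrow> linear (\<A> t)"
    and cont: "continuous_on ({0..T} \<times> UNIV) (\<lambda>(t, x). \<A> t x)"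
    and bound: "\<And>t x. t \<in> {0..T} \<Longrightarrow> norm (\<A> t x) \<le> L * norm x"
begin

lemma cont_path:
  assumes "continuous_on {0..T} z"
  shows "continuous_on {0..T} (\<lambda>s. \<A> s (z s))"
proof -
  have "continuous_on {0..T} (\<lambda>s. (s, z s))" by (intro continuous_intros assms)
  from continuous_on_compose2[OF cont this] show ?thesis by (auto simp: image_subset_iff)
qed

lemma flow_zero:
  assumes z: "continuous_on {0..T} z" and eq: "\<And>t. t \<in> {0..T} \<Longrightarrow> z t = integral {0..t} (\<lambda>s. \<A> s (z s))"
    and t: "t \<in> {0..T}"
  shows "z t = 0"
proof (rule linear_growth_zero[OF _ bound L t])
  show "(z has_vector_derivative \<A> s (z s)) (at s within {0..T})" if "s \<in> {0..T}" for s
    using has_vector_derivative_transform[OF that eq integral_has_vector_derivative[OF cont_path[OF z] that]] by simp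
  show "z 0 = 0 \<or> z T = 0" using eq[of 0] T by simp
qed

lemma flow_unique:
  assumes z: "continuous_on {0..T} z" "continuous_on {0..T} z'"
    and eq: "\<And>t. t \<in> {0..T} \<Longrightarrow> z t = n t + integral {0..t} (\<lambda>s. \<A> s (z s))"
      "\<And>t. t \<in> {0..T} \<Longrightarrow> z' t = n t + integral {0..t} (\<lambda>s. \<A> s (z' s))"
    and t: "t \<in> {0..T}"
  shows "z t = z' t"
proof -
  have "(\<lambda>t. z t - z' t) t = 0"
  proof (rule flow_zero[OF _ _ t])
    show "continuous_on {0..T} (\<lambda>t. z t - z' t)" by (intro continuous_intros z)
    fix r assume r: "r \<in> {0..T}"
    have sub: "{0..r} \<subseteq> {0..T}" using r by auto
    have "z r - z' r = integral {0..r} (\<lambda>s. \<A> s (z s)) - integral {0..r} (\<lambda>s. \<A> s (z' s))"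
      unfolding eq(1)[OF r] eq(2)[OF r] by simp
    also have "\<dots> = integral {0..r} (\<lambda>s. \<A> s (z s) - \<A> s (z' s))"
      by (intro integral_diff[symmetric] integrable_continuous_real continuous_on_subset[OF cont_path sub] z)
    also have "\<dots> = integral {0..r} (\<lambda>s. \<A> s (z s - z' s))"
      using lin sub by (intro integral_cong) (auto simp: linear_diff)
    finally show "z r - z' r = integral {0..r} (\<lambda>s. \<A> s (z s - z' s))" .
  qed
  then show ?thesis by simp
qed

lemma flow_growth:
  assumes z: "continuous_on {0..T} z"
    and eq: "\<And>t. t \<in> {0..T} \<Longrightarrow> z t = n t + integral {0..t} (\<lambda>s. \<A> s (z s))"
    and t: "t \<in> {0..T}"
  shows "continuous_on {0..T} n"
    and "(norm (z t))\<^sup>2 \<le> 2 * (norm (n t))\<^sup>2 + 2 * (exp ((2 * L + 1) * T) * L\<^sup>2) * integral {0..T} (\<lambda>s. (norm (n s))\<^sup>2)"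
proof -
  \<comment> \<open>Gronwall is applied to the integral part and not to \<open>z\<close>, because
    the driving path \<open>n\<close> will be Brownian and has no derivative. Continuity of
    \<open>n\<close> follows from n = z - y.\<close>
  let ?y = "\<lambda>t. integral {0..t} (\<lambda>s. \<A> s (z s))"
  note c = cont_path[OF z]
  have dy: "(?y has_vector_derivative \<A> s (z s)) (at s within {0..T})" if "s \<in> {0..T}" for s
    using integral_has_vector_derivative[OF c that] by simp
  have "continuous_on {0..T} (\<lambda>t. z t - ?y t)"
    by (intro continuous_intros z continuous_on_vector_derivative[OF dy])
  then show cn: "continuous_on {0..T} n"
    by (rule continuous_on_eq) (simp add: eq)
  have cn2: "continuous_on {0..T} (\<lambda>s. (norm (n s))\<^sup>2)" by (intro continuous_intros cn)
  have "(norm (?y t))\<^sup>2 \<le> exp ((2 * L + 1) * t) * integral {0..t} (\<lambda>s. (L * norm (n s))\<^sup>2)"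
  proof (rule gronwall_sq[OF dy _ _ _ _ L t])
    show "norm (\<A> s (z s)) \<le> L * norm (?y s) + L * norm (n s)" if s: "s \<in> {0..T}" for s
    proof -
      have "norm (\<A> s (z s)) \<le> L * norm (n s + ?y s)" using bound[OF s] eq[OF s] by simp
      also have "\<dots> \<le> L * (norm (n s) + norm (?y s))" by (intro mult_left_mono norm_triangle_ineq L)
      finally show ?thesis by (simp add: algebra_simps)
    qed
    show "continuous_on {0..T} (\<lambda>s. L * norm (n s))" by (intro continuous_intros cn)
  qed (use L in auto)
  also have "\<dots> \<le> exp ((2 * L + 1) * T) * (L\<^sup>2 * integral {0..T} (\<lambda>s. (norm (n s))\<^sup>2))"
  proof (rule mult_mono)
    show "exp ((2 * L + 1) * t) \<le> exp ((2 * L + 1) * T)" using t L by (simp add: mult_left_mono)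
    have "integral {0..t} (\<lambda>s. (L * norm (n s))\<^sup>2) = L\<^sup>2 * integral {0..t} (\<lambda>s. (norm (n s))\<^sup>2)"
      by (simp add: power_mult_distrib)
    also have "\<dots> \<le> L\<^sup>2 * integral {0..T} (\<lambda>s. (norm (n s))\<^sup>2)"
      using t by (intro mult_left_mono integral_subset_le integrable_continuous_real continuous_on_subset[OF cn2] cn2) auto
    finally show "integral {0..t} (\<lambda>s. (L * norm (n s))\<^sup>2) \<le> L\<^sup>2 * integral {0..T} (\<lambda>s. (norm (n s))\<^sup>2)" .
    show "0 \<le> integral {0..t} (\<lambda>s. (L * norm (n s))\<^sup>2)"
      using t by (intro integral_nonneg integrable_continuous_real continuous_intros continuous_on_subset[OF cn]) auto
  qed auto
  finally have y: "(norm (?y t))\<^sup>2 \<le> exp ((2 * L + 1) * T) * L\<^sup>2 * integral {0..T} (\<lambda>s. (norm (n s))\<^sup>2)"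
    by (simp add: mult.assoc)
  have "(norm (z t))\<^sup>2 \<le> (norm (n t) + norm (?y t))\<^sup>2"
    unfolding eq[OF t] by (intro power_mono norm_triangle_ineq) auto
  also have "\<dots> \<le> 2 * (norm (n t))\<^sup>2 + 2 * (norm (?y t))\<^sup>2"
    using sum_squares_bound[of "norm (n t)" "norm (?y t)"] by (simp add: power2_sum)
  finally show "(norm (z t))\<^sup>2 \<le> 2 * (norm (n t))\<^sup>2 + 2 * (exp ((2 * L + 1) * T) * L\<^sup>2) * integral {0..T} (\<lambda>s. (norm (n s))\<^sup>2)"
    using y by simp
qed

end

lemma riemann_sum_real:
  fixes h :: "real \<Rightarrow> real"
  assumes "0 \<le> T" "continuous_on {0..T} h"
  shows "(\<lambda>m. \<Sum>k<m. T / real m * h (real k * T / real m)) \<longlonglongrightarrow> integral {0..T} h"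
proof -
  have "(\<lambda>m. \<Sum>k<m. h (real k * T / real m) * (integral {0..real (Suc k) * T / real m} (\<lambda>_. 1 :: real)
      - integral {0..real k * T / real m} (\<lambda>_. 1))) \<longlonglongrightarrow> integral {0..T} (\<lambda>s. h s * 1)"
    by (rule riemann_sum_tendsto[OF bounded_bilinear_mult assms continuous_on_const])
  moreover have "(\<Sum>k<m. h (real k * T / real m) * (integral {0..real (Suc k) * T / real m} (\<lambda>_. 1 :: real)
      - integral {0..real k * T / real m} (\<lambda>_. 1))) = (\<Sum>k<m. T / real m * h (real k * T / real m))" for m
    using assms(1) by (intro sum.cong refl) (auto simp: field_simps)
  ultimately show ?thesis by simp
qed

lemma norm_le_one_plus_sq: "norm x \<le> 1 + (norm x)\<^sup>2"
proof -
  have "2 * norm x \<le> (norm x)\<^sup>2 + 1" using sum_squares_bound[of "norm x" 1] by simp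
  with zero_le_power2[of "norm x"] show ?thesis by linarith
qed

lemma centered_L2_pair_integrable:
  fixes x :: "real \<Rightarrow> 'w \<Rightarrow> 'a::euclidean_space"
  assumes M: "prob_space M" and x: "measurable_process M T x"
    and C: "\<And>t. t \<in> {0..T} \<Longrightarrow> integrable M (\<lambda>\<omega>. (norm (x t \<omega>))\<^sup>2)" "\<And>t. t \<in> {0..T} \<Longrightarrow> (\<integral>\<omega>. (norm (x t \<omega>))\<^sup>2 \<partial>M) \<le> C"
  shows "integrable (lbT T \<Otimes>\<^sub>M M) (\<lambda>p. (norm (x (fst p) (snd p)))\<^sup>2)" "integrable (lbT T \<Otimes>\<^sub>M M) (\<lambda>p. x (fst p) (snd p))"
proof -
  interpret prob_space M by fact
  interpret T: finite_measure "lbT T" by (rule finite_measure_lbT)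
  interpret P: pair_sigma_finite "lbT T" M ..
  interpret F: finite_measure "lbT T \<Otimes>\<^sub>M M" by (rule finite_measure_pair_measure) unfold_locales
  have m [measurable]: "(\<lambda>p. x (fst p) (snd p)) \<in> borel_measurable (lbT T \<Otimes>\<^sub>M M)"
    using x by (simp add: measurable_process_lbT case_prod_unfold)
  have "(\<integral>\<^sup>+p. ennreal ((norm (x (fst p) (snd p)))\<^sup>2) \<partial>(lbT T \<Otimes>\<^sub>M M)) = (\<integral>\<^sup>+t. (\<integral>\<^sup>+\<omega>. ennreal ((norm (x t \<omega>))\<^sup>2) \<partial>M) \<partial>lbT T)"
    using nn_integral_fst[of "\<lambda>p. ennreal ((norm (x (fst p) (snd p)))\<^sup>2)" "lbT T"] by simp
  also have "\<dots> \<le> (\<integral>\<^sup>+t. ennreal C \<partial>lbT T)"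
    using C by (intro nn_integral_mono) (simp add: nn_integral_eq_integral ennreal_leI)
  also have "\<dots> < \<infinity>" using T.emeasure_finite[of "{0..T}"] by (simp add: ennreal_mult_eq_top_iff less_top[symmetric])
  finally show 2: "integrable (lbT T \<Otimes>\<^sub>M M) (\<lambda>p. (norm (x (fst p) (snd p)))\<^sup>2)"
    by (intro integrableI_bounded) auto
  show "integrable (lbT T \<Otimes>\<^sub>M M) (\<lambda>p. x (fst p) (snd p))"
    by (rule Bochner_Integration.integrable_bound[of _ "\<lambda>p. 1 + (norm (x (fst p) (snd p)))\<^sup>2"])
      (use 2 in \<open>auto intro!: AE_I2 norm_le_one_plus_sq\<close>)
qed

lemma L2_imp_integrable:
  fixes X :: "'w \<Rightarrow> 'a::euclidean_space"
  assumes "finite_measure M" "X \<in> borel_measurable M" "integrable M (\<lambda>\<omega>. (norm (X \<omega>))\<^sup>2)"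
  shows "integrable M X"
proof -
  interpret finite_measure M by fact
  show ?thesis
    by (rule Bochner_Integration.integrable_bound[of _ "\<lambda>\<omega>. 1 + (norm (X \<omega>))\<^sup>2"])
      (use assms in \<open>auto intro!: AE_I2 norm_le_one_plus_sq\<close>)
qed

text \<open>The pathwise growth bound is integrated to obtain second moments; with these, Fubini
  turns the equation into one for the mean. Only the single variables \<open>n t\<close> are known
  to be measurable, so the time integral of |n|^2 is reached as a lower limit of Riemann
  sums.\<close>

lemma (in linear_flow) centered_L2_flow:
  fixes z n :: "real \<Rightarrow> 'w \<Rightarrow> 'a"
  assumes M: "prob_space M" and z: "measurable_process M T z" and zc: "AE \<omega> in M. continuous_on {0..T} (\<lambda>t. z t \<omega>)"
    and n: "\<And>t. t \<in> {0..T} \<Longrightarrow> integrable M (n t)" "\<And>t. t \<in> {0..T} \<Longrightarrow> (\<integral>\<omega>. n t \<omega> \<partial>M) = 0"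
      "\<And>t. t \<in> {0..T} \<Longrightarrow> integrable M (\<lambda>\<omega>. (norm (n t \<omega>))\<^sup>2)" "\<And>t. t \<in> {0..T} \<Longrightarrow> (\<integral>\<omega>. (norm (n t \<omega>))\<^sup>2 \<partial>M) \<le> C"
    and eq: "AE \<omega> in M. \<forall>t\<in>{0..T}. z t \<omega> = n t \<omega> + (LINT s:{0..t}|lborel. \<A> s (z s \<omega>))"
  shows "centered_L2 M T z"
proof -
  interpret prob_space M by fact
  interpret T: finite_measure "lbT T" by (rule finite_measure_lbT)
  interpret P: pair_sigma_finite "lbT T" M ..
  have C0: "0 \<le> C"
  proof -
    have "0 \<le> (\<integral>\<omega>. (norm (n 0 \<omega>))\<^sup>2 \<partial>M)" by (intro integral_nonneg_AE) auto
    also have "\<dots> \<le> C" using n(4)[of 0] T by simp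
    finally show ?thesis .
  qed
  define K where "K = 2 * (exp ((2 * L + 1) * T) * L\<^sup>2)"
  have K: "0 \<le> K" by (simp add: K_def)
  define q where "q m k = real k * T / real m" for m k :: nat
  have q: "q m k \<in> {0..T}" if "k < m" for m k
    using that T by (auto simp: q_def field_simps)
  \<comment> \<open>A finite combination of variables at fixed times, hence measurable. Its mean is
    at most T C for every \<open>m\<close>, which Fatou's lemma hands on to the limit
    \<open>G\<close>.\<close>
  define S where "S m \<omega> = (\<Sum>k<m. T / real m * (norm (n (q m k) \<omega>))\<^sup>2)" for m \<omega>
  have iS: "integrable M (S m)" for m
    unfolding S_def using n(3) q by (intro Bochner_Integration.integrable_sum integrable_mult_right) auto
  have Sm: "(\<lambda>\<omega>. ennreal (S m \<omega>)) \<in> borel_measurable M" for m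
    using borel_measurable_integrable[OF iS] by simp
  have S0: "0 \<le> S m \<omega>" for m \<omega> using T by (auto simp: S_def intro!: sum_nonneg)
  define G where "G \<omega> = liminf (\<lambda>m. ennreal (S m \<omega>))" for \<omega>
  have Gm [measurable]: "G \<in> borel_measurable M" unfolding G_def by (rule borel_measurable_liminf) (rule Sm)
  have GE: "(\<integral>\<^sup>+\<omega>. G \<omega> \<partial>M) \<le> ennreal (T * C)"
  proof -
    have "(\<integral>\<^sup>+\<omega>. G \<omega> \<partial>M) \<le> liminf (\<lambda>m. \<integral>\<^sup>+\<omega>. ennreal (S m \<omega>) \<partial>M)"
      unfolding G_def by (rule nn_integral_liminf) (rule Sm)
    also have "\<dots> \<le> liminf (\<lambda>m. ennreal (T * C))"
    proof (intro Liminf_mono always_eventually allI)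
      fix m
      have "(\<integral>\<omega>. S m \<omega> \<partial>M) = (\<Sum>k<m. (\<integral>\<omega>. T / real m * (norm (n (q m k) \<omega>))\<^sup>2 \<partial>M))"
        unfolding S_def using n(3) q by (intro Bochner_Integration.integral_sum integrable_mult_right) auto
      also have "\<dots> = (\<Sum>k<m. T / real m * (\<integral>\<omega>. (norm (n (q m k) \<omega>))\<^sup>2 \<partial>M))" by simp
      also have "\<dots> \<le> (\<Sum>k<m. T / real m * C)"
        using n(4) q T by (intro sum_mono mult_left_mono) auto
      also have "\<dots> \<le> T * C" using T C0 by (cases "m = 0") auto
      finally show "(\<integral>\<^sup>+\<omega>. ennreal (S m \<omega>) \<partial>M) \<le> ennreal (T * C)"
        using iS[of m] S0 by (subst nn_integral_eq_integral) (auto intro: ennreal_leI)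
    qed
    finally show ?thesis by (simp add: Liminf_const)
  qed
  \<comment> \<open>Stated with extended nonnegative values so that it can be integrated before
    \<open>z\<close> is known to be integrable. On almost every path \<open>n\<close> is continuous,
    so \<open>G\<close> is the time integral of |n|^2.\<close>
  have path: "AE \<omega> in M. \<forall>t\<in>{0..T}. ennreal ((norm (z t \<omega>))\<^sup>2) \<le> ennreal (2 * (norm (n t \<omega>))\<^sup>2) + ennreal K * G \<omega>"
    using zc eq
  proof eventually_elim
    case (elim \<omega>)
    have zeq: "z t \<omega> = n t \<omega> + integral {0..t} (\<lambda>s. \<A> s (z s \<omega>))" if "t \<in> {0..T}" for t
      using elim(2) that set_integral_continuous(1)[OF cont_path[OF elim(1)], of t] by auto
    have "continuous_on {0..T} (\<lambda>s. n s \<omega>)"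
      using flow_growth(1)[OF elim(1), of "\<lambda>t. n t \<omega>" 0] zeq T by auto
    then have cn2: "continuous_on {0..T} (\<lambda>s. (norm (n s \<omega>))\<^sup>2)"
      by (intro continuous_intros)
    have "(\<lambda>m. S m \<omega>) \<longlonglongrightarrow> integral {0..T} (\<lambda>s. (norm (n s \<omega>))\<^sup>2)"
      unfolding S_def q_def using T by (intro riemann_sum_real cn2) auto
    then have "(\<lambda>m. ennreal (S m \<omega>)) \<longlonglongrightarrow> ennreal (integral {0..T} (\<lambda>s. (norm (n s \<omega>))\<^sup>2))"
      by (rule tendsto_ennrealI)
    then have G: "G \<omega> = ennreal (integral {0..T} (\<lambda>s. (norm (n s \<omega>))\<^sup>2))"
      unfolding G_def by (intro lim_imp_Liminf) auto
    have i0: "0 \<le> integral {0..T} (\<lambda>s. (norm (n s \<omega>))\<^sup>2)"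
      by (intro integral_nonneg integrable_continuous_real cn2) auto
    show ?case
    proof
      fix t assume t: "t \<in> {0..T}"
      have "ennreal ((norm (z t \<omega>))\<^sup>2) \<le> ennreal (2 * (norm (n t \<omega>))\<^sup>2 + K * integral {0..T} (\<lambda>s. (norm (n s \<omega>))\<^sup>2))"
        using flow_growth(2)[OF elim(1), of "\<lambda>t. n t \<omega>" t] zeq t
        by (intro ennreal_leI) (simp add: K_def)
      also have "\<dots> = ennreal (2 * (norm (n t \<omega>))\<^sup>2) + ennreal K * G \<omega>"
        using K i0 by (simp add: G ennreal_plus ennreal_mult)
      finally show "ennreal ((norm (z t \<omega>))\<^sup>2) \<le> ennreal (2 * (norm (n t \<omega>))\<^sup>2) + ennreal K * G \<omega>" .
    qed
  qed
  \<comment> \<open>The expectation of the growth bound, with \<open>C\<close> for each |n|^2 and T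
    C for its time integral.\<close>
  define C' where "C' = 2 * C + K * (T * C)"
  have C'0: "0 \<le> C'" using C0 K T by (simp add: C'_def)
  have zm: "z t \<in> borel_measurable M" if "t \<in> {0..T}" for t by (rule measurable_process_slice[OF z that])
  have nn: "(\<integral>\<^sup>+\<omega>. ennreal ((norm (z t \<omega>))\<^sup>2) \<partial>M) \<le> ennreal C'" if t: "t \<in> {0..T}" for t
  proof -
    have [measurable]: "n t \<in> borel_measurable M" using n(1)[OF t] by auto
    have "(\<integral>\<^sup>+\<omega>. ennreal ((norm (z t \<omega>))\<^sup>2) \<partial>M) \<le> (\<integral>\<^sup>+\<omega>. ennreal (2 * (norm (n t \<omega>))\<^sup>2) + ennreal K * G \<omega> \<partial>M)"
      using path by (intro nn_integral_mono_AE) (use t in auto)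
    also have "\<dots> = (\<integral>\<^sup>+\<omega>. ennreal (2 * (norm (n t \<omega>))\<^sup>2) \<partial>M) + ennreal K * (\<integral>\<^sup>+\<omega>. G \<omega> \<partial>M)"
      by (subst nn_integral_add) (auto simp: nn_integral_cmult)
    also have "\<dots> \<le> ennreal (2 * C) + ennreal K * ennreal (T * C)"
      using n(3,4)[OF t] by (intro add_mono mult_left_mono GE) (auto simp: nn_integral_eq_integral ennreal_leI)
    also have "\<dots> = ennreal C'" using C0 K T by (simp add: C'_def ennreal_plus ennreal_mult)
    finally show ?thesis .
  qed
  have i2: "integrable M (\<lambda>\<omega>. (norm (z t \<omega>))\<^sup>2)" if t: "t \<in> {0..T}" for t
    using zm[OF t] nn[OF t] by (intro integrableI_bounded) (auto intro: order.strict_trans1)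
  have b2: "(\<integral>\<omega>. (norm (z t \<omega>))\<^sup>2 \<partial>M) \<le> C'" if t: "t \<in> {0..T}" for t
    using nn[OF t] i2[OF t] C'0 by (simp add: nn_integral_eq_integral)
  have iz: "integrable M (z t)" if t: "t \<in> {0..T}" for t
    by (rule L2_imp_integrable[OF _ zm[OF t] i2[OF t]]) unfold_locales
  \<comment> \<open>Taking expectations removes the centred \<open>n\<close>, so the mean solves the
    homogeneous integral equation and must be zero.\<close>
  define g where "g t = (\<integral>\<omega>. z t \<omega> \<partial>M)" for t
  note pz = centered_L2_pair_integrable[OF M z i2 b2]
  have Az: "measurable_process M T (\<lambda>t \<omega>. \<A> t (z t \<omega>))" by (rule measurable_process_compose[OF z cont])
  have bl: "bounded_linear (\<A> t)" if "t \<in> {0..T}" for t using lin[OF that] by (simp add: linear_conv_bounded_linear)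
  \<comment> \<open>Domination by L |z| on the product space is what licenses the exchange of
    expectation and time integral.\<close>
  have pA: "integrable (lbT T \<Otimes>\<^sub>M M) (\<lambda>(s, \<omega>). indicator {0..t} s *\<^sub>R \<A> s (z s \<omega>))" for t
  proof (rule Bochner_Integration.integrable_bound[of _ "\<lambda>p. L * norm (z (fst p) (snd p))"])
    show "integrable (lbT T \<Otimes>\<^sub>M M) (\<lambda>p. L * norm (z (fst p) (snd p)))" using pz(2) by simp
    have 1: "(\<lambda>p. indicator {0..t} (fst p) :: real) \<in> borel_measurable (lbT T \<Otimes>\<^sub>M M)"
      by (rule measurable_compose[OF measurable_fst]) (simp add: measurable_restrict_space1)
    show "(\<lambda>(s, \<omega>). indicator {0..t} s *\<^sub>R \<A> s (z s \<omega>)) \<in> borel_measurable (lbT T \<Otimes>\<^sub>M M)"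
      using borel_measurable_scaleR[OF 1 Az[unfolded measurable_process_lbT case_prod_unfold]] by (simp add: case_prod_unfold)
    show "AE p in lbT T \<Otimes>\<^sub>M M. norm (case p of (s, \<omega>) \<Rightarrow> indicator {0..t} s *\<^sub>R \<A> s (z s \<omega>)) \<le> norm (L * norm (z (fst p) (snd p)))"
      using bound L by (intro AE_I2) (auto simp: space_pair_measure indicator_def abs_mult)
  qed
  have geq: "g t = (LINT s:{0..t}|lborel. \<A> s (g s))" if t: "t \<in> {0..T}" for t
  proof -
    have "g t = (\<integral>\<omega>. n t \<omega> + (\<integral>s. indicator {0..t} s *\<^sub>R \<A> s (z s \<omega>) \<partial>lbT T) \<partial>M)"
      unfolding g_def
    proof (rule integral_cong_AE[OF zm[OF t]])
      show "(\<lambda>\<omega>. n t \<omega> + (\<integral>s. indicator {0..t} s *\<^sub>R \<A> s (z s \<omega>) \<partial>lbT T)) \<in> borel_measurable M"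
        using measurable_set_integral[OF sigma_finite_measure_axioms Az t] n(1)[OF t] by (auto simp: set_integral_lbT[OF t])
      show "AE \<omega> in M. z t \<omega> = n t \<omega> + (\<integral>s. indicator {0..t} s *\<^sub>R \<A> s (z s \<omega>) \<partial>lbT T)"
        using eq by eventually_elim (use t in \<open>simp add: set_integral_lbT\<close>)
    qed
    also have "\<dots> = (\<integral>\<omega>. n t \<omega> \<partial>M) + (\<integral>\<omega>. (\<integral>s. indicator {0..t} s *\<^sub>R \<A> s (z s \<omega>) \<partial>lbT T) \<partial>M)"
      using P.integrable_snd[OF pA[of t]] n(1)[OF t] by (intro Bochner_Integration.integral_add) auto
    also have "\<dots> = (\<integral>s. (\<integral>\<omega>. indicator {0..t} s *\<^sub>R \<A> s (z s \<omega>) \<partial>M) \<partial>lbT T)"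
      using P.Fubini_integral[OF pA[of t]] n(2)[OF t] by simp
    also have "\<dots> = (\<integral>s. indicator {0..t} s *\<^sub>R \<A> s (g s) \<partial>lbT T)"
      unfolding g_def using integral_bounded_linear[OF bl iz] by (intro Bochner_Integration.integral_cong refl) simp
    finally show ?thesis by (simp add: set_integral_lbT[OF t])
  qed
  have gm: "g \<in> borel_measurable (lbT T)"
    unfolding g_def by (rule borel_measurable_lebesgue_integral) (use z in \<open>simp add: measurable_process_lbT\<close>)
  have Agm: "set_integrable lborel {0..T} (\<lambda>s. \<A> s (g s))"
  proof -
    have "integrable (lbT T) (\<lambda>s. \<A> s (g s))"
    proof -
      have "integrable (lbT T) (\<lambda>s. \<integral>\<omega>. indicator {0..T} s *\<^sub>R \<A> s (z s \<omega>) \<partial>M)"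
        by (rule P.integrable_fst[OF pA[of T]])
      moreover have "(\<integral>\<omega>. indicator {0..T} s *\<^sub>R \<A> s (z s \<omega>) \<partial>M) = \<A> s (g s)" if "s \<in> {0..T}" for s
        unfolding g_def using integral_bounded_linear[OF bl[OF that] iz[OF that]] that by simp
      ultimately show ?thesis by (subst Bochner_Integration.integrable_cong[OF refl, symmetric]) auto
    qed
    then show ?thesis
      unfolding set_integrable_def by (subst (asm) integrable_restrict_space) auto
  qed
  have hk: "(\<lambda>s. \<A> s (g s)) integrable_on {0..T}" using set_borel_integral_eq_integral(1)[OF Agm] .
  have geq': "g t = integral {0..t} (\<lambda>s. \<A> s (g s))" if t: "t \<in> {0..T}" for t
  proof -
    have "set_integrable lborel {0..t} (\<lambda>s. \<A> s (g s))"
      by (rule set_integrable_subset[OF Agm]) (use t in auto)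
    from set_borel_integral_eq_integral(2)[OF this] geq[OF t] show ?thesis by simp
  qed
  \<comment> \<open>Continuity of the mean is drawn from its representation as an indefinite
    integral of an integrable function.\<close>
  have "continuous_on {0..T} g"
    by (rule continuous_on_eq[OF indefinite_integral_continuous_1[OF hk]]) (simp add: geq')
  then have g0: "g t = 0" if "t \<in> {0..T}" for t using flow_zero[OF _ geq' that] by blast
  show ?thesis
    unfolding centered_L2_def using z i2 b2 iz g0[unfolded g_def] by blast
qed

text \<open>The bound is a maximum over the compact set of times and unit vectors, extended to all
  vectors by homogeneity.\<close>

lemma linear_family_bound:
  fixes B :: "real \<Rightarrow> 'a::euclidean_space \<Rightarrow> 'b::euclidean_space"
  assumes lin: "\<And>t. t \<in> {0..T} \<Longrightarrow> linear (B t)" and cont: "continuous_on ({0..T} \<times> UNIV) (\<lambda>(t, x). B t x)"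
  obtains b where "0 \<le> b" "\<And>t x. t \<in> {0..T} \<Longrightarrow> norm (B t x) \<le> b * norm x"
proof -
  have "continuous_on ({0..T} \<times> sphere 0 1) (\<lambda>(t, x). B t x)"
    by (rule continuous_on_subset[OF cont]) auto
  from compact_continuous_bound[OF compact_Times[OF compact_Icc compact_sphere] this]
  obtain b where b: "0 \<le> b" "\<And>p. p \<in> {0..T} \<times> sphere 0 1 \<Longrightarrow> norm (case p of (t, x) \<Rightarrow> B t x) \<le> b"
    by blast
  have "norm (B t x) \<le> b * norm x" if t: "t \<in> {0..T}" for t x
  proof (cases "x = 0")
    case True
    then show ?thesis using linear_0[OF lin[OF t]] by simp
  next
    case False
    have "norm (B t (x /\<^sub>R norm x)) \<le> b" using b(2)[of "(t, x /\<^sub>R norm x)"] t False by simp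
    then show ?thesis using False by (simp add: linear_scale[OF lin[OF t]] field_simps)
  qed
  with b(1) show ?thesis by (rule that)
qed

lemma centered_L2_image:
  fixes z :: "real \<Rightarrow> 'w \<Rightarrow> 'a::euclidean_space" and B :: "real \<Rightarrow> 'a \<Rightarrow> 'b::euclidean_space"
  assumes M: "prob_space M" and z: "centered_L2 M T z"
    and lin: "\<And>t. t \<in> {0..T} \<Longrightarrow> linear (B t)" and cont: "continuous_on ({0..T} \<times> UNIV) (\<lambda>(t, x). B t x)"
  shows "centered_L2 M T (\<lambda>t \<omega>. B t (z t \<omega>))"
proof -
  obtain b where b: "0 \<le> b" "\<And>t x. t \<in> {0..T} \<Longrightarrow> norm (B t x) \<le> b * norm x"
    using linear_family_bound[of T B] lin cont by blast
  obtain C where C: "\<And>t. t \<in> {0..T} \<Longrightarrow> integrable M (\<lambda>\<omega>. (norm (z t \<omega>))\<^sup>2)"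
    "\<And>t. t \<in> {0..T} \<Longrightarrow> (\<integral>\<omega>. (norm (z t \<omega>))\<^sup>2 \<partial>M) \<le> C"
    and iz: "\<And>t. t \<in> {0..T} \<Longrightarrow> integrable M (z t)" "\<And>t. t \<in> {0..T} \<Longrightarrow> (\<integral>\<omega>. z t \<omega> \<partial>M) = 0"
    and zm: "measurable_process M T z"
    using z unfolding centered_L2_def by blast
  have bl: "bounded_linear (B t)" if "t \<in> {0..T}" for t using lin[OF that] by (simp add: linear_conv_bounded_linear)
  have mB: "measurable_process M T (\<lambda>t \<omega>. B t (z t \<omega>))" by (rule measurable_process_compose[OF zm cont])
  have le: "(norm (B t x))\<^sup>2 \<le> b\<^sup>2 * (norm x)\<^sup>2" if "t \<in> {0..T}" for t x
    using power_mono[OF b(2)[OF that, of x], of 2] by (simp add: power_mult_distrib)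
  have i2: "integrable M (\<lambda>\<omega>. (norm (B t (z t \<omega>)))\<^sup>2)" if t: "t \<in> {0..T}" for t
  proof (rule Bochner_Integration.integrable_bound[of _ "\<lambda>\<omega>. b\<^sup>2 * (norm (z t \<omega>))\<^sup>2"])
    show "integrable M (\<lambda>\<omega>. b\<^sup>2 * (norm (z t \<omega>))\<^sup>2)" using C(1)[OF t] by simp
    show "(\<lambda>\<omega>. (norm (B t (z t \<omega>)))\<^sup>2) \<in> borel_measurable M" using measurable_process_slice[OF mB t] by simp
  qed (use le[OF t] in auto)
  have "(\<integral>\<omega>. (norm (B t (z t \<omega>)))\<^sup>2 \<partial>M) \<le> b\<^sup>2 * C" if t: "t \<in> {0..T}" for t
  proof -
    have "(\<integral>\<omega>. (norm (B t (z t \<omega>)))\<^sup>2 \<partial>M) \<le> (\<integral>\<omega>. b\<^sup>2 * (norm (z t \<omega>))\<^sup>2 \<partial>M)"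
      using C(1)[OF t] by (intro integral_mono i2 t le) auto
    also have "\<dots> \<le> b\<^sup>2 * C" using C(2)[OF t] by (simp add: mult_left_mono)
    finally show ?thesis .
  qed
  moreover have "integrable M (\<lambda>\<omega>. B t (z t \<omega>))" "(\<integral>\<omega>. B t (z t \<omega>) \<partial>M) = 0" if t: "t \<in> {0..T}" for t
    using integrable_bounded_linear[OF bl[OF t] iz(1)[OF t]] integral_bounded_linear[OF bl[OF t] iz(1)[OF t]] iz(2)[OF t]
      linear_0[OF lin[OF t]] by auto
  ultimately show ?thesis unfolding centered_L2_def using mB i2 by blast
qed

lemma set_integral_lbT_full:
  fixes f :: "real \<Rightarrow> real"
  shows "(LINT s:{0..T}|lborel. f s) = (\<integral>s. f s \<partial>lbT T)"
  by (subst integral_restrict_space) (auto simp: set_lebesgue_integral_def)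

text \<open>The quadratic form splits into a deterministic part, mixed terms and a centred part, and
  the mixed terms have mean zero. Almost sure integrability in time is exported as well, because one
  criterion puts two such forms under a single time integral.\<close>

lemma quadratic_expectation:
  fixes x :: "real \<Rightarrow> 'w \<Rightarrow> real^'k" and Q :: "real \<Rightarrow> real^'k^'k"
  assumes M: "prob_space M" and T: "0 \<le> T" and x: "centered_L2 M T x"
    and xb: "continuous_on {0..T} xb" and Q: "continuous_on {0..T} Q"
  defines "X \<equiv> \<lambda>t \<omega>. xb t + x t \<omega>"
  shows "integrable M (\<lambda>\<omega>. LINT t:{0..T}|lborel. X t \<omega> \<bullet> (Q t *v X t \<omega>))"
    and "(\<integral>\<omega>. (LINT t:{0..T}|lborel. X t \<omega> \<bullet> (Q t *v X t \<omega>)) \<partial>M)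
      = integral {0..T} (\<lambda>t. xb t \<bullet> (Q t *v xb t)) + (\<integral>\<omega>. (LINT t:{0..T}|lborel. x t \<omega> \<bullet> (Q t *v x t \<omega>)) \<partial>M)"
    and "AE \<omega> in M. set_integrable lborel {0..T} (\<lambda>t. X t \<omega> \<bullet> (Q t *v X t \<omega>))"
proof -
  interpret prob_space M by fact
  interpret T: finite_measure "lbT T" by (rule finite_measure_lbT)
  interpret P: pair_sigma_finite "lbT T" M ..
  interpret F: finite_measure "lbT T \<Otimes>\<^sub>M M" by (rule finite_measure_pair_measure) unfold_locales
  obtain C where C: "\<And>t. t \<in> {0..T} \<Longrightarrow> integrable M (\<lambda>\<omega>. (norm (x t \<omega>))\<^sup>2)"
    "\<And>t. t \<in> {0..T} \<Longrightarrow> (\<integral>\<omega>. (norm (x t \<omega>))\<^sup>2 \<partial>M) \<le> C"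
    and ix: "\<And>t. t \<in> {0..T} \<Longrightarrow> integrable M (x t)" "\<And>t. t \<in> {0..T} \<Longrightarrow> (\<integral>\<omega>. x t \<omega> \<partial>M) = 0"
    and xm: "measurable_process M T x"
    using x unfolding centered_L2_def by blast
  note px = centered_L2_pair_integrable[OF M xm C]
  obtain K where K: "0 < K" "\<And>(B :: real^'k^'k) (v :: real^'k). norm (B *v v) \<le> norm B * norm v * K"
    using bounded_bilinear.pos_bounded[OF bounded_bilinear_matrix_vector_mult] by blast
  obtain q where q: "0 \<le> q" "\<And>t. t \<in> {0..T} \<Longrightarrow> norm (Q t) \<le> q"
    using compact_continuous_bound[OF _ Q] by (metis compact_Icc)
  obtain c where c: "0 \<le> c" "\<And>t. t \<in> {0..T} \<Longrightarrow> norm (xb t) \<le> c"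
    using compact_continuous_bound[OF _ xb] by (metis compact_Icc)
  have Qb: "\<bar>u \<bullet> (Q t *v v)\<bar> \<le> q * K * (norm u * norm v)" if t: "t \<in> {0..T}" for t u v
  proof -
    have "\<bar>u \<bullet> (Q t *v v)\<bar> \<le> norm u * norm (Q t *v v)" by (rule Cauchy_Schwarz_ineq2)
    also have "\<dots> \<le> norm u * (q * norm v * K)"
      using q(2)[OF t] K(1) by (intro mult_left_mono order.trans[OF K(2)] mult_right_mono) auto
    finally show ?thesis by (simp add: mult_ac)
  qed
  define f1 where "f1 t \<omega> = xb t \<bullet> (Q t *v xb t)" for t and \<omega> :: 'w
  define f2 where "f2 t \<omega> = xb t \<bullet> (Q t *v x t \<omega>) + x t \<omega> \<bullet> (Q t *v xb t)" for t and \<omega> :: 'w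
  define f4 where "f4 t \<omega> = x t \<omega> \<bullet> (Q t *v x t \<omega>)" for t and \<omega> :: 'w
  have X: "X t \<omega> \<bullet> (Q t *v X t \<omega>) = f1 t \<omega> + f2 t \<omega> + f4 t \<omega>" for t \<omega>
    by (simp add: X_def f1_def f2_def f4_def matrix_vector_right_distrib inner_add_left inner_add_right)
  have cQ: "continuous_on ({0..T} \<times> UNIV) (\<lambda>p. Q (fst p))" "continuous_on ({0..T} \<times> UNIV) (\<lambda>p. xb (fst p))"
    for U :: "(real^'k) set"
    by (rule continuous_on_compose2[OF Q] continuous_on_compose2[OF xb], auto intro!: continuous_intros)+
  have m: "measurable_process M T f1" "measurable_process M T f2" "measurable_process M T f4"
  proof -
    have "measurable_process M T (\<lambda>t \<omega>. (\<lambda>t v. xb t \<bullet> (Q t *v xb t)) t (x t \<omega>))"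
      "measurable_process M T (\<lambda>t \<omega>. (\<lambda>t v. xb t \<bullet> (Q t *v v) + v \<bullet> (Q t *v xb t)) t (x t \<omega>))"
      "measurable_process M T (\<lambda>t \<omega>. (\<lambda>t v. v \<bullet> (Q t *v v)) t (x t \<omega>))"
      by (rule measurable_process_compose[OF xm], unfold case_prod_unfold,
          intro continuous_intros continuous_on_inner cQ)+
    then show "measurable_process M T f1" "measurable_process M T f2" "measurable_process M T f4"
      by (simp_all add: f1_def[abs_def] f2_def[abs_def] f4_def[abs_def])
  qed
  note m = m[unfolded measurable_process_lbT]
  have i1: "integrable (lbT T \<Otimes>\<^sub>M M) (\<lambda>(t, \<omega>). f1 t \<omega>)"
    by (rule F.integrable_const_bound[OF _ m(1), of "q * K * (c * c)"])
      (use Qb c q K in \<open>auto intro!: AE_I2 order.trans[OF Qb] mult_left_mono mult_mono simp: f1_def space_pair_measure\<close>)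
  have i2: "integrable (lbT T \<Otimes>\<^sub>M M) (\<lambda>(t, \<omega>). f2 t \<omega>)"
  proof (rule Bochner_Integration.integrable_bound[OF _ m(2)])
    show "integrable (lbT T \<Otimes>\<^sub>M M) (\<lambda>p. 2 * (q * K * c) * norm (x (fst p) (snd p)))" using px(2) by simp
    have "\<bar>f2 t \<omega>\<bar> \<le> 2 * (q * K * c) * norm (x t \<omega>)" if t: "t \<in> {0..T}" for t \<omega>
    proof -
      have "\<bar>f2 t \<omega>\<bar> \<le> q * K * (norm (xb t) * norm (x t \<omega>)) + q * K * (norm (x t \<omega>) * norm (xb t))"
        unfolding f2_def by (intro order.trans[OF abs_triangle_ineq] add_mono Qb t)
      also have "\<dots> \<le> q * K * (c * norm (x t \<omega>)) + q * K * (norm (x t \<omega>) * c)"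
        using c(2)[OF t] q K by (intro add_mono mult_left_mono mult_right_mono) auto
      finally show ?thesis by (simp add: algebra_simps)
    qed
    then show "AE p in lbT T \<Otimes>\<^sub>M M. norm (case p of (t, \<omega>) \<Rightarrow> f2 t \<omega>) \<le> norm (2 * (q * K * c) * norm (x (fst p) (snd p)))"
      using c q K by (intro AE_I2) (auto simp: space_pair_measure abs_mult)
  qed
  have i4: "integrable (lbT T \<Otimes>\<^sub>M M) (\<lambda>(t, \<omega>). f4 t \<omega>)"
  proof (rule Bochner_Integration.integrable_bound[OF _ m(3)])
    show "integrable (lbT T \<Otimes>\<^sub>M M) (\<lambda>p. q * K * (norm (x (fst p) (snd p)))\<^sup>2)" using px(1) by simp
    show "AE p in lbT T \<Otimes>\<^sub>M M. norm (case p of (t, \<omega>) \<Rightarrow> f4 t \<omega>) \<le> norm (q * K * (norm (x (fst p) (snd p)))\<^sup>2)"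
      using Qb q K by (intro AE_I2) (auto simp: space_pair_measure abs_mult f4_def power2_eq_square)
  qed
  have iX: "integrable (lbT T \<Otimes>\<^sub>M M) (\<lambda>(t, \<omega>). X t \<omega> \<bullet> (Q t *v X t \<omega>))"
    using Bochner_Integration.integrable_add[OF Bochner_Integration.integrable_add[OF i1 i2] i4]
    by (simp add: X case_prod_unfold)
  show "integrable M (\<lambda>\<omega>. LINT t:{0..T}|lborel. X t \<omega> \<bullet> (Q t *v X t \<omega>))"
    unfolding set_integral_lbT_full by (rule P.integrable_snd[OF iX])
  have "(\<integral>\<omega>. (LINT t:{0..T}|lborel. X t \<omega> \<bullet> (Q t *v X t \<omega>)) \<partial>M)
      = (\<integral>p. (case p of (t, \<omega>) \<Rightarrow> X t \<omega> \<bullet> (Q t *v X t \<omega>)) \<partial>(lbT T \<Otimes>\<^sub>M M))"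
    unfolding set_integral_lbT_full by (rule P.integral_snd[OF iX])
  also have "\<dots> = (\<integral>p. (case p of (t, \<omega>) \<Rightarrow> f1 t \<omega>) + (case p of (t, \<omega>) \<Rightarrow> f2 t \<omega>) + (case p of (t, \<omega>) \<Rightarrow> f4 t \<omega>) \<partial>(lbT T \<Otimes>\<^sub>M M))"
    by (simp add: X case_prod_unfold)
  also have "\<dots> = (\<integral>p. (case p of (t, \<omega>) \<Rightarrow> f1 t \<omega>) \<partial>(lbT T \<Otimes>\<^sub>M M))
      + (\<integral>p. (case p of (t, \<omega>) \<Rightarrow> f2 t \<omega>) \<partial>(lbT T \<Otimes>\<^sub>M M)) + (\<integral>p. (case p of (t, \<omega>) \<Rightarrow> f4 t \<omega>) \<partial>(lbT T \<Otimes>\<^sub>M M))"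
    using i1 i2 i4 by (subst Bochner_Integration.integral_add | simp)+
  also have "(\<integral>p. (case p of (t, \<omega>) \<Rightarrow> f1 t \<omega>) \<partial>(lbT T \<Otimes>\<^sub>M M)) = integral {0..T} (\<lambda>t. xb t \<bullet> (Q t *v xb t))"
  proof -
    have "(\<integral>p. (case p of (t, \<omega>) \<Rightarrow> f1 t \<omega>) \<partial>(lbT T \<Otimes>\<^sub>M M)) = (\<integral>t. (\<integral>\<omega>. f1 t \<omega> \<partial>M) \<partial>lbT T)"
      by (rule P.integral_fst'[OF i1, symmetric, simplified])
    also have "\<dots> = (LINT t:{0..T}|lborel. xb t \<bullet> (Q t *v xb t))"
      unfolding set_integral_lbT_full by (simp add: f1_def prob_space)
    also have "\<dots> = integral {0..T} (\<lambda>t. xb t \<bullet> (Q t *v xb t))"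
      by (rule set_integral_continuous(1)[of T]) (intro continuous_on_inner continuous_intros xb Q, simp)
    finally show ?thesis .
  qed
  \<comment> \<open>At each fixed time the mixed terms are linear in the centred variable.\<close>
  also have "(\<integral>p. (case p of (t, \<omega>) \<Rightarrow> f2 t \<omega>) \<partial>(lbT T \<Otimes>\<^sub>M M)) = 0"
  proof -
    have "(\<integral>p. (case p of (t, \<omega>) \<Rightarrow> f2 t \<omega>) \<partial>(lbT T \<Otimes>\<^sub>M M)) = (\<integral>t. (\<integral>\<omega>. f2 t \<omega> \<partial>M) \<partial>lbT T)"
      by (rule P.integral_fst'[OF i2, symmetric, simplified])
    also have "\<dots> = (\<integral>t. 0 \<partial>lbT T)"
    proof (rule Bochner_Integration.integral_cong[OF refl])
      fix t assume "t \<in> space (lbT T)"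
      then have t: "t \<in> {0..T}" by simp
      have Qx: "integrable M (\<lambda>\<omega>. Q t *v x t \<omega>)" "(\<integral>\<omega>. Q t *v x t \<omega> \<partial>M) = 0"
        using integrable_bounded_linear[OF matrix_vector_mul_bounded_linear ix(1)[OF t]]
          integral_bounded_linear[OF matrix_vector_mul_bounded_linear ix(1)[OF t]] ix(2)[OF t] by auto
      have "(\<integral>\<omega>. f2 t \<omega> \<partial>M) = (\<integral>\<omega>. xb t \<bullet> (Q t *v x t \<omega>) \<partial>M) + (\<integral>\<omega>. x t \<omega> \<bullet> (Q t *v xb t) \<partial>M)"
        unfolding f2_def using Qx(1) ix(1)[OF t] by (intro Bochner_Integration.integral_add) auto
      also have "\<dots> = 0" using Qx ix(1,2)[OF t] by simp
      finally show "(\<integral>\<omega>. f2 t \<omega> \<partial>M) = 0" .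
    qed
    finally show ?thesis by simp
  qed
  also have "(\<integral>p. (case p of (t, \<omega>) \<Rightarrow> f4 t \<omega>) \<partial>(lbT T \<Otimes>\<^sub>M M)) = (\<integral>\<omega>. (LINT t:{0..T}|lborel. x t \<omega> \<bullet> (Q t *v x t \<omega>)) \<partial>M)"
    unfolding set_integral_lbT_full f4_def[symmetric] by (rule P.integral_snd[OF i4, symmetric])
  finally show "(\<integral>\<omega>. (LINT t:{0..T}|lborel. X t \<omega> \<bullet> (Q t *v X t \<omega>)) \<partial>M)
      = integral {0..T} (\<lambda>t. xb t \<bullet> (Q t *v xb t)) + (\<integral>\<omega>. (LINT t:{0..T}|lborel. x t \<omega> \<bullet> (Q t *v x t \<omega>)) \<partial>M)"
    by simp
  show "AE \<omega> in M. set_integrable lborel {0..T} (\<lambda>t. X t \<omega> \<bullet> (Q t *v X t \<omega>))"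
    using P.AE_integrable_snd[OF iX]
  proof eventually_elim
    case (elim \<omega>)
    then show ?case unfolding set_integrable_def by (subst (asm) integrable_restrict_space) auto
  qed
qed

section \<open>The martingale part of the Ito integral\<close>

text \<open>Rounding down keeps the rational approximants inside [0, T], also when \<open>t\<close>
  is an irrational right end point.\<close>

lemma floor_approx:
  fixes t :: real
  assumes t: "t \<in> {0..T}"
  defines "r \<equiv> \<lambda>n. of_int \<lfloor>real (Suc n) * t\<rfloor> / real (Suc n)"
  shows "r \<longlonglongrightarrow> t" "r n \<in> {0..T} \<inter> \<rat>"
proof -
  have b: "t - 1 / real (Suc n) \<le> r n" "r n \<le> t" "0 \<le> r n" for n
  proof -
    define m where "m = real (Suc n)"
    have m: "0 < m" by (simp add: m_def)
    have f: "of_int \<lfloor>m * t\<rfloor> \<le> m * t" "m * t - 1 \<le> of_int \<lfloor>m * t\<rfloor>"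
      by linarith+
    have "t - 1 / m = (m * t - 1) / m" using m by (simp add: field_simps)
    also have "\<dots> \<le> of_int \<lfloor>m * t\<rfloor> / m" using f m by (intro divide_right_mono) auto
    finally show "t - 1 / real (Suc n) \<le> r n" by (simp only: r_def m_def)
    have "of_int \<lfloor>m * t\<rfloor> / m \<le> (m * t) / m" using f m by (intro divide_right_mono) auto
    then show "r n \<le> t" using m by (simp add: r_def m_def)
    have "0 \<le> real (Suc n) * t" using t by (intro mult_nonneg_nonneg) auto
    then show "0 \<le> r n" unfolding r_def by (intro divide_nonneg_pos) auto
  qed
  have "(\<lambda>n. t - 1 / real (Suc n)) \<longlonglongrightarrow> t - 0"
    by (intro tendsto_diff tendsto_const LIMSEQ_Suc lim_1_over_n)
  then have lim: "(\<lambda>n. t - 1 / real (Suc n)) \<longlonglongrightarrow> t" by (simp only: diff_0_right)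
  show "r \<longlonglongrightarrow> t"
    by (rule tendsto_sandwich[OF _ _ lim tendsto_const]; rule always_eventually; rule allI; rule b)
  have "r n \<in> {0..T}" using order.trans[OF b(2)[of n], of T] b(3)[of n] t by auto
  moreover have "r n \<in> \<rat>" unfolding r_def by (intro Rats_divide Rats_of_int Rats_of_nat)
  ultimately show "r n \<in> {0..T} \<inter> \<rat>" ..
qed

text \<open>The exceptional null set may depend on \<open>t\<close>. Countably many of them, at
  rational times, are united, and continuity of the paths extends the equality to all times.\<close>

lemma AE_continuous_eq:
  fixes X Y :: "real \<Rightarrow> 'w \<Rightarrow> 'a::euclidean_space"
  assumes eq: "\<And>t. t \<in> {0..T} \<Longrightarrow> AE \<omega> in M. X t \<omega> = Y t \<omega>"
    and c: "AE \<omega> in M. continuous_on {0..T} (\<lambda>t. X t \<omega>)" "AE \<omega> in M. continuous_on {0..T} (\<lambda>t. Y t \<omega>)"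
  shows "AE \<omega> in M. \<forall>t\<in>{0..T}. X t \<omega> = Y t \<omega>"
proof -
  have "countable ({0..T} \<inter> \<rat>)" using countable_rat by (rule countable_subset[rotated]) auto
  then have "AE \<omega> in M. \<forall>t\<in>{0..T} \<inter> \<rat>. X t \<omega> = Y t \<omega>"
    using eq by (intro AE_ball_countable') auto
  with c show ?thesis
  proof eventually_elim
    case (elim \<omega>)
    show ?case
    proof
      fix t assume t: "t \<in> {0..T}"
      define r where "r n = of_int \<lfloor>real (Suc n) * t\<rfloor> / real (Suc n)" for n
      note r = floor_approx[OF t, folded r_def]
      have "(\<lambda>n. X (r n) \<omega>) \<longlonglongrightarrow> X t \<omega>" "(\<lambda>n. Y (r n) \<omega>) \<longlonglongrightarrow> Y t \<omega>"
        using r t by (auto intro!: continuous_on_tendsto_compose[OF elim(1)] continuous_on_tendsto_compose[OF elim(2)]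
            always_eventually)
      moreover have "X (r n) \<omega> = Y (r n) \<omega>" for n using elim(3) r(2) by blast
      ultimately show "X t \<omega> = Y t \<omega>" by (simp add: LIMSEQ_unique)
    qed
  qed
qed

context
  fixes M :: "'w measure" and W :: "real \<Rightarrow> 'w \<Rightarrow> real^'q" and T :: real
    and g :: "real \<Rightarrow> real^'m^'d" and \<sigma> :: "real^'q^'m"
  assumes M: "prob_space M" and W: "brownian_motion M W" and T: "0 < T" and g: "continuous_on {0..T} g"
begin

interpretation prob_space M by (rule M)

text \<open>Riemann sums of the martingale part of the integral against \<open>Yc\<close>. They
  involve only \<open>W\<close>, not \<tau>, and thus are common to all attacks.\<close>

definition noise_sum :: "real \<Rightarrow> nat \<Rightarrow> 'w \<Rightarrow> real^'d" where
  "noise_sum t n \<omega> = (\<Sum>k<n. (g (real k * t / real n) ** \<sigma>) *v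
     (W (real (Suc k) * t / real n) \<omega> - W (real k * t / real n) \<omega>))"

lemma noise_sum_measurable:
  assumes "0 \<le> t"
  shows "noise_sum t n \<in> borel_measurable M"
proof -
  have [measurable]: "W (real k * t / real n) \<in> borel_measurable M" for k
    using assms by (intro brownian_measurable[OF M W]) auto
  have "(\<lambda>\<omega>. (g (real k * t / real n) ** \<sigma>) *v (W (real (Suc k) * t / real n) \<omega> - W (real k * t / real n) \<omega>)) \<in> borel_measurable M" for k
    by (rule measurable_compose[of "\<lambda>\<omega>. W (real (Suc k) * t / real n) \<omega> - W (real k * t / real n) \<omega>" M borel])
      (auto intro!: borel_measurable_continuous_onI continuous_intros borel_measurable_diff simp del: of_nat_Suc)
  then show ?thesis unfolding noise_sum_def by (intro borel_measurable_sum)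
qed

text \<open>One constant serves every time and every limit of the noise sums, whichever attack or
  filter the limit comes from.\<close>

lemma noise_moments:
  obtains C where "\<And>t N. t \<in> {0..T} \<Longrightarrow> N \<in> borel_measurable M \<Longrightarrow> conv0 M (\<lambda>n \<omega>. noise_sum t n \<omega> - N \<omega>) \<Longrightarrow>
    integrable M N \<and> (\<integral>\<omega>. N \<omega> \<partial>M) = 0 \<and> integrable M (\<lambda>\<omega>. (norm (N \<omega>))\<^sup>2) \<and> (\<integral>\<omega>. (norm (N \<omega>))\<^sup>2 \<partial>M) \<le> C"
proof -
  have "continuous_on ({0..T} \<times> UNIV) (\<lambda>p. (g (fst p) ** \<sigma>) *v snd p)"
    by (intro continuous_intros continuous_on_compose2[OF g]) auto
  then obtain b where b: "0 \<le> b" "\<And>t x. t \<in> {0..T} \<Longrightarrow> norm ((g t ** \<sigma>) *v x) \<le> b * norm x"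
    using linear_family_bound[of T "\<lambda>t x. (g t ** \<sigma>) *v x"] by (auto simp: case_prod_unfold)
  show ?thesis
  proof (rule that[of "b\<^sup>2 * CARD('q) * T"])
    fix t N assume t: "t \<in> {0..T}" and N: "N \<in> borel_measurable M" "conv0 M (\<lambda>n \<omega>. noise_sum t n \<omega> - N \<omega>)"
    have p: "real k * t / real n \<in> {0..T}" if "k < n" for k n
    proof -
      have "real k / real n * t \<le> 1 * t" using that t by (intro mult_right_mono) auto
      then show ?thesis using t by auto
    qed
    have B: "norm ((g (real k * t / real n) ** \<sigma>) *v x) \<le> b * norm x" if "k < n" for k n x
      using b(2)[OF p[OF that]] .
    have t0: "0 \<le> t" using t by simp
    have S: "integrable M (noise_sum t n)" "(\<integral>\<omega>. noise_sum t n \<omega> \<partial>M) = 0"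
      "integrable M (\<lambda>\<omega>. (norm (noise_sum t n \<omega>))\<^sup>2)"
      "(\<integral>\<omega>. (norm (noise_sum t n \<omega>))\<^sup>2 \<partial>M) \<le> b\<^sup>2 * CARD('q) * t" for n
      unfolding noise_sum_def[abs_def]
      by (rule brownian_riemann_sum(1)[OF M W t0 b(1)], erule B,
          rule brownian_riemann_sum(2)[OF M W t0 b(1)], erule B,
          rule brownian_riemann_sum(3)[OF M W t0 b(1)], erule B,
          rule brownian_riemann_sum(4)[OF M W t0 b(1)], erule B)
    have S4: "(\<integral>\<omega>. (norm (noise_sum t n \<omega>))\<^sup>2 \<partial>M) \<le> b\<^sup>2 * CARD('q) * T" for n
      by (rule order.trans[OF S(4)]) (use t in \<open>auto intro!: mult_left_mono\<close>)
    show "integrable M N \<and> (\<integral>\<omega>. N \<omega> \<partial>M) = 0 \<and> integrable M (\<lambda>\<omega>. (norm (N \<omega>))\<^sup>2) \<and> (\<integral>\<omega>. (norm (N \<omega>))\<^sup>2 \<partial>M) \<le> b\<^sup>2 * CARD('q) * T"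
      using L2_limit[OF S(1) S(2) S(3) S4 N] by blast
  qed
qed

text \<open>Identifies the martingale parts both of the two filters within one system and of the
  systems under two different attacks.\<close>

lemma noise_unique:
  assumes t: "t \<in> {0..T}" and N: "N \<in> borel_measurable M" "conv0 M (\<lambda>n \<omega>. noise_sum t n \<omega> - N \<omega>)"
    and N': "N' \<in> borel_measurable M" "conv0 M (\<lambda>n \<omega>. noise_sum t n \<omega> - N' \<omega>)"
  shows "AE \<omega> in M. N \<omega> = N' \<omega>"
proof -
  have S: "noise_sum t n \<in> borel_measurable M" for n using t by (intro noise_sum_measurable) auto
  have "conv0 M (\<lambda>n \<omega>. (noise_sum t n \<omega> - N \<omega>) + - (noise_sum t n \<omega> - N' \<omega>))"
    using N N' S by (intro conv0_add) (auto simp only: conv0_minus intro!: borel_measurable_diff borel_measurable_uminus)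
  then have "conv0 M (\<lambda>_::nat. \<lambda>\<omega>. N' \<omega> - N \<omega>)" by simp
  from conv0_const[OF _ this] N(1) N'(1) have "AE \<omega> in M. N' \<omega> - N \<omega> = 0" by simp
  then show ?thesis by eventually_elim simp
qed

text \<open>Riemann sums against \<open>Y\<close> are noise sums plus sums against increments of the
  integral of \<open>y\<close>. The latter converge pathwise to the drift integral, so subtracting
  it from \<open>I\<close> leaves the limit of the noise sums.\<close>

lemma ito_noise:
  fixes Y :: "real \<Rightarrow> 'w \<Rightarrow> real^'m" and y :: "real \<Rightarrow> 'w \<Rightarrow> real^'m"
  assumes I: "ito_integral M T g Y I" and Ym: "\<And>t. t \<in> {0..T} \<Longrightarrow> Y t \<in> borel_measurable M"
    and y: "measurable_process M T y" "AE \<omega> in M. continuous_on {0..T} (\<lambda>t. y t \<omega>)"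
    and eq: "AE \<omega> in M. \<forall>t\<in>{0..T}. Y t \<omega> = (LINT s:{0..t}|lborel. y s \<omega>) + \<sigma> *v W t \<omega>"
  defines "N \<equiv> \<lambda>t \<omega>. I t \<omega> - (LINT s:{0..t}|lborel. g s *v y s \<omega>)"
  shows "\<And>t. t \<in> {0..T} \<Longrightarrow> N t \<in> borel_measurable M"
    and "AE \<omega> in M. continuous_on {0..T} (\<lambda>t. N t \<omega>)"
    and "\<And>t. t \<in> {0..T} \<Longrightarrow> conv0 M (\<lambda>n \<omega>. noise_sum t n \<omega> - N t \<omega>)"
proof -
  have "continuous_on ({0..T} \<times> UNIV) (\<lambda>p. g (fst p) *v snd p)"
    by (intro continuous_intros continuous_on_compose2[OF g]) auto
  then have gy: "measurable_process M T (\<lambda>t \<omega>. g t *v y t \<omega>)"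
    by (intro measurable_process_compose[OF y(1), of "\<lambda>t x. g t *v x"]) (simp add: case_prod_unfold)
  have sint: "(\<lambda>\<omega>. LINT s:{0..t}|lborel. g s *v y s \<omega>) \<in> borel_measurable M" if "t \<in> {0..T}" for t
    by (rule measurable_set_integral[OF sigma_finite_measure_axioms gy that])
  have Im: "I t \<in> borel_measurable M" if "t \<in> {0..T}" for t using I that by (simp add: ito_integral_def)
  show Nm: "N t \<in> borel_measurable M" if "t \<in> {0..T}" for t
    unfolding N_def using Im[OF that] sint[OF that] by (rule borel_measurable_diff)
  have "AE \<omega> in M. continuous_on {0..T} (\<lambda>t. I t \<omega>)" using I by (simp add: ito_integral_def)
  with y(2) show "AE \<omega> in M. continuous_on {0..T} (\<lambda>t. N t \<omega>)"
  proof eventually_elim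
    case (elim \<omega>)
    have c: "continuous_on {0..T} (\<lambda>s. g s *v y s \<omega>)" by (intro continuous_intros g elim)
    have "continuous_on {0..T} (\<lambda>t. I t \<omega> - integral {0..t} (\<lambda>s. g s *v y s \<omega>))"
      by (intro continuous_intros elim indefinite_integral_continuous_1 integrable_continuous_real c)
    then show ?case
      by (rule continuous_on_eq) (simp add: N_def set_integral_continuous(1)[OF c])
  qed
  fix t assume t: "t \<in> {0..T}"
  \<comment> \<open>k = n is included because the last cell ends there; for n = 0 the quotient is 0
    by the convention on division.\<close>
  have p: "real k * t / real n \<in> {0..T}" if "k \<le> n" for k n
  proof (cases "n = 0")
    case False
    have "real k / real n * t \<le> 1 * t" using that t False by (intro mult_right_mono) auto
    then show ?thesis using t by auto
  qed (use T in simp)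
  define SY where "SY n \<omega> = (\<Sum>k<n. g (real k * t / real n) *v
     (Y (real (Suc k) * t / real n) \<omega> - Y (real k * t / real n) \<omega>))" for n \<omega>
  have SYm: "SY n \<in> borel_measurable M" for n
  proof -
    have "(\<lambda>\<omega>. g (real k * t / real n) *v (Y (real (Suc k) * t / real n) \<omega> - Y (real k * t / real n) \<omega>)) \<in> borel_measurable M"
      if "k < n" for k
    proof (rule measurable_compose[of "\<lambda>\<omega>. Y (real (Suc k) * t / real n) \<omega> - Y (real k * t / real n) \<omega>" M borel])
      show "(\<lambda>\<omega>. Y (real (Suc k) * t / real n) \<omega> - Y (real k * t / real n) \<omega>) \<in> borel_measurable M"
        using that by (intro borel_measurable_diff Ym p) auto
    qed (intro borel_measurable_continuous_onI continuous_intros)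
    then show ?thesis unfolding SY_def by (intro borel_measurable_sum) auto
  qed
  have Sm: "noise_sum t n \<in> borel_measurable M" for n using t by (intro noise_sum_measurable) auto
  have c1: "conv0 M (\<lambda>n \<omega>. SY n \<omega> - I t \<omega>)"
  proof (rule conv0_prob)
    show "(\<lambda>\<omega>. SY n \<omega> - I t \<omega>) \<in> borel_measurable M" for n by (intro borel_measurable_diff SYm Im t)
    show "(\<lambda>n. prob {\<omega> \<in> space M. \<epsilon> < norm (SY n \<omega> - I t \<omega>)}) \<longlonglongrightarrow> 0" if "0 < \<epsilon>" for \<epsilon>
      using I t that unfolding ito_integral_def SY_def by blast
  qed
  \<comment> \<open>The difference of the two sums sees only the drift and converges almost surely.
    The sign is chosen so that adding \<open>c1\<close> cancels \<open>SY\<close>.\<close>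
  have c2: "conv0 M (\<lambda>n \<omega>. - (SY n \<omega> - noise_sum t n \<omega> - (LINT s:{0..t}|lborel. g s *v y s \<omega>)))"
    unfolding conv0_minus
  proof (rule conv0_AE)
    show "(\<lambda>\<omega>. SY n \<omega> - noise_sum t n \<omega> - (LINT s:{0..t}|lborel. g s *v y s \<omega>)) \<in> borel_measurable M" for n
      by (intro borel_measurable_diff SYm Sm sint t)
    show "AE \<omega> in M. (\<lambda>n. SY n \<omega> - noise_sum t n \<omega> - (LINT s:{0..t}|lborel. g s *v y s \<omega>)) \<longlonglongrightarrow> 0"
      using y(2) eq
    proof eventually_elim
      case (elim \<omega>)
      have sub: "{0..t} \<subseteq> {0..T}" using t by auto
      have c: "continuous_on {0..T} (\<lambda>s. g s *v y s \<omega>)" by (intro continuous_intros g elim)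
      have Y: "Y r \<omega> - \<sigma> *v W r \<omega> = integral {0..r} (\<lambda>s. y s \<omega>)" if "r \<in> {0..T}" for r
        using elim(2) that set_integral_continuous(1)[OF elim(1), of r] by auto
      have "SY n \<omega> - noise_sum t n \<omega> = (\<Sum>k<n. g (real k * t / real n) *v
         (integral {0..real (Suc k) * t / real n} (\<lambda>s. y s \<omega>) - integral {0..real k * t / real n} (\<lambda>s. y s \<omega>)))" for n
        unfolding SY_def noise_sum_def sum_subtractf[symmetric]
      proof (rule sum.cong[OF refl])
        fix k assume "k \<in> {..<n}"
        then have k: "real (Suc k) * t / real n \<in> {0..T}" "real k * t / real n \<in> {0..T}" using p[of "Suc k" n] p[of k n] by auto
        show "g (real k * t / real n) *v (Y (real (Suc k) * t / real n) \<omega> - Y (real k * t / real n) \<omega>) -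
          (g (real k * t / real n) ** \<sigma>) *v (W (real (Suc k) * t / real n) \<omega> - W (real k * t / real n) \<omega>) =
          g (real k * t / real n) *v
            (integral {0..real (Suc k) * t / real n} (\<lambda>s. y s \<omega>) - integral {0..real k * t / real n} (\<lambda>s. y s \<omega>))"
          unfolding Y[OF k(1), symmetric] Y[OF k(2), symmetric]
          by (simp add: matrix_vector_mul_assoc[symmetric] matrix_vector_mult_diff_distrib algebra_simps del: of_nat_Suc)
      qed
      moreover have "(\<lambda>n. \<Sum>k<n. g (real k * t / real n) *v
         (integral {0..real (Suc k) * t / real n} (\<lambda>s. y s \<omega>) - integral {0..real k * t / real n} (\<lambda>s. y s \<omega>)))
         \<longlonglongrightarrow> integral {0..t} (\<lambda>s. g s *v y s \<omega>)"
        using t by (intro riemann_sum_tendsto[OF bounded_bilinear_matrix_vector_mult] continuous_on_subset[OF g sub]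
            continuous_on_subset[OF elim(1) sub]) auto
      ultimately have "(\<lambda>n. SY n \<omega> - noise_sum t n \<omega>) \<longlonglongrightarrow> integral {0..t} (\<lambda>s. g s *v y s \<omega>)" by simp
      from tendsto_diff[OF this tendsto_const[of "integral {0..t} (\<lambda>s. g s *v y s \<omega>)"]]
      show ?case using t by (simp add: set_integral_continuous(1)[OF c])
    qed
  qed
  have "conv0 M (\<lambda>n \<omega>. (SY n \<omega> - I t \<omega>) + - (SY n \<omega> - noise_sum t n \<omega> - (LINT s:{0..t}|lborel. g s *v y s \<omega>)))"
    by (intro conv0_add c1 c2 borel_measurable_diff borel_measurable_uminus SYm Sm Im sint t)
  then show "conv0 M (\<lambda>n \<omega>. noise_sum t n \<omega> - N t \<omega>)"
    by (simp add: N_def algebra_simps)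
qed

end

section \<open>The closed-loop deviations\<close>

lemma Concat_matrix_mult: "Concat P Q R *v v = Concat (P *v v) (Q *v v) (R *v v)" for P :: "real^'n^'d"
  by (auto simp: vec_eq_iff matrix_vector_mult_def Concat_def split: sum.split)

lemma sum_UNIV_sum3:
  fixes F :: "'d::finite + 'd + 'd \<Rightarrow> real"
  shows "(\<Sum>i\<in>UNIV. F i) = (\<Sum>i\<in>UNIV. F (Inl i)) + ((\<Sum>i\<in>UNIV. F (Inr (Inl i))) + (\<Sum>i\<in>UNIV. F (Inr (Inr i))))"
  by (simp add: UNIV_Plus_UNIV[symmetric] sum.Plus del: UNIV_Plus_UNIV)

lemma HConcat_mult: "HConcat A B C *v Concat x y z = A *v x + B *v y + C *v z" for A :: "real^'d^'n"
  by (auto simp: vec_eq_iff matrix_vector_mult_def HConcat_def Concat_def sum_UNIV_sum3)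

lemma Concat_add: "Concat x y z + Concat x' y' z' = Concat (x + x') (y + y') (z + z')" for x :: "real^'d"
  by (auto simp: vec_eq_iff Concat_def split: sum.split)

lemma Concat_diff: "Concat x y z - Concat x' y' z' = Concat (x - x') (y - y') (z - z')" for x :: "real^'d"
  by (auto simp: vec_eq_iff Concat_def split: sum.split)

lemma Concat_minus: "- Concat x y z = Concat (- x) (- y) (- z)" for x :: "real^'d"
  by (auto simp: vec_eq_iff Concat_def split: sum.split)

lemma Concat_scaleR: "c *\<^sub>R Concat x y z = Concat (c *\<^sub>R x) (c *\<^sub>R y) (c *\<^sub>R z)" for x :: "real^'d"
  by (auto simp: vec_eq_iff Concat_def split: sum.split)

lemma e_mult:
  "e_xc *v x = Concat x 0 0" "e_xa *v x = Concat 0 x 0" "e_dx *v x = Concat 0 0 x" for x :: "real^'d"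
  by (simp_all add: e_xc_def e_xa_def e_dx_def Concat_matrix_mult)

lemma has_integral_Concat:
  fixes f g h :: "real \<Rightarrow> real^'d"
  assumes "(f has_integral a) S" "(g has_integral b) S" "(h has_integral c) S"
  shows "((\<lambda>s. Concat (f s) (g s) (h s)) has_integral Concat a b c) S"
proof -
  have eq: "Concat x y z = e_xc *v x + e_xa *v y + e_dx *v z" for x y z :: "real^'d"
    by (simp add: e_mult Concat_add)
  show ?thesis
    unfolding eq
    by (intro has_integral_add has_integral_linear[OF assms(1) matrix_vector_mul_bounded_linear, unfolded o_def]
        has_integral_linear[OF assms(2) matrix_vector_mul_bounded_linear, unfolded o_def]
        has_integral_linear[OF assms(3) matrix_vector_mul_bounded_linear, unfolded o_def])
qed

lemma has_integral_Pair:
  fixes f :: "real \<Rightarrow> 'a::euclidean_space" and g :: "real \<Rightarrow> 'b::euclidean_space"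
  assumes "(f has_integral a) S" "(g has_integral b) S"
  shows "((\<lambda>s. (f s, g s)) has_integral (a, b)) S"
proof -
  have "bounded_linear (\<lambda>x. (x, 0 :: 'b) :: 'a \<times> 'b)" "bounded_linear (\<lambda>x. (0 :: 'a, x) :: 'a \<times> 'b)"
    by (intro bounded_linear_Pair bounded_linear_ident bounded_linear_zero)+
  from has_integral_add[OF has_integral_linear[OF assms(1) this(1)] has_integral_linear[OF assms(2) this(2)]]
  show ?thesis by (simp add: o_def)
qed

lemma D_phi_mult:
  "D_phi \<M> F R t *v Concat x y z = Concat (dyn_A \<M> t *v x - K_mat \<M> t *v (F t *v y))
    (Theta \<M> R t *v x + (dyn_A \<M> t *v y - K_mat \<M> t *v (F t *v y) - Theta \<M> R t *v y))
    (dyn_A \<M> t *v z - Theta \<M> R t *v z)"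
  by (simp add: D_phi_def Concat_matrix_mult HConcat_mult matrix_vector_mult_diff_rdistrib matrix_vector_mult_minus_left
      matrix_vector_mul_assoc)

lemma dyn_B_u_star:
  "dyn_B \<M> t *v u_star \<M> F f t x = - (K_mat \<M> t *v (F t *v x)) - (1/2) *\<^sub>R (K_mat \<M> t *v f t)"
  by (simp add: u_star_def K_mat_def matrix_vector_mult_diff_distrib matrix_vector_mult_minus_right
      matrix_vector_mult_scaleR matrix_vector_mul_assoc matrix_mul_assoc)

lemma O_mat_rho:
  fixes \<M> :: "('d::finite, 'm::finite, 'c::finite, 'p::finite, 'q::finite) model" and p :: "real^('d + 'd + 'd)"
  shows "O_mat \<M> t *v p = Concat ((matrix_inv (pen_P \<M> t) ** transpose (e_xc + e_dx)) *v p) 0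
    ((matrix_inv (pen_P \<M> t) ** transpose (e_xc + e_dx)) *v p)"
proof -
  have "O_mat \<M> t *v p = (e_xc + e_dx) *v ((matrix_inv (pen_P \<M> t) ** transpose (e_xc + e_dx)) *v p)"
    by (simp only: O_mat_def matrix_vector_mul_assoc matrix_mul_assoc)
  then show ?thesis by (simp only: matrix_vector_mult_add_rdistrib e_mult Concat_add) simp
qed

text \<open>The filtering error evolves on its own and enters both filters with the same gain, hence
  \<Theta> e in the first two blocks and nothing in their difference. Neither \<tau> nor
  \<open>f\<phi>\<close> occurs, which is the source of independence from the attack.\<close>

definition flow_err :: "('d::finite, 'm::finite, 'c::finite, 'p::finite, 'q::finite) model
    \<Rightarrow> (real \<Rightarrow> real^'d^'d) \<Rightarrow> (real \<Rightarrow> real^'d^'d) \<Rightarrow> (real \<Rightarrow> real^('d + 'd + 'd)^('d + 'd + 'd))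
    \<Rightarrow> real \<Rightarrow> (real^'d) \<times> (real^('d + 'd + 'd)) \<Rightarrow> (real^'d) \<times> (real^('d + 'd + 'd))" where
  "flow_err \<M> F R F\<phi> t = (\<lambda>(e, x). ((dyn_A \<M> t - Theta \<M> R t) *v e,
     (D_phi \<M> F R t - O_mat \<M> t ** F\<phi> t) *v x + Concat (Theta \<M> R t *v e) (Theta \<M> R t *v e) 0))"

text \<open>Linear algebra along one path. Control and state attack cancel in the filtering error;
  \<tau>, the affine drifts and \<open>f\<phi>\<close> cancel against the mean path. The same
  \<open>N\<close> appears in both filters, so the third block carries no noise.\<close>

lemma path_flow:
  fixes \<M> :: "('d::finite, 'm::finite, 'c::finite, 'p::finite, 'q::finite) model"
    and xc xh xa \<rho> u :: "real \<Rightarrow> real^'d" and \<phi> :: "real \<Rightarrow> real^('d + 'd + 'd)"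
  assumes u: "\<And>s. u s = dyn_B \<M> s *v u_star \<M> F f s (xa s)"
    and \<rho>: "\<And>s. s \<in> {0..t} \<Longrightarrow> \<rho> s = - ((matrix_inv (pen_P \<M> s) ** transpose (e_xc + e_dx)) *v
         (F\<phi> s *v Concat (xh s) (xa s) (xh s - xa s) + f\<phi> s))"
    and xc: "((\<lambda>s. dyn_A \<M> s *v xc s + u s + dyn_a \<M> s + \<rho> s) has_integral xc t - X0 - v) {0..t}"
    and xh: "((\<lambda>s. dyn_A \<M> s *v xh s + u s + dyn_a \<M> s + \<rho> s - gain \<M> R s *v (obs_H \<M> s *v xh s + obs_h \<M> s + \<tau> s))
      has_integral xh t - x0 - Ih) {0..t}"
    and xa: "((\<lambda>s. dyn_A \<M> s *v xa s + u s + dyn_a \<M> s - gain \<M> R s *v (obs_H \<M> s *v xa s + obs_h \<M> s))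
      has_integral xa t - x0 - Ia) {0..t}"
    and I: "((\<lambda>s. gain \<M> R s *v (obs_H \<M> s *v xc s + obs_h \<M> s + \<tau> s)) has_integral Ih - N) {0..t}"
      "((\<lambda>s. gain \<M> R s *v (obs_H \<M> s *v xc s + obs_h \<M> s + \<tau> s)) has_integral Ia - N) {0..t}"
    and \<phi>: "((\<lambda>s. (D_phi \<M> F R s - O_mat \<M> s ** F\<phi> s) *v \<phi> s
       + (d_phi \<M> f s + d_tau \<M> R \<tau> s - O_mat \<M> s *v f\<phi> s)) has_integral \<phi> t - Concat x0 x0 0) {0..t}"
  defines "z \<equiv> \<lambda>s. (xc s - xh s, Concat (xh s) (xa s) (xh s - xa s) - \<phi> s)"
  shows "((\<lambda>s. flow_err \<M> F R F\<phi> s (z s)) has_integral z t - (X0 - x0 + v - N, Concat N N 0)) {0..t}"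
proof -
  \<comment> \<open>Adding the drift of the observations replaces the integral against
    \<open>Yc\<close> in each filter by its martingale part \<open>N\<close>.\<close>
  note xh' = has_integral_add[OF xh I(1)]
  note xa' = has_integral_add[OF xa I(2)]
  have e: "((\<lambda>s. (dyn_A \<M> s - Theta \<M> R s) *v (xc s - xh s)) has_integral xc t - xh t - (X0 - x0 + v - N)) {0..t}"
    by (rule has_integral_eq_rhs[OF has_integral_eq[OF _ has_integral_diff[OF xc xh']]])
      (simp_all add: Theta_def matrix_vector_mult_diff_rdistrib matrix_vector_mult_diff_distrib matrix_vector_right_distrib
        matrix_vector_mul_assoc)
  have P: "((\<lambda>s. (D_phi \<M> F R s - O_mat \<M> s ** F\<phi> s) *v (Concat (xh s) (xa s) (xh s - xa s) - \<phi> s)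
       + Concat (Theta \<M> R s *v (xc s - xh s)) (Theta \<M> R s *v (xc s - xh s)) 0)
      has_integral Concat (xh t) (xa t) (xh t - xa t) - \<phi> t - Concat N N 0) {0..t}"
  proof (rule has_integral_eq_rhs[OF has_integral_eq[OF _ has_integral_diff[OF has_integral_Concat[OF xh' xa' has_integral_diff[OF xh' xa']] \<phi>]]])
    fix s assume s: "s \<in> {0..t}"
    \<comment> \<open>\<open>O_mat\<close> contains the factor e_xc + e_dx, which places the
      feedback with a minus sign in exactly those blocks whose equations contain \<rho>.\<close>
    have O: "(O_mat \<M> s ** F\<phi> s) *v Concat (xh s) (xa s) (xh s - xa s) + O_mat \<M> s *v f\<phi> s = - Concat (\<rho> s) 0 (\<rho> s)"
    proof -
      have "(O_mat \<M> s ** F\<phi> s) *v Concat (xh s) (xa s) (xh s - xa s) + O_mat \<M> s *v f\<phi> s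
          = O_mat \<M> s *v (F\<phi> s *v Concat (xh s) (xa s) (xh s - xa s) + f\<phi> s)"
        by (simp only: matrix_vector_mul_assoc matrix_vector_right_distrib)
      then show ?thesis unfolding O_mat_rho \<rho>[OF s] Concat_minus by simp
    qed
    have lhs: "(D_phi \<M> F R s - O_mat \<M> s ** F\<phi> s) *v (Concat (xh s) (xa s) (xh s - xa s) - \<phi> s)
       = (D_phi \<M> F R s *v Concat (xh s) (xa s) (xh s - xa s) + (d_phi \<M> f s + d_tau \<M> R \<tau> s)
           - ((O_mat \<M> s ** F\<phi> s) *v Concat (xh s) (xa s) (xh s - xa s) + O_mat \<M> s *v f\<phi> s))
         - ((D_phi \<M> F R s - O_mat \<M> s ** F\<phi> s) *v \<phi> s + (d_phi \<M> f s + d_tau \<M> R \<tau> s - O_mat \<M> s *v f\<phi> s))"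
      by (simp add: matrix_vector_mult_diff_rdistrib matrix_vector_mult_diff_distrib)
    have rhs: "D_phi \<M> F R s *v Concat (xh s) (xa s) (xh s - xa s) + (d_phi \<M> f s + d_tau \<M> R \<tau> s) + Concat (\<rho> s) 0 (\<rho> s)
        + Concat (Theta \<M> R s *v (xc s - xh s)) (Theta \<M> R s *v (xc s - xh s)) 0
      = Concat (dyn_A \<M> s *v xh s + u s + dyn_a \<M> s + \<rho> s - gain \<M> R s *v (obs_H \<M> s *v xh s + obs_h \<M> s + \<tau> s)
            + gain \<M> R s *v (obs_H \<M> s *v xc s + obs_h \<M> s + \<tau> s))
          (dyn_A \<M> s *v xa s + u s + dyn_a \<M> s - gain \<M> R s *v (obs_H \<M> s *v xa s + obs_h \<M> s)
            + gain \<M> R s *v (obs_H \<M> s *v xc s + obs_h \<M> s + \<tau> s))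
          (dyn_A \<M> s *v xh s + u s + dyn_a \<M> s + \<rho> s - gain \<M> R s *v (obs_H \<M> s *v xh s + obs_h \<M> s + \<tau> s)
            + gain \<M> R s *v (obs_H \<M> s *v xc s + obs_h \<M> s + \<tau> s)
           - (dyn_A \<M> s *v xa s + u s + dyn_a \<M> s - gain \<M> R s *v (obs_H \<M> s *v xa s + obs_h \<M> s)
            + gain \<M> R s *v (obs_H \<M> s *v xc s + obs_h \<M> s + \<tau> s)))"
      unfolding D_phi_mult d_phi_def d_tau_def Concat_add u dyn_B_u_star Theta_def
      by (rule arg_cong3[where f = Concat])
        (simp_all add: matrix_vector_mult_diff_distrib matrix_vector_right_distrib matrix_vector_mul_assoc[symmetric] algebra_simps)
    show "Concat (dyn_A \<M> s *v xh s + u s + dyn_a \<M> s + \<rho> s - gain \<M> R s *v (obs_H \<M> s *v xh s + obs_h \<M> s + \<tau> s)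
            + gain \<M> R s *v (obs_H \<M> s *v xc s + obs_h \<M> s + \<tau> s))
          (dyn_A \<M> s *v xa s + u s + dyn_a \<M> s - gain \<M> R s *v (obs_H \<M> s *v xa s + obs_h \<M> s)
            + gain \<M> R s *v (obs_H \<M> s *v xc s + obs_h \<M> s + \<tau> s))
          (dyn_A \<M> s *v xh s + u s + dyn_a \<M> s + \<rho> s - gain \<M> R s *v (obs_H \<M> s *v xh s + obs_h \<M> s + \<tau> s)
            + gain \<M> R s *v (obs_H \<M> s *v xc s + obs_h \<M> s + \<tau> s)
           - (dyn_A \<M> s *v xa s + u s + dyn_a \<M> s - gain \<M> R s *v (obs_H \<M> s *v xa s + obs_h \<M> s)
            + gain \<M> R s *v (obs_H \<M> s *v xc s + obs_h \<M> s + \<tau> s)))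
        - ((D_phi \<M> F R s - O_mat \<M> s ** F\<phi> s) *v \<phi> s + (d_phi \<M> f s + d_tau \<M> R \<tau> s - O_mat \<M> s *v f\<phi> s))
      = (D_phi \<M> F R s - O_mat \<M> s ** F\<phi> s) *v (Concat (xh s) (xa s) (xh s - xa s) - \<phi> s)
       + Concat (Theta \<M> R s *v (xc s - xh s)) (Theta \<M> R s *v (xc s - xh s)) 0"
      unfolding lhs O rhs[symmetric] by simp
  qed (simp add: Concat_diff Concat_add algebra_simps)
  show ?thesis
    using has_integral_Pair[OF e P] by (simp add: flow_err_def z_def case_prod_unfold)
qed

definition L2c :: "'w measure \<Rightarrow> ('w \<Rightarrow> 'a::euclidean_space) \<Rightarrow> real \<Rightarrow> bool" where
  "L2c M X C \<longleftrightarrow> integrable M X \<and> (\<integral>\<omega>. X \<omega> \<partial>M) = 0 \<and> integrable M (\<lambda>\<omega>. (norm (X \<omega>))\<^sup>2)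
     \<and> (\<integral>\<omega>. (norm (X \<omega>))\<^sup>2 \<partial>M) \<le> C"

lemma L2c_add:
  assumes "L2c M X C" "L2c M Y C'"
  shows "L2c M (\<lambda>\<omega>. X \<omega> + Y \<omega>) (2 * C + 2 * C')"
proof -
  have le: "(norm (x + y))\<^sup>2 \<le> 2 * (norm x)\<^sup>2 + 2 * (norm y)\<^sup>2" for x y :: 'b
  proof -
    have "(norm (x + y))\<^sup>2 \<le> (norm x + norm y)\<^sup>2" by (intro power_mono norm_triangle_ineq) auto
    also have "\<dots> \<le> 2 * (norm x)\<^sup>2 + 2 * (norm y)\<^sup>2"
      using sum_squares_bound[of "norm x" "norm y"] by (simp add: power2_sum)
    finally show ?thesis .
  qed
  have i: "integrable M (\<lambda>\<omega>. 2 * (norm (X \<omega>))\<^sup>2 + 2 * (norm (Y \<omega>))\<^sup>2)" using assms by (simp add: L2c_def)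
  have i2: "integrable M (\<lambda>\<omega>. (norm (X \<omega> + Y \<omega>))\<^sup>2)"
    by (rule Bochner_Integration.integrable_bound[OF i]) (use assms le in \<open>auto simp: L2c_def\<close>)
  have "(\<integral>\<omega>. (norm (X \<omega> + Y \<omega>))\<^sup>2 \<partial>M) \<le> (\<integral>\<omega>. 2 * (norm (X \<omega>))\<^sup>2 + 2 * (norm (Y \<omega>))\<^sup>2 \<partial>M)"
    by (intro integral_mono i i2 le)
  also have "\<dots> = 2 * (\<integral>\<omega>. (norm (X \<omega>))\<^sup>2 \<partial>M) + 2 * (\<integral>\<omega>. (norm (Y \<omega>))\<^sup>2 \<partial>M)"
    using assms by (simp add: L2c_def)
  also have "\<dots> \<le> 2 * C + 2 * C'" using assms by (simp add: L2c_def)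
  finally show ?thesis using i2 assms by (simp add: L2c_def)
qed

lemma L2c_image:
  fixes B :: "'a::euclidean_space \<Rightarrow> 'b::euclidean_space"
  assumes X: "L2c M X C" and B: "bounded_linear B" "\<And>x. norm (B x) \<le> b * norm x"
  shows "L2c M (\<lambda>\<omega>. B (X \<omega>)) (b\<^sup>2 * C)"
proof -
  have le: "(norm (B x))\<^sup>2 \<le> b\<^sup>2 * (norm x)\<^sup>2" for x
    using power_mono[OF B(2)[of x], of 2] by (simp add: power_mult_distrib)
  have iB: "integrable M (\<lambda>\<omega>. B (X \<omega>))" "(\<integral>\<omega>. B (X \<omega>) \<partial>M) = 0"
    using integrable_bounded_linear[OF B(1)] integral_bounded_linear[OF B(1), of M X] X
    by (auto simp: L2c_def linear_0[OF bounded_linear.linear[OF B(1)]])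
  have i: "integrable M (\<lambda>\<omega>. b\<^sup>2 * (norm (X \<omega>))\<^sup>2)" using X by (simp add: L2c_def)
  have i2: "integrable M (\<lambda>\<omega>. (norm (B (X \<omega>)))\<^sup>2)"
    by (rule Bochner_Integration.integrable_bound[OF i]) (use iB le in auto)
  have "(\<integral>\<omega>. (norm (B (X \<omega>)))\<^sup>2 \<partial>M) \<le> (\<integral>\<omega>. b\<^sup>2 * (norm (X \<omega>))\<^sup>2 \<partial>M)"
    by (intro integral_mono i i2 le)
  also have "\<dots> \<le> b\<^sup>2 * C" using X by (simp add: L2c_def mult_left_mono)
  finally show ?thesis using iB i2 by (simp add: L2c_def)
qed

lemma L2c_AE:
  assumes "L2c M X C" "Y \<in> borel_measurable M" "AE \<omega> in M. X \<omega> = Y \<omega>"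
  shows "L2c M Y C"
proof -
  have m: "X \<in> borel_measurable M" using assms(1) by (auto simp: L2c_def)
  have n: "AE \<omega> in M. (norm (X \<omega>))\<^sup>2 = (norm (Y \<omega>))\<^sup>2" using assms(3) by eventually_elim simp
  have "integrable M X = integrable M Y" "integral\<^sup>L M X = integral\<^sup>L M Y"
    "integrable M (\<lambda>\<omega>. (norm (X \<omega>))\<^sup>2) = integrable M (\<lambda>\<omega>. (norm (Y \<omega>))\<^sup>2)"
    "(\<integral>\<omega>. (norm (X \<omega>))\<^sup>2 \<partial>M) = (\<integral>\<omega>. (norm (Y \<omega>))\<^sup>2 \<partial>M)"
    using integrable_cong_AE[OF m assms(2,3)] integral_cong_AE[OF m assms(2,3)]
      integrable_cong_AE[OF _ _ n] integral_cong_AE[OF _ _ n] m assms(2)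
    by (simp_all add: borel_measurable_power borel_measurable_norm)
  with assms(1) show ?thesis by (simp add: L2c_def)
qed

lemma brownian_L2c:
  fixes V :: "real \<Rightarrow> 'w \<Rightarrow> real^'n"
  assumes M: "prob_space M" and V: "brownian_motion M V" and t: "t \<in> {0..T}"
  shows "L2c M (V t) (T * CARD('n))"
proof -
  have V0: "AE \<omega> in M. V 0 \<omega> = 0" using V by (simp add: brownian_motion_def)
  have Vm: "V t \<in> borel_measurable M" using t by (intro brownian_measurable[OF M V]) auto
  show ?thesis
  proof (cases "t = 0")
    case True
    have "L2c M (\<lambda>_. 0 :: real^'n) (T * CARD('n))" using t by (simp add: L2c_def)
    then show ?thesis by (rule L2c_AE[OF _ Vm]) (use V0 True in auto)
  next
    case False
    with t have t': "0 < t" by simp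
    have "L2c M (\<lambda>\<omega>. V t \<omega> - V 0 \<omega>) (T * CARD('n))"
      using brownian_increment[OF M V order_refl t'] t by (simp add: L2c_def mult_right_mono)
    then show ?thesis by (rule L2c_AE[OF _ Vm]) (use V0 in auto)
  qed
qed



lemma continuous_on_fst_time:
  "continuous_on {0..T} h \<Longrightarrow> continuous_on ({0..T :: real} \<times> UNIV) (\<lambda>p. h (fst p))"
  by (rule continuous_on_compose2[of "{0..T}" h _ fst]) (auto intro!: continuous_intros)

lemma has_integral_set_integral:
  fixes h :: "real \<Rightarrow> 'a::euclidean_space"
  assumes "continuous_on {0..T} h" "t \<in> {0..T}"
  shows "(h has_integral (LINT s:{0..t}|lborel. h s)) {0..t}"
proof -
  have "h integrable_on {0..t}"
    using assms(2) by (intro integrable_continuous_real continuous_on_subset[OF assms(1)]) auto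
  then show ?thesis using set_integral_continuous(1)[OF assms(1), of t] assms(2) by (simp add: integrable_integral)
qed

text \<open>The random fluctuation of the system around its mean. The filtering error has to be a
  component because the observations bring in the true state; with it the equation is
  closed.\<close>

definition z_proc :: "(real \<Rightarrow> 'w \<Rightarrow> real^'d) \<Rightarrow> (real \<Rightarrow> 'w \<Rightarrow> real^'d) \<Rightarrow> (real \<Rightarrow> 'w \<Rightarrow> real^'d) \<Rightarrow> (real \<Rightarrow> real^('d + 'd + 'd))
    \<Rightarrow> real \<Rightarrow> 'w \<Rightarrow> (real^'d) \<times> (real^('d + 'd + 'd))" where
  "z_proc Xc Xa Xhat \<phi> t \<omega> = (Xc t \<omega> - Xhat t \<omega>, Concat (Xhat t \<omega>) (Xa t \<omega>) (Xhat t \<omega> - Xa t \<omega>) - \<phi> t)"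

context
  fixes \<M> :: "('d::finite, 'm::finite, 'c::finite, 'p::finite, 'q::finite) model" and T :: real
    and F R :: "real \<Rightarrow> real^'d^'d" and f :: "real \<Rightarrow> real^'d"
    and F\<phi> :: "real \<Rightarrow> real^('d + 'd + 'd)^('d + 'd + 'd)"
    and M :: "'w measure" and X0 :: "'w \<Rightarrow> real^'d" and V :: "real \<Rightarrow> 'w \<Rightarrow> real^'p" and W :: "real \<Rightarrow> 'w \<Rightarrow> real^'q"
  assumes T: "0 < T" and v: "valid_model \<M> T" and noise: "noise_setup \<M> M X0 V W"
    and F: "is_F \<M> T F" and f: "is_f \<M> T F f" and R: "is_R \<M> T R" and F\<phi>: "is_Fphi \<M> T F R F\<phi>"
begin

lemmas contC = is_F_continuous[OF F] is_f_continuous[OF f] is_R_continuous[OF R] is_Fphi_continuous[OF F\<phi>]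

lemmas coefC = continuous_on_coefficients[OF v contC(1,3,2,4)] continuous_on_data_id[OF v] continuous_on_K_mat_id[OF v]
    continuous_on_O_mat_id[OF v] continuous_on_inv_data_id[OF v]

lemma noise_facts:
  shows "prob_space M" "brownian_motion M V" "brownian_motion M W" "gaussian M X0 (init_x \<M>) (init_R \<M>)"
  using noise by (simp_all add: noise_setup_def)

lemma flow_err_flow: obtains L where "linear_flow T L (flow_err \<M> F R F\<phi>)"
proof -
  have lin: "linear (flow_err \<M> F R F\<phi> t)" for t
    by (rule linearI) (auto simp: flow_err_def matrix_vector_right_distrib matrix_vector_mult_scaleR Concat_add Concat_scaleR
        scaleR_add_right)
  have cont: "continuous_on ({0..T} \<times> UNIV) (\<lambda>(t, x). flow_err \<M> F R F\<phi> t x)"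
    unfolding flow_err_def case_prod_unfold
    by (intro continuous_intros continuous_on_fst_time coefC contC)
  obtain L where "0 \<le> L" "\<And>t x. t \<in> {0..T} \<Longrightarrow> norm (flow_err \<M> F R F\<phi> t x) \<le> L * norm x"
    using linear_family_bound[OF lin cont] by blast
  then have "linear_flow T L (flow_err \<M> F R F\<phi>)"
    unfolding linear_flow_def using T lin cont by blast
  then show ?thesis by (rule that)
qed

context
  fixes \<tau> :: "real \<Rightarrow> real^'m" and f\<phi> \<phi> :: "real \<Rightarrow> real^('d + 'd + 'd)"
    and Xc Xa Xhat :: "real \<Rightarrow> 'w \<Rightarrow> real^'d" and Yc :: "real \<Rightarrow> 'w \<Rightarrow> real^'m"
  assumes f\<phi>: "is_fphi \<M> T F f R F\<phi> \<tau> f\<phi>" and \<phi>: "is_mean \<M> T F f R F\<phi> f\<phi> \<tau> \<phi>"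
    and sys: "full_system \<M> T M X0 V W F f R (rho_star \<M> F\<phi> f\<phi> Xa Xhat) \<tau> Xc Yc Xa Xhat"
begin

lemma mean_continuous: "continuous_on {0..T} \<phi>"
  using \<phi> unfolding is_mean_def by (intro continuous_on_vector_derivative) blast

lemma \<tau>_continuous: "continuous_on {0..T} \<tau>"
  using sys by (simp add: full_system_def obs_attack_def)

lemma sys_measurable:
  shows "measurable_process M T Xc" "measurable_process M T Yc" "measurable_process M T Xa" "measurable_process M T Xhat"
  using sys by (simp_all add: full_system_def attacked_system_def agent_filter_def aware_filter_def)

lemma z_measurable: "measurable_process M T (z_proc Xc Xa Xhat \<phi>)"
proof -
  note p = measurable_process_Pair[OF sys_measurable(1) measurable_process_Pair[OF sys_measurable(3,4)]]
  have "continuous_on ({0..T} \<times> UNIV) (\<lambda>(t, x). (fst x - snd (snd x),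
      Concat (snd (snd x)) (fst (snd x)) (snd (snd x) - fst (snd x)) - \<phi> t))"
    unfolding case_prod_unfold by (intro continuous_intros continuous_on_fst_time mean_continuous)
  from measurable_process_compose[OF p this] show ?thesis by (simp add: z_proc_def[abs_def])
qed

text \<open>Brings every attacked system into the common form of one linear flow driven by
  \<open>X0\<close>, \<open>V\<close> and a limit \<open>N\<close> of the noise sums.\<close>

lemma attack_paths:
  obtains N where "\<And>t. t \<in> {0..T} \<Longrightarrow> N t \<in> borel_measurable M"
    "AE \<omega> in M. continuous_on {0..T} (\<lambda>t. N t \<omega>)"
    "\<And>t. t \<in> {0..T} \<Longrightarrow> conv0 M (\<lambda>n \<omega>. noise_sum W (gain \<M> R) (sig_W \<M>) t n \<omega> - N t \<omega>)"
    "AE \<omega> in M. continuous_on {0..T} (\<lambda>t. z_proc Xc Xa Xhat \<phi> t \<omega>)"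
    "AE \<omega> in M. \<forall>t\<in>{0..T}. z_proc Xc Xa Xhat \<phi> t \<omega>
      = (X0 \<omega> - init_x \<M> + sig_V \<M> *v V t \<omega> - N t \<omega>, Concat (N t \<omega>) (N t \<omega>) 0)
        + (LINT s:{0..t}|lborel. flow_err \<M> F R F\<phi> s (z_proc Xc Xa Xhat \<phi> s \<omega>))"
proof -
  note M = noise_facts(1) and W = noise_facts(3)
  let ?g = "gain \<M> R" and ?\<rho> = "rho_star \<M> F\<phi> f\<phi> Xa Xhat"
  define y where "y t \<omega> = obs_H \<M> t *v Xc t \<omega> + obs_h \<M> t + \<tau> t" for t \<omega>
  note cg = coefC(1)
  have aXY: "AE \<omega> in M. continuous_on {0..T} (\<lambda>t. Xc t \<omega>) \<and> continuous_on {0..T} (\<lambda>t. Yc t \<omega>)"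
    and Xc_eq: "AE \<omega> in M. \<forall>t\<in>{0..T}. Xc t \<omega> = X0 \<omega>
        + (LINT s:{0..t}|lborel. dyn_A \<M> s *v Xc s \<omega> + dyn_B \<M> s *v u_star \<M> F f s (Xa s \<omega>) + dyn_a \<M> s + ?\<rho> s \<omega>)
        + sig_V \<M> *v V t \<omega>"
    and Yc_eq: "AE \<omega> in M. \<forall>t\<in>{0..T}. Yc t \<omega> = (LINT s:{0..t}|lborel. y s \<omega>) + sig_W \<M> *v W t \<omega>"
    using sys by (simp_all add: full_system_def attacked_system_def y_def)
  obtain Ia where aXa: "AE \<omega> in M. continuous_on {0..T} (\<lambda>t. Xa t \<omega>)" and Ia: "ito_integral M T ?g Yc Ia"
    and Xa_eq: "AE \<omega> in M. \<forall>t\<in>{0..T}. Xa t \<omega> = init_x \<M>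
          + (LINT s:{0..t}|lborel. dyn_A \<M> s *v Xa s \<omega> + dyn_B \<M> s *v u_star \<M> F f s (Xa s \<omega>)
                                   + dyn_a \<M> s - ?g s *v (obs_H \<M> s *v Xa s \<omega> + obs_h \<M> s)) + Ia t \<omega>"
    using sys unfolding full_system_def agent_filter_def by blast
  obtain Ih where aXh: "AE \<omega> in M. continuous_on {0..T} (\<lambda>t. Xhat t \<omega>)" and Ih: "ito_integral M T ?g Yc Ih"
    and Xh_eq: "AE \<omega> in M. \<forall>t\<in>{0..T}. Xhat t \<omega> = init_x \<M>
          + (LINT s:{0..t}|lborel. dyn_A \<M> s *v Xhat s \<omega> + dyn_B \<M> s *v u_star \<M> F f s (Xa s \<omega>)
                                   + dyn_a \<M> s + ?\<rho> s \<omega>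
                                   - ?g s *v (obs_H \<M> s *v Xhat s \<omega> + obs_h \<M> s + \<tau> s)) + Ih t \<omega>"
    using sys unfolding full_system_def aware_filter_def by blast
  have Ym: "Yc t \<in> borel_measurable M" if "t \<in> {0..T}" for t by (rule measurable_process_slice[OF sys_measurable(2) that])
  have "continuous_on ({0..T} \<times> UNIV) (\<lambda>(t, x). obs_H \<M> t *v x + obs_h \<M> t + \<tau> t)"
    unfolding case_prod_unfold by (intro continuous_intros continuous_on_fst_time coefC \<tau>_continuous)
  from measurable_process_compose[OF sys_measurable(1) this] have ym: "measurable_process M T y"
    by (simp add: y_def[abs_def])
  have yc: "AE \<omega> in M. continuous_on {0..T} (\<lambda>t. y t \<omega>)"
    using aXY unfolding y_def by eventually_elim (intro continuous_intros coefC \<tau>_continuous, simp)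
  define N where "N t \<omega> = Ih t \<omega> - (LINT s:{0..t}|lborel. ?g s *v y s \<omega>)" for t \<omega>
  define Na where "Na t \<omega> = Ia t \<omega> - (LINT s:{0..t}|lborel. ?g s *v y s \<omega>)" for t \<omega>
  note nh = ito_noise[OF M W T cg Ih Ym ym yc Yc_eq, folded N_def]
  note na = ito_noise[OF M W T cg Ia Ym ym yc Yc_eq, folded Na_def]
  \<comment> \<open>\<open>Ih\<close> and \<open>Ia\<close> stem from separate existence statements;
    their martingale parts agree as limits of the same noise sums.\<close>
  have "AE \<omega> in M. N t \<omega> = Na t \<omega>" if "t \<in> {0..T}" for t
    by (rule noise_unique[OF M W T cg that nh(1) nh(3) na(1) na(3)]) (use that in auto)
  then have NN: "AE \<omega> in M. \<forall>t\<in>{0..T}. N t \<omega> = Na t \<omega>"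
    by (rule AE_continuous_eq[OF _ nh(2) na(2)])
  have aZ: "AE \<omega> in M. continuous_on {0..T} (\<lambda>t. z_proc Xc Xa Xhat \<phi> t \<omega>)"
    using aXY aXa aXh unfolding z_proc_def
    by eventually_elim (intro continuous_intros mean_continuous, simp_all)
  obtain L where L: "linear_flow T L (flow_err \<M> F R F\<phi>)" by (rule flow_err_flow)
  have "AE \<omega> in M. \<forall>t\<in>{0..T}. z_proc Xc Xa Xhat \<phi> t \<omega>
      = (X0 \<omega> - init_x \<M> + sig_V \<M> *v V t \<omega> - N t \<omega>, Concat (N t \<omega>) (N t \<omega>) 0)
        + (LINT s:{0..t}|lborel. flow_err \<M> F R F\<phi> s (z_proc Xc Xa Xhat \<phi> s \<omega>))"
    using aXY aXa aXh Xc_eq Xa_eq Xh_eq NN aZ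
  proof eventually_elim
    case (elim \<omega>)
    have cXc: "continuous_on {0..T} (\<lambda>t. Xc t \<omega>)" using elim(1) by simp
    have cu: "continuous_on {0..T} (\<lambda>s. dyn_B \<M> s *v u_star \<M> F f s (Xa s \<omega>))"
      unfolding dyn_B_u_star by (intro continuous_intros coefC contC elim(2))
    have c\<rho>: "continuous_on {0..T} (\<lambda>s. ?\<rho> s \<omega>)"
      unfolding rho_star_def
      by (intro continuous_intros coefC contC elim(2,3) is_fphi_continuous[OF f\<phi>])
    have cy: "continuous_on {0..T} (\<lambda>s. ?g s *v (obs_H \<M> s *v Xc s \<omega> + obs_h \<M> s + \<tau> s))"
      by (intro continuous_intros coefC cXc \<tau>_continuous)
    show ?case
    proof
      fix t assume t: "t \<in> {0..T}"
      note hi = has_integral_set_integral[OF _ t]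
      have 1: "((\<lambda>s. dyn_A \<M> s *v Xc s \<omega> + dyn_B \<M> s *v u_star \<M> F f s (Xa s \<omega>) + dyn_a \<M> s + ?\<rho> s \<omega>)
          has_integral Xc t \<omega> - X0 \<omega> - sig_V \<M> *v V t \<omega>) {0..t}"
        by (rule has_integral_eq_rhs[OF hi])
          (use elim(4) t in \<open>auto intro!: continuous_intros coefC cXc cu c\<rho>\<close>)
      have 2: "((\<lambda>s. dyn_A \<M> s *v Xhat s \<omega> + dyn_B \<M> s *v u_star \<M> F f s (Xa s \<omega>) + dyn_a \<M> s + ?\<rho> s \<omega>
           - ?g s *v (obs_H \<M> s *v Xhat s \<omega> + obs_h \<M> s + \<tau> s)) has_integral Xhat t \<omega> - init_x \<M> - Ih t \<omega>) {0..t}"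
        by (rule has_integral_eq_rhs[OF hi])
          (use elim(6) t in \<open>auto intro!: continuous_intros coefC elim(3) cu c\<rho> \<tau>_continuous\<close>)
      have 3: "((\<lambda>s. dyn_A \<M> s *v Xa s \<omega> + dyn_B \<M> s *v u_star \<M> F f s (Xa s \<omega>) + dyn_a \<M> s
           - ?g s *v (obs_H \<M> s *v Xa s \<omega> + obs_h \<M> s)) has_integral Xa t \<omega> - init_x \<M> - Ia t \<omega>) {0..t}"
        by (rule has_integral_eq_rhs[OF hi])
          (use elim(5) t in \<open>auto intro!: continuous_intros coefC elim(2) cu\<close>)
      have 4: "((\<lambda>s. ?g s *v (obs_H \<M> s *v Xc s \<omega> + obs_h \<M> s + \<tau> s)) has_integral Ih t \<omega> - N t \<omega>) {0..t}"
        by (rule has_integral_eq_rhs[OF hi[OF cy]]) (simp add: N_def y_def)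
      have 5: "((\<lambda>s. ?g s *v (obs_H \<M> s *v Xc s \<omega> + obs_h \<M> s + \<tau> s)) has_integral Ia t \<omega> - N t \<omega>) {0..t}"
        by (rule has_integral_eq_rhs[OF hi[OF cy]]) (use elim(7) t in \<open>simp add: Na_def y_def\<close>)
      have 6: "((\<lambda>s. (D_phi \<M> F R s - O_mat \<M> s ** F\<phi> s) *v \<phi> s
         + (d_phi \<M> f s + d_tau \<M> R \<tau> s - O_mat \<M> s *v f\<phi> s)) has_integral \<phi> t - Concat (init_x \<M>) (init_x \<M>) 0) {0..t}"
      proof -
        have "((\<lambda>s. (D_phi \<M> F R s - O_mat \<M> s ** F\<phi> s) *v \<phi> s
         + (d_phi \<M> f s + d_tau \<M> R \<tau> s - O_mat \<M> s *v f\<phi> s)) has_integral \<phi> t - \<phi> 0) {0..t}"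
        proof (rule fundamental_theorem_of_calculus)
          show "0 \<le> t" using t by simp
          fix s assume s: "s \<in> {0..t}"
          have "{0..t} \<subseteq> {0..T}" using t by auto
          then show "(\<phi> has_vector_derivative (D_phi \<M> F R s - O_mat \<M> s ** F\<phi> s) *v \<phi> s
            + (d_phi \<M> f s + d_tau \<M> R \<tau> s - O_mat \<M> s *v f\<phi> s)) (at s within {0..t})"
            using \<phi> s by (intro has_vector_derivative_within_subset[of \<phi> _ s "{0..T}" "{0..t}"]) (auto simp: is_mean_def)
        qed
        then show ?thesis using \<phi> by (simp add: is_mean_def Phi0_def)
      qed
      have "((\<lambda>s. flow_err \<M> F R F\<phi> s (z_proc Xc Xa Xhat \<phi> s \<omega>)) has_integral z_proc Xc Xa Xhat \<phi> t \<omega>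
        - (X0 \<omega> - init_x \<M> + sig_V \<M> *v V t \<omega> - N t \<omega>, Concat (N t \<omega>) (N t \<omega>) 0)) {0..t}"
        unfolding z_proc_def
        by (rule path_flow[OF refl _ 1 2 3 4 5 6]) (simp add: rho_star_def)
      moreover have "((\<lambda>s. flow_err \<M> F R F\<phi> s (z_proc Xc Xa Xhat \<phi> s \<omega>)) has_integral
          (LINT s:{0..t}|lborel. flow_err \<M> F R F\<phi> s (z_proc Xc Xa Xhat \<phi> s \<omega>))) {0..t}"
        by (rule hi[OF linear_flow.cont_path[OF L elim(8)]])
      ultimately have "z_proc Xc Xa Xhat \<phi> t \<omega> - (X0 \<omega> - init_x \<M> + sig_V \<M> *v V t \<omega> - N t \<omega>, Concat (N t \<omega>) (N t \<omega>) 0)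
        = (LINT s:{0..t}|lborel. flow_err \<M> F R F\<phi> s (z_proc Xc Xa Xhat \<phi> s \<omega>))"
        by (rule has_integral_unique)
      then show "z_proc Xc Xa Xhat \<phi> t \<omega>
        = (X0 \<omega> - init_x \<M> + sig_V \<M> *v V t \<omega> - N t \<omega>, Concat (N t \<omega>) (N t \<omega>) 0)
          + (LINT s:{0..t}|lborel. flow_err \<M> F R F\<phi> s (z_proc Xc Xa Xhat \<phi> s \<omega>))"
        by (simp only: diff_eq_eq add.commute)
    qed
  qed
  from nh(1,2,3) aZ this show ?thesis by (rule that[of N])
qed

end

end



section \<open>The cost of the fluctuations\<close>

definition dev_obs where "dev_obs \<M> t z = obs_H \<M> t *v (transpose e_dx *v snd z)"
definition dev_state where "dev_state z = fst z + transpose e_xc *v snd z"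
definition dev_ctrl where "dev_ctrl \<M> F t z =
  - ((matrix_inv (cost_S \<M> t) ** transpose (dyn_B \<M> t) ** F t) *v (transpose e_xa *v snd z))"
definition dev_rho where "dev_rho \<M> F\<phi> t z =
  - ((matrix_inv (pen_P \<M> t) ** transpose (e_xc + e_dx)) *v (F\<phi> t *v snd z))"

definition quad_E :: "'w measure \<Rightarrow> real \<Rightarrow> (real \<Rightarrow> real^'k^'k) \<Rightarrow> (real \<Rightarrow> 'w \<Rightarrow> real^'k) \<Rightarrow> real" where
  "quad_E M T Q x = (\<integral>\<omega>. (LINT t:{0..T}|lborel. x t \<omega> \<bullet> (Q t *v x t \<omega>)) \<partial>M)"

text \<open>The criterion evaluated on the centred parts alone. Target, \<tau> and the affine parts
  of both feedbacks belong to the means and are absent.\<close>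

definition resid_cost :: "('d::finite, 'm::finite, 'c::finite, 'p::finite, 'q::finite) model \<Rightarrow> real \<Rightarrow> 'w measure
    \<Rightarrow> (real \<Rightarrow> real^'d^'d) \<Rightarrow> (real \<Rightarrow> real^('d + 'd + 'd)^('d + 'd + 'd))
    \<Rightarrow> (real \<Rightarrow> 'w \<Rightarrow> (real^'d) \<times> (real^('d + 'd + 'd))) \<Rightarrow> real" where
  "resid_cost \<M> T M F F\<phi> z = (1/2) * quad_E M T (\<lambda>_. matrix_inv (Sig_W \<M>)) (\<lambda>t \<omega>. dev_obs \<M> t (z t \<omega>))
     - lam \<M> * (quad_E M T (cost_Q \<M>) (\<lambda>t \<omega>. dev_state (z t \<omega>)) + quad_E M T (cost_S \<M>) (\<lambda>t \<omega>. dev_ctrl \<M> F t (z t \<omega>)))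
     + (1/2) * quad_E M T (pen_P \<M>) (\<lambda>t \<omega>. dev_rho \<M> F\<phi> t (z t \<omega>))"

text \<open>One constant serves all \<open>Y\<close> at once, as bounds uniform in time
  require.\<close>

lemma bounded_linear_L2c:
  fixes B :: "'a::euclidean_space \<Rightarrow> 'b::euclidean_space"
  assumes "L2c M X C" "linear B"
  obtains C' where "\<And>Y. L2c M Y C \<Longrightarrow> L2c M (\<lambda>\<omega>. B (Y \<omega>)) C'"
proof -
  have b: "bounded_linear B" using assms(2) by (simp add: linear_conv_bounded_linear)
  then obtain K where "\<And>x. norm (B x) \<le> norm x * K" using bounded_linear.bounded by blast
  then have "norm (B x) \<le> K * norm x" for x by (simp add: mult.commute)
  then show ?thesis using that[of "K\<^sup>2 * C"] L2c_image[OF _ b] by blast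
qed

context
  fixes \<M> :: "('d::finite, 'm::finite, 'c::finite, 'p::finite, 'q::finite) model" and T :: real
    and F R :: "real \<Rightarrow> real^'d^'d" and f :: "real \<Rightarrow> real^'d"
    and F\<phi> :: "real \<Rightarrow> real^('d + 'd + 'd)^('d + 'd + 'd)"
    and M :: "'w measure" and X0 :: "'w \<Rightarrow> real^'d" and V :: "real \<Rightarrow> 'w \<Rightarrow> real^'p" and W :: "real \<Rightarrow> 'w \<Rightarrow> real^'q"
  assumes T: "0 < T" and v: "valid_model \<M> T" and noise: "noise_setup \<M> M X0 V W"
    and F: "is_F \<M> T F" and f: "is_f \<M> T F f" and R: "is_R \<M> T R" and F\<phi>: "is_Fphi \<M> T F R F\<phi>"
begin

lemmas ctx = T v noise F f R F\<phi>
lemmas contD = contC[OF ctx]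
lemmas coefD = coefC[OF ctx]
lemmas nf = noise_facts[OF ctx]

lemma driving_noise_L2c:
  obtains C where "\<And>t N. t \<in> {0..T} \<Longrightarrow> N \<in> borel_measurable M \<Longrightarrow>
      conv0 M (\<lambda>n \<omega>. noise_sum W (gain \<M> R) (sig_W \<M>) t n \<omega> - N \<omega>) \<Longrightarrow>
      L2c M (\<lambda>\<omega>. (X0 \<omega> - init_x \<M> + sig_V \<M> *v V t \<omega> - N \<omega>, Concat (N \<omega>) (N \<omega>) 0)) C"
proof -
  let ?B1 = "\<lambda>x :: real^'d. (x, 0 :: real^('d + 'd + 'd))"
  let ?B2 = "\<lambda>x :: real^'p. (sig_V \<M> *v x, 0 :: real^('d + 'd + 'd))"
  let ?B3 = "\<lambda>x :: real^'d. (- x, Concat x x 0)"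
  have psd: "0 \<le> w \<bullet> (init_R \<M> *v w)" for w using v by (simp add: valid_model_def psd_mat_def)
  obtain C1 where X: "L2c M (\<lambda>\<omega>. X0 \<omega> - init_x \<M>) C1"
  proof -
    interpret prob_space M by (rule nf(1))
    show ?thesis
      using gaussian_moments[OF nf(1,4) psd] that[of "\<Sum>b\<in>Basis. b \<bullet> (init_R \<M> *v b)"]
      by (simp add: L2c_def prob_space)
  qed
  have lin: "linear ?B1" "linear ?B2" "linear ?B3"
    by (rule linearI; simp add: matrix_vector_right_distrib matrix_vector_mult_scaleR Concat_add Concat_scaleR)+
  have V: "L2c M (V t) (T * CARD('p))" if "t \<in> {0..T}" for t by (rule brownian_L2c[OF nf(1,2) that])
  obtain D1 where D1: "L2c M (\<lambda>\<omega>. ?B1 (X0 \<omega> - init_x \<M>)) D1"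
    using bounded_linear_L2c[OF X lin(1)] X by metis
  obtain D2 where D2: "\<And>Y. L2c M Y (T * CARD('p)) \<Longrightarrow> L2c M (\<lambda>\<omega>. ?B2 (Y \<omega>)) D2"
    using bounded_linear_L2c[OF V lin(2), of 0] T by (metis atLeastAtMost_iff less_imp_le order_refl)
  obtain C3 where N0: "\<And>t N. t \<in> {0..T} \<Longrightarrow> N \<in> borel_measurable M \<Longrightarrow>
      conv0 M (\<lambda>n \<omega>. noise_sum W (gain \<M> R) (sig_W \<M>) t n \<omega> - N \<omega>) \<Longrightarrow>
      integrable M N \<and> (\<integral>\<omega>. N \<omega> \<partial>M) = 0 \<and> integrable M (\<lambda>\<omega>. (norm (N \<omega>))\<^sup>2) \<and> (\<integral>\<omega>. (norm (N \<omega>))\<^sup>2 \<partial>M) \<le> C3"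
    by (rule noise_moments[OF nf(1,3) T coefD(1)], rule that)
  note N = N0[folded L2c_def]
  \<comment> \<open>The zero variable is a witness that fixes the bound before any \<open>N\<close>
    is given; the maximum is taken because the sign of \<open>C3\<close> is not known.\<close>
  have Z: "L2c M (\<lambda>_. 0 :: real^'d) (max C3 0)" by (simp add: L2c_def)
  obtain D3 where D3: "\<And>Y. L2c M Y (max C3 0) \<Longrightarrow> L2c M (\<lambda>\<omega>. ?B3 (Y \<omega>)) D3"
    by (rule bounded_linear_L2c[OF Z lin(3)], rule that)
  show ?thesis
  proof (rule that[of "2 * (2 * D1 + 2 * D2) + 2 * D3"])
    fix t N
    assume t: "t \<in> {0..T}" and n: "N \<in> borel_measurable M"
      "conv0 M (\<lambda>n \<omega>. noise_sum W (gain \<M> R) (sig_W \<M>) t n \<omega> - N \<omega>)"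
    have "L2c M N (max C3 0)" using N[OF t n] by (auto simp: L2c_def)
    from L2c_add[OF L2c_add[OF D1 D2[OF V[OF t]]] D3[OF this]]
    show "L2c M (\<lambda>\<omega>. (X0 \<omega> - init_x \<M> + sig_V \<M> *v V t \<omega> - N \<omega>, Concat (N \<omega>) (N \<omega>) 0)) (2 * (2 * D1 + 2 * D2) + 2 * D3)"
      by simp
  qed
qed

lemma z_centered:
  assumes "is_fphi \<M> T F f R F\<phi> \<tau> f\<phi>" "is_mean \<M> T F f R F\<phi> f\<phi> \<tau> \<phi>"
    "full_system \<M> T M X0 V W F f R (rho_star \<M> F\<phi> f\<phi> Xa Xhat) \<tau> Xc Yc Xa Xhat"
  shows "centered_L2 M T (z_proc Xc Xa Xhat \<phi>)"
proof -
  obtain N where N: "\<And>t. t \<in> {0..T} \<Longrightarrow> N t \<in> borel_measurable M"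
    "\<And>t. t \<in> {0..T} \<Longrightarrow> conv0 M (\<lambda>n \<omega>. noise_sum W (gain \<M> R) (sig_W \<M>) t n \<omega> - N t \<omega>)"
    and zc: "AE \<omega> in M. continuous_on {0..T} (\<lambda>t. z_proc Xc Xa Xhat \<phi> t \<omega>)"
    and eq: "AE \<omega> in M. \<forall>t\<in>{0..T}. z_proc Xc Xa Xhat \<phi> t \<omega>
      = (X0 \<omega> - init_x \<M> + sig_V \<M> *v V t \<omega> - N t \<omega>, Concat (N t \<omega>) (N t \<omega>) 0)
        + (LINT s:{0..t}|lborel. flow_err \<M> F R F\<phi> s (z_proc Xc Xa Xhat \<phi> s \<omega>))"
    by (rule attack_paths[OF ctx assms]) blast
  obtain C where C: "\<And>t. t \<in> {0..T} \<Longrightarrow>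
      L2c M (\<lambda>\<omega>. (X0 \<omega> - init_x \<M> + sig_V \<M> *v V t \<omega> - N t \<omega>, Concat (N t \<omega>) (N t \<omega>) 0)) C"
    by (rule driving_noise_L2c) (use N in blast)
  obtain L where "linear_flow T L (flow_err \<M> F R F\<phi>)" by (rule flow_err_flow[OF ctx])
  then interpret linear_flow T L "flow_err \<M> F R F\<phi>" .
  show ?thesis
    by (rule centered_L2_flow[OF nf(1) z_measurable[OF ctx assms] zc _ _ _ _ eq]) (use C in \<open>auto simp: L2c_def\<close>)
qed

text \<open>The fluctuations do not depend on the attack: \<open>X0\<close> and \<open>V\<close> are
  common, the limits of the noise sums agree almost surely, and the linear flow has a unique
  solution along each path.\<close>

lemma z_unique:
  assumes 1: "is_fphi \<M> T F f R F\<phi> \<tau> f\<phi>" "is_mean \<M> T F f R F\<phi> f\<phi> \<tau> \<phi>"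
    "full_system \<M> T M X0 V W F f R (rho_star \<M> F\<phi> f\<phi> Xa Xhat) \<tau> Xc Yc Xa Xhat"
    and 2: "is_fphi \<M> T F f R F\<phi> \<tau>' f\<phi>'" "is_mean \<M> T F f R F\<phi> f\<phi>' \<tau>' \<phi>'"
    "full_system \<M> T M X0 V W F f R (rho_star \<M> F\<phi> f\<phi>' Xa' Xhat') \<tau>' Xc' Yc' Xa' Xhat'"
  shows "AE \<omega> in M. \<forall>t\<in>{0..T}. z_proc Xc Xa Xhat \<phi> t \<omega> = z_proc Xc' Xa' Xhat' \<phi>' t \<omega>"
proof -
  obtain N where N: "\<And>t. t \<in> {0..T} \<Longrightarrow> N t \<in> borel_measurable M"
    "AE \<omega> in M. continuous_on {0..T} (\<lambda>t. N t \<omega>)"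
    "\<And>t. t \<in> {0..T} \<Longrightarrow> conv0 M (\<lambda>n \<omega>. noise_sum W (gain \<M> R) (sig_W \<M>) t n \<omega> - N t \<omega>)"
    and zc: "AE \<omega> in M. continuous_on {0..T} (\<lambda>t. z_proc Xc Xa Xhat \<phi> t \<omega>)"
    and eq: "AE \<omega> in M. \<forall>t\<in>{0..T}. z_proc Xc Xa Xhat \<phi> t \<omega>
      = (X0 \<omega> - init_x \<M> + sig_V \<M> *v V t \<omega> - N t \<omega>, Concat (N t \<omega>) (N t \<omega>) 0)
        + (LINT s:{0..t}|lborel. flow_err \<M> F R F\<phi> s (z_proc Xc Xa Xhat \<phi> s \<omega>))"
    by (rule attack_paths[OF ctx 1], rule that)
  obtain N' where N': "\<And>t. t \<in> {0..T} \<Longrightarrow> N' t \<in> borel_measurable M"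
    "AE \<omega> in M. continuous_on {0..T} (\<lambda>t. N' t \<omega>)"
    "\<And>t. t \<in> {0..T} \<Longrightarrow> conv0 M (\<lambda>n \<omega>. noise_sum W (gain \<M> R) (sig_W \<M>) t n \<omega> - N' t \<omega>)"
    and zc': "AE \<omega> in M. continuous_on {0..T} (\<lambda>t. z_proc Xc' Xa' Xhat' \<phi>' t \<omega>)"
    and eq': "AE \<omega> in M. \<forall>t\<in>{0..T}. z_proc Xc' Xa' Xhat' \<phi>' t \<omega>
      = (X0 \<omega> - init_x \<M> + sig_V \<M> *v V t \<omega> - N' t \<omega>, Concat (N' t \<omega>) (N' t \<omega>) 0)
        + (LINT s:{0..t}|lborel. flow_err \<M> F R F\<phi> s (z_proc Xc' Xa' Xhat' \<phi>' s \<omega>))"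
    by (rule attack_paths[OF ctx 2], rule that)
  have "AE \<omega> in M. N t \<omega> = N' t \<omega>" if t: "t \<in> {0..T}" for t
    by (rule noise_unique[OF nf(1,3) T coefD(1) t N(1)[OF t] N(3)[OF t] N'(1)[OF t] N'(3)[OF t]])
  then have NN: "AE \<omega> in M. \<forall>t\<in>{0..T}. N t \<omega> = N' t \<omega>"
    by (rule AE_continuous_eq[OF _ N(2) N'(2)])
  obtain L where "linear_flow T L (flow_err \<M> F R F\<phi>)" by (rule flow_err_flow[OF ctx])
  then interpret linear_flow T L "flow_err \<M> F R F\<phi>" .
  show ?thesis
    using zc zc' eq eq' NN
  proof eventually_elim
    case (elim \<omega>)
    let ?n = "\<lambda>t. (X0 \<omega> - init_x \<M> + sig_V \<M> *v V t \<omega> - N t \<omega>, Concat (N t \<omega>) (N t \<omega>) 0)"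
    have "z_proc Xc Xa Xhat \<phi> t \<omega> = ?n t + integral {0..t} (\<lambda>s. flow_err \<M> F R F\<phi> s (z_proc Xc Xa Xhat \<phi> s \<omega>))"
      "z_proc Xc' Xa' Xhat' \<phi>' t \<omega> = ?n t + integral {0..t} (\<lambda>s. flow_err \<M> F R F\<phi> s (z_proc Xc' Xa' Xhat' \<phi>' s \<omega>))"
      if t: "t \<in> {0..T}" for t
      using elim(3-5) t set_integral_continuous(1)[OF cont_path[OF elim(1)], of t]
        set_integral_continuous(1)[OF cont_path[OF elim(2)], of t] by auto
    then show ?case
      by (intro ballI flow_unique[OF elim(1,2), of ?n])
  qed
qed

lemma quad_E_cong:
  fixes x y :: "real \<Rightarrow> 'w \<Rightarrow> real^'k"
  assumes c: "centered_L2 M T x" "centered_L2 M T y" and Q: "continuous_on {0..T} Q"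
    and eq: "AE \<omega> in M. \<forall>t\<in>{0..T}. x t \<omega> = y t \<omega>"
  shows "quad_E M T Q x = quad_E M T Q y"
  unfolding quad_E_def
proof (rule integral_cong_AE)
  have T0: "0 \<le> T" using T by simp
  \<comment> \<open>Measurability is taken from \<open>quadratic_expectation\<close> with the zero
    function as mean path.\<close>
  show "(\<lambda>\<omega>. LINT t:{0..T}|lborel. x t \<omega> \<bullet> (Q t *v x t \<omega>)) \<in> borel_measurable M"
    "(\<lambda>\<omega>. LINT t:{0..T}|lborel. y t \<omega> \<bullet> (Q t *v y t \<omega>)) \<in> borel_measurable M"
    using quadratic_expectation(1)[OF nf(1) T0 c(1) continuous_on_const[of _ 0] Q]
      quadratic_expectation(1)[OF nf(1) T0 c(2) continuous_on_const[of _ 0] Q] by auto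
  show "AE \<omega> in M. (LINT t:{0..T}|lborel. x t \<omega> \<bullet> (Q t *v x t \<omega>)) = (LINT t:{0..T}|lborel. y t \<omega> \<bullet> (Q t *v y t \<omega>))"
    using eq by eventually_elim (intro set_lebesgue_integral_cong, auto)
qed

lemma dev_continuous:
  shows "continuous_on ({0..T} \<times> UNIV) (\<lambda>(t, z). dev_obs \<M> t z)" "continuous_on ({0..T} \<times> UNIV) (\<lambda>(t::real, z). dev_state z)"
    "continuous_on ({0..T} \<times> UNIV) (\<lambda>(t, z). dev_ctrl \<M> F t z)" "continuous_on ({0..T} \<times> UNIV) (\<lambda>(t, z). dev_rho \<M> F\<phi> t z)"
  unfolding dev_obs_def dev_state_def dev_ctrl_def dev_rho_def case_prod_unfold
  by (intro continuous_intros continuous_on_fst_time coefD contD)+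

lemma dev_linear: "linear (dev_obs \<M> t)" "linear dev_state" "linear (dev_ctrl \<M> F t)" "linear (dev_rho \<M> F\<phi> t)"
  unfolding dev_obs_def dev_state_def dev_ctrl_def dev_rho_def
  by (rule linearI; simp del: transpose_matrix_vector add: matrix_vector_right_distrib matrix_vector_mult_scaleR algebra_simps)+

lemma dev_centered:
  fixes z :: "real \<Rightarrow> 'w \<Rightarrow> (real^'d) \<times> (real^('d + 'd + 'd))"
  assumes z: "centered_L2 M T z"
  shows "centered_L2 M T (\<lambda>t \<omega>. dev_obs \<M> t (z t \<omega>))" "centered_L2 M T (\<lambda>t \<omega>. dev_state (z t \<omega>))"
    "centered_L2 M T (\<lambda>t \<omega>. dev_ctrl \<M> F t (z t \<omega>))" "centered_L2 M T (\<lambda>t \<omega>. dev_rho \<M> F\<phi> t (z t \<omega>))"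
  by (rule centered_L2_image[OF nf(1) z dev_linear(1) dev_continuous(1)] centered_L2_image[OF nf(1) z dev_linear(2) dev_continuous(2)]
      centered_L2_image[OF nf(1) z dev_linear(3) dev_continuous(3)] centered_L2_image[OF nf(1) z dev_linear(4) dev_continuous(4)])+

lemma resid_cost_cong:
  assumes c: "centered_L2 M T z" "centered_L2 M T z'" and eq: "AE \<omega> in M. \<forall>t\<in>{0..T}. z t \<omega> = z' t \<omega>"
  shows "resid_cost \<M> T M F F\<phi> z = resid_cost \<M> T M F F\<phi> z'"
proof -
  note d = dev_centered[OF c(1)] and d' = dev_centered[OF c(2)]
  have "quad_E M T (\<lambda>_. matrix_inv (Sig_W \<M>)) (\<lambda>t \<omega>. dev_obs \<M> t (z t \<omega>)) = quad_E M T (\<lambda>_. matrix_inv (Sig_W \<M>)) (\<lambda>t \<omega>. dev_obs \<M> t (z' t \<omega>))"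
    by (rule quad_E_cong[OF d(1) d'(1) continuous_on_const]) (use eq in eventually_elim, simp)
  moreover have "quad_E M T (cost_Q \<M>) (\<lambda>t \<omega>. dev_state (z t \<omega>)) = quad_E M T (cost_Q \<M>) (\<lambda>t \<omega>. dev_state (z' t \<omega>))"
    by (rule quad_E_cong[OF d(2) d'(2)]) (intro coefD, use eq in eventually_elim, simp)
  moreover have "quad_E M T (cost_S \<M>) (\<lambda>t \<omega>. dev_ctrl \<M> F t (z t \<omega>)) = quad_E M T (cost_S \<M>) (\<lambda>t \<omega>. dev_ctrl \<M> F t (z' t \<omega>))"
    by (rule quad_E_cong[OF d(3) d'(3)]) (intro coefD, use eq in eventually_elim, simp)
  moreover have "quad_E M T (pen_P \<M>) (\<lambda>t \<omega>. dev_rho \<M> F\<phi> t (z t \<omega>)) = quad_E M T (pen_P \<M>) (\<lambda>t \<omega>. dev_rho \<M> F\<phi> t (z' t \<omega>))"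
    by (rule quad_E_cong[OF d(4) d'(4)]) (intro coefD, use eq in eventually_elim, simp)
  ultimately show ?thesis by (simp only: resid_cost_def)
qed

end

section \<open>Comparison of attacks and the minimiser\<close>

lemma J_decomposition:
  fixes \<M> :: "('d::finite, 'm::finite, 'c::finite, 'p::finite, 'q::finite) model"
    and M :: "'w measure"
  assumes ctx: "0 < T" "valid_model \<M> T" "noise_setup \<M> M X0 V W"
      "is_F \<M> T F" "is_f \<M> T F f" "is_R \<M> T R" "is_Fphi \<M> T F R F\<phi>"
    and sys: "is_fphi \<M> T F f R F\<phi> \<tau> f\<phi>" "is_mean \<M> T F f R F\<phi> f\<phi> \<tau> \<phi>"
      "full_system \<M> T M X0 V W F f R (rho_star \<M> F\<phi> f\<phi> Xa Xhat) \<tau> Xc Yc Xa Xhat"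
  shows "J_crit \<M> T M F f (rho_star \<M> F\<phi> f\<phi> Xa Xhat) \<tau> Xc Xa Xhat
    = integral {0..T} (det_cost \<M> F f F\<phi> f\<phi> \<tau> \<phi>) + resid_cost \<M> T M F F\<phi> (z_proc Xc Xa Xhat \<phi>)"
proof -
  have M: "prob_space M" using ctx(3) by (simp add: noise_setup_def)
  interpret prob_space M by (rule M)
  have T0: "0 \<le> T" using ctx(1) by simp
  let ?z = "z_proc Xc Xa Xhat \<phi>" and ?\<rho> = "rho_star \<M> F\<phi> f\<phi> Xa Xhat" and ?\<Sigma>i = "matrix_inv (Sig_W \<M>)"
  define b1 where "b1 t = obs_H \<M> t *v (transpose e_dx *v \<phi> t) + \<tau> t" for t
  define b2 where "b2 t = transpose e_xc *v \<phi> t - target \<M> t" for t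
  define b3 where "b3 t = u_star \<M> F f t (transpose e_xa *v \<phi> t)" for t
  define b4 where "b4 t = det_rho \<M> F\<phi> f\<phi> \<phi> t" for t
  note coef = coefC[OF ctx] contC[OF ctx] mean_continuous[OF ctx sys] \<tau>_continuous[OF ctx sys] is_fphi_continuous[OF sys(1)]
  have cb: "continuous_on {0..T} b1" "continuous_on {0..T} b2" "continuous_on {0..T} b3" "continuous_on {0..T} b4"
    unfolding b1_def b2_def b3_def b4_def u_star_def det_rho_def by (intro continuous_intros coef)+
  \<comment> \<open>Every quantity that the criteria square is a deterministic mean,
    \<open>b1\<close> to \<open>b4\<close>, plus a linear image of the centred process; all affine
    terms are put into the means.\<close>
  have p1: "obs_H \<M> t *v (Xhat t \<omega> - Xa t \<omega>) + \<tau> t = b1 t + dev_obs \<M> t (?z t \<omega>)" for t \<omega>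
    by (simp del: transpose_matrix_vector add: b1_def dev_obs_def z_proc_def matrix_vector_mult_diff_distrib transpose_e_Concat)
  have p2: "Xc t \<omega> - target \<M> t = b2 t + dev_state (?z t \<omega>)" for t \<omega>
    by (simp del: transpose_matrix_vector add: b2_def dev_state_def z_proc_def matrix_vector_mult_diff_distrib transpose_e_Concat)
  have p3: "u_star \<M> F f t (Xa t \<omega>) = b3 t + dev_ctrl \<M> F t (?z t \<omega>)" for t \<omega>
    by (simp del: transpose_matrix_vector add: b3_def u_star_def dev_ctrl_def z_proc_def matrix_vector_mult_diff_distrib transpose_e_Concat)
  have p4: "?\<rho> t \<omega> = b4 t + dev_rho \<M> F\<phi> t (?z t \<omega>)" for t \<omega>
    by (simp del: transpose_matrix_vector add: b4_def rho_star_def det_rho_def dev_rho_def z_proc_def matrix_vector_mult_diff_distrib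
        matrix_vector_right_distrib)
  note zc = z_centered[OF ctx sys]
  note d = dev_centered[OF ctx zc]
  note q1 = quadratic_expectation[OF M T0 d(1) cb(1) continuous_on_const[of _ ?\<Sigma>i]]
  note q2 = quadratic_expectation[OF M T0 d(2) cb(2) continuous_on_data_id(6)[OF ctx(2)]]
  note q3 = quadratic_expectation[OF M T0 d(3) cb(3) continuous_on_data_id(7)[OF ctx(2)]]
  note q4 = quadratic_expectation[OF M T0 d(4) cb(4) continuous_on_data_id(9)[OF ctx(2)]]
  have S: "S_crit \<M> T M \<tau> Xa Xhat = (1/2) * (integral {0..T} (\<lambda>t. b1 t \<bullet> (?\<Sigma>i *v b1 t))
      + quad_E M T (\<lambda>_. ?\<Sigma>i) (\<lambda>t \<omega>. dev_obs \<M> t (?z t \<omega>)))"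
    unfolding S_crit_def p1 q1(2) quad_E_def ..
  have P: "(\<integral>\<omega>. (LINT t:{0..T}|lborel. ?\<rho> t \<omega> \<bullet> (pen_P \<M> t *v ?\<rho> t \<omega>)) \<partial>M)
      = integral {0..T} (\<lambda>t. b4 t \<bullet> (pen_P \<M> t *v b4 t)) + quad_E M T (pen_P \<M>) (\<lambda>t \<omega>. dev_rho \<M> F\<phi> t (?z t \<omega>))"
    unfolding p4 q4(2) quad_E_def ..
  let ?X2 = "\<lambda>t \<omega>. b2 t + dev_state (?z t \<omega>)" and ?X3 = "\<lambda>t \<omega>. b3 t + dev_ctrl \<M> F t (?z t \<omega>)"
  have D: "D_crit \<M> T M F f Xc Xa = (integral {0..T} (\<lambda>t. b2 t \<bullet> (cost_Q \<M> t *v b2 t))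
      + quad_E M T (cost_Q \<M>) (\<lambda>t \<omega>. dev_state (?z t \<omega>)))
     + (integral {0..T} (\<lambda>t. b3 t \<bullet> (cost_S \<M> t *v b3 t)) + quad_E M T (cost_S \<M>) (\<lambda>t \<omega>. dev_ctrl \<M> F t (?z t \<omega>)))"
  proof -
    \<comment> \<open>Here state and control costs share one time integral. Splitting it needs
      almost sure integrability of each part, and measurability of the joint integral is established
      separately.\<close>
    have zm: "measurable_process M T ?z" by (rule z_measurable[OF ctx sys])
    have c2: "continuous_on ({0..T} \<times> UNIV) (\<lambda>p. dev_state (snd p) :: real^'d)"
      and c3: "continuous_on ({0..T} \<times> UNIV) (\<lambda>p. dev_ctrl \<M> F (fst p) (snd p))"
      using dev_continuous(2,3)[OF ctx] by (simp_all add: case_prod_unfold)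
    have "continuous_on ({0..T} \<times> UNIV) (\<lambda>(t, x). (b2 t + dev_state x) \<bullet> (cost_Q \<M> t *v (b2 t + dev_state x))
        + (b3 t + dev_ctrl \<M> F t x) \<bullet> (cost_S \<M> t *v (b3 t + dev_ctrl \<M> F t x)))"
      unfolding case_prod_unfold
      by (intro continuous_intros continuous_on_inner continuous_on_fst_time cb coef c2 c3)
    from measurable_process_compose[OF zm this]
    have m: "(\<lambda>\<omega>. LINT t:{0..T}|lborel. ?X2 t \<omega> \<bullet> (cost_Q \<M> t *v ?X2 t \<omega>) + ?X3 t \<omega> \<bullet> (cost_S \<M> t *v ?X3 t \<omega>)) \<in> borel_measurable M"
      using T0 by (intro measurable_set_integral[OF sigma_finite_measure_axioms]) auto
    have "D_crit \<M> T M F f Xc Xa = (\<integral>\<omega>. (LINT t:{0..T}|lborel. ?X2 t \<omega> \<bullet> (cost_Q \<M> t *v ?X2 t \<omega>))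
        + (LINT t:{0..T}|lborel. ?X3 t \<omega> \<bullet> (cost_S \<M> t *v ?X3 t \<omega>)) \<partial>M)"
      unfolding D_crit_def p2 p3
    proof (rule integral_cong_AE[OF m])
      show "(\<lambda>\<omega>. (LINT t:{0..T}|lborel. ?X2 t \<omega> \<bullet> (cost_Q \<M> t *v ?X2 t \<omega>))
        + (LINT t:{0..T}|lborel. ?X3 t \<omega> \<bullet> (cost_S \<M> t *v ?X3 t \<omega>))) \<in> borel_measurable M"
        using q2(1) q3(1) by auto
      show "AE \<omega> in M. (LINT t:{0..T}|lborel. ?X2 t \<omega> \<bullet> (cost_Q \<M> t *v ?X2 t \<omega>) + ?X3 t \<omega> \<bullet> (cost_S \<M> t *v ?X3 t \<omega>))
        = (LINT t:{0..T}|lborel. ?X2 t \<omega> \<bullet> (cost_Q \<M> t *v ?X2 t \<omega>))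
        + (LINT t:{0..T}|lborel. ?X3 t \<omega> \<bullet> (cost_S \<M> t *v ?X3 t \<omega>))"
        using q2(3) q3(3) by eventually_elim (rule set_integral_add(2))
    qed
    also have "\<dots> = (\<integral>\<omega>. (LINT t:{0..T}|lborel. ?X2 t \<omega> \<bullet> (cost_Q \<M> t *v ?X2 t \<omega>)) \<partial>M)
        + (\<integral>\<omega>. (LINT t:{0..T}|lborel. ?X3 t \<omega> \<bullet> (cost_S \<M> t *v ?X3 t \<omega>)) \<partial>M)"
      by (rule Bochner_Integration.integral_add[OF q2(1) q3(1)])
    finally show ?thesis unfolding q2(2) q3(2) quad_E_def .
  qed
  have i: "(\<lambda>t. b1 t \<bullet> (?\<Sigma>i *v b1 t)) integrable_on {0..T}" "(\<lambda>t. b2 t \<bullet> (cost_Q \<M> t *v b2 t)) integrable_on {0..T}"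
    "(\<lambda>t. b3 t \<bullet> (cost_S \<M> t *v b3 t)) integrable_on {0..T}" "(\<lambda>t. b4 t \<bullet> (pen_P \<M> t *v b4 t)) integrable_on {0..T}"
    by (intro integrable_continuous_real continuous_on_inner continuous_intros cb coef)+
  have dc: "det_cost \<M> F f F\<phi> f\<phi> \<tau> \<phi> = (\<lambda>t. (1/2) * (b1 t \<bullet> (?\<Sigma>i *v b1 t))
      - lam \<M> * (b2 t \<bullet> (cost_Q \<M> t *v b2 t) + b3 t \<bullet> (cost_S \<M> t *v b3 t)) + (1/2) * (b4 t \<bullet> (pen_P \<M> t *v b4 t)))"
    by (simp add: det_cost_def Let_def b1_def b2_def b3_def b4_def fun_eq_iff)
  have "(det_cost \<M> F f F\<phi> f\<phi> \<tau> \<phi> has_integral ((1/2) * integral {0..T} (\<lambda>t. b1 t \<bullet> (?\<Sigma>i *v b1 t))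
      - lam \<M> * (integral {0..T} (\<lambda>t. b2 t \<bullet> (cost_Q \<M> t *v b2 t)) + integral {0..T} (\<lambda>t. b3 t \<bullet> (cost_S \<M> t *v b3 t)))
      + (1/2) * integral {0..T} (\<lambda>t. b4 t \<bullet> (pen_P \<M> t *v b4 t)))) {0..T}"
    unfolding dc by (intro has_integral_add has_integral_diff has_integral_mult_right integrable_integral i)
  then have "integral {0..T} (det_cost \<M> F f F\<phi> f\<phi> \<tau> \<phi>) = (1/2) * integral {0..T} (\<lambda>t. b1 t \<bullet> (?\<Sigma>i *v b1 t))
      - lam \<M> * (integral {0..T} (\<lambda>t. b2 t \<bullet> (cost_Q \<M> t *v b2 t)) + integral {0..T} (\<lambda>t. b3 t \<bullet> (cost_S \<M> t *v b3 t)))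
      + (1/2) * integral {0..T} (\<lambda>t. b4 t \<bullet> (pen_P \<M> t *v b4 t))"
    by (rule integral_unique)
  then show ?thesis
    unfolding J_crit_def S P D resid_cost_def by (simp add: algebra_simps)
qed

text \<open>Since the excess \<open>d\<close> attains zero, minimising amounts to solving d = 0; the
  second part turns uniqueness of the minimiser into uniqueness of that zero.\<close>

lemma is_arg_min_square:
  fixes J :: "'a \<Rightarrow> real"
  assumes J: "\<And>x. P x \<Longrightarrow> J x = c + d x" and d: "\<And>x. P x \<Longrightarrow> 0 \<le> d x" and s: "P s" "d s = 0"
  shows "is_arg_min J P s" "is_arg_min J P x \<Longrightarrow> P x \<and> d x = 0"
proof -
  show "is_arg_min J P s" using J d s by (force simp: is_arg_min_def)
  assume "is_arg_min J P x"
  then have x: "P x" "\<not> J s < J x" using s by (auto simp: is_arg_min_def)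
  then show "P x \<and> d x = 0" using J[OF x(1)] J[OF s(1)] s(2) d[OF x(1)] by linarith
qed

theorem theorem18:
  fixes \<M> :: "('d::finite, 'm::finite, 'c::finite, 'p::finite, 'q::finite) model"
    and T :: real
    and M :: "'w measure"
    and X0 :: "'w \<Rightarrow> real^'d"
    and V :: "real \<Rightarrow> 'w \<Rightarrow> real^'p"
    and W :: "real \<Rightarrow> 'w \<Rightarrow> real^'q"
  assumes "0 < T"
    and "valid_model \<M> T"
    and "noise_setup \<M> M X0 V W"
  shows
    "(\<forall>F f R F\<phi> F\<tau> f\<tau>.
      \<forall>f\<phi> :: (real \<Rightarrow> real^'m) \<Rightarrow> real \<Rightarrow> real^('d + 'd + 'd).
      \<forall>(Xc :: (real \<Rightarrow> real^'m) \<Rightarrow> real \<Rightarrow> 'w \<Rightarrow> real^'d)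
       (Yc :: (real \<Rightarrow> real^'m) \<Rightarrow> real \<Rightarrow> 'w \<Rightarrow> real^'m)
       (Xa :: (real \<Rightarrow> real^'m) \<Rightarrow> real \<Rightarrow> 'w \<Rightarrow> real^'d)
       (Xhat :: (real \<Rightarrow> real^'m) \<Rightarrow> real \<Rightarrow> 'w \<Rightarrow> real^'d).
        is_F \<M> T F \<and> is_f \<M> T F f \<and> is_R \<M> T R \<and>
        is_Fphi \<M> T F R F\<phi> \<and>
        (\<forall>\<tau>. obs_attack T \<tau> \<longrightarrow> is_fphi \<M> T F f R F\<phi> \<tau> (f\<phi> \<tau>)) \<and>
        is_Ftau \<M> T F R F\<phi> F\<tau> \<and> is_ftau \<M> T F f R F\<phi> F\<tau> f\<tau> \<and>
        (\<forall>\<tau>. obs_attack T \<tau> \<longrightarrow>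
           full_system \<M> T M X0 V W F f R (rho_star \<M> F\<phi> (f\<phi> \<tau>) (Xa \<tau>) (Xhat \<tau>)) \<tau>
             (Xc \<tau>) (Yc \<tau>) (Xa \<tau>) (Xhat \<tau>))
      \<longrightarrow>
        (\<exists>\<tau>s. is_arg_min
             (\<lambda>\<tau>. J_crit \<M> T M F f (rho_star \<M> F\<phi> (f\<phi> \<tau>) (Xa \<tau>) (Xhat \<tau>)) \<tau>
                    (Xc \<tau>) (Xa \<tau>) (Xhat \<tau>))
             (obs_attack T) \<tau>s \<and>
           (\<forall>t\<in>{0..T}. \<tau>s t = tau_formula \<M> R F\<phi> F\<tau> f\<tau> (f\<phi> \<tau>s) t) \<and>
           (\<forall>\<tau>. is_arg_min
             (\<lambda>\<tau>. J_crit \<M> T M F f (rho_star \<M> F\<phi> (f\<phi> \<tau>) (Xa \<tau>) (Xhat \<tau>)) \<tau>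
                    (Xc \<tau>) (Xa \<tau>) (Xhat \<tau>))
             (obs_attack T) \<tau> \<longrightarrow> (\<forall>t\<in>{0..T}. \<tau> t = \<tau>s t)) \<and>
           (\<forall>\<tau>. obs_attack T \<tau> \<and>
                 (\<forall>t\<in>{0..T}. \<tau> t = tau_formula \<M> R F\<phi> F\<tau> f\<tau> (f\<phi> \<tau>) t)
               \<longrightarrow> (\<forall>t\<in>{0..T}. \<tau> t = \<tau>s t))))
     \<and>
     (\<exists>\<epsilon>>0. \<epsilon> \<le> T \<and> (\<forall>T'. 0 < T' \<and> T' \<le> \<epsilon> \<longrightarrow>
        (\<exists>F f R F\<phi>. is_F \<M> T' F \<and> is_f \<M> T' F f \<and> is_R \<M> T' R \<and> is_Fphi \<M> T' F R F\<phi>) \<and>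
        (\<forall>F f R F\<phi>.
           is_F \<M> T' F \<and> is_f \<M> T' F f \<and> is_R \<M> T' R \<and> is_Fphi \<M> T' F R F\<phi> \<longrightarrow>
           (\<exists>F\<tau> f\<tau>. is_Ftau \<M> T' F R F\<phi> F\<tau> \<and> is_ftau \<M> T' F f R F\<phi> F\<tau> f\<tau> \<and>
              (\<forall>F\<tau>' f\<tau>'. is_Ftau \<M> T' F R F\<phi> F\<tau>' \<and> is_ftau \<M> T' F f R F\<phi> F\<tau>' f\<tau>' \<longrightarrow>
                 (\<forall>t\<in>{0..T'}. F\<tau>' t = F\<tau> t \<and> f\<tau>' t = f\<tau> t))))))"
proof (rule conjI[OF _ small_time_solvability[OF assms(1,2)]], intro allI impI, elim conjE)
  fix F f R F\<phi> F\<tau> f\<tau>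
  fix f\<phi> :: "(real \<Rightarrow> real^'m) \<Rightarrow> real \<Rightarrow> real^('d + 'd + 'd)"
  fix Xc :: "(real \<Rightarrow> real^'m) \<Rightarrow> real \<Rightarrow> 'w \<Rightarrow> real^'d"
    and Yc :: "(real \<Rightarrow> real^'m) \<Rightarrow> real \<Rightarrow> 'w \<Rightarrow> real^'m"
    and Xa Xhat :: "(real \<Rightarrow> real^'m) \<Rightarrow> real \<Rightarrow> 'w \<Rightarrow> real^'d"
  assume F: "is_F \<M> T F" and f: "is_f \<M> T F f" and R: "is_R \<M> T R" and F\<phi>: "is_Fphi \<M> T F R F\<phi>"
    and f\<phi>': "\<forall>\<tau>. obs_attack T \<tau> \<longrightarrow> is_fphi \<M> T F f R F\<phi> \<tau> (f\<phi> \<tau>)"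
    and F\<tau>: "is_Ftau \<M> T F R F\<phi> F\<tau>" and f\<tau>: "is_ftau \<M> T F f R F\<phi> F\<tau> f\<tau>"
    and sys': "\<forall>\<tau>. obs_attack T \<tau> \<longrightarrow>
           full_system \<M> T M X0 V W F f R (rho_star \<M> F\<phi> (f\<phi> \<tau>) (Xa \<tau>) (Xhat \<tau>)) \<tau>
             (Xc \<tau>) (Yc \<tau>) (Xa \<tau>) (Xhat \<tau>)"
  note f\<phi> = f\<phi>'[rule_format] and sys = sys'[rule_format]
  note ctx = assms F f R F\<phi> and dctx = assms(1,2) F f R F\<phi> F\<tau> f\<tau>
  let ?J = "\<lambda>\<tau>. J_crit \<M> T M F f (rho_star \<M> F\<phi> (f\<phi> \<tau>) (Xa \<tau>) (Xhat \<tau>)) \<tau> (Xc \<tau>) (Xa \<tau>) (Xhat \<tau>)"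
  define dev where "dev \<tau> t = \<tau> t - tau_formula \<M> R F\<phi> F\<tau> f\<tau> (f\<phi> \<tau>) t" for \<tau> t
  define d where "d \<tau> = (1/2) * integral {0..T} (\<lambda>t. dev \<tau> t \<bullet> (matrix_inv (Sig_W \<M>) *v dev \<tau> t))" for \<tau>
  have "\<exists>\<phi>. is_mean \<M> T F f R F\<phi> (f\<phi> \<tau>) \<tau> \<phi>" if "obs_attack T \<tau>" for \<tau>
    by (rule is_mean_exists[OF dctx that f\<phi>[OF that]]) blast
  then obtain \<phi> where \<phi>: "\<And>\<tau>. obs_attack T \<tau> \<Longrightarrow> is_mean \<M> T F f R F\<phi> (f\<phi> \<tau>) \<tau> (\<phi> \<tau>)"
    by metis
  obtain C where C: "\<And>\<tau> f\<phi> \<phi>. obs_attack T \<tau> \<Longrightarrow> is_fphi \<M> T F f R F\<phi> \<tau> f\<phi> \<Longrightarrow> is_mean \<M> T F f R F\<phi> f\<phi> \<tau> \<phi> \<Longrightarrow>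
    (det_cost \<M> F f F\<phi> f\<phi> \<tau> \<phi> has_integral
      C + (1/2) * integral {0..T} (\<lambda>t. (\<tau> t - tau_formula \<M> R F\<phi> F\<tau> f\<tau> f\<phi> t) \<bullet>
        (matrix_inv (Sig_W \<M>) *v (\<tau> t - tau_formula \<M> R F\<phi> F\<tau> f\<tau> f\<phi> t)))) {0..T}"
    by (rule det_cost_integral[OF dctx], rule that)
  obtain \<tau>s where \<tau>s: "obs_attack T \<tau>s"
    "\<And>f\<phi> t. is_fphi \<M> T F f R F\<phi> \<tau>s f\<phi> \<Longrightarrow> t \<in> {0..T} \<Longrightarrow> \<tau>s t = tau_formula \<M> R F\<phi> F\<tau> f\<tau> f\<phi> t"
    by (rule feedback_attack_exists[OF dctx], rule that)
  have fs: "\<tau>s t = tau_formula \<M> R F\<phi> F\<tau> f\<tau> (f\<phi> \<tau>s) t" if "t \<in> {0..T}" for t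
    by (rule \<tau>s(2)[OF f\<phi>[OF \<tau>s(1)] that])
  \<comment> \<open>The closed-loop attack serves as reference; by \<open>z_unique\<close> every
    other attack has the same residual cost.\<close>
  define K where "K = resid_cost \<M> T M F F\<phi> (z_proc (Xc \<tau>s) (Xa \<tau>s) (Xhat \<tau>s) (\<phi> \<tau>s))"
  have J: "?J \<tau> = (C + K) + d \<tau>" if \<tau>: "obs_attack T \<tau>" for \<tau>
  proof -
    note s = f\<phi>[OF \<tau>] \<phi>[OF \<tau>] sys[OF \<tau>] and ss = f\<phi>[OF \<tau>s(1)] \<phi>[OF \<tau>s(1)] sys[OF \<tau>s(1)]
    have "resid_cost \<M> T M F F\<phi> (z_proc (Xc \<tau>) (Xa \<tau>) (Xhat \<tau>) (\<phi> \<tau>)) = K"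
      unfolding K_def
      by (rule resid_cost_cong[OF ctx z_centered[OF ctx s] z_centered[OF ctx ss] z_unique[OF ctx s ss]])
    then show ?thesis
      using J_decomposition[OF ctx s] integral_unique[OF C[OF \<tau> f\<phi>[OF \<tau>] \<phi>[OF \<tau>]]]
      by (simp add: d_def dev_def)
  qed
  have d0: "0 \<le> d \<tau>" if "obs_attack T \<tau>" for \<tau>
    using deviation_nonneg(1)[OF dctx that f\<phi>[OF that]] by (simp add: d_def dev_def)
  have dz: "\<tau> t = tau_formula \<M> R F\<phi> F\<tau> f\<tau> (f\<phi> \<tau>) t" if "obs_attack T \<tau>" "d \<tau> = 0" "t \<in> {0..T}" for \<tau> t
    using deviation_nonneg(2)[OF dctx that(1) f\<phi>[OF that(1)] _ that(3)] that(2) by (simp add: d_def dev_def)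
  have ds: "d \<tau>s = 0"
    using deviation_nonneg(3)[OF dctx \<tau>s(1) f\<phi>[OF \<tau>s(1)]] fs by (simp add: d_def dev_def)
  note am = is_arg_min_square[of "obs_attack T" ?J "C + K" d, OF J d0 \<tau>s(1) ds]
  \<comment> \<open>Used twice: for minimisers, whose excess vanishes so that they satisfy the
    formula, and for arbitrary attacks that satisfy the formula.\<close>
  have uniq: "\<tau> t = \<tau>s t" if "obs_attack T \<tau>" "\<And>t. t \<in> {0..T} \<Longrightarrow> \<tau> t = tau_formula \<M> R F\<phi> F\<tau> f\<tau> (f\<phi> \<tau>) t" "t \<in> {0..T}" for \<tau> t
    using feedback_attack_unique[OF dctx f\<phi>[OF that(1)] _ f\<phi>[OF \<tau>s(1)] _ that(3)] that(2) fs by blast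
  show "\<exists>\<tau>s. is_arg_min ?J (obs_attack T) \<tau>s \<and>
      (\<forall>t\<in>{0..T}. \<tau>s t = tau_formula \<M> R F\<phi> F\<tau> f\<tau> (f\<phi> \<tau>s) t) \<and>
      (\<forall>\<tau>. is_arg_min ?J (obs_attack T) \<tau> \<longrightarrow> (\<forall>t\<in>{0..T}. \<tau> t = \<tau>s t)) \<and>
      (\<forall>\<tau>. obs_attack T \<tau> \<and> (\<forall>t\<in>{0..T}. \<tau> t = tau_formula \<M> R F\<phi> F\<tau> f\<tau> (f\<phi> \<tau>) t)
         \<longrightarrow> (\<forall>t\<in>{0..T}. \<tau> t = \<tau>s t))"
  proof (intro exI[of _ \<tau>s] conjI allI impI ballI)
    show "is_arg_min ?J (obs_attack T) \<tau>s" by (rule am(1)) auto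
    show "\<tau>s t = tau_formula \<M> R F\<phi> F\<tau> f\<tau> (f\<phi> \<tau>s) t" if "t \<in> {0..T}" for t by (rule fs[OF that])
    show "\<tau> t = \<tau>s t" if "is_arg_min ?J (obs_attack T) \<tau>" "t \<in> {0..T}" for \<tau> t
      using am(2)[OF _ _ that(1)] uniq[OF _ _ that(2)] dz by blast
    show "\<tau> t = \<tau>s t"
      if "obs_attack T \<tau> \<and> (\<forall>t\<in>{0..T}. \<tau> t = tau_formula \<M> R F\<phi> F\<tau> f\<tau> (f\<phi> \<tau>) t)" "t \<in> {0..T}" for \<tau> t
      using uniq that by blast
  qed
qed

end
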